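(* Let $A$ be a dg $k$-algebra with homotopy category $\mathscr{K}(A)$ of right dg $A$-modules, let $M$ be a dg $A$-module, and let $$X\xrightarrow{f} M_1\xrightarrow{g} Y\xrightarrow{h} X[1]$$ be a triangle in $\mathscr{K}(A)$ with $M_1\in \langle M\rangle$. Then there is a derived equivalence between the dg algebras $\mathcal{H}om_A(X\oplus M, X\oplus M)$ and $\mathcal{H}om_A(Y\oplus M, Y\oplus M)$.
   Context: $k$ is a commutative ring with identity. A dg $k$-algebra is a $\mathbb{Z}$-graded associative $k$-algebra $A=\bigoplus_{i\in\mathbb{Z}}A^i$ with a differential $d:A^i\to A^{i+1}$ satisfying $d(ab)=d(a)b+(-1)^p a\,d(b)$ for $a\in A^p$, $b\in A$. dg $A$-modules are right dg $A$-modules: $\mathbb{Z}$-graded right $A$-modules $M=\bigoplus_i M^i$ with a $k$-linear differential $d:M^i\to M^{i+1}$ satisfying $d(ma)=d(m)a+(-1)^n m\,d(a)$ for $m\in M^n$, $a\in A$. For dg $A$-modules $M,N$, $\mathcal{H}om_A(M,N)$ is the complex of $k$-modules whose degree-$n$ part consists of the $k$-linear maps $f:M\to N$ homogeneous of degree $n$ with $f(ma)=f(m)a$, with differential $d(f)=d_N\circ f+(-1)^{|f|+1}f\circ d_M$. With composition as multiplication, $\mathcal{H}om_A(M,M)$ is a dg algebra (the dg endomorphism algebra). $\mathscr{K}(A)$ is the homotopy category of right dg $A$-modules (morphisms: degree-$0$ chain maps of dg modules modulo null-homotopic ones), a triangulated category with shift $[1]$; one has $\mathrm{Hom}_{\mathscr{K}(A)}(X,Y[n])\cong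 H^n(\mathcal{H}om_A(X,Y))$. $\mathscr{D}(A)$ is the derived category of right dg $A$-modules, i.e. the localization of $\mathscr{K}(A)$ at quasi-isomorphisms. $\mathrm{add}(N)$ is the full subcategory of direct summands of finite direct sums of copies of $N$, and $\langle M\rangle$ denotes the full additive subcategory of $\mathscr{K}(A)$ generated by $\bigcup_{i\in\mathbb{Z}}\mathrm{add}(M[i])$. Two dg algebras $\Lambda$ and $\Gamma$ are derived equivalent if $\mathscr{D}(\Lambda)$ and $\mathscr{D}(\Gamma)$ are equivalent as triangulated categories. *)

theory Defs
  imports "HOL-Algebra.Module" "HOL-Algebra.AbelCoset"
begin

section \<open>Dg algebras and right dg modules over a commutative ring\<close>

text \<open>
  Graded objects are given by the family of their homogeneous components.  The \<open>i\<close>-th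
  component is a \<open>K\<close>-module in the sense of HOL-Algebra; the ring fields \<open>mult\<close> and \<open>one\<close> of
  the component records are never used.  Products and differentials carry the degrees of
  their arguments as indices.
\<close>

definition linear_map ::
  "'k ring \<Rightarrow> ('k, 'm) module \<Rightarrow> ('k, 'n) module \<Rightarrow> ('m \<Rightarrow> 'n) \<Rightarrow> bool" where
  "linear_map K V W f \<longleftrightarrow>
     f \<in> carrier V \<rightarrow> carrier W \<and>
     (\<forall>x\<in>carrier V. \<forall>y\<in>carrier V. f (x \<oplus>\<^bsub>V\<^esub> y) = f x \<oplus>\<^bsub>W\<^esub> f y) \<and>
     (\<forall>c\<in>carrier K. \<forall>x\<in>carrier V. f (c \<odot>\<^bsub>V\<^esub> x) = c \<odot>\<^bsub>W\<^esub> f x)"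

text \<open>\<open>ksign V p x\<close> is \<open>(-1)\<^sup>p x\<close> in \<open>V\<close>.\<close>

definition ksign :: "('k, 'm) module \<Rightarrow> int \<Rightarrow> 'm \<Rightarrow> 'm" where
  "ksign V p x = (if even p then x else \<ominus>\<^bsub>V\<^esub> x)"

record ('k, 'a) dg_alg =
  acomp :: "int \<Rightarrow> ('k, 'a) module"
  amult :: "int \<Rightarrow> int \<Rightarrow> 'a \<Rightarrow> 'a \<Rightarrow> 'a"
  aone :: 'a
  adiff :: "int \<Rightarrow> 'a \<Rightarrow> 'a"

locale dg_algebra = cring K for K :: "'k ring" (structure) +
  fixes A :: "('k, 'a) dg_alg"
  assumes acomp_module: "module K (acomp A i)"
    and amult_linear_left: "b \<in> carrier (acomp A j) \<Longrightarrow>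
      linear_map K (acomp A i) (acomp A (i + j)) (\<lambda>a. amult A i j a b)"
    and amult_linear_right: "a \<in> carrier (acomp A i) \<Longrightarrow>
      linear_map K (acomp A j) (acomp A (i + j)) (amult A i j a)"
    and amult_assoc:
      "\<lbrakk>a \<in> carrier (acomp A i); b \<in> carrier (acomp A j); c \<in> carrier (acomp A l)\<rbrakk> \<Longrightarrow>
       amult A (i + j) l (amult A i j a b) c = amult A i (j + l) a (amult A j l b c)"
    and aone_closed: "aone A \<in> carrier (acomp A 0)"
    and aone_left: "a \<in> carrier (acomp A i) \<Longrightarrow> amult A 0 i (aone A) a = a"
    and aone_right: "a \<in> carrier (acomp A i) \<Longrightarrow> amult A i 0 a (aone A) = a"
    and adiff_linear: "linear_map K (acomp A i) (acomp A (i + 1)) (adiff A i)"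
    and adiff_square: "a \<in> carrier (acomp A i) \<Longrightarrow>
      adiff A (i + 1) (adiff A i a) = \<zero>\<^bsub>acomp A (i + 2)\<^esub>"
    and adiff_leibniz: "\<lbrakk>a \<in> carrier (acomp A p); b \<in> carrier (acomp A q)\<rbrakk> \<Longrightarrow>
      adiff A (p + q) (amult A p q a b) =
        amult A (p + 1) q (adiff A p a) b \<oplus>\<^bsub>acomp A (p + q + 1)\<^esub>
        ksign (acomp A (p + q + 1)) p (amult A p (q + 1) a (adiff A q b))"

record ('k, 'a, 'm) dg_mod =
  mcomp :: "int \<Rightarrow> ('k, 'm) module"
  mact :: "int \<Rightarrow> int \<Rightarrow> 'm \<Rightarrow> 'a \<Rightarrow> 'm"
  mdiff :: "int \<Rightarrow> 'm \<Rightarrow> 'm"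

locale dg_module = dg_algebra K A for K :: "'k ring" (structure) and A :: "('k, 'a) dg_alg" +
  fixes M :: "('k, 'a, 'm) dg_mod"
  assumes mcomp_module: "module K (mcomp M i)"
    and mact_linear_left: "a \<in> carrier (acomp A j) \<Longrightarrow>
      linear_map K (mcomp M i) (mcomp M (i + j)) (\<lambda>x. mact M i j x a)"
    and mact_linear_right: "x \<in> carrier (mcomp M i) \<Longrightarrow>
      linear_map K (acomp A j) (mcomp M (i + j)) (mact M i j x)"
    and mact_assoc:
      "\<lbrakk>x \<in> carrier (mcomp M i); a \<in> carrier (acomp A j); b \<in> carrier (acomp A l)\<rbrakk> \<Longrightarrow>
       mact M (i + j) l (mact M i j x a) b = mact M i (j + l) x (amult A j l a b)"
    and mact_one: "x \<in> carrier (mcomp M i) \<Longrightarrow> mact M i 0 x (aone A) = x"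
    and mdiff_linear: "linear_map K (mcomp M i) (mcomp M (i + 1)) (mdiff M i)"
    and mdiff_square: "x \<in> carrier (mcomp M i) \<Longrightarrow>
      mdiff M (i + 1) (mdiff M i x) = \<zero>\<^bsub>mcomp M (i + 2)\<^esub>"
    and mdiff_leibniz: "\<lbrakk>x \<in> carrier (mcomp M n); a \<in> carrier (acomp A q)\<rbrakk> \<Longrightarrow>
      mdiff M (n + q) (mact M n q x a) =
        mact M (n + 1) q (mdiff M n x) a \<oplus>\<^bsub>mcomp M (n + q + 1)\<^esub>
        ksign (mcomp M (n + q + 1)) n (mact M n (q + 1) x (adiff A q a))"

section \<open>Direct sums, shifts and mapping cones\<close>

definition module_sum :: "('k, 'm) module \<Rightarrow> ('k, 'n) module \<Rightarrow> ('k, 'm \<times> 'n) module" where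
  "module_sum V W =
     \<lparr>carrier = carrier V \<times> carrier W, mult = undefined, one = undefined,
      zero = (\<zero>\<^bsub>V\<^esub>, \<zero>\<^bsub>W\<^esub>),
      add = (\<lambda>u v. (fst u \<oplus>\<^bsub>V\<^esub> fst v, snd u \<oplus>\<^bsub>W\<^esub> snd v)),
      smult = (\<lambda>c u. (c \<odot>\<^bsub>V\<^esub> fst u, c \<odot>\<^bsub>W\<^esub> snd u))\<rparr>"

definition dg_sum ::
  "('k, 'a, 'm) dg_mod \<Rightarrow> ('k, 'a, 'n) dg_mod \<Rightarrow> ('k, 'a, 'm \<times> 'n) dg_mod" where
  "dg_sum M N =
     \<lparr>mcomp = (\<lambda>i. module_sum (mcomp M i) (mcomp N i)),
      mact = (\<lambda>i j u a. (mact M i j (fst u) a, mact N i j (snd u) a)),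
      mdiff = (\<lambda>i u. (mdiff M i (fst u), mdiff N i (snd u)))\<rparr>"

definition module_power :: "nat \<Rightarrow> ('k, 'm) module \<Rightarrow> ('k, nat \<Rightarrow> 'm) module" where
  "module_power r V =
     \<lparr>carrier = {..<r} \<rightarrow>\<^sub>E carrier V, mult = undefined, one = undefined,
      zero = (\<lambda>t\<in>{..<r}. \<zero>\<^bsub>V\<^esub>),
      add = (\<lambda>u v. \<lambda>t\<in>{..<r}. u t \<oplus>\<^bsub>V\<^esub> v t),
      smult = (\<lambda>c u. \<lambda>t\<in>{..<r}. c \<odot>\<^bsub>V\<^esub> u t)\<rparr>"

definition dg_power :: "nat \<Rightarrow> ('k, 'a, 'm) dg_mod \<Rightarrow> ('k, 'a, nat \<Rightarrow> 'm) dg_mod" where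
  "dg_power r M =
     \<lparr>mcomp = (\<lambda>i. module_power r (mcomp M i)),
      mact = (\<lambda>i j u a. \<lambda>t\<in>{..<r}. mact M i j (u t) a),
      mdiff = (\<lambda>i u. \<lambda>t\<in>{..<r}. mdiff M i (u t))\<rparr>"

text \<open>\<open>M[s]\<close>: \<open>M[s]\<^sup>n = M\<^sup>n\<^sup>+\<^sup>s\<close> with differential \<open>(-1)\<^sup>s d\<close>; for right modules
  the action is unchanged.\<close>

definition dg_shift :: "int \<Rightarrow> ('k, 'a, 'm) dg_mod \<Rightarrow> ('k, 'a, 'm) dg_mod" where
  "dg_shift s M =
     \<lparr>mcomp = (\<lambda>i. mcomp M (i + s)),
      mact = (\<lambda>i j. mact M (i + s) j),
      mdiff = (\<lambda>i x. ksign (mcomp M (i + s + 1)) s (mdiff M (i + s) x))\<rparr>"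

text \<open>The cone of \<open>f : X \<rightarrow> Y\<close> is \<open>Y \<oplus> X[1]\<close> with \<open>d (y, x) = (d y + f x, - d x)\<close>.\<close>

definition dg_cone ::
  "('k, 'a, 'm) dg_mod \<Rightarrow> ('k, 'a, 'n) dg_mod \<Rightarrow> (int \<Rightarrow> 'm \<Rightarrow> 'n) \<Rightarrow> ('k, 'a, 'n \<times> 'm) dg_mod" where
  "dg_cone X Y f = (dg_sum Y (dg_shift 1 X))
     \<lparr>mdiff := (\<lambda>i u. (mdiff Y i (fst u) \<oplus>\<^bsub>mcomp Y (i + 1)\<^esub> f (i + 1) (snd u),
                       mdiff (dg_shift 1 X) i (snd u)))\<rparr>"

section \<open>Complexes of homomorphisms and dg endomorphism algebras\<close>

text \<open>A homogeneous map of degree \<open>n\<close> is a family \<open>f i : M\<^sup>i \<rightarrow> N\<^sup>i\<^sup>+\<^sup>n\<close>; outside the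
  carriers it is normalised to \<open>undefined\<close>, so that equality of maps is equality of families.\<close>

definition hom_set :: "'k ring \<Rightarrow> ('k, 'a) dg_alg \<Rightarrow> ('k, 'a, 'm) dg_mod \<Rightarrow>
    ('k, 'a, 'n) dg_mod \<Rightarrow> int \<Rightarrow> (int \<Rightarrow> 'm \<Rightarrow> 'n) set" where
  "hom_set K A M N n =
     {f. (\<forall>i. f i \<in> extensional (carrier (mcomp M i)) \<and>
              linear_map K (mcomp M i) (mcomp N (i + n)) (f i)) \<and>
         (\<forall>i j. \<forall>x\<in>carrier (mcomp M i). \<forall>a\<in>carrier (acomp A j).
              f (i + j) (mact M i j x a) = mact N (i + n) j (f i x) a)}"

definition hom_module :: "'k ring \<Rightarrow> ('k, 'a) dg_alg \<Rightarrow> ('k, 'a, 'm) dg_mod \<Rightarrow>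
    ('k, 'a, 'n) dg_mod \<Rightarrow> int \<Rightarrow> ('k, int \<Rightarrow> 'm \<Rightarrow> 'n) module" where
  "hom_module K A M N n =
     \<lparr>carrier = hom_set K A M N n, mult = undefined, one = undefined,
      zero = (\<lambda>i. \<lambda>x\<in>carrier (mcomp M i). \<zero>\<^bsub>mcomp N (i + n)\<^esub>),
      add = (\<lambda>f g i. \<lambda>x\<in>carrier (mcomp M i). f i x \<oplus>\<^bsub>mcomp N (i + n)\<^esub> g i x),
      smult = (\<lambda>c f i. \<lambda>x\<in>carrier (mcomp M i). c \<odot>\<^bsub>mcomp N (i + n)\<^esub> f i x)\<rparr>"

definition hom_diff :: "('k, 'a, 'm) dg_mod \<Rightarrow> ('k, 'a, 'n) dg_mod \<Rightarrow> int \<Rightarrow>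
    (int \<Rightarrow> 'm \<Rightarrow> 'n) \<Rightarrow> (int \<Rightarrow> 'm \<Rightarrow> 'n)" where
  "hom_diff M N n f = (\<lambda>i. \<lambda>x\<in>carrier (mcomp M i).
     mdiff N (i + n) (f i x) \<oplus>\<^bsub>mcomp N (i + n + 1)\<^esub>
     ksign (mcomp N (i + n + 1)) (n + 1) (f (i + 1) (mdiff M i x)))"

definition gcomp :: "('k, 'a, 'm) dg_mod \<Rightarrow> int \<Rightarrow>
    (int \<Rightarrow> 'n \<Rightarrow> 'p) \<Rightarrow> (int \<Rightarrow> 'm \<Rightarrow> 'n) \<Rightarrow> (int \<Rightarrow> 'm \<Rightarrow> 'p)" where
  "gcomp M q g f = (\<lambda>i. \<lambda>x\<in>carrier (mcomp M i). g (i + q) (f i x))"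

definition gid :: "('k, 'a, 'm) dg_mod \<Rightarrow> (int \<Rightarrow> 'm \<Rightarrow> 'm)" where
  "gid M = (\<lambda>i. \<lambda>x\<in>carrier (mcomp M i). x)"

definition dg_End :: "'k ring \<Rightarrow> ('k, 'a) dg_alg \<Rightarrow> ('k, 'a, 'm) dg_mod \<Rightarrow>
    ('k, int \<Rightarrow> 'm \<Rightarrow> 'm) dg_alg" where
  "dg_End K A M =
     \<lparr>acomp = hom_module K A M M,
      amult = (\<lambda>p q f g. gcomp M q f g),
      aone = gid M,
      adiff = hom_diff M M\<rparr>"

section \<open>The homotopy category\<close>

text \<open>The morphisms \<open>X \<rightarrow> Y\<close> are the classes of degree 0 cycles of the complex of homomorphisms
  modulo boundaries, that is, of chain maps modulo the maps \<open>d h + h d\<close> with \<open>h\<close> of degree -1.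
  Source and target may have different element types, since cones and direct sums live on
  pair types.\<close>

definition chain_maps :: "'k ring \<Rightarrow> ('k, 'a) dg_alg \<Rightarrow> ('k, 'a, 'm) dg_mod \<Rightarrow>
    ('k, 'a, 'n) dg_mod \<Rightarrow> (int \<Rightarrow> 'm \<Rightarrow> 'n) set" where
  "chain_maps K A X Y = {f \<in> hom_set K A X Y 0.
     \<forall>i. \<forall>x\<in>carrier (mcomp X i). f (i + 1) (mdiff X i x) = mdiff Y i (f i x)}"

definition hclass :: "'k ring \<Rightarrow> ('k, 'a) dg_alg \<Rightarrow> ('k, 'a, 'm) dg_mod \<Rightarrow>
    ('k, 'a, 'n) dg_mod \<Rightarrow> (int \<Rightarrow> 'm \<Rightarrow> 'n) \<Rightarrow> (int \<Rightarrow> 'm \<Rightarrow> 'n) set" where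
  "hclass K A X Y f = {g \<in> chain_maps K A X Y. \<exists>h\<in>hom_set K A X Y (-1).
     g = f \<oplus>\<^bsub>hom_module K A X Y 0\<^esub> hom_diff X Y (-1) h}"

definition hmors :: "'k ring \<Rightarrow> ('k, 'a) dg_alg \<Rightarrow> ('k, 'a, 'm) dg_mod \<Rightarrow>
    ('k, 'a, 'n) dg_mod \<Rightarrow> (int \<Rightarrow> 'm \<Rightarrow> 'n) set set" where
  "hmors K A X Y = hclass K A X Y ` chain_maps K A X Y"

definition hcomp :: "'k ring \<Rightarrow> ('k, 'a) dg_alg \<Rightarrow> ('k, 'a, 'm) dg_mod \<Rightarrow>
    ('k, 'a, 'p) dg_mod \<Rightarrow> (int \<Rightarrow> 'n \<Rightarrow> 'p) set \<Rightarrow> (int \<Rightarrow> 'm \<Rightarrow> 'n) set \<Rightarrow>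
    (int \<Rightarrow> 'm \<Rightarrow> 'p) set" where
  "hcomp K A X Z G F = (\<Union>g\<in>G. \<Union>f\<in>F. hclass K A X Z (gcomp X 0 g f))"

definition hid :: "'k ring \<Rightarrow> ('k, 'a) dg_alg \<Rightarrow> ('k, 'a, 'm) dg_mod \<Rightarrow> (int \<Rightarrow> 'm \<Rightarrow> 'm) set" where
  "hid K A X = hclass K A X X (gid X)"

definition hadd :: "'k ring \<Rightarrow> ('k, 'a) dg_alg \<Rightarrow> ('k, 'a, 'm) dg_mod \<Rightarrow> ('k, 'a, 'n) dg_mod \<Rightarrow>
    (int \<Rightarrow> 'm \<Rightarrow> 'n) set \<Rightarrow> (int \<Rightarrow> 'm \<Rightarrow> 'n) set \<Rightarrow> (int \<Rightarrow> 'm \<Rightarrow> 'n) set" where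
  "hadd K A X Y F G = (\<Union>f\<in>F. \<Union>g\<in>G. hclass K A X Y (f \<oplus>\<^bsub>hom_module K A X Y 0\<^esub> g))"

definition hshift :: "int \<Rightarrow> (int \<Rightarrow> 'm \<Rightarrow> 'n) set \<Rightarrow> (int \<Rightarrow> 'm \<Rightarrow> 'n) set" where
  "hshift s F = (\<lambda>f i. f (i + s)) ` F"

definition hiso :: "'k ring \<Rightarrow> ('k, 'a) dg_alg \<Rightarrow> ('k, 'a, 'm) dg_mod \<Rightarrow>
    ('k, 'a, 'n) dg_mod \<Rightarrow> (int \<Rightarrow> 'm \<Rightarrow> 'n) set \<Rightarrow> bool" where
  "hiso K A X Y F \<longleftrightarrow> F \<in> hmors K A X Y \<and>
     (\<exists>G\<in>hmors K A Y X. hcomp K A X X G F = hid K A X \<and> hcomp K A Y Y F G = hid K A Y)"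

definition hisomorphic :: "'k ring \<Rightarrow> ('k, 'a) dg_alg \<Rightarrow> ('k, 'a, 'm) dg_mod \<Rightarrow>
    ('k, 'a, 'n) dg_mod \<Rightarrow> bool" where
  "hisomorphic K A X Y \<longleftrightarrow> (\<exists>F. hiso K A X Y F)"

text \<open>The distinguished triangles are those isomorphic in the homotopy category to a
  standard triangle \<open>X' \<rightarrow> Y' \<rightarrow> cone \<phi> \<rightarrow> X'[1]\<close>.\<close>

definition cone_in :: "('k, 'a, 'm) dg_mod \<Rightarrow> ('k, 'a, 'n) dg_mod \<Rightarrow> (int \<Rightarrow> 'n \<Rightarrow> 'n \<times> 'm)" where
  "cone_in X Y = (\<lambda>i. \<lambda>y\<in>carrier (mcomp Y i). (y, \<zero>\<^bsub>mcomp X (i + 1)\<^esub>))"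

definition cone_out :: "('k, 'a, 'm) dg_mod \<Rightarrow> ('k, 'a, 'n) dg_mod \<Rightarrow> (int \<Rightarrow> 'n \<times> 'm \<Rightarrow> 'm)" where
  "cone_out X Y = (\<lambda>i. \<lambda>u\<in>carrier (mcomp Y i) \<times> carrier (mcomp X (i + 1)). snd u)"

definition htriangle :: "'k ring \<Rightarrow> ('k, 'a) dg_alg \<Rightarrow>
    ('k, 'a, 'u) dg_mod \<Rightarrow> ('k, 'a, 'u) dg_mod \<Rightarrow> ('k, 'a, 'u) dg_mod \<Rightarrow>
    (int \<Rightarrow> 'u \<Rightarrow> 'u) set \<Rightarrow> (int \<Rightarrow> 'u \<Rightarrow> 'u) set \<Rightarrow> (int \<Rightarrow> 'u \<Rightarrow> 'u) set \<Rightarrow> bool" where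
  "htriangle K A X Y Z f g h \<longleftrightarrow>
     dg_module K A X \<and> dg_module K A Y \<and> dg_module K A Z \<and>
     f \<in> hmors K A X Y \<and> g \<in> hmors K A Y Z \<and> h \<in> hmors K A Z (dg_shift 1 X) \<and>
     (\<exists>(X' :: ('k, 'a, 'u) dg_mod) (Y' :: ('k, 'a, 'u) dg_mod) \<phi> \<alpha> \<beta> \<gamma>.
        dg_module K A X' \<and> dg_module K A Y' \<and> \<phi> \<in> chain_maps K A X' Y' \<and>
        hiso K A X X' \<alpha> \<and> hiso K A Y Y' \<beta> \<and> hiso K A Z (dg_cone X' Y' \<phi>) \<gamma> \<and>
        hcomp K A X Y' \<beta> f = hcomp K A X Y' (hclass K A X' Y' \<phi>) \<alpha> \<and>
        hcomp K A Y (dg_cone X' Y' \<phi>) \<gamma> g =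
          hcomp K A Y (dg_cone X' Y' \<phi>)
            (hclass K A Y' (dg_cone X' Y' \<phi>) (cone_in X' Y')) \<beta> \<and>
        hcomp K A Z (dg_shift 1 X') (hshift 1 \<alpha>) h =
          hcomp K A Z (dg_shift 1 X')
            (hclass K A (dg_cone X' Y' \<phi>) (dg_shift 1 X') (cone_out X' Y')) \<gamma>)"

text \<open>\<open>add_cat K A N\<close> is \<open>add(N)\<close>: a summand \<open>L\<close> of a power \<open>N\<^sup>r\<close> in the homotopy category.
  \<open>add_gen K A M\<close> is the smallest class containing all \<open>add(M[s])\<close> and closed under
  finite direct sums and isomorphism in the homotopy category (zero objects already lie in
  \<open>add(M)\<close>, as \<open>r = 0\<close> is allowed).\<close>

definition add_cat :: "'k ring \<Rightarrow> ('k, 'a) dg_alg \<Rightarrow> ('k, 'a, 'u) dg_mod \<Rightarrow>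
    ('k, 'a, 'u) dg_mod set" where
  "add_cat K A N = {L. dg_module K A L \<and>
     (\<exists>(L' :: ('k, 'a, 'u) dg_mod) r. dg_module K A L' \<and>
        hisomorphic K A (dg_sum L L') (dg_power r N))}"

inductive_set add_gen :: "'k ring \<Rightarrow> ('k, 'a) dg_alg \<Rightarrow> ('k, 'a, 'u) dg_mod \<Rightarrow>
    ('k, 'a, 'u) dg_mod set"
  for K :: "'k ring" and A :: "('k, 'a) dg_alg" and M :: "('k, 'a, 'u) dg_mod" where
  base: "L \<in> add_cat K A (dg_shift s M) \<Longrightarrow> L \<in> add_gen K A M"
| sum: "\<lbrakk>L1 \<in> add_gen K A M; L2 \<in> add_gen K A M; dg_module K A L;
         hisomorphic K A L (dg_sum L1 L2)\<rbrakk> \<Longrightarrow> L \<in> add_gen K A M"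

section \<open>Triangulated categories, localization and triangle equivalence\<close>

text \<open>The data of a triangulated category.  \<open>cmps C X Y Z g f\<close> is the composite
  \<open>g \<circ> f : X \<rightarrow> Y \<rightarrow> Z\<close>; hom sets need not be disjoint.\<close>

record ('o, 'f) tri_cat =
  objs :: "'o set"
  mors :: "'o \<Rightarrow> 'o \<Rightarrow> 'f set"
  ids :: "'o \<Rightarrow> 'f"
  cmps :: "'o \<Rightarrow> 'o \<Rightarrow> 'o \<Rightarrow> 'f \<Rightarrow> 'f \<Rightarrow> 'f"
  adds :: "'o \<Rightarrow> 'o \<Rightarrow> 'f \<Rightarrow> 'f \<Rightarrow> 'f"
  shobj :: "'o \<Rightarrow> 'o"
  shmor :: "'o \<Rightarrow> 'o \<Rightarrow> 'f \<Rightarrow> 'f"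
  triangles :: "('o \<times> 'o \<times> 'o \<times> 'f \<times> 'f \<times> 'f) set"

definition cat_iso :: "('o, 'f) tri_cat \<Rightarrow> 'o \<Rightarrow> 'o \<Rightarrow> 'f \<Rightarrow> bool" where
  "cat_iso C X Y f \<longleftrightarrow> f \<in> mors C X Y \<and>
     (\<exists>g\<in>mors C Y X. cmps C X Y X g f = ids C X \<and> cmps C Y X Y f g = ids C Y)"

subsection \<open>Localization\<close>

text \<open>The localization of \<open>C\<close> at a class \<open>W\<close> of morphisms has the objects of \<open>C\<close>, and as
  morphisms the finite zigzags of morphisms of \<open>C\<close> and formal inverses of elements of \<open>W\<close>,
  modulo the least congruence which respects identities and composites of \<open>C\<close> and makes the
  formal inverses inverse to the elements of \<open>W\<close>.
  \<open>Fwd X Y f\<close> is \<open>f : X \<rightarrow> Y\<close>; \<open>Bwd X Y s\<close> is the formal inverse \<open>Y \<rightarrow> X\<close> of \<open>s : X \<rightarrow> Y\<close>.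
  Zigzags are composed from left to right.\<close>

datatype ('o, 'f) step = Fwd 'o 'o 'f | Bwd 'o 'o 'f

inductive zigzag :: "('o, 'f) tri_cat \<Rightarrow> ('o \<Rightarrow> 'o \<Rightarrow> 'f set) \<Rightarrow>
    'o \<Rightarrow> 'o \<Rightarrow> ('o, 'f) step list \<Rightarrow> bool"
  for C :: "('o, 'f) tri_cat" and W :: "'o \<Rightarrow> 'o \<Rightarrow> 'f set" where
  nil: "X \<in> objs C \<Longrightarrow> zigzag C W X X []"
| fwd: "\<lbrakk>X \<in> objs C; f \<in> mors C X Y; zigzag C W Y Z p\<rbrakk> \<Longrightarrow> zigzag C W X Z (Fwd X Y f # p)"
| bwd: "\<lbrakk>Y \<in> objs C; s \<in> W X Y; zigzag C W X Z p\<rbrakk> \<Longrightarrow> zigzag C W Y Z (Bwd X Y s # p)"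

inductive zigzag_eq :: "('o, 'f) tri_cat \<Rightarrow> ('o \<Rightarrow> 'o \<Rightarrow> 'f set) \<Rightarrow>
    'o \<Rightarrow> 'o \<Rightarrow> ('o, 'f) step list \<Rightarrow> ('o, 'f) step list \<Rightarrow> bool"
  for C :: "('o, 'f) tri_cat" and W :: "'o \<Rightarrow> 'o \<Rightarrow> 'f set" where
  refl: "zigzag C W X Y p \<Longrightarrow> zigzag_eq C W X Y p p"
| sym: "zigzag_eq C W X Y p q \<Longrightarrow> zigzag_eq C W X Y q p"
| trans: "\<lbrakk>zigzag_eq C W X Y p q; zigzag_eq C W X Y q r\<rbrakk> \<Longrightarrow> zigzag_eq C W X Y p r"
| append: "\<lbrakk>zigzag_eq C W X Y p p'; zigzag_eq C W Y Z q q'\<rbrakk> \<Longrightarrow>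
    zigzag_eq C W X Z (p @ q) (p' @ q')"
| ident: "X \<in> objs C \<Longrightarrow> zigzag_eq C W X X [Fwd X X (ids C X)] []"
| comp: "\<lbrakk>X \<in> objs C; Y \<in> objs C; Z \<in> objs C; f \<in> mors C X Y; g \<in> mors C Y Z\<rbrakk> \<Longrightarrow>
    zigzag_eq C W X Z [Fwd X Y f, Fwd Y Z g] [Fwd X Z (cmps C X Y Z g f)]"
| inv_right: "\<lbrakk>X \<in> objs C; Y \<in> objs C; s \<in> W X Y\<rbrakk> \<Longrightarrow>
    zigzag_eq C W X X [Fwd X Y s, Bwd X Y s] []"
| inv_left: "\<lbrakk>X \<in> objs C; Y \<in> objs C; s \<in> W X Y\<rbrakk> \<Longrightarrow>
    zigzag_eq C W Y Y [Bwd X Y s, Fwd X Y s] []"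

definition zclass :: "('o, 'f) tri_cat \<Rightarrow> ('o \<Rightarrow> 'o \<Rightarrow> 'f set) \<Rightarrow>
    'o \<Rightarrow> 'o \<Rightarrow> ('o, 'f) step list \<Rightarrow> ('o, 'f) step list set" where
  "zclass C W X Y p = {q. zigzag_eq C W X Y p q}"

text \<open>The category underlying the localization; \<open>W\<close> is assumed stable under the shift.
  When \<open>W\<close> is a multiplicative system, any two morphisms \<open>X \<rightarrow> Y\<close> can be written with a common
  denominator as \<open>a \<circ> s\<inverse>\<close> and \<open>b \<circ> s\<inverse>\<close>, and their sum is \<open>(a + b) \<circ> s\<inverse>\<close>.
  The triangles are added below.\<close>

definition loc_base :: "('o, 'f) tri_cat \<Rightarrow> ('o \<Rightarrow> 'o \<Rightarrow> 'f set) \<Rightarrow>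
    ('o, ('o, 'f) step list set) tri_cat" where
  "loc_base C W =
     \<lparr>objs = objs C,
      mors = (\<lambda>X Y. {zclass C W X Y p | p. zigzag C W X Y p}),
      ids = (\<lambda>X. zclass C W X X []),
      cmps = (\<lambda>X Y Z G F. \<Union>p\<in>F. \<Union>q\<in>G. zclass C W X Z (p @ q)),
      adds = (\<lambda>X Y F G. \<Union>{zclass C W X Y [Bwd Z X s, Fwd Z Y (adds C Z Y a b)] | Z s a b.
                Z \<in> objs C \<and> s \<in> W Z X \<and> a \<in> mors C Z Y \<and> b \<in> mors C Z Y \<and>
                F = zclass C W X Y [Bwd Z X s, Fwd Z Y a] \<and>
                G = zclass C W X Y [Bwd Z X s, Fwd Z Y b]}),
      shobj = shobj C,
      shmor = (\<lambda>X Y F. \<Union>p\<in>F. zclass C W (shobj C X) (shobj C Y)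
                (map (\<lambda>t. case t of
                    Fwd U V f \<Rightarrow> Fwd (shobj C U) (shobj C V) (shmor C U V f)
                  | Bwd U V s \<Rightarrow> Bwd (shobj C U) (shobj C V) (shmor C U V s)) p)),
      triangles = {}\<rparr>"

text \<open>A triangle of the localization is distinguished when it is isomorphic there to the image
  of a distinguished triangle of \<open>C\<close>.\<close>

definition localization :: "('o, 'f) tri_cat \<Rightarrow> ('o \<Rightarrow> 'o \<Rightarrow> 'f set) \<Rightarrow>
    ('o, ('o, 'f) step list set) tri_cat" where
  "localization C W = (let D = loc_base C W; Q = (\<lambda>X Y f. zclass C W X Y [Fwd X Y f]) in
     D\<lparr>triangles := {(X, Y, Z, f, g, h).
        X \<in> objs D \<and> Y \<in> objs D \<and> Z \<in> objs D \<and>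
        f \<in> mors D X Y \<and> g \<in> mors D Y Z \<and> h \<in> mors D Z (shobj D X) \<and>
        (\<exists>X' Y' Z' f' g' h' \<alpha> \<beta> \<gamma>.
           (X', Y', Z', f', g', h') \<in> triangles C \<and>
           cat_iso D X X' \<alpha> \<and> cat_iso D Y Y' \<beta> \<and> cat_iso D Z Z' \<gamma> \<and>
           cmps D X Y Y' \<beta> f = cmps D X X' Y' (Q X' Y' f') \<alpha> \<and>
           cmps D Y Z Z' \<gamma> g = cmps D Y Y' Z' (Q Y' Z' g') \<beta> \<and>
           cmps D Z (shobj D X) (shobj D X') (shmor D X X' \<alpha>) h =
             cmps D Z Z' (shobj D X') (Q Z' (shobj C X') h') \<gamma>)}\<rparr>)"

subsection \<open>Equivalence of triangulated categories\<close>

definition is_functor :: "('o, 'f) tri_cat \<Rightarrow> ('p, 'g) tri_cat \<Rightarrow>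
    ('o \<Rightarrow> 'p) \<Rightarrow> ('o \<Rightarrow> 'o \<Rightarrow> 'f \<Rightarrow> 'g) \<Rightarrow> bool" where
  "is_functor C D F \<Phi> \<longleftrightarrow>
     (\<forall>X\<in>objs C. F X \<in> objs D \<and> \<Phi> X X (ids C X) = ids D (F X)) \<and>
     (\<forall>X\<in>objs C. \<forall>Y\<in>objs C. \<Phi> X Y \<in> mors C X Y \<rightarrow> mors D (F X) (F Y)) \<and>
     (\<forall>X\<in>objs C. \<forall>Y\<in>objs C. \<forall>Z\<in>objs C. \<forall>f\<in>mors C X Y. \<forall>g\<in>mors C Y Z.
        \<Phi> X Z (cmps C X Y Z g f) = cmps D (F X) (F Y) (F Z) (\<Phi> Y Z g) (\<Phi> X Y f))"

definition is_equivalence :: "('o, 'f) tri_cat \<Rightarrow> ('p, 'g) tri_cat \<Rightarrow>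
    ('o \<Rightarrow> 'p) \<Rightarrow> ('o \<Rightarrow> 'o \<Rightarrow> 'f \<Rightarrow> 'g) \<Rightarrow> bool" where
  "is_equivalence C D F \<Phi> \<longleftrightarrow> is_functor C D F \<Phi> \<and>
     (\<forall>X\<in>objs C. \<forall>Y\<in>objs C. bij_betw (\<Phi> X Y) (mors C X Y) (mors D (F X) (F Y))) \<and>
     (\<forall>Z\<in>objs D. \<exists>X\<in>objs C. \<exists>f. cat_iso D (F X) Z f)"

text \<open>A triangle functor is an additive functor \<open>F\<close> with a natural isomorphism
  \<open>\<eta> X : F (X[1]) \<rightarrow> (F X)[1]\<close> through which \<open>F\<close> maps distinguished triangles to
  distinguished triangles.\<close>

definition is_triangle_functor :: "('o, 'f) tri_cat \<Rightarrow> ('p, 'g) tri_cat \<Rightarrow>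
    ('o \<Rightarrow> 'p) \<Rightarrow> ('o \<Rightarrow> 'o \<Rightarrow> 'f \<Rightarrow> 'g) \<Rightarrow> ('o \<Rightarrow> 'g) \<Rightarrow> bool" where
  "is_triangle_functor C D F \<Phi> \<eta> \<longleftrightarrow> is_functor C D F \<Phi> \<and>
     (\<forall>X\<in>objs C. \<forall>Y\<in>objs C. \<forall>f\<in>mors C X Y. \<forall>g\<in>mors C X Y.
        \<Phi> X Y (adds C X Y f g) = adds D (F X) (F Y) (\<Phi> X Y f) (\<Phi> X Y g)) \<and>
     (\<forall>X\<in>objs C. cat_iso D (F (shobj C X)) (shobj D (F X)) (\<eta> X)) \<and>
     (\<forall>X\<in>objs C. \<forall>Y\<in>objs C. \<forall>f\<in>mors C X Y.
        cmps D (F (shobj C X)) (F (shobj C Y)) (shobj D (F Y)) (\<eta> Y)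
          (\<Phi> (shobj C X) (shobj C Y) (shmor C X Y f)) =
        cmps D (F (shobj C X)) (shobj D (F X)) (shobj D (F Y))
          (shmor D (F X) (F Y) (\<Phi> X Y f)) (\<eta> X)) \<and>
     (\<forall>(X, Y, Z, f, g, h)\<in>triangles C.
        (F X, F Y, F Z, \<Phi> X Y f, \<Phi> Y Z g,
         cmps D (F Z) (F (shobj C X)) (shobj D (F X)) (\<eta> X) (\<Phi> Z (shobj C X) h))
        \<in> triangles D)"

definition triangle_equivalent :: "('o, 'f) tri_cat \<Rightarrow> ('p, 'g) tri_cat \<Rightarrow> bool" where
  "triangle_equivalent C D \<longleftrightarrow>
     (\<exists>F \<Phi> \<eta>. is_equivalence C D F \<Phi> \<and> is_triangle_functor C D F \<Phi> \<eta>)"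

section \<open>Derived categories\<close>

text \<open>The homotopy category of the right dg modules with elements in \<open>'u\<close>.  For infinite \<open>'u\<close>
  these modules are closed, up to isomorphism, under shifts, cones and finite direct sums.\<close>

definition homotopy_cat :: "'k ring \<Rightarrow> ('k, 'a) dg_alg \<Rightarrow>
    (('k, 'a, 'u) dg_mod, (int \<Rightarrow> 'u \<Rightarrow> 'u) set) tri_cat" where
  "homotopy_cat K A =
     \<lparr>objs = {X. dg_module K A X},
      mors = hmors K A,
      ids = hid K A,
      cmps = (\<lambda>X Y Z. hcomp K A X Z),
      adds = hadd K A,
      shobj = dg_shift 1,
      shmor = (\<lambda>X Y. hshift 1),
      triangles = {(X, Y, Z, f, g, h). htriangle K A X Y Z f g h}\<rparr>"

definition cocycles :: "('k, 'a, 'm) dg_mod \<Rightarrow> int \<Rightarrow> 'm set" where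
  "cocycles M i = {x \<in> carrier (mcomp M i). mdiff M i x = \<zero>\<^bsub>mcomp M (i + 1)\<^esub>}"

definition coboundaries :: "('k, 'a, 'm) dg_mod \<Rightarrow> int \<Rightarrow> 'm set" where
  "coboundaries M i = mdiff M (i - 1) ` carrier (mcomp M (i - 1))"

definition cohomology :: "('k, 'a, 'm) dg_mod \<Rightarrow> int \<Rightarrow> 'm set set" where
  "cohomology M i = (\<lambda>x. coboundaries M i +>\<^bsub>mcomp M i\<^esub> x) ` cocycles M i"

definition cohomology_map :: "('k, 'a, 'n) dg_mod \<Rightarrow> (int \<Rightarrow> 'm \<Rightarrow> 'n) \<Rightarrow> int \<Rightarrow>
    'm set \<Rightarrow> 'n set" where
  "cohomology_map N f i S = (\<Union>x\<in>S. coboundaries N i +>\<^bsub>mcomp N i\<^esub> f i x)"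

definition quasi_isos :: "'k ring \<Rightarrow> ('k, 'a) dg_alg \<Rightarrow> ('k, 'a, 'm) dg_mod \<Rightarrow>
    ('k, 'a, 'n) dg_mod \<Rightarrow> (int \<Rightarrow> 'm \<Rightarrow> 'n) set set" where
  "quasi_isos K A X Y = {F \<in> hmors K A X Y. \<exists>f\<in>F. \<forall>i.
     bij_betw (cohomology_map Y f i) (cohomology X i) (cohomology Y i)}"

definition derived_cat :: "'k ring \<Rightarrow> ('k, 'a) dg_alg \<Rightarrow>
    (('k, 'a, 'u) dg_mod,
     (('k, 'a, 'u) dg_mod, (int \<Rightarrow> 'u \<Rightarrow> 'u) set) step list set) tri_cat" where
  "derived_cat K A = localization (homotopy_cat K A) (quasi_isos K A)"

text \<open>HOL has no type of all dg modules.  The first argument fixes a type \<open>'v\<close>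
  which serves as the universe from which the elements of the dg modules in both derived categories
  are drawn; it has to be chosen large enough (infinite, and containing a copy of both
  algebras) for these to be the derived categories of the algebras.\<close>

definition derived_equivalent :: "'v itself \<Rightarrow> 'k ring \<Rightarrow> ('k, 'b) dg_alg \<Rightarrow>
    ('k, 'c) dg_alg \<Rightarrow> bool" where
  "derived_equivalent _ K \<Lambda> \<Gamma> \<longleftrightarrow>
     triangle_equivalent
       (derived_cat K \<Lambda> ::
         (('k, 'b, 'v) dg_mod,
          (('k, 'b, 'v) dg_mod, (int \<Rightarrow> 'v \<Rightarrow> 'v) set) step list set) tri_cat)
       (derived_cat K \<Gamma> ::
         (('k, 'c, 'v) dg_mod,
          (('k, 'c, 'v) dg_mod, (int \<Rightarrow> 'v \<Rightarrow> 'v) set) step list set) tri_cat)"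

end

theory Submission
  imports Defs
begin

text \<open>
 Two corners \<open>e \<Omega> e\<close> of one dg algebra \<open>\<Omega>\<close> are compared.  Let \<open>x = X \<oplus> M\<close>, \<open>y = Y \<oplus> M\<close>, and let the
 triangle be equivalent to the mapping cone triangle of a chain map \<open>X' \<rightarrow> Y'\<close> with cone \<open>C\<close>.  Put
 \<open>W = (x \<oplus> y) \<oplus> (C \<oplus> (X' \<oplus> Y'))\<close> and let \<open>\<Omega>\<close> be the dg endomorphism algebra of \<open>W\<close>.  Since \<open>x\<close> and \<open>y\<close>
 are strict direct summands of \<open>W\<close>, their dg endomorphism algebras are the corners \<open>e \<Omega> e\<close> and
 \<open>e' \<Omega> e'\<close> of the corresponding closed idempotents (\<open>retract_corner\<close>).

 For such a corner \<open>L = e \<Omega> e\<close> there are two dg functors: restriction \<open>N \<mapsto> N e\<close> from \<open>\<Omega>\<close>-modules to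
 \<open>L\<close>-modules, and \<open>N \<mapsto> N \<otimes>\<^sub>L e \<Omega>\<close> in the other direction.  The map \<open>(N \<otimes> e \<Omega>) e \<rightarrow> N\<close> is always an
 isomorphism (\<open>iota_mu\<close>).  It follows formally that \<open>M e \<otimes> e \<Omega> \<rightarrow> M\<close> is a quasi-isomorphism and that the
 tensor product preserves quasi-isomorphisms, as soon as restriction detects acyclic modules
 (\<open>nu_qis\<close>, \<open>tp_qis\<close>).  So no resolutions are needed, and if both corners detect acyclicity, then
 tensoring up from one and restricting to the other gives two dg functors that are mutually
 inverse up to natural quasi-isomorphisms (\<open>corners_derived_equivalent\<close>).

 That restriction detects acyclicity is where the triangle enters.  Fix an \<open>\<Omega>\<close>-module \<open>N\<close> and call
 an object \<open>P\<close> null if every composite \<open>W \<rightarrow> P \<rightarrow> W\<close> of cocycles acts as zero on the cohomology of \<open>N\<close>.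
 The module \<open>N\<close> is acyclic if \<open>W\<close> is null, and if \<open>N e\<close> is acyclic then \<open>x\<close> is null.  Null objects are
 closed under shifts, finite sums and homotopy retracts, hence contain every object of \<open>\<langle>M\<rangle>\<close> with \<open>M\<close>
 (\<open>null_obj_add_gen\<close>); and if the middle term of a cone triangle is null, then its two outer terms
 are null together (\<open>null_obj_cone\<close>).  So \<open>x\<close> null means \<open>M\<close> and \<open>X\<close> null, hence \<open>M\<^sub>1\<close> null, hence \<open>Y\<close> null,
 hence \<open>W\<close> null; and symmetrically for \<open>y\<close> (\<open>triangle_common_retract\<close>).

 The passage from dg functors to derived categories (\<open>dg_equivalence.derived_equivalence\<close>) has
 three ingredients.  A pair of functors that respects the inverted arrows and is inverse up to natural
 inverted arrows gives an equivalence of zigzag localizations (\<open>loc_equivalence\<close>).  Dg functors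
 preserve shifts and mapping cones, which are described by equations in the dg category
 (\<open>is_cone\<close>), so they induce triangle functors on homotopy categories (\<open>\<Phi>_triangle\<close>), and these
 descend (\<open>loc_triangle_functor\<close>).  Additivity of the induced functor has to be
 seen on zigzags; it is reduced to the addition of two arrows with a common denominator
 (\<open>Ore_chain\<close>, \<open>common_roof\<close>, \<open>adds_roof\<close>).

 The derived categories consist of modules whose elements lie in a given type \<open>'v\<close>.  Tensor products
 and direct sums are therefore coded into \<open>'v\<close>; the injections that this requires exist because \<open>'v\<close>
 is at least as large as the degreewise functions on \<open>'u \<times> 'u\<close>, with \<open>'u\<close> infinite (\<open>codes_exist\<close>).  This
 is also why tensor products are used, and not coinduced modules \<open>Hom\<^sub>L(\<Omega> e, N)\<close>, which need not fit
 into \<open>'v\<close>.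
\<close>

section \<open>Abelian groups, linear maps and signs\<close>

text \<open>The same symbols with the structure in brackets; the forms with two parameters name
 a module and a degree.\<close>

abbreviation group_add ("(_ \<oplus>[_]/ _)" [65, 0, 66] 65) where "x \<oplus>[G] y \<equiv> x \<oplus>\<^bsub>G\<^esub> y"
abbreviation group_neg ("\<ominus>[_]/ _" [0, 81] 80) where "\<ominus>[G] x \<equiv> \<ominus>\<^bsub>G\<^esub> x"
abbreviation group_zero ("\<zero>[_]") where "\<zero>[G] \<equiv> \<zero>\<^bsub>G\<^esub>"
abbreviation module_smult ("(_ \<odot>[_]/ _)" [70, 0, 71] 70) where "c \<odot>[V] x \<equiv> c \<odot>\<^bsub>V\<^esub> x"
abbreviation car where "car M i \<equiv> carrier (mcomp M i)"
abbreviation comp_add ("(_ \<oplus>[_,_]/ _)" [65, 0, 0, 66] 65) where "x \<oplus>[M,i] y \<equiv> x \<oplus>[mcomp M i] y"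
abbreviation comp_neg ("\<ominus>[_,_]/ _" [0, 0, 81] 80) where "\<ominus>[M,i] x \<equiv> \<ominus>[mcomp M i] x"
abbreviation comp_zero ("\<zero>[_,_]") where "\<zero>[M,i] \<equiv> \<zero>[mcomp M i]"
abbreviation comp_smult ("(_ \<odot>[_,_]/ _)" [70, 0, 0, 71] 70) where "c \<odot>[M,i] x \<equiv> c \<odot>[mcomp M i] x"

lemma UN_const: "[|a \<in> S; \<And>x. x \<in> S ==> F x = C|] ==> (\<Union>x\<in>S. F x) = C"
 by auto

lemma UN2_const: "[|a \<in> S; b \<in> T; \<And>x y. [|x \<in> S; y \<in> T|] ==> F x y = C|] ==> (\<Union>x\<in>S. \<Union>y\<in>T. F x y) = C"
 by auto

lemma ag_add_closed: "[|abelian_group G; x \<in> carrier G; y \<in> carrier G|] ==> x \<oplus>[G] y \<in> carrier G"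
 by (simp add: abelian_group_def abelian_monoid.a_closed)

lemma ag_zero_closed: "abelian_group G ==> \<zero>[G] \<in> carrier G"
 by (simp add: abelian_group_def abelian_monoid.zero_closed)

lemma ag_l_zero: "[|abelian_group G; x \<in> carrier G|] ==> \<zero>[G] \<oplus>[G] x = x"
 by (simp add: abelian_group_def abelian_monoid.l_zero)

lemma ag_r_zero: "[|abelian_group G; x \<in> carrier G|] ==> x \<oplus>[G] \<zero>[G] = x"
 by (simp add: abelian_group_def abelian_monoid.r_zero)

lemma ag_assoc: "[|abelian_group G; x \<in> carrier G; y \<in> carrier G; z \<in> carrier G|] ==>
  x \<oplus>[G] y \<oplus>[G] z = x \<oplus>[G] (y \<oplus>[G] z)"
 by (simp add: abelian_group_def abelian_monoid.a_assoc)

lemma ag_comm: "[|abelian_group G; x \<in> carrier G; y \<in> carrier G|] ==> x \<oplus>[G] y = y \<oplus>[G] x"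
 by (simp add: abelian_group_def abelian_monoid.a_comm)

lemma ag_lcomm: "[|abelian_group G; x \<in> carrier G; y \<in> carrier G; z \<in> carrier G|] ==>
  x \<oplus>[G] (y \<oplus>[G] z) = y \<oplus>[G] (x \<oplus>[G] z)"
 by (simp add: abelian_group_def abelian_monoid.a_lcomm)

lemmas ag_neg_closed = abelian_group.a_inv_closed
lemmas ag_l_neg = abelian_group.l_neg
lemmas ag_r_neg = abelian_group.r_neg
lemmas ag_r_neg1 = abelian_group.r_neg1
lemmas ag_r_neg2 = abelian_group.r_neg2
lemmas ag_neg_add = abelian_group.minus_add
lemmas ag_neg_neg = abelian_group.minus_minus

lemma ag_neg_zero: "abelian_group G ==> \<ominus>[G] \<zero>[G] = \<zero>[G]"
 by (metis ag_l_zero ag_r_neg ag_neg_closed ag_zero_closed)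

lemmas ag_simps = ag_add_closed ag_zero_closed ag_l_zero ag_r_zero ag_neg_closed ag_l_neg ag_r_neg
 ag_r_neg1 ag_r_neg2 ag_neg_add ag_neg_neg ag_neg_zero
lemmas ag_ac = ag_assoc ag_comm ag_lcomm

lemma ag_neg_unique: "[|abelian_group G; x \<in> carrier G; y \<in> carrier G; x \<oplus>[G] y = \<zero>[G]|] ==> \<ominus>[G] x = y"
 by (metis ag_r_neg1 ag_r_zero ag_neg_closed)

lemma ag_idem_zero: "[|abelian_group G; x \<in> carrier G; x \<oplus>[G] x = x|] ==> x = \<zero>[G]"
 by (metis ag_r_neg1 ag_l_neg)

lemma module_ag: "module K V ==> abelian_group V"
 by (simp add: module_def)

lemma linear_mapI:
 assumes "\<And>x. x \<in> carrier V ==> f x \<in> carrier W"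
  and "\<And>x y. [|x \<in> carrier V; y \<in> carrier V|] ==> f (x \<oplus>[V] y) = f x \<oplus>[W] f y"
  and "\<And>c x. [|c \<in> carrier K; x \<in> carrier V|] ==> f (c \<odot>[V] x) = c \<odot>[W] f x"
 shows "linear_map K V W f"
 using assms by (auto simp: linear_map_def)

lemma linear_mapD:
 assumes "linear_map K V W f"
 shows "x \<in> carrier V ==> f x \<in> carrier W"
  and "[|x \<in> carrier V; y \<in> carrier V|] ==> f (x \<oplus>[V] y) = f x \<oplus>[W] f y"
  and "[|c \<in> carrier K; x \<in> carrier V|] ==> f (c \<odot>[V] x) = c \<odot>[W] f x"
 using assms by (auto simp: linear_map_def)

lemma additive_zero:
 assumes "abelian_group V" "abelian_group W" "\<And>x. x \<in> carrier V ==> f x \<in> carrier W"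
  and "\<And>x y. [|x \<in> carrier V; y \<in> carrier V|] ==> f (x \<oplus>[V] y) = f x \<oplus>[W] f y"
 shows "f \<zero>[V] = \<zero>[W]"
 using assms by (metis ag_idem_zero ag_l_zero ag_zero_closed)

lemma additive_neg:
 assumes "abelian_group V" "abelian_group W" "\<And>x. x \<in> carrier V ==> f x \<in> carrier W"
  and "\<And>x y. [|x \<in> carrier V; y \<in> carrier V|] ==> f (x \<oplus>[V] y) = f x \<oplus>[W] f y"
  and "x \<in> carrier V"
 shows "f (\<ominus>[V] x) = \<ominus>[W] f x"
 using additive_zero[OF assms(1-4)] assms
 by (metis ag_neg_closed ag_neg_unique ag_r_neg)

lemma additive_ksign:
 assumes "abelian_group V" "abelian_group W" "\<And>x. x \<in> carrier V ==> f x \<in> carrier W"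
  and "\<And>x y. [|x \<in> carrier V; y \<in> carrier V|] ==> f (x \<oplus>[V] y) = f x \<oplus>[W] f y"
  and "x \<in> carrier V"
 shows "f (ksign V p x) = ksign W p (f x)"
 using additive_neg[of V W f, OF assms(1-4)] assms(5) by (simp add: ksign_def)

lemma ksign_closed: "[|abelian_group V; x \<in> carrier V|] ==> ksign V p x \<in> carrier V"
 by (simp add: ksign_def ag_simps)

lemma ksign_add: "[|abelian_group V; x \<in> carrier V; y \<in> carrier V|] ==>
  ksign V p (x \<oplus>[V] y) = ksign V p x \<oplus>[V] ksign V p y"
 by (simp add: ksign_def ag_simps)

lemma ksign_ksign: "[|abelian_group V; x \<in> carrier V|] ==> ksign V p (ksign V q x) = ksign V (p + q) x"
 by (auto simp: ksign_def ag_simps)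

lemma ksign_zero: "abelian_group V ==> ksign V p \<zero>[V] = \<zero>[V]"
 by (simp add: ksign_def ag_simps)

lemma ksign_0 [simp]: "ksign V 0 x = x"
 by (simp add: ksign_def)

lemma ksign_smult: "[|module K V; c \<in> carrier K; x \<in> carrier V|] ==>
  ksign V p (c \<odot>[V] x) = c \<odot>[V] ksign V p x"
 by (simp add: ksign_def module.smult_r_minus)

lemma moduleI':
 assumes "cring K" "abelian_group V"
  and "\<And>c x. [|c \<in> carrier K; x \<in> carrier V|] ==> c \<odot>[V] x \<in> carrier V"
  and "\<And>c d x. [|c \<in> carrier K; d \<in> carrier K; x \<in> carrier V|] ==>
   (c \<oplus>[K] d) \<odot>[V] x = c \<odot>[V] x \<oplus>[V] d \<odot>[V] x"
  and "\<And>c x y. [|c \<in> carrier K; x \<in> carrier V; y \<in> carrier V|] ==>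
   c \<odot>[V] (x \<oplus>[V] y) = c \<odot>[V] x \<oplus>[V] c \<odot>[V] y"
  and "\<And>c d x. [|c \<in> carrier K; d \<in> carrier K; x \<in> carrier V|] ==>
   (c \<otimes>\<^bsub>K\<^esub> d) \<odot>[V] x = c \<odot>[V] (d \<odot>[V] x)"
  and "\<And>x. x \<in> carrier V ==> \<one>\<^bsub>K\<^esub> \<odot>[V] x = x"
 shows "module K V"
 using assms by (intro module.intro module_axioms.intro) auto

section \<open>Dg modules and their complexes of homomorphisms\<close>

context dg_algebra begin

abbreviation acar where "acar i \<equiv> carrier (acomp A i)"
abbreviation Hom where "Hom M N n \<equiv> hom_set K A M N n"
abbreviation HM where "HM M N n \<equiv> hom_module K A M N n"
abbreviation dgm where "dgm M \<equiv> dg_module K A M"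

lemma dgm_module: "dgm M ==> module K (mcomp M i)"
 by (simp add: dg_module_def dg_module_axioms_def)

lemma dgm_ag [simp]: "dgm M ==> abelian_group (mcomp M i)"
 using dgm_module module_ag by blast

lemma acomp_ag [simp]: "abelian_group (acomp A i)"
 using acomp_module module_ag by blast

lemma smult_closed [simp]: "[|dgm M; c \<in> carrier K; x \<in> car M i|] ==> c \<odot>[M,i] x \<in> car M i"
 using dgm_module module.smult_closed by metis

lemma act_closed: "[|dgm M; x \<in> car M i; a \<in> acar j; k = i + j|] ==> mact M i j x a \<in> car M k"
 using linear_mapD(1)[OF dg_module.mact_linear_left[of K A M a j i]] by simp

lemma act_add_left: "[|dgm M; x \<in> car M i; y \<in> car M i; a \<in> acar j|] ==>
  mact M i j (x \<oplus>[M,i] y) a = mact M i j x a \<oplus>[M,i + j] mact M i j y a"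
 using linear_mapD(2)[OF dg_module.mact_linear_left[of K A M a j i]] by simp

lemma act_smult_left: "[|dgm M; c \<in> carrier K; x \<in> car M i; a \<in> acar j|] ==>
  mact M i j (c \<odot>[M,i] x) a = c \<odot>[M,i + j] mact M i j x a"
 using linear_mapD(3)[OF dg_module.mact_linear_left[of K A M a j i]] by simp

lemma act_add_right: "[|dgm M; x \<in> car M i; a \<in> acar j; b \<in> acar j|] ==>
  mact M i j x (a \<oplus>[acomp A j] b) = mact M i j x a \<oplus>[M,i + j] mact M i j x b"
 using linear_mapD(2)[OF dg_module.mact_linear_right[of K A M x i j]] by simp

lemma act_smult_right: "[|dgm M; c \<in> carrier K; x \<in> car M i; a \<in> acar j|] ==>
  mact M i j x (c \<odot>[acomp A j] a) = c \<odot>[M,i + j] mact M i j x a"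
 using linear_mapD(3)[OF dg_module.mact_linear_right[of K A M x i j]] by simp

lemma act_neg_left: "[|dgm M; x \<in> car M i; a \<in> acar j|] ==>
  mact M i j (\<ominus>[M,i] x) a = \<ominus>[M,i + j] mact M i j x a"
 by (rule additive_neg[where f = "\<lambda>x. mact M i j x a"]) (auto simp: act_closed act_add_left)

lemma act_zero_left: "[|dgm M; a \<in> acar j|] ==> mact M i j \<zero>[M,i] a = \<zero>[M,i + j]"
 by (rule additive_zero[where f = "\<lambda>x. mact M i j x a"]) (auto simp: act_closed act_add_left)

lemma act_zero_right: "[|dgm M; x \<in> car M i|] ==> mact M i j x \<zero>[acomp A j] = \<zero>[M,i + j]"
 by (rule additive_zero[where f = "\<lambda>a. mact M i j x a"]) (auto simp: act_closed act_add_right)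

lemma act_ksign_left: "[|dgm M; x \<in> car M i; a \<in> acar j|] ==>
  mact M i j (ksign (mcomp M i) p x) a = ksign (mcomp M (i + j)) p (mact M i j x a)"
 by (rule additive_ksign[where f = "\<lambda>x. mact M i j x a"]) (auto simp: act_closed act_add_left)

lemma act_ksign_right: "[|dgm M; x \<in> car M i; a \<in> acar j|] ==>
  mact M i j x (ksign (acomp A j) p a) = ksign (mcomp M (i + j)) p (mact M i j x a)"
 by (rule additive_ksign[where f = "\<lambda>a. mact M i j x a"]) (auto simp: act_closed act_add_right)

lemma act_assoc: "[|dgm M; x \<in> car M i; a \<in> acar j; b \<in> acar l; k = i + j|] ==>
  mact M k l (mact M i j x a) b = mact M i (j + l) x (amult A j l a b)"
 by (simp add: dg_module.mact_assoc)

lemma act_one: "[|dgm M; x \<in> car M i|] ==> mact M i 0 x (aone A) = x"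
 by (rule dg_module.mact_one)

lemma diff_closed: "[|dgm M; x \<in> car M i; k = i + 1|] ==> mdiff M i x \<in> car M k"
 using linear_mapD(1)[OF dg_module.mdiff_linear[of K A M i]] by simp

lemma diff_add: "[|dgm M; x \<in> car M i; y \<in> car M i|] ==>
  mdiff M i (x \<oplus>[M,i] y) = mdiff M i x \<oplus>[M,i + 1] mdiff M i y"
 using linear_mapD(2)[OF dg_module.mdiff_linear[of K A M i]] by simp

lemma diff_smult: "[|dgm M; c \<in> carrier K; x \<in> car M i|] ==>
  mdiff M i (c \<odot>[M,i] x) = c \<odot>[M,i + 1] mdiff M i x"
 using linear_mapD(3)[OF dg_module.mdiff_linear[of K A M i]] by simp

lemma diff_neg: "[|dgm M; x \<in> car M i|] ==> mdiff M i (\<ominus>[M,i] x) = \<ominus>[M,i + 1] mdiff M i x"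
 by (rule additive_neg) (auto simp: diff_closed diff_add)

lemma diff_zero: "dgm M ==> mdiff M i \<zero>[M,i] = \<zero>[M,i + 1]"
 by (rule additive_zero) (auto simp: diff_closed diff_add)

lemma diff_ksign: "[|dgm M; x \<in> car M i|] ==>
  mdiff M i (ksign (mcomp M i) p x) = ksign (mcomp M (i + 1)) p (mdiff M i x)"
 by (rule additive_ksign) (auto simp: diff_closed diff_add)

lemma diff_diff: "[|dgm M; x \<in> car M i; j = i + 1|] ==> mdiff M j (mdiff M i x) = \<zero>[M,i + 2]"
 using dg_module.mdiff_square by metis

lemma diff_act: "[|dgm M; x \<in> car M n; a \<in> acar q; k = n + q|] ==>
  mdiff M k (mact M n q x a) =
   mact M (n + 1) q (mdiff M n x) a \<oplus>[M,n + q + 1]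
   ksign (mcomp M (n + q + 1)) n (mact M n (q + 1) x (adiff A q a))"
 by (simp add: dg_module.mdiff_leibniz)

lemmas dgm_closed = ag_add_closed ag_zero_closed ag_neg_closed ksign_closed act_closed diff_closed

lemma Hom_I:
 assumes "\<And>i. f i \<in> extensional (car M i)"
  and "\<And>i x. x \<in> car M i ==> f i x \<in> car N (i + n)"
  and "\<And>i x y. [|x \<in> car M i; y \<in> car M i|] ==>
   f i (x \<oplus>[M,i] y) = f i x \<oplus>[N,i + n] f i y"
  and "\<And>i c x. [|c \<in> carrier K; x \<in> car M i|] ==>
   f i (c \<odot>[M,i] x) = c \<odot>[N,i + n] f i x"
  and "\<And>i j x a. [|x \<in> car M i; a \<in> acar j|] ==> f (i + j) (mact M i j x a) = mact N (i + n) j (f i x) a"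
 shows "f \<in> Hom M N n"
 using assms by (auto simp: hom_set_def intro!: linear_mapI)

lemma Hom_closed: "[|f \<in> Hom M N n; x \<in> car M i; k = i + n|] ==> f i x \<in> car N k"
 by (auto simp: hom_set_def dest: linear_mapD(1))

lemma Hom_add: "[|f \<in> Hom M N n; x \<in> car M i; y \<in> car M i|] ==>
  f i (x \<oplus>[M,i] y) = f i x \<oplus>[N,i + n] f i y"
 by (auto simp: hom_set_def dest: linear_mapD(2))

lemma Hom_smult: "[|f \<in> Hom M N n; c \<in> carrier K; x \<in> car M i|] ==>
  f i (c \<odot>[M,i] x) = c \<odot>[N,i + n] f i x"
 by (auto simp: hom_set_def dest: linear_mapD(3))

lemma Hom_act: "[|f \<in> Hom M N n; x \<in> car M i; a \<in> acar j; k = i + j|] ==>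
  f k (mact M i j x a) = mact N (i + n) j (f i x) a"
 by (auto simp: hom_set_def)

lemma Hom_neg: "[|f \<in> Hom M N n; dgm M; dgm N; x \<in> car M i|] ==>
  f i (\<ominus>[M,i] x) = \<ominus>[N,i + n] f i x"
 by (rule additive_neg) (auto simp: Hom_closed Hom_add)

lemma Hom_zero: "[|f \<in> Hom M N n; dgm M; dgm N|] ==> f i \<zero>[M,i] = \<zero>[N,i + n]"
 by (rule additive_zero) (auto simp: Hom_closed Hom_add)

text \<open>Homomorphisms are extensional, so they are determined by their values on the carriers.\<close>

lemma Hom_eqI:
 assumes "f \<in> Hom M N n" "g \<in> Hom M N n" "\<And>i x. x \<in> car M i ==> f i x = g i x"
 shows "f = g"
proof
 fix i show "f i = g i"
  using assms by (intro extensionalityI[of _ "car M i"]) (auto simp: hom_set_def)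
qed

lemma HM_carrier [simp]: "carrier (HM M N n) = Hom M N n"
 by (simp add: hom_module_def)

lemma HM_add_apply [simp]: "x \<in> car M i ==> (f \<oplus>[HM M N n] g) i x = f i x \<oplus>[N,i + n] g i x"
 by (simp add: hom_module_def)

lemma HM_zero_apply [simp]: "x \<in> car M i ==> \<zero>[HM M N n] i x = \<zero>[N,i + n]"
 by (simp add: hom_module_def)

lemma HM_smult_apply [simp]: "x \<in> car M i ==> (c \<odot>[HM M N n] f) i x = c \<odot>[N,i + n] f i x"
 by (simp add: hom_module_def)

lemma HM_add_closed: "[|dgm M; dgm N; f \<in> Hom M N n; g \<in> Hom M N n|] ==> f \<oplus>[HM M N n] g \<in> Hom M N n"
 apply (rule Hom_I)
 subgoal by (simp add: hom_module_def)
 subgoal by (simp add: ag_simps Hom_closed)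
 subgoal by (simp add: ag_simps ag_ac Hom_closed Hom_add)
 subgoal by (simp add: module.smult_r_distr[OF dgm_module] Hom_closed Hom_smult)
 subgoal by (simp add: act_closed Hom_act act_add_left Hom_closed ac_simps)
 done

lemma HM_zero_closed: "[|dgm M; dgm N|] ==> \<zero>[HM M N n] \<in> Hom M N n"
 apply (rule Hom_I)
 subgoal by (simp add: hom_module_def)
 subgoal by (simp add: ag_simps)
 subgoal by (simp add: ag_simps)
 subgoal by (simp add: module.smult_r_null[OF dgm_module])
 subgoal by (simp add: act_closed act_zero_left ac_simps)
 done

lemma HM_smult_closed: "[|dgm M; dgm N; c \<in> carrier K; f \<in> Hom M N n|] ==> c \<odot>[HM M N n] f \<in> Hom M N n"
 apply (rule Hom_I)
 subgoal by (simp add: hom_module_def)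
 subgoal by (simp add: Hom_closed)
 subgoal by (simp add: ag_simps Hom_closed Hom_add module.smult_r_distr[OF dgm_module])
 subgoal for i d x
  by (simp add: Hom_closed Hom_smult module.smult_assoc1[OF dgm_module, symmetric] m_comm)
 subgoal by (simp add: act_closed Hom_act act_smult_left Hom_closed ac_simps)
 done

lemma HM_module: assumes "dgm M" "dgm N" shows "module K (HM M N n)"
proof (rule moduleI')
 show "cring K" by (rule is_cring)
 show "abelian_group (HM M N n)"
 proof (rule abelian_groupI)
  fix f assume f: "f \<in> carrier (HM M N n)"
  let ?g = "\<lambda>i. \<lambda>x\<in>car M i. \<ominus>[N,i + n] f i x"
  have "?g \<in> Hom M N n"
   using f assms
   apply (intro Hom_I)
   subgoal by simp
   subgoal by (simp add: ag_simps Hom_closed)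
   subgoal by (simp add: ag_simps Hom_closed Hom_add)
   subgoal by (simp add: Hom_closed Hom_smult module.smult_r_minus[OF dgm_module])
   subgoal by (simp add: act_closed Hom_act act_neg_left Hom_closed ac_simps)
   done
  moreover have "?g \<oplus>[HM M N n] f = \<zero>[HM M N n]"
   using f assms calculation
   by (intro Hom_eqI[OF HM_add_closed HM_zero_closed]) (auto simp: ag_simps Hom_closed)
  ultimately show "\<exists>y\<in>carrier (HM M N n). y \<oplus>[HM M N n] f = \<zero>[HM M N n]" by auto
 qed (use assms in \<open>auto simp: HM_add_closed HM_zero_closed ag_simps ag_ac Hom_closed intro!: Hom_eqI[of _ M N n]\<close>)
qed (use assms in \<open>auto simp: HM_add_closed HM_smult_closed Hom_closed module.smult_l_distr[OF dgm_module]
  module.smult_r_distr[OF dgm_module] module.smult_assoc1[OF dgm_module]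
  module.smult_one[OF dgm_module] intro!: Hom_eqI[of _ M N n]\<close>)

lemma HM_ag [simp]: "[|dgm M; dgm N|] ==> abelian_group (HM M N n)"
 using HM_module module_ag by blast

lemma HM_neg_apply: "[|dgm M; dgm N; f \<in> Hom M N n; x \<in> car M i|] ==>
  (\<ominus>[HM M N n] f) i x = \<ominus>[N,i + n] f i x"
proof -
 assume a: "dgm M" "dgm N" "f \<in> Hom M N n" "x \<in> car M i"
 have c: "\<ominus>[HM M N n] f \<in> Hom M N n"
  using ag_neg_closed[OF HM_ag[OF a(1,2)], of f n] a by simp
 have "(f \<oplus>[HM M N n] \<ominus>[HM M N n] f) i x = \<zero>[N,i + n]"
  using ag_r_neg[OF HM_ag[OF a(1,2)], of f n] a by simp
 then show ?thesis
  using a c by (intro ag_neg_unique[symmetric]) (auto simp: Hom_closed)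
qed

lemma HM_neg_closed: "[|dgm M; dgm N; f \<in> Hom M N n|] ==> \<ominus>[HM M N n] f \<in> Hom M N n"
 using ag_neg_closed[OF HM_ag] by fastforce

lemma HM_ksign_closed: "[|dgm M; dgm N; f \<in> Hom M N n|] ==> ksign (HM M N n) p f \<in> Hom M N n"
 using ksign_closed[OF HM_ag] by fastforce

lemmas HM_closed = HM_add_closed HM_zero_closed HM_neg_closed HM_ksign_closed

lemma gcomp_apply [simp]: "x \<in> car M i ==> gcomp M q g f i x = g (i + q) (f i x)"
 by (simp add: gcomp_def)

lemma gid_apply [simp]: "x \<in> car M i ==> gid M i x = x"
 by (simp add: gid_def)

lemma hom_diff_apply: "x \<in> car M i ==> hom_diff M N n f i x =
  mdiff N (i + n) (f i x) \<oplus>[N,i + n + 1] ksign (mcomp N (i + n + 1)) (n + 1) (f (i + 1) (mdiff M i x))"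
 by (simp add: hom_diff_def)

end

lemma ag_cancel1:
 "[|abelian_group G; x \<in> carrier G; y \<in> carrier G|] ==> x \<oplus>[G] (y \<oplus>[G] \<ominus>[G] x) = y"
 "[|abelian_group G; x \<in> carrier G; y \<in> carrier G; z \<in> carrier G|] ==> x \<oplus>[G] (y \<oplus>[G] (\<ominus>[G] x \<oplus>[G] z)) = y \<oplus>[G] z"
 "[|abelian_group G; x \<in> carrier G; y \<in> carrier G; z \<in> carrier G|] ==> x \<oplus>[G] (y \<oplus>[G] (z \<oplus>[G] \<ominus>[G] x)) = y \<oplus>[G] z"
 "[|abelian_group G; x \<in> carrier G; y \<in> carrier G; z \<in> carrier G; w \<in> carrier G|] ==> x \<oplus>[G] (y \<oplus>[G] (z \<oplus>[G] (\<ominus>[G] x \<oplus>[G] w))) = y \<oplus>[G] (z \<oplus>[G] w)"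
 using ag_lcomm[of G "x" y] ag_lcomm[of G "x" z] by (simp_all add: ag_simps)

lemma ag_cancel2:
 "[|abelian_group G; x \<in> carrier G; y \<in> carrier G|] ==> \<ominus>[G] x \<oplus>[G] (y \<oplus>[G] x) = y"
 "[|abelian_group G; x \<in> carrier G; y \<in> carrier G; z \<in> carrier G|] ==> \<ominus>[G] x \<oplus>[G] (y \<oplus>[G] (x \<oplus>[G] z)) = y \<oplus>[G] z"
 "[|abelian_group G; x \<in> carrier G; y \<in> carrier G; z \<in> carrier G|] ==> \<ominus>[G] x \<oplus>[G] (y \<oplus>[G] (z \<oplus>[G] x)) = y \<oplus>[G] z"
 "[|abelian_group G; x \<in> carrier G; y \<in> carrier G; z \<in> carrier G; w \<in> carrier G|] ==> \<ominus>[G] x \<oplus>[G] (y \<oplus>[G] (z \<oplus>[G] (x \<oplus>[G] w))) = y \<oplus>[G] (z \<oplus>[G] w)"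
 using ag_lcomm[of G "\<ominus>[G] x" y] ag_lcomm[of G "\<ominus>[G] x" z] by (simp_all add: ag_simps)

lemmas ag_cancel = ag_cancel1 ag_cancel2

context dg_algebra begin

lemma gcomp_closed: "[|dgm M; f \<in> Hom M N q; g \<in> Hom N P p; r = q + p|] ==> gcomp M q g f \<in> Hom M P r"
 apply (rule Hom_I)
 subgoal by (simp add: gcomp_def)
 subgoal by (simp add: Hom_closed add.assoc[symmetric])
 subgoal by (simp add: dgm_closed Hom_closed Hom_add[of f] Hom_add[of g] add.assoc)
 subgoal by (simp add: dgm_closed Hom_closed Hom_smult[of f] Hom_smult[of g] add.assoc)
 subgoal by (simp add: dgm_closed Hom_closed Hom_act[of f M N q] Hom_act[of g N P p] add.assoc)
 done

lemma gcomp_assoc: "f \<in> Hom X Y q ==>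
  gcomp X q (gcomp Y p h g) f = gcomp X (q + p) h (gcomp X q g f)"
 by (auto simp: gcomp_def fun_eq_iff Hom_closed add.assoc)

lemma gid_closed: "dgm X ==> gid X \<in> Hom X X 0"
 by (rule Hom_I) (auto simp: gid_def dgm_closed)

lemma gcomp_gid_left: "[|dgm X; dgm Y; f \<in> Hom X Y q|] ==> gcomp X q (gid Y) f = f"
 by (rule Hom_eqI[of _ X Y q]) (auto simp: Hom_closed intro!: gcomp_closed gid_closed)

lemma gcomp_gid_right: "[|dgm X; f \<in> Hom X Y q|] ==> gcomp X 0 f (gid X) = f"
 by (rule Hom_eqI[of _ X Y q]) (auto simp: Hom_closed intro!: gcomp_closed gid_closed)

lemma gcomp_add_left: "[|dgm X; dgm Y; dgm Z; f \<in> Hom X Y q; g \<in> Hom Y Z p; h \<in> Hom Y Z p; r = q + p|] ==>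
  gcomp X q (g \<oplus>[HM Y Z p] h) f = gcomp X q g f \<oplus>[HM X Z r] gcomp X q h f"
 by (rule Hom_eqI[of _ X Z r]) (auto simp: Hom_closed add.assoc intro!: gcomp_closed HM_closed)

lemma gcomp_add_right: "[|dgm X; dgm Y; dgm Z; f \<in> Hom X Y q; h \<in> Hom X Y q; g \<in> Hom Y Z p; r = q + p|] ==>
  gcomp X q g (f \<oplus>[HM X Y q] h) = gcomp X q g f \<oplus>[HM X Z r] gcomp X q g h"
 by (rule Hom_eqI[of _ X Z r]) (auto simp: Hom_closed Hom_add[of g] add.assoc intro!: gcomp_closed HM_closed)

lemma gcomp_smult_left: "[|dgm X; dgm Y; dgm Z; f \<in> Hom X Y q; g \<in> Hom Y Z p; c \<in> carrier K; r = q + p|] ==>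
  gcomp X q (c \<odot>[HM Y Z p] g) f = c \<odot>[HM X Z r] gcomp X q g f"
 by (rule Hom_eqI[of _ X Z r]) (auto simp: Hom_closed add.assoc intro!: gcomp_closed HM_smult_closed)

lemma gcomp_smult_right: "[|dgm X; dgm Y; dgm Z; f \<in> Hom X Y q; g \<in> Hom Y Z p; c \<in> carrier K; r = q + p|] ==>
  gcomp X q g (c \<odot>[HM X Y q] f) = c \<odot>[HM X Z r] gcomp X q g f"
 by (rule Hom_eqI[of _ X Z r]) (auto simp: Hom_closed Hom_smult[of g] add.assoc intro!: gcomp_closed HM_smult_closed)

lemma gcomp_zero_left: "[|dgm X; dgm Y; dgm Z; f \<in> Hom X Y q; r = q + p|] ==>
  gcomp X q \<zero>[HM Y Z p] f = \<zero>[HM X Z r]"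
 by (rule additive_zero[of "HM Y Z p" "HM X Z r" "\<lambda>g. gcomp X q g f"])
   (auto simp: gcomp_closed gcomp_add_left)

lemma gcomp_zero_right: "[|dgm X; dgm Y; dgm Z; g \<in> Hom Y Z p; r = q + p|] ==>
  gcomp X q g \<zero>[HM X Y q] = \<zero>[HM X Z r]"
 by (rule additive_zero[of "HM X Y q" "HM X Z r"]) (auto simp: gcomp_closed gcomp_add_right)

lemma gcomp_neg_left: "[|dgm X; dgm Y; dgm Z; f \<in> Hom X Y q; g \<in> Hom Y Z p; r = q + p|] ==>
  gcomp X q (\<ominus>[HM Y Z p] g) f = \<ominus>[HM X Z r] gcomp X q g f"
 by (rule additive_neg[of "HM Y Z p" "HM X Z r" "\<lambda>g. gcomp X q g f"])
   (auto simp: gcomp_closed gcomp_add_left)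

abbreviation D where "D \<equiv> hom_diff"

lemma D_closed: "[|dgm M; dgm N; f \<in> Hom M N n; k = n + 1|] ==> D M N n f \<in> Hom M N k"
 apply (rule Hom_I)
 subgoal by (simp add: hom_diff_def)
 subgoal by (simp add: hom_diff_apply dgm_closed Hom_closed ac_simps)
 subgoal by (simp add: hom_diff_apply dgm_closed Hom_closed Hom_add diff_add ksign_add ag_ac ac_simps)
 subgoal by (simp add: hom_diff_apply dgm_closed Hom_closed Hom_smult diff_smult
    ksign_smult[OF dgm_module] module.smult_r_distr[OF dgm_module] ac_simps)
 subgoal for i j x a
  using adiff_linear[of j]
  by (cases "even i"; cases "even n")
    (simp_all add: hom_diff_apply dgm_closed Hom_closed Hom_act[of f M N n] Hom_add Hom_neg diff_act
     linear_mapD(1) act_add_left act_neg_left ksign_def ag_cancel ag_simps ag_ac ac_simps)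
 done

lemma D_add: "[|dgm X; dgm Y; f \<in> Hom X Y n; g \<in> Hom X Y n|] ==>
  D X Y n (f \<oplus>[HM X Y n] g) = D X Y n f \<oplus>[HM X Y (n + 1)] D X Y n g"
 by (rule Hom_eqI[of _ X Y "n + 1"])
   (auto simp: hom_diff_apply dgm_closed Hom_closed diff_add ksign_add ag_ac ac_simps
    intro!: D_closed HM_closed)

lemma D_smult: "[|dgm X; dgm Y; f \<in> Hom X Y n; c \<in> carrier K|] ==>
  D X Y n (c \<odot>[HM X Y n] f) = c \<odot>[HM X Y (n + 1)] D X Y n f"
 by (rule Hom_eqI[of _ X Y "n + 1"])
   (auto simp: hom_diff_apply dgm_closed Hom_closed diff_smult ksign_smult[OF dgm_module]
    module.smult_r_distr[OF dgm_module] ac_simps intro!: D_closed HM_smult_closed)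

lemma D_neg: "[|dgm X; dgm Y; f \<in> Hom X Y n|] ==>
  D X Y n (\<ominus>[HM X Y n] f) = \<ominus>[HM X Y (n + 1)] D X Y n f"
 by (rule additive_neg[of "HM X Y n" "HM X Y (n + 1)"]) (auto simp: D_closed D_add)

lemma D_zero: "[|dgm X; dgm Y|] ==> D X Y n \<zero>[HM X Y n] = \<zero>[HM X Y (n + 1)]"
 by (rule additive_zero[of "HM X Y n" "HM X Y (n + 1)"]) (auto simp: D_closed D_add)

lemma D_D: "[|dgm X; dgm Y; f \<in> Hom X Y n; k = n + 1|] ==> D X Y k (D X Y n f) = \<zero>[HM X Y (n + 2)]"
 apply (rule Hom_eqI[of _ X Y "n + 2"])
 subgoal by (auto intro!: D_closed)
 subgoal by (auto intro!: HM_closed)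
 subgoal for i x
 by (cases "even n")
   (simp_all add: hom_diff_apply dgm_closed Hom_closed diff_add diff_neg diff_diff Hom_zero[of f X Y n] ksign_def
    ag_cancel ag_simps ag_ac ac_simps)
 done

lemma D_gcomp: "[|dgm X; dgm Y; dgm Z; f \<in> Hom X Y q; g \<in> Hom Y Z p; r = q + p|] ==>
  D X Z r (gcomp X q g f) =
   gcomp X q (D Y Z p g) f \<oplus>[HM X Z (r + 1)] ksign (HM X Z (r + 1)) p (gcomp X (q + 1) g (D X Y q f))"
 apply (rule Hom_eqI[of _ X Z "r + 1"])
 subgoal by (auto intro!: D_closed gcomp_closed)
 subgoal by (auto intro!: D_closed gcomp_closed HM_closed)
 subgoal for i x
  using D_closed[of X Y f q "q + 1"] D_closed[of Y Z g p "p + 1"]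
   gcomp_closed[of X "D X Y q f" Y "q + 1" g Z p "r + 1"]
  by (cases "even p"; cases "even q") (simp_all add: HM_neg_apply hom_diff_apply dgm_closed Hom_closed gcomp_closed D_closed
    Hom_add[of g] Hom_neg[of g] ksign_def ag_cancel ag_simps ag_ac ac_simps)
 done

lemma D_gid: "dgm X ==> D X X 0 (gid X) = \<zero>[HM X X 1]"
 apply (rule Hom_eqI[of _ X X 1])
 subgoal by (auto intro!: D_closed gid_closed)
 subgoal by (auto intro!: HM_closed)
 subgoal by (simp add: hom_diff_apply ksign_def dgm_closed ag_simps)
 done

text \<open>The rules of \<open>gcomp\<close> and \<open>D\<close> proved so far are exactly the axioms.\<close>

theorem dg_End_dg_algebra: assumes W: "dgm W" shows "dg_algebra K (dg_End K A W)"
proof (intro dg_algebra.intro dg_algebra_axioms.intro is_cring, goal_cases)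
 case (1 i)
 then show ?case using W by (simp add: dg_End_def HM_module)
next
 case (2 b j i)
 then show ?case using W
  by (auto simp: dg_End_def add.commute intro!: linear_mapI gcomp_closed gcomp_add_left gcomp_smult_left)
next
 case (3 a i j)
 then show ?case using W
  by (auto simp: dg_End_def add.commute intro!: linear_mapI gcomp_closed gcomp_add_right gcomp_smult_right)
next
 case (4 a i b j c l)
 then show ?case by (auto simp: dg_End_def gcomp_assoc add.commute)
next
 case 5
 then show ?case using W by (auto simp: dg_End_def gid_closed)
next
 case (6 a i)
 then show ?case using W by (auto simp: dg_End_def gcomp_gid_left)
next
 case (7 a i)
 then show ?case using W by (auto simp: dg_End_def gcomp_gid_right)
next
 case (8 i)
 then show ?case using W by (auto simp: dg_End_def intro!: linear_mapI D_closed D_add D_smult)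
next
 case (9 a i)
 then show ?case using W by (auto simp: dg_End_def D_D)
next
 case (10 a p b q)
 then show ?case using W by (auto simp: dg_End_def D_gcomp add.commute add.left_commute)
qed

lemma dgmI:
 assumes "\<And>i. module K (mcomp M i)"
  and "\<And>i j x a. [|x \<in> car M i; a \<in> acar j|] ==> mact M i j x a \<in> car M (i + j)"
  and "\<And>i j x y a. [|x \<in> car M i; y \<in> car M i; a \<in> acar j|] ==>
   mact M i j (x \<oplus>[M,i] y) a = mact M i j x a \<oplus>[M,i + j] mact M i j y a"
  and "\<And>i j c x a. [|c \<in> carrier K; x \<in> car M i; a \<in> acar j|] ==>
   mact M i j (c \<odot>[M,i] x) a = c \<odot>[M,i + j] mact M i j x a"
  and "\<And>i j x a b. [|x \<in> car M i; a \<in> acar j; b \<in> acar j|] ==>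
   mact M i j x (a \<oplus>[acomp A j] b) = mact M i j x a \<oplus>[M,i + j] mact M i j x b"
  and "\<And>i j c x a. [|c \<in> carrier K; x \<in> car M i; a \<in> acar j|] ==>
   mact M i j x (c \<odot>[acomp A j] a) = c \<odot>[M,i + j] mact M i j x a"
  and "\<And>i j l x a b. [|x \<in> car M i; a \<in> acar j; b \<in> acar l|] ==>
   mact M (i + j) l (mact M i j x a) b = mact M i (j + l) x (amult A j l a b)"
  and "\<And>i x. x \<in> car M i ==> mact M i 0 x (aone A) = x"
  and "\<And>i x. x \<in> car M i ==> mdiff M i x \<in> car M (i + 1)"
  and "\<And>i x y. [|x \<in> car M i; y \<in> car M i|] ==>
   mdiff M i (x \<oplus>[M,i] y) = mdiff M i x \<oplus>[M,i + 1] mdiff M i y"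
  and "\<And>i c x. [|c \<in> carrier K; x \<in> car M i|] ==>
   mdiff M i (c \<odot>[M,i] x) = c \<odot>[M,i + 1] mdiff M i x"
  and "\<And>i x. x \<in> car M i ==> mdiff M (i + 1) (mdiff M i x) = \<zero>[M,i + 2]"
  and "\<And>n q x a. [|x \<in> car M n; a \<in> acar q|] ==>
   mdiff M (n + q) (mact M n q x a) =
    mact M (n + 1) q (mdiff M n x) a \<oplus>[M,n + q + 1]
    ksign (mcomp M (n + q + 1)) n (mact M n (q + 1) x (adiff A q a))"
 shows "dgm M"
 by (intro dg_module.intro dg_module_axioms.intro linear_mapI dg_algebra_axioms assms)

end

section \<open>Direct sums, shifts, cones and powers inside the dg category of dg modules\<close>

lemma module_sum_simps [simp]:
 "carrier (module_sum V W) = carrier V \<times> carrier W"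
 "\<zero>[module_sum V W] = (\<zero>[V], \<zero>[W])"
 "u \<oplus>[module_sum V W] v = (fst u \<oplus>[V] fst v, snd u \<oplus>[W] snd v)"
 "c \<odot>[module_sum V W] u = (c \<odot>[V] fst u, c \<odot>[W] snd u)"
 by (simp_all add: module_sum_def)

lemma module_sum_ag [simp]:
 assumes "abelian_group V" "abelian_group W" shows "abelian_group (module_sum V W)"
proof (rule abelian_groupI)
 fix x assume x: "x \<in> carrier (module_sum V W)"
 show "\<exists>y\<in>carrier (module_sum V W). y \<oplus>[module_sum V W] x = \<zero>[module_sum V W]"
  using x assms by (intro bexI[of _ "(\<ominus>[V] fst x, \<ominus>[W] snd x)"]) (auto simp: ag_simps)
qed (use assms in \<open>auto simp: ag_simps ag_ac\<close>)

lemma module_sum_neg: "[|abelian_group V; abelian_group W; u \<in> carrier V \<times> carrier W|] ==>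
  \<ominus>[module_sum V W] u = (\<ominus>[V] fst u, \<ominus>[W] snd u)"
 by (rule ag_neg_unique) (auto simp: ag_simps)

lemma module_sum_ksign: "[|abelian_group V; abelian_group W; u \<in> carrier V \<times> carrier W|] ==>
  ksign (module_sum V W) p u = (ksign V p (fst u), ksign W p (snd u))"
 by (auto simp: ksign_def module_sum_neg)

lemma module_sum_module:
 assumes V: "module K V" and W: "module K W" shows "module K (module_sum V W)"
proof -
 note rules = module.smult_closed module.smult_l_distr module.smult_r_distr module.smult_assoc1 module.smult_one
 show ?thesis
  by (rule moduleI')
    (auto simp: rules[OF V] rules[OF W] module_ag[OF V] module_ag[OF W] module.axioms(1)[OF V])
qed

lemma module_power_carrier: "carrier (module_power r V) = {..<r} \<rightarrow>\<^sub>E carrier V"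
 by (simp add: module_power_def)

lemma module_power_mem: "[|u \<in> carrier (module_power r V); t < r|] ==> u t \<in> carrier V"
 by (auto simp: module_power_def)

lemma module_power_restrict:
 "(\<And>t. t < r ==> u t \<in> carrier V) ==> (\<lambda>t\<in>{..<r}. u t) \<in> carrier (module_power r V)"
 by (auto simp: module_power_def)

lemma module_power_eqI:
 "[|u \<in> carrier (module_power r V); v \<in> carrier (module_power r V); \<And>t. t < r ==> u t = v t|] ==> u = v"
 unfolding module_power_carrier by (rule PiE_ext) auto

lemma module_power_apply:
 "t < r ==> (u \<oplus>[module_power r V] v) t = u t \<oplus>[V] v t"
 "t < r ==> \<zero>[module_power r V] t = \<zero>[V]"
 "t < r ==> (c \<odot>[module_power r V] u) t = c \<odot>[V] u t"
 by (simp_all add: module_power_def)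

lemma module_power_closed:
 assumes "abelian_group V" "u \<in> carrier (module_power r V)" "v \<in> carrier (module_power r V)"
 shows "u \<oplus>[module_power r V] v \<in> carrier (module_power r V)"
  and "\<zero>[module_power r V] \<in> carrier (module_power r V)"
 using module_power_restrict[of r "\<lambda>t. u t \<oplus>[V] v t" V] module_power_restrict[of r "\<lambda>t. \<zero>[V]" V] assms
 by (simp_all add: module_power_mem ag_simps) (simp_all add: module_power_def)

lemma module_power_ag [simp]:
 assumes V: "abelian_group V" shows "abelian_group (module_power r V)"
proof (rule abelian_groupI)
 fix x assume x: "x \<in> carrier (module_power r V)"
 have y: "(\<lambda>t\<in>{..<r}. \<ominus>[V] x t) \<in> carrier (module_power r V)"
  using x V by (intro module_power_restrict) (simp add: ag_simps module_power_mem)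
 moreover have "(\<lambda>t\<in>{..<r}. \<ominus>[V] x t) \<oplus>[module_power r V] x = \<zero>[module_power r V]"
  using x y V module_power_closed[OF V x x] module_power_closed[OF V y x]
  by (intro module_power_eqI[of _ r V]) (simp_all add: module_power_apply module_power_mem ag_simps)
 ultimately show "\<exists>y\<in>carrier (module_power r V). y \<oplus>[module_power r V] x = \<zero>[module_power r V]" by blast
 show "\<zero>[module_power r V] \<oplus>[module_power r V] x = x"
  using x V by (intro module_power_eqI[of _ r V] module_power_closed)
   (simp_all add: module_power_apply module_power_mem module_power_closed ag_simps)
next
 fix x y z assume xyz: "x \<in> carrier (module_power r V)" "y \<in> carrier (module_power r V)"
  "z \<in> carrier (module_power r V)"
 note closed = module_power_closed[OF V]
 show "x \<oplus>[module_power r V] y \<oplus>[module_power r V] z = x \<oplus>[module_power r V] (y \<oplus>[module_power r V] z)"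
  using V xyz by (intro module_power_eqI[of _ r V])
   (simp_all add: closed module_power_apply module_power_mem ag_assoc)
next
 fix x y assume xy: "x \<in> carrier (module_power r V)" "y \<in> carrier (module_power r V)"
 show "x \<oplus>[module_power r V] y \<in> carrier (module_power r V)"
  using V xy by (rule module_power_closed)
 show "x \<oplus>[module_power r V] y = y \<oplus>[module_power r V] x"
  using V xy by (intro module_power_eqI[of _ r V] module_power_closed)
   (simp_all add: module_power_apply module_power_mem ag_comm)
next
 show "\<zero>[module_power r V] \<in> carrier (module_power r V)"
  using module_power_restrict[of r "\<lambda>t. \<zero>[V]" V] V by (simp add: ag_simps) (simp add: module_power_def)
qed

lemma module_power_neg: assumes "abelian_group V" "u \<in> carrier (module_power r V)"
 shows "\<ominus>[module_power r V] u = (\<lambda>t\<in>{..<r}. \<ominus>[V] u t)"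
proof (rule ag_neg_unique)
 show y: "(\<lambda>t\<in>{..<r}. \<ominus>[V] u t) \<in> carrier (module_power r V)"
  using assms by (intro module_power_restrict) (simp add: ag_simps module_power_mem)
 show "u \<oplus>[module_power r V] (\<lambda>t\<in>{..<r}. \<ominus>[V] u t) = \<zero>[module_power r V]"
  using assms y module_power_closed[OF assms(1) y y] module_power_closed[OF assms(1,2) y]
  by (intro module_power_eqI[of _ r V]) (simp_all add: module_power_apply module_power_mem ag_simps)
qed (use assms in auto)

lemma module_power_ksign: assumes "abelian_group V" "u \<in> carrier (module_power r V)"
 shows "ksign (module_power r V) p u = (\<lambda>t\<in>{..<r}. ksign V p (u t))"
 using module_power_restrict[of r "\<lambda>t. ksign V p (u t)" V] assms
 by (intro module_power_eqI[of _ r V])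
   (simp_all add: ksign_closed module_power_mem, simp add: ksign_def module_power_neg)

lemma module_power_ops:
 "u \<oplus>[module_power r V] v = (\<lambda>t\<in>{..<r}. u t \<oplus>[V] v t)"
 "\<zero>[module_power r V] = (\<lambda>t\<in>{..<r}. \<zero>[V])"
 "c \<odot>[module_power r V] u = (\<lambda>t\<in>{..<r}. c \<odot>[V] u t)"
 by (simp_all add: module_power_def)

lemma module_power_module:
 assumes V: "module K V" shows "module K (module_power r V)"
proof -
 have ag: "abelian_group V" using V by (rule module_ag)
 have sm: "c \<odot>[module_power r V] u \<in> carrier (module_power r V)"
  if "c \<in> carrier K" "u \<in> carrier (module_power r V)" for c u
  using module_power_restrict[of r "\<lambda>t. c \<odot>[V] u t" V] that module.smult_closed[OF V]
  by (simp add: module_power_mem) (simp add: module_power_def)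
 note rules = module.smult_closed[OF V] module.smult_l_distr[OF V] module.smult_r_distr[OF V]
  module.smult_assoc1[OF V] module.smult_one[OF V]
 interpret K: cring K using V by (rule module.axioms(1))
 note closed = sm module_power_closed[OF ag] module_power_mem
 show ?thesis
 proof (rule moduleI', goal_cases)
  case 4 then show ?case
   by (intro module_power_eqI[of _ r V]) (simp_all add: closed module_power_apply rules)
 next
  case 5 then show ?case
   by (intro module_power_eqI[of _ r V]) (simp_all add: closed module_power_apply rules)
 next
  case 6 then show ?case
   by (intro module_power_eqI[of _ r V]) (simp_all add: closed module_power_apply rules)
 next
  case 7 then show ?case
   by (intro module_power_eqI[of _ r V]) (simp_all add: closed module_power_apply rules)
 qed (simp_all add: ag sm K.is_cring)
qed

lemma dg_sum_simps [simp]: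
 "mcomp (dg_sum M N) i = module_sum (mcomp M i) (mcomp N i)"
 "mact (dg_sum M N) i j u a = (mact M i j (fst u) a, mact N i j (snd u) a)"
 "mdiff (dg_sum M N) i u = (mdiff M i (fst u), mdiff N i (snd u))"
 by (simp_all add: dg_sum_def)

lemma dg_shift_simps [simp]:
 "mcomp (dg_shift s M) i = mcomp M (i + s)"
 "mact (dg_shift s M) i j = mact M (i + s) j"
 "mdiff (dg_shift s M) i x = ksign (mcomp M (i + s + 1)) s (mdiff M (i + s) x)"
 by (simp_all add: dg_shift_def)

lemma dg_cone_simps [simp]:
 "mcomp (dg_cone X Y f) i = module_sum (mcomp Y i) (mcomp X (i + 1))"
 "mact (dg_cone X Y f) i j u a = (mact Y i j (fst u) a, mact X (i + 1) j (snd u) a)"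
 "mdiff (dg_cone X Y f) i u = (mdiff Y i (fst u) \<oplus>[Y,i + 1] f (i + 1) (snd u),
   \<ominus>[X,i + 1 + 1] mdiff X (i + 1) (snd u))"
 by (simp_all add: dg_cone_def dg_sum_def ksign_def)

lemma dg_power_simps [simp]:
 "mcomp (dg_power r M) i = module_power r (mcomp M i)"
 "mact (dg_power r M) i j u a = (\<lambda>t\<in>{..<r}. mact M i j (u t) a)"
 "mdiff (dg_power r M) i u = (\<lambda>t\<in>{..<r}. mdiff M i (u t))"
 by (simp_all add: dg_power_def)

context dg_algebra begin

lemma adiff_closed: "a \<in> acar j ==> k = j + 1 ==> adiff A j a \<in> acar k"
 using linear_mapD(1)[OF adiff_linear[of j]] by simp

lemma amult_closed: "[|a \<in> acar i; b \<in> acar j; k = i + j|] ==> amult A i j a b \<in> acar k"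
 using linear_mapD(1)[OF amult_linear_left[of b j i]] by simp

lemmas module_rules = module.smult_l_distr module.smult_r_distr module.smult_assoc1 module.smult_one
 module.smult_closed module.smult_r_minus

lemma dgm_sum [simp]: assumes "dgm X" "dgm Y" shows "dgm (dg_sum X Y)"
 apply (rule dgmI; use assms in \<open>simp split: prod.splits\<close>)
 subgoal by (simp add: module_sum_module dgm_module)
 subgoal by (auto simp: dgm_closed)
 subgoal by (auto simp: act_add_left)
 subgoal by (auto simp: act_smult_left)
 subgoal by (auto simp: act_add_right)
 subgoal by (auto simp: act_smult_right)
 subgoal by (auto simp: act_assoc)
 subgoal by (auto simp: act_one)
 subgoal by (auto simp: dgm_closed)
 subgoal by (auto simp: diff_add)
 subgoal by (auto simp: diff_smult)
 subgoal by (auto simp: diff_diff)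
 subgoal for n q x a
  using adiff_closed[of a q "q + 1"]
  by (auto simp: diff_act module_sum_ksign act_closed ac_simps)
 done

lemma dgm_shift [simp]: assumes "dgm X" shows "dgm (dg_shift s X)"
 apply (rule dgmI; use assms in simp)
 subgoal by (simp add: dgm_module)
 subgoal by (simp add: dgm_closed)
 subgoal by (simp add: act_add_left ac_simps)
 subgoal by (simp add: act_smult_left ac_simps)
 subgoal by (simp add: act_add_right ac_simps)
 subgoal by (simp add: act_smult_right ac_simps)
 subgoal by (simp add: act_assoc)
 subgoal by (simp add: act_one)
 subgoal by (simp add: dgm_closed ac_simps)
 subgoal by (simp add: diff_add ksign_add dgm_closed ac_simps)
 subgoal by (simp add: diff_smult ksign_smult[OF dgm_module] dgm_closed ac_simps)
 subgoal for i x
  using diff_ksign[of X "mdiff X (i + s) x" "i + s + 1" s] by (simp add: diff_diff dgm_closed ksign_zero ac_simps)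
 subgoal for n q x a
  using adiff_closed[of a q "q + 1"]
  by (cases "even s"; cases "even n")
    (simp_all add: diff_act dgm_closed ksign_def ag_simps act_neg_left ac_simps)
 done

lemma dgm_cone [simp]:
 assumes "dgm X" "dgm Y" "f \<in> Hom X Y 0" "\<And>i x. x \<in> car X i ==> f (i + 1) (mdiff X i x) = mdiff Y i (f i x)"
 shows "dgm (dg_cone X Y f)"
 apply (rule dgmI; use assms in \<open>simp split: prod.splits\<close>)
 subgoal by (simp add: module_sum_module dgm_module)
 subgoal by (auto simp: dgm_closed)
 subgoal by (auto simp: act_add_left ac_simps)
 subgoal by (auto simp: act_smult_left ac_simps)
 subgoal by (auto simp: act_add_right ac_simps)
 subgoal by (auto simp: act_smult_right ac_simps)
 subgoal by (auto simp: act_assoc)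
 subgoal by (auto simp: act_one)
 subgoal by (auto simp: dgm_closed Hom_closed)
 subgoal by (auto simp: diff_add Hom_add[of f X Y 0] Hom_closed dgm_closed ag_simps ag_ac)
 subgoal by (auto simp: diff_smult Hom_smult[of f X Y 0] Hom_closed dgm_closed module_rules[OF dgm_module])
 subgoal for i x
  using diff_diff[of X "snd x" "i + 1" "i + 2"] Hom_closed[of f X Y 0 "snd x" "i + 1" "i + 1"]
   assms(4)[of "snd x" "i + 1"]
  by (auto simp: diff_diff diff_add diff_neg Hom_neg[of f X Y 0] Hom_closed dgm_closed ag_simps ac_simps)
 subgoal for n q x a
  using adiff_closed[of a q "q + 1"]
  by (cases "even n") (auto simp: diff_act module_sum_ksign module_sum_neg dgm_closed Hom_closed Hom_act[of f X Y 0]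
   act_add_left act_neg_left ag_simps ag_ac ksign_def ac_simps)
 done

lemma dgm_power [simp]: assumes X: "dgm X" shows "dgm (dg_power r X)"
proof -
 have act: "(\<lambda>t\<in>{..<r}. mact X i j (u t) a) \<in> carrier (module_power r (mcomp X k))"
  if "u \<in> carrier (module_power r (mcomp X i))" "a \<in> acar j" "k = i + j" for u a i j k
  using that X by (intro module_power_restrict) (simp add: module_power_mem act_closed)
 have dif: "(\<lambda>t\<in>{..<r}. mdiff X i (u t)) \<in> carrier (module_power r (mcomp X k))"
  if "u \<in> carrier (module_power r (mcomp X i))" "k = i + 1" for u i k
  using that X by (intro module_power_restrict) (simp add: module_power_mem diff_closed)
 note simps = X module_power_ops module_power_mem
 show ?thesis
 proof (rule dgmI, unfold dg_power_simps, goal_cases)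
  case 1 then show ?case by (simp add: module_power_module dgm_module X)
 next
  case 2 then show ?case by (simp add: act)
 next
  case 3 then show ?case unfolding module_power_ops by (intro restrict_ext) (simp add: simps act_add_left)
 next
  case 4 then show ?case unfolding module_power_ops by (intro restrict_ext) (simp add: simps act_smult_left)
 next
  case 5 then show ?case unfolding module_power_ops by (intro restrict_ext) (simp add: simps act_add_right)
 next
  case 6 then show ?case unfolding module_power_ops by (intro restrict_ext) (simp add: simps act_smult_right)
 next
  case 7 then show ?case by (intro restrict_ext) (simp add: simps act_assoc)
 next
  case (8 i x) then show ?case using act[of x i "aone A" 0 i] aone_closed
   by (intro module_power_eqI[of _ r "mcomp X i"]) (simp_all add: simps act_one)
 next
  case 9 then show ?case by (simp add: dif)
 next
  case 10 then show ?case unfolding module_power_ops by (intro restrict_ext) (simp add: simps diff_add)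
 next
  case 11 then show ?case unfolding module_power_ops by (intro restrict_ext) (simp add: simps diff_smult)
 next
  case 12 then show ?case unfolding module_power_ops by (intro restrict_ext) (simp add: simps diff_diff)
 next
  case (13 n q x a)
  have "(\<lambda>t\<in>{..<r}. mact X n (q + 1) (x t) (adiff A q a)) \<in> carrier (module_power r (mcomp X (n + q + 1)))"
   using 13 by (intro act) (auto simp: adiff_closed)
  then show ?case unfolding module_power_ops using 13
   by (simp add: module_power_ksign X) (intro restrict_ext, simp add: simps diff_act)
 qed
qed

end

definition sum_inl where "sum_inl X Y = (\<lambda>i. \<lambda>x\<in>car X i. (x, \<zero>[Y,i]))"
definition sum_inr where "sum_inr X Y = (\<lambda>i. \<lambda>y\<in>car Y i. (\<zero>[X,i], y))"
definition sum_prl where "sum_prl X Y = (\<lambda>i. \<lambda>u\<in>car X i \<times> car Y i. fst u)"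
definition sum_prr where "sum_prr X Y = (\<lambda>i. \<lambda>u\<in>car X i \<times> car Y i. snd u)"
definition to_shift :: "int => ('k, 'a, 'm) dg_mod => int => 'm => 'm" where
 "to_shift s X = (\<lambda>i. \<lambda>x\<in>car X i. x)"
definition from_shift :: "int => ('k, 'a, 'm) dg_mod => int => 'm => 'm" where
 "from_shift s X = (\<lambda>i. \<lambda>x\<in>car X (i + s). x)"
definition cone_inr where "cone_inr X Y = (\<lambda>i. \<lambda>x\<in>car X i. (\<zero>[Y,i - 1], x))"
definition cone_prl where "cone_prl X Y = (\<lambda>i. \<lambda>u\<in>car Y i \<times> car X (i + 1). fst u)"

context dg_algebra begin

text \<open>The closed elements: chain maps of degree \<open>n\<close>, up to sign.\<close>

definition Cyc :: "('k, 'a, 'm) dg_mod => ('k, 'a, 'n) dg_mod => int => (int => 'm => 'n) set" where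
 "Cyc M N n = {f \<in> Hom M N n. D M N n f = \<zero>[HM M N (n + 1)]}"

lemma CycD: "f \<in> Cyc M N n ==> f \<in> Hom M N n" "f \<in> Cyc M N n ==> D M N n f = \<zero>[HM M N (n + 1)]"
 by (auto simp: Cyc_def)

lemmas CycH = CycD(1)

lemma CycI_pointwise:
 assumes "dgm M" "dgm N" "f \<in> Hom M N n"
  and "\<And>i x. x \<in> car M i ==> mdiff N (i + n) (f i x) = ksign (mcomp N (i + n + 1)) n (f (i + 1) (mdiff M i x))"
 shows "f \<in> Cyc M N n"
proof -
 have "D M N n f = \<zero>[HM M N (n + 1)]"
 proof (rule Hom_eqI)
  fix i x assume x: "x \<in> car M i"
  then have "f (i + 1) (mdiff M i x) \<in> car N (i + n + 1)"
   using assms by (simp add: Hom_closed diff_closed)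
  then show "D M N n f i x = \<zero>[HM M N (n + 1)] i x"
   using assms x by (cases "even n") (auto simp: hom_diff_apply ksign_def ag_simps ac_simps)
 qed (use assms in \<open>auto intro!: D_closed HM_zero_closed\<close>)
 then show ?thesis using assms by (simp add: Cyc_def)
qed

text \<open>Only this sign rule is needed to compute with cocycles of nonzero degree, such as the
 projection of a cone to the shifted summand.\<close>

lemma Cyc_diff:
 assumes "dgm M" "dgm N" "f \<in> Cyc M N n" "x \<in> car M i" "k = i + n"
 shows "mdiff N k (f i x) = ksign (mcomp N (k + 1)) n (f (i + 1) (mdiff M i x))"
proof -
 have f: "f \<in> Hom M N n" using assms CycD by blast
 have c: "mdiff N k (f i x) \<in> car N (k + 1)" "f (i + 1) (mdiff M i x) \<in> car N (k + 1)"
  using assms f by (auto simp: Hom_closed diff_closed)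
 have "mdiff N k (f i x) \<oplus>[N,k + 1] ksign (mcomp N (k + 1)) (n + 1) (f (i + 1) (mdiff M i x)) = \<zero>[N,k + 1]"
  using assms fun_cong[OF fun_cong[OF CycD(2)[OF assms(3)]], of i x] by (simp add: hom_diff_apply add.assoc)
 then have "\<ominus>[N,k + 1] mdiff N k (f i x) = ksign (mcomp N (k + 1)) (n + 1) (f (i + 1) (mdiff M i x))"
  using assms c by (intro ag_neg_unique) (auto simp: ksign_closed)
 then have "mdiff N k (f i x) = \<ominus>[N,k + 1] ksign (mcomp N (k + 1)) (n + 1) (f (i + 1) (mdiff M i x))"
  using assms c by (metis ag_neg_neg dgm_ag)
 then show ?thesis using assms c by (auto simp: ksign_def ag_simps)
qed

lemma chain_maps_Cyc: assumes "dgm M" "dgm N" shows "chain_maps K A M N = Cyc M N 0"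
proof (intro equalityI subsetI)
 fix f assume f: "f \<in> chain_maps K A M N"
 show "f \<in> Cyc M N 0"
  by (rule CycI_pointwise[OF assms]) (use f in \<open>simp_all add: chain_maps_def\<close>)
next
 fix f assume f: "f \<in> Cyc M N 0"
 have "f (i + 1) (mdiff M i x) = mdiff N i (f i x)" if "x \<in> car M i" for i x
  using Cyc_diff[OF assms f that, of i] by simp
 then show "f \<in> chain_maps K A M N" using CycH[OF f] by (simp add: chain_maps_def)
qed

lemma Cyc_gcomp: "[|dgm X; dgm Y; dgm Z; f \<in> Cyc X Y q; g \<in> Cyc Y Z p; r = q + p|] ==> gcomp X q g f \<in> Cyc X Z r"
 by (auto simp: Cyc_def D_gcomp gcomp_closed gcomp_zero_left gcomp_zero_right ksign_zero HM_zero_closed ag_simps ac_simps)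

lemma Cyc_gid: "dgm X ==> gid X \<in> Cyc X X 0"
 by (simp add: Cyc_def gid_closed D_gid)

lemma Cyc_add: "[|dgm X; dgm Y; f \<in> Cyc X Y n; g \<in> Cyc X Y n|] ==> f \<oplus>[HM X Y n] g \<in> Cyc X Y n"
 by (auto simp: Cyc_def D_add HM_add_closed HM_zero_closed ag_simps)

lemma Cyc_D: "[|dgm X; dgm Y; f \<in> Hom X Y n; k = n + 1|] ==> D X Y n f \<in> Cyc X Y k"
 by (auto simp: Cyc_def D_D D_closed ac_simps)

lemma D_ksign: "[|dgm X; dgm Y; f \<in> Hom X Y n|] ==> D X Y n (ksign (HM X Y n) p f) = ksign (HM X Y (n + 1)) p (D X Y n f)"
 by (simp add: ksign_def D_neg)

lemma sum_in_out_Cyc: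
 assumes "dgm X" "dgm Y"
 shows "sum_inl X Y \<in> Cyc X (dg_sum X Y) 0" "sum_inr X Y \<in> Cyc Y (dg_sum X Y) 0"
  and "sum_prl X Y \<in> Cyc (dg_sum X Y) X 0" "sum_prr X Y \<in> Cyc (dg_sum X Y) Y 0"
proof -
 have r: "c \<odot>[N,i] \<zero>[N,i] = \<zero>[N,i]" if "dgm N" "c \<in> carrier K" for N :: "('k, 'a, 'w) dg_mod" and c i
  using module.smult_r_null[OF dgm_module[OF that(1)] that(2)] .
 show "sum_inl X Y \<in> Cyc X (dg_sum X Y) 0"
  using assms by (intro CycI_pointwise Hom_I) (auto simp: sum_inl_def dgm_closed ag_simps r act_zero_left diff_zero)
 show "sum_inr X Y \<in> Cyc Y (dg_sum X Y) 0"
  using assms by (intro CycI_pointwise Hom_I) (auto simp: sum_inr_def dgm_closed ag_simps r act_zero_left diff_zero)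
 show "sum_prl X Y \<in> Cyc (dg_sum X Y) X 0" "sum_prr X Y \<in> Cyc (dg_sum X Y) Y 0"
  using assms by (auto intro!: CycI_pointwise Hom_I simp: sum_prl_def sum_prr_def dgm_closed ag_simps)
qed

lemma sum_in_out:
 assumes "dgm X" "dgm Y"
 shows "gcomp X 0 (sum_prl X Y) (sum_inl X Y) = gid X" "gcomp Y 0 (sum_prr X Y) (sum_inr X Y) = gid Y"
  and "gcomp Y 0 (sum_prl X Y) (sum_inr X Y) = \<zero>[HM Y X 0]" "gcomp X 0 (sum_prr X Y) (sum_inl X Y) = \<zero>[HM X Y 0]"
  and "gcomp (dg_sum X Y) 0 (sum_inl X Y) (sum_prl X Y) \<oplus>[HM (dg_sum X Y) (dg_sum X Y) 0]
   gcomp (dg_sum X Y) 0 (sum_inr X Y) (sum_prr X Y) = gid (dg_sum X Y)"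
 using assms
 by (auto simp: gcomp_def gid_def hom_module_def sum_prl_def sum_prr_def sum_inl_def sum_inr_def
   fun_eq_iff ag_simps)

lemma shift_Cyc:
 assumes "dgm X"
 shows "to_shift s X \<in> Cyc X (dg_shift s X) (- s)" "from_shift s X \<in> Cyc (dg_shift s X) X s"
proof -
 show "to_shift s X \<in> Cyc X (dg_shift s X) (- s)"
  using assms by (intro CycI_pointwise Hom_I) (auto simp: to_shift_def dgm_closed ksign_def)
 show "from_shift s X \<in> Cyc (dg_shift s X) X s"
  using assms by (intro CycI_pointwise Hom_I) (auto simp: from_shift_def dgm_closed ksign_def ag_simps ac_simps)
qed

lemma shift_inverse:
 assumes "dgm X"
 shows "gcomp X (- s) (from_shift s X) (to_shift s X) = gid X"
  "gcomp (dg_shift s X) s (to_shift s X) (from_shift s X) = gid (dg_shift s X)"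
 by (auto simp: gcomp_def gid_def to_shift_def from_shift_def fun_eq_iff)

lemma dgm_cone' [simp]: "[|dgm X; dgm Y; f \<in> Cyc X Y 0|] ==> dgm (dg_cone X Y f)"
 using chain_maps_Cyc[of X Y] by (intro dgm_cone) (auto simp: chain_maps_def)

lemma cone_maps_Hom:
 assumes "dgm X" "dgm Y" "f \<in> Cyc X Y 0"
 shows "cone_in X Y \<in> Hom Y (dg_cone X Y f) 0" "cone_out X Y \<in> Hom (dg_cone X Y f) X 1"
  "cone_inr X Y \<in> Hom X (dg_cone X Y f) (-1)" "cone_prl X Y \<in> Hom (dg_cone X Y f) Y 0"
proof -
 have r: "c \<odot>[N,i] \<zero>[N,i] = \<zero>[N,i]" if "dgm N" "c \<in> carrier K" for N :: "('k, 'a, 'w) dg_mod" and c i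
  using module.smult_r_null[OF dgm_module[OF that(1)] that(2)] .
 show "cone_in X Y \<in> Hom Y (dg_cone X Y f) 0"
  using assms by (intro Hom_I) (auto simp: cone_in_def dgm_closed ag_simps r act_zero_left ac_simps)
 show "cone_inr X Y \<in> Hom X (dg_cone X Y f) (-1)"
  using assms by (intro Hom_I) (auto simp: cone_inr_def dgm_closed ag_simps r act_zero_left algebra_simps)
 show "cone_out X Y \<in> Hom (dg_cone X Y f) X 1" "cone_prl X Y \<in> Hom (dg_cone X Y f) Y 0"
  using assms by (auto intro!: Hom_I simp: cone_out_def cone_prl_def dgm_closed ag_simps ac_simps)
qed

text \<open>All that is ever used about a mapping cone: it is \<open>Y \<oplus> X[1]\<close> as a graded module, the inclusion of \<open>Y\<close>
 and the projection to \<open>X\<close> are closed, and the differentials of the two other structure maps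
 are given by \<open>f\<close>.  These equations make sense in any dg category, so dg functors preserve
 them.\<close>

definition is_cone :: "('k, 'a, 'm) dg_mod => ('k, 'a, 'n) dg_mod => ('k, 'a, 'p) dg_mod => (int => 'm => 'n) =>
  (int => 'n => 'p) => (int => 'p => 'm) => (int => 'm => 'p) => (int => 'p => 'n) => bool" where
 "is_cone X Y C f g h \<sigma> \<rho> \<longleftrightarrow> f \<in> Cyc X Y 0 & g \<in> Cyc Y C 0 & h \<in> Cyc C X 1 &
   \<sigma> \<in> Hom X C (-1) & \<rho> \<in> Hom C Y 0 &
   D X C (-1) \<sigma> = gcomp X 0 g f & D C Y 0 \<rho> = \<ominus>[HM C Y 1] gcomp C 1 f h &
   gcomp C 0 g \<rho> \<oplus>[HM C C 0] gcomp C 1 \<sigma> h = gid C &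
   gcomp Y 0 \<rho> g = gid Y & gcomp X (-1) h \<sigma> = gid X &
   gcomp Y 0 h g = \<zero>[HM Y X 1] & gcomp X (-1) \<rho> \<sigma> = \<zero>[HM X Y (-1)]"

lemma is_cone_cone:
 assumes X: "dgm X" and Y: "dgm Y" and f: "f \<in> Cyc X Y 0"
 shows "is_cone X Y (dg_cone X Y f) f (cone_in X Y) (cone_out X Y) (cone_inr X Y) (cone_prl X Y)"
proof -
 let ?C = "dg_cone X Y f"
 have C: "dgm ?C" using assms by simp
 note H = cone_maps_Hom[OF assms]
 have fH: "f \<in> Hom X Y 0" using f CycD by blast
 note pw = assms fH Hom_zero[OF fH X Y] Hom_closed[OF fH] dgm_closed ag_simps diff_zero
 have "cone_in X Y \<in> Cyc Y ?C 0"
  using H by (intro CycI_pointwise C Y) (auto simp: cone_in_def pw)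
 moreover have "cone_out X Y \<in> Cyc ?C X 1"
  using H by (intro CycI_pointwise C X) (auto simp: cone_out_def ksign_def pw)
 moreover have "D X ?C (-1) (cone_inr X Y) = gcomp X 0 (cone_in X Y) f"
  using H by (intro Hom_eqI[of _ X ?C 0] D_closed gcomp_closed X C)
   (auto simp: pw hom_diff_apply ksign_def cone_inr_def cone_in_def)
 moreover have "D ?C Y 0 (cone_prl X Y) = \<ominus>[HM ?C Y 1] gcomp ?C 1 f (cone_out X Y)"
  using H gcomp_closed[OF C H(2) fH HOL.refl] by (intro Hom_eqI[of _ ?C Y 1] D_closed HM_closed gcomp_closed C Y)
   (auto simp: pw hom_diff_apply HM_neg_apply[OF C Y] ksign_def cone_prl_def cone_out_def ag_ac ag_cancel)
 moreover have "gcomp ?C 0 (cone_in X Y) (cone_prl X Y) \<oplus>[HM ?C ?C 0] gcomp ?C 1 (cone_inr X Y) (cone_out X Y) = gid ?C"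
  using H by (intro Hom_eqI[of _ ?C ?C 0] HM_closed gcomp_closed gid_closed C)
   (auto simp: pw cone_prl_def cone_out_def cone_in_def cone_inr_def)
 moreover have "gcomp Y 0 (cone_prl X Y) (cone_in X Y) = gid Y" "gcomp X (-1) (cone_out X Y) (cone_inr X Y) = gid X"
  "gcomp Y 0 (cone_out X Y) (cone_in X Y) = \<zero>[HM Y X 1]" "gcomp X (-1) (cone_prl X Y) (cone_inr X Y) = \<zero>[HM X Y (-1)]"
  using assms by (auto simp: gcomp_def gid_def hom_module_def fun_eq_iff cone_prl_def cone_in_def cone_out_def cone_inr_def ag_simps)
 ultimately show ?thesis using H f by (simp add: is_cone_def)
qed

end

section \<open>The homotopy category\<close>

context dg_algebra begin

lemma Hom_undefined: "[|f \<in> Hom X Y n; x \<notin> car X i|] ==> f i x = undefined"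
 by (auto simp: hom_set_def extensional_def)

text \<open>Keeping the degree arbitrary lets degree-one maps and shifts be treated like chain maps.\<close>

definition htp :: "('k, 'a, 'm) dg_mod => ('k, 'a, 'n) dg_mod => int => (int => 'm => 'n) => (int => 'm => 'n) => bool" where
 "htp X Y n f g \<longleftrightarrow> f \<in> Cyc X Y n & (\<exists>h\<in>Hom X Y (n - 1). g = f \<oplus>[HM X Y n] D X Y (n - 1) h)"

lemma htpD: "htp X Y n f g ==> dgm X ==> dgm Y ==> f \<in> Cyc X Y n" "htp X Y n f g ==> dgm X ==> dgm Y ==> g \<in> Cyc X Y n"
 by (auto simp: htp_def intro!: Cyc_add Cyc_D)

lemma htp_refl: "[|dgm X; dgm Y; f \<in> Cyc X Y n|] ==> htp X Y n f f"
 unfolding htp_def using CycH[of f X Y n] ag_r_zero[OF HM_ag, of X Y f n] D_zero[of X Y "n - 1"]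
 by (intro conjI bexI[of _ "\<zero>[HM X Y (n - 1)]"]) (auto intro: HM_zero_closed)

lemma htp_sym: assumes X: "dgm X" "dgm Y" and h: "htp X Y n f g" shows "htp X Y n g f"
proof -
 obtain h where f: "f \<in> Cyc X Y n" and h: "h \<in> Hom X Y (n - 1)" "g = f \<oplus>[HM X Y n] D X Y (n - 1) h"
  using h htp_def by blast
 have c: "D X Y (n - 1) h \<in> carrier (HM X Y n)" "f \<in> carrier (HM X Y n)"
  using h X f by (auto intro: D_closed dest: CycD)
 have "f = g \<oplus>[HM X Y n] D X Y (n - 1) (\<ominus>[HM X Y (n - 1)] h)"
  using D_neg[OF X h(1)] h(2) c X by (simp add: ag_assoc[OF HM_ag] HM_neg_closed ag_r_neg[OF HM_ag] ag_r_zero[OF HM_ag])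
 then show ?thesis unfolding htp_def using h X f
  by (auto intro!: Cyc_add Cyc_D HM_neg_closed bexI[of _ "\<ominus>[HM X Y (n - 1)] h"])
qed

lemma htp_trans: assumes X: "dgm X" "dgm Y" and h: "htp X Y n f g" "htp X Y n g k" shows "htp X Y n f k"
proof -
 obtain h where f: "f \<in> Cyc X Y n" and h: "h \<in> Hom X Y (n - 1)" "g = f \<oplus>[HM X Y n] D X Y (n - 1) h"
  using h htp_def by blast
 obtain h' where h': "h' \<in> Hom X Y (n - 1)" "k = g \<oplus>[HM X Y n] D X Y (n - 1) h'"
  using \<open>htp X Y n g k\<close> htp_def by blast
 have c: "D X Y (n - 1) h \<in> carrier (HM X Y n)" "D X Y (n - 1) h' \<in> carrier (HM X Y n)" "f \<in> carrier (HM X Y n)"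
  using h h' X f by (auto intro: D_closed dest: CycD)
 have "k = f \<oplus>[HM X Y n] D X Y (n - 1) (h \<oplus>[HM X Y (n - 1)] h')"
  using D_add[OF X h(1) h'(1)] h(2) h'(2) c X by (simp add: ag_assoc[OF HM_ag])
 then show ?thesis unfolding htp_def using h h' X f
  by (auto intro!: HM_add_closed)
qed

lemma htp_D: "[|dgm X; dgm Y; f \<in> Cyc X Y n; h \<in> Hom X Y m; m = n - 1|] ==> htp X Y n f (f \<oplus>[HM X Y n] D X Y m h)"
 by (auto simp: htp_def)

lemma htp_add:
 assumes X: "dgm X" "dgm Y" and h: "htp X Y n f f'" "htp X Y n g g'"
 shows "htp X Y n (f \<oplus>[HM X Y n] g) (f' \<oplus>[HM X Y n] g')"
proof -
 obtain h where f: "f \<in> Cyc X Y n" and h: "h \<in> Hom X Y (n - 1)" "f' = f \<oplus>[HM X Y n] D X Y (n - 1) h"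
  using h htp_def by blast
 obtain h' where g: "g \<in> Cyc X Y n" and h': "h' \<in> Hom X Y (n - 1)" "g' = g \<oplus>[HM X Y n] D X Y (n - 1) h'"
  using \<open>htp X Y n g g'\<close> htp_def by blast
 have c: "D X Y (n - 1) h \<in> carrier (HM X Y n)" "D X Y (n - 1) h' \<in> carrier (HM X Y n)"
   "f \<in> carrier (HM X Y n)" "g \<in> carrier (HM X Y n)"
  using h h' X f g by (auto intro: D_closed dest: CycD)
 have "f' \<oplus>[HM X Y n] g' = f \<oplus>[HM X Y n] g \<oplus>[HM X Y n] D X Y (n - 1) (h \<oplus>[HM X Y (n - 1)] h')"
  using D_add[OF X h(1) h'(1)] h(2) h'(2) c X
  by (simp add: ag_assoc[OF HM_ag] ag_lcomm[OF HM_ag] ag_add_closed[OF HM_ag] del: HM_carrier)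
 then show ?thesis unfolding htp_def using h h' X f g
  by (auto intro!: HM_add_closed Cyc_add)
qed

lemma htp_comp_left:
 assumes X: "dgm X" "dgm Y" "dgm Z" and h: "htp X Y q f f'" and g: "g \<in> Cyc Y Z p" and r: "r = q + p"
 shows "htp X Z r (gcomp X q g f) (gcomp X q g f')"
proof -
 obtain h where f: "f \<in> Cyc X Y q" and h: "h \<in> Hom X Y (q - 1)" "f' = f \<oplus>[HM X Y q] D X Y (q - 1) h"
  using h htp_def by blast
 have gH: "g \<in> Hom Y Z p" "f \<in> Hom X Y q" using g f CycD by blast+
 have gh: "gcomp X (q - 1) g h \<in> Hom X Z (r - 1)" "gcomp X q g (D X Y (q - 1) h) \<in> Hom X Z r"
  using X h gH r by (auto intro!: gcomp_closed D_closed)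
 have "D X Z (r - 1) (gcomp X (q - 1) g h) = ksign (HM X Z r) p (gcomp X q g (D X Y (q - 1) h))"
  using D_gcomp[OF X h(1) gH(1), of "r - 1"] CycD(2)[OF g] gcomp_zero_left[OF X h(1), of r "p + 1"] X gh r
  by (simp add: ag_l_zero HM_ksign_closed)
 then have "D X Z (r - 1) (ksign (HM X Z (r - 1)) p (gcomp X (q - 1) g h)) = gcomp X q g (D X Y (q - 1) h)"
  using X gh D_ksign[OF X(1,3) gh(1), of p] by (simp add: ksign_ksign) (simp add: ksign_def)
 moreover have "gcomp X q g f' = gcomp X q g f \<oplus>[HM X Z r] gcomp X q g (D X Y (q - 1) h)"
  unfolding h(2) using X gH h(1) r by (intro gcomp_add_right D_closed) auto
 ultimately show ?thesis unfolding htp_def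
  using X gh f g r by (auto intro!: Cyc_gcomp bexI[of _ "ksign (HM X Z (r - 1)) p (gcomp X (q - 1) g h)"] HM_ksign_closed)
qed

lemma htp_comp_right:
 assumes X: "dgm X" "dgm Y" "dgm Z" and h: "htp Y Z p g g'" and f: "f \<in> Cyc X Y q" and r: "r = q + p"
 shows "htp X Z r (gcomp X q g f) (gcomp X q g' f)"
proof -
 obtain h where g: "g \<in> Cyc Y Z p" and h: "h \<in> Hom Y Z (p - 1)" "g' = g \<oplus>[HM Y Z p] D Y Z (p - 1) h"
  using h htp_def by blast
 have gH: "g \<in> Hom Y Z p" "f \<in> Hom X Y q" using g f CycD by blast+
 have gh: "gcomp X q h f \<in> Hom X Z (r - 1)" "gcomp X q (D Y Z (p - 1) h) f \<in> Hom X Z r"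
  using X h gH r by (auto intro!: gcomp_closed D_closed)
 have "D X Z (r - 1) (gcomp X q h f) = gcomp X q (D Y Z (p - 1) h) f"
  using D_gcomp[OF X gH(2) h(1), of "r - 1"] CycD(2)[OF f] gcomp_zero_right[OF X h(1), of r "q + 1"] X gh r
  by (simp add: ag_r_zero ksign_zero)
 moreover have "gcomp X q g' f = gcomp X q g f \<oplus>[HM X Z r] gcomp X q (D Y Z (p - 1) h) f"
  unfolding h(2) using X gH h(1) r by (intro gcomp_add_left D_closed) auto
 ultimately show ?thesis unfolding htp_def
  using X gh f g r by (auto intro!: Cyc_gcomp bexI[of _ "gcomp X q h f"])
qed

lemma htp_comp:
 assumes "dgm X" "dgm Y" "dgm Z" "htp X Y q f f'" "htp Y Z p g g'" "r = q + p"
 shows "htp X Z r (gcomp X q g f) (gcomp X q g' f')"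
 using htp_trans[OF _ _ htp_comp_left[OF assms(1-4) htpD(1)[OF assms(5)]] htp_comp_right[OF assms(1-3,5) htpD(2)[OF assms(4)]]] assms by blast

lemma hclass_htp: "[|dgm X; dgm Y; f \<in> Cyc X Y 0|] ==> hclass K A X Y f = {g. htp X Y 0 f g}"
 unfolding hclass_def htp_def by (auto simp: chain_maps_Cyc intro!: Cyc_add Cyc_D)

lemma hclass_eq_iff: assumes "dgm X" "dgm Y" "f \<in> Cyc X Y 0" "g \<in> Cyc X Y 0"
 shows "hclass K A X Y f = hclass K A X Y g \<longleftrightarrow> htp X Y 0 f g"
proof
 assume "hclass K A X Y f = hclass K A X Y g"
 then show "htp X Y 0 f g"
  using htp_refl[OF assms(1,2,4)] unfolding hclass_htp[OF assms(1-3)] hclass_htp[OF assms(1,2,4)] by blast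
next
 assume "htp X Y 0 f g"
 then show "hclass K A X Y f = hclass K A X Y g"
  unfolding hclass_htp[OF assms(1-3)] hclass_htp[OF assms(1,2,4)]
  by (blast intro: htp_trans[OF assms(1,2)] htp_sym[OF assms(1,2)])
qed

lemma hclass_self: "[|dgm X; dgm Y; f \<in> Cyc X Y 0|] ==> f \<in> hclass K A X Y f"
 by (simp add: hclass_htp htp_refl)

lemma hmors_Cyc: "[|dgm X; dgm Y|] ==> hmors K A X Y = hclass K A X Y ` Cyc X Y 0"
 by (simp only: hmors_def chain_maps_Cyc)

lemma hcomp_hclass: assumes "dgm X" "dgm Y" "dgm Z" "f \<in> Cyc X Y 0" "g \<in> Cyc Y Z 0"
 shows "hcomp K A X Z (hclass K A Y Z g) (hclass K A X Y f) = hclass K A X Z (gcomp X 0 g f)"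
 unfolding hcomp_def
proof (rule UN2_const)
 fix g' f' assume "g' \<in> hclass K A Y Z g" "f' \<in> hclass K A X Y f"
 then have h: "htp Y Z 0 g g'" "htp X Y 0 f f'" using assms by (simp_all add: hclass_htp)
 have "htp X Z 0 (gcomp X 0 g f) (gcomp X 0 g' f')"
  by (rule htp_comp[OF assms(1-3) h(2,1)]) simp
 then show "hclass K A X Z (gcomp X 0 g' f') = hclass K A X Z (gcomp X 0 g f)"
  using hclass_eq_iff[OF assms(1,3)] htpD[OF _ assms(1,3)] by metis
qed (use assms hclass_self in \<open>blast+\<close>)

lemma hadd_hclass: assumes "dgm X" "dgm Y" "f \<in> Cyc X Y 0" "g \<in> Cyc X Y 0"
 shows "hadd K A X Y (hclass K A X Y f) (hclass K A X Y g) = hclass K A X Y (f \<oplus>[HM X Y 0] g)"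
 unfolding hadd_def
proof (rule UN2_const)
 fix f' g' assume "f' \<in> hclass K A X Y f" "g' \<in> hclass K A X Y g"
 then have h: "htp X Y 0 f f'" "htp X Y 0 g g'" using assms by (simp_all add: hclass_htp)
 have "htp X Y 0 (f \<oplus>[HM X Y 0] g) (f' \<oplus>[HM X Y 0] g')"
  by (rule htp_add[OF assms(1,2) h])
 then show "hclass K A X Y (f' \<oplus>[HM X Y 0] g') = hclass K A X Y (f \<oplus>[HM X Y 0] g)"
  using hclass_eq_iff[OF assms(1,2)] htpD[OF _ assms(1,2)] by metis
qed (use assms hclass_self in \<open>blast+\<close>)

text \<open>The shift of a morphism, written as conjugation by the closed isomorphism \<open>X \<rightarrow> X[s]\<close> of degree \<open>- s\<close>.
 In this form its properties follow from those of composition alone, also after applying a dg functor.\<close>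

definition conj_shift :: "int => ('k, 'a, 'm) dg_mod => ('k, 'a, 'n) dg_mod => (int => 'm => 'n) => int => 'm => 'n" where
 "conj_shift s X Y f = gcomp (dg_shift s X) s (gcomp X 0 (to_shift s Y) f) (from_shift s X)"

lemma conj_shift_eq: "f \<in> Hom X Y 0 ==> conj_shift s X Y f = (\<lambda>i. f (i + s))"
 by (intro ext) (auto simp: conj_shift_def gcomp_def from_shift_def to_shift_def Hom_closed Hom_undefined)

lemma conj_shift_htp:
 assumes X: "dgm X" "dgm Y" and h: "htp X Y 0 f g"
 shows "htp (dg_shift s X) (dg_shift s Y) 0 (conj_shift s X Y f) (conj_shift s X Y g)"
 unfolding conj_shift_def using X
 by (intro htp_comp_right[where p = "- s" and Y = X] htp_comp_left[where Y = Y and p = "- s"] h) (auto intro!: shift_Cyc)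

lemma hshift_hclass:
 assumes X: "dgm X" "dgm Y" and f: "f \<in> Cyc X Y 0"
 shows "hshift s (hclass K A X Y f) = hclass K A (dg_shift s X) (dg_shift s Y) (conj_shift s X Y f)"
proof -
 let ?X = "dg_shift s X" and ?Y = "dg_shift s Y"
 have c: "conj_shift s X Y f \<in> Cyc ?X ?Y 0"
  by (rule htpD(1)[OF conj_shift_htp[OF X htp_refl[OF X f]]]) (simp_all add: X)
 have "\<exists>g'. htp X Y 0 f g' & (\<lambda>i. g' (i + s)) = g" if g: "htp ?X ?Y 0 (conj_shift s X Y f) g" for g
 proof -
  let ?c = "\<lambda>u. gcomp X (- s) (gcomp ?X 0 (from_shift s Y) u) (to_shift s X)"
  have gH: "g \<in> Cyc ?X ?Y 0" by (rule htpD(2)[OF g]) (simp_all add: X)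
  have e: "?c u = (\<lambda>i. u (i - s))" if "u \<in> Hom ?X ?Y 0" for u
  proof (intro ext)
   fix i x
   show "?c u i x = u (i - s) x"
    using Hom_closed[OF that, of x "i - s" "i - s"] Hom_undefined[OF that, of x "i - s"]
    by (cases "x \<in> car X i") (simp_all add: gcomp_def from_shift_def to_shift_def)
  qed
  have "htp X Y 0 (?c (conj_shift s X Y f)) (?c g)"
   using X g by (intro htp_comp_right[where p = s and Y = ?X] htp_comp_left[where Y = ?Y and p = s]) (auto intro!: shift_Cyc)
  moreover have "?c (conj_shift s X Y f) = f"
   using e[OF CycH[OF c]] conj_shift_eq[OF CycH[OF f]] by simp
  ultimately show ?thesis using e[OF CycH[OF gH]] by (intro exI[of _ "?c g"]) simp
 qed
 moreover have "htp ?X ?Y 0 (conj_shift s X Y f) (\<lambda>i. g (i + s))" if "htp X Y 0 f g" for g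
  using conj_shift_htp[OF X that] conj_shift_eq[OF CycH[OF htpD(2)[OF that X]]] by simp
 ultimately show ?thesis
  unfolding hshift_def hclass_htp[OF X f] hclass_htp[OF dgm_shift[OF X(1)] dgm_shift[OF X(2)] c] by blast
qed

lemma hiso_iff: assumes X: "dgm X" "dgm Y"
 shows "hiso K A X Y F \<longleftrightarrow> (\<exists>f\<in>Cyc X Y 0. \<exists>g\<in>Cyc Y X 0. F = hclass K A X Y f &
   htp X X 0 (gcomp X 0 g f) (gid X) & htp Y Y 0 (gcomp Y 0 f g) (gid Y))"
 using X by (auto simp: hiso_def hid_def hmors_Cyc hcomp_hclass hclass_eq_iff Cyc_gcomp Cyc_gid)
   (use htp_refl[OF X] in blast)

end

section \<open>Quasi-isomorphisms\<close>

context dg_algebra begin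

text \<open>Bijectivity on cohomology in terms of representatives, which avoids cosets; see \<open>qis_iff_bij\<close>.\<close>

definition qis :: "('k, 'a, 'm) dg_mod => ('k, 'a, 'n) dg_mod => (int => 'm => 'n) => bool" where
 "qis X Y f \<longleftrightarrow>
   (\<forall>i. \<forall>x\<in>cocycles X i. f i x \<in> coboundaries Y i --> x \<in> coboundaries X i) &
   (\<forall>i. \<forall>y\<in>cocycles Y i. \<exists>x\<in>cocycles X i. y \<oplus>[Y,i] \<ominus>[Y,i] f i x \<in> coboundaries Y i)"

definition acyclic :: "('k, 'a, 'm) dg_mod => bool" where
 "acyclic X \<longleftrightarrow> (\<forall>i. cocycles X i \<subseteq> coboundaries X i)"

lemma cocyclesI: "[|x \<in> car X i; mdiff X i x = \<zero>[X,i + 1]|] ==> x \<in> cocycles X i"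
 by (simp add: cocycles_def)

lemma cocyclesD: "x \<in> cocycles X i ==> x \<in> car X i" "x \<in> cocycles X i ==> mdiff X i x = \<zero>[X,i + 1]"
 by (auto simp: cocycles_def)

lemma coboundariesI: "[|w \<in> car X j; i = j + 1; x = mdiff X j w|] ==> x \<in> coboundaries X i"
 by (auto simp: coboundaries_def)

lemma coboundariesE:
 assumes "x \<in> coboundaries X i"
 obtains w where "w \<in> car X (i - 1)" "x = mdiff X (i - 1) w"
 using assms by (auto simp: coboundaries_def)

lemma coboundaries_cocycles: "[|dgm X; x \<in> coboundaries X i|] ==> x \<in> cocycles X i"
 using diff_diff[of X _ "i - 1" i] by (auto elim!: coboundariesE intro!: cocyclesI diff_closed simp: ac_simps)

lemma coboundaries_closed: "[|dgm X; x \<in> coboundaries X i|] ==> x \<in> car X i"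
 by (rule cocyclesD(1)[OF coboundaries_cocycles])

lemma cocycles_subgroup:
 assumes "dgm X"
 shows "[|x \<in> cocycles X i; y \<in> cocycles X i|] ==> x \<oplus>[X,i] y \<in> cocycles X i"
  and "x \<in> cocycles X i ==> \<ominus>[X,i] x \<in> cocycles X i"
  and "\<zero>[X,i] \<in> cocycles X i"
  and "x \<in> cocycles X i ==> ksign (mcomp X i) p x \<in> cocycles X i"
 using assms by (auto simp: cocycles_def dgm_closed ag_simps diff_add diff_neg diff_zero diff_ksign ksign_zero)

lemma coboundaries_subgroup:
 assumes "dgm X"
 shows "[|x \<in> coboundaries X i; y \<in> coboundaries X i|] ==> x \<oplus>[X,i] y \<in> coboundaries X i"
  and "x \<in> coboundaries X i ==> \<ominus>[X,i] x \<in> coboundaries X i"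
  and "\<zero>[X,i] \<in> coboundaries X i"
  and "x \<in> coboundaries X i ==> ksign (mcomp X i) p x \<in> coboundaries X i"
proof -
 show "x \<oplus>[X,i] y \<in> coboundaries X i" if "x \<in> coboundaries X i" "y \<in> coboundaries X i"
 proof -
  obtain v w where "v \<in> car X (i - 1)" "x = mdiff X (i - 1) v" "w \<in> car X (i - 1)" "y = mdiff X (i - 1) w"
   using \<open>x \<in> coboundaries X i\<close> \<open>y \<in> coboundaries X i\<close> by (auto elim!: coboundariesE)
  then show ?thesis using assms diff_add[of X v "i - 1" w]
   by (intro coboundariesI[of "v \<oplus>[X,i - 1] w" X "i - 1"]) (auto simp: ag_simps)
 qed
 show n: "x \<in> coboundaries X i ==> \<ominus>[X,i] x \<in> coboundaries X i"
 proof (elim coboundariesE)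
  fix w assume "w \<in> car X (i - 1)" "x = mdiff X (i - 1) w"
  then show ?thesis using assms diff_neg[of X w "i - 1"]
   by (intro coboundariesI[of "\<ominus>[X,i - 1] w" X "i - 1"]) (auto simp: ag_simps)
 qed
 show "\<zero>[X,i] \<in> coboundaries X i"
  using assms diff_zero[of X "i - 1"] by (intro coboundariesI[of "\<zero>[X,i - 1]" X "i - 1"]) (auto simp: ag_zero_closed)
 show "x \<in> coboundaries X i ==> ksign (mcomp X i) p x \<in> coboundaries X i"
  using n by (simp add: ksign_def)
qed

lemma coset_eq_iff:
 assumes "dgm X" "x \<in> car X i" "y \<in> car X i"
 shows "coboundaries X i +>\<^bsub>mcomp X i\<^esub> x = coboundaries X i +>\<^bsub>mcomp X i\<^esub> y \<longleftrightarrow>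
  x \<oplus>[X,i] \<ominus>[X,i] y \<in> coboundaries X i" (is "?L = ?R \<longleftrightarrow> ?d \<in> ?B")
proof
 note B = coboundaries_subgroup(1-3)[OF assms(1)] coboundaries_closed[OF assms(1)]
 have x: "x \<in> ?L" using B(3) assms by (force simp: a_r_coset_def' ag_simps)
 assume "?L = ?R"
 then obtain b where "b \<in> ?B" "x = b \<oplus>[X,i] y" using x by (auto simp: a_r_coset_def')
 then show "?d \<in> ?B" using B assms by (simp add: ag_assoc ag_simps)
next
 note B = coboundaries_subgroup(1-3)[OF assms(1)] coboundaries_closed[OF assms(1)]
 assume d: "?d \<in> ?B"
 have *: "b \<oplus>[X,i] u \<in> ?B +>\<^bsub>mcomp X i\<^esub> v" if "b \<in> ?B" "u \<in> car X i" "v \<in> car X i"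
  "u \<oplus>[X,i] \<ominus>[X,i] v \<in> ?B" for b u v
  unfolding a_r_coset_def' using that B assms
  by (auto simp: ag_assoc ag_simps intro!: bexI[of _ "b \<oplus>[X,i] (u \<oplus>[X,i] \<ominus>[X,i] v)"])
 have "y \<oplus>[X,i] \<ominus>[X,i] x \<in> ?B"
  using B(2)[OF d] assms by (simp add: ag_simps ag_comm)
 then show "?L = ?R" using *[OF _ assms(2,3) d] *[OF _ assms(3,2)]
  by (intro equalityI subsetI) (auto simp: a_r_coset_def')
qed

lemma Cyc_cocycle:
 assumes "dgm X" "dgm Y" "f \<in> Cyc X Y n" "x \<in> cocycles X i" "k = i + n"
 shows "f i x \<in> cocycles Y k"
proof (rule cocyclesI)
 note fH = CycH[OF assms(3)]
 show "f i x \<in> car Y k" using cocyclesD(1)[OF assms(4)] assms(5) by (simp add: Hom_closed[OF fH])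
 show "mdiff Y k (f i x) = \<zero>[Y,k + 1]"
  using Cyc_diff[OF assms(1-3) cocyclesD(1)[OF assms(4)] assms(5)] cocyclesD(2)[OF assms(4)]
   Hom_zero[OF fH assms(1,2), of "i + 1"] ksign_zero[OF dgm_ag[OF assms(2)]]
  by (simp add: assms(5) ac_simps)
qed

lemma Cyc_coboundary:
 assumes "dgm X" "dgm Y" "f \<in> Cyc X Y n" "x \<in> coboundaries X i" "k = i + n"
 shows "f i x \<in> coboundaries Y k"
proof -
 obtain w where w: "w \<in> car X (i - 1)" "x = mdiff X (i - 1) w" using assms(4) by (rule coboundariesE)
 have fw: "f (i - 1) w \<in> car Y (k - 1)" using assms w by (intro Hom_closed[OF CycH[OF assms(3)]]) auto
 have "mdiff Y (k - 1) (f (i - 1) w) = ksign (mcomp Y k) n (f i x)"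
  using Cyc_diff[OF assms(1-3) w(1), of "k - 1"] w assms by simp
 then have "ksign (mcomp Y k) n (f i x) \<in> coboundaries Y k"
  using fw by (intro coboundariesI[of "f (i - 1) w" Y "k - 1"]) auto
 then have "ksign (mcomp Y k) n (ksign (mcomp Y k) n (f i x)) \<in> coboundaries Y k"
  by (rule coboundaries_subgroup[OF assms(2)])
 moreover have "f i x \<in> car Y k"
  using assms coboundaries_closed[OF assms(1,4)] Hom_closed[OF CycH[OF assms(3)]] by simp
 ultimately show ?thesis using assms by (simp add: ksign_ksign) (simp add: ksign_def)
qed

lemma cohomology_map_coset:
 assumes "dgm X" "dgm Y" "f \<in> Cyc X Y 0" "x \<in> cocycles X i"
 shows "cohomology_map Y f i (coboundaries X i +>\<^bsub>mcomp X i\<^esub> x) = coboundaries Y i +>\<^bsub>mcomp Y i\<^esub> f i x"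
proof -
 have x: "x \<in> car X i" and fH: "f \<in> Hom X Y 0" using assms by (auto dest: CycD cocyclesD)
 have "coboundaries Y i +>\<^bsub>mcomp Y i\<^esub> f i (b \<oplus>[X,i] x) = coboundaries Y i +>\<^bsub>mcomp Y i\<^esub> f i x" if "b \<in> coboundaries X i" for b
 proof -
  have b: "b \<in> car X i" by (rule coboundaries_closed[OF assms(1) that])
  have "f i (b \<oplus>[X,i] x) \<oplus>[Y,i] \<ominus>[Y,i] f i x = f i b"
   using b x assms Hom_closed[OF fH] Hom_add[OF fH b x] by (simp add: ag_assoc ag_simps)
  then show ?thesis
   using Cyc_coboundary[OF assms(1-3) that, of i] x b assms by (subst coset_eq_iff) (auto simp: Hom_closed[OF fH] ag_simps)
 qed
 moreover have "coboundaries X i \<noteq> {}" using coboundaries_subgroup(3)[OF assms(1)] by blast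
 ultimately show ?thesis unfolding cohomology_map_def a_r_coset_def' by simp
qed

lemma bij_betw_cosets:
 assumes "\<And>x. x \<in> Z ==> g (c x) = c' (f x)" "\<And>x. x \<in> Z ==> f x \<in> Z'"
 shows "bij_betw g (c ` Z) (c' ` Z') \<longleftrightarrow>
  (\<forall>x\<in>Z. \<forall>y\<in>Z. c' (f x) = c' (f y) --> c x = c y) & (\<forall>y\<in>Z'. \<exists>x\<in>Z. c' y = c' (f x))"
proof -
 have "inj_on g (c ` Z) \<longleftrightarrow> (\<forall>x\<in>Z. \<forall>y\<in>Z. c' (f x) = c' (f y) --> c x = c y)"
  using assms(1) by (simp add: inj_on_def)
 moreover have "g ` c ` Z = (\<lambda>x. c' (f x)) ` Z" using assms(1) by (simp add: image_image)
 moreover have "(\<lambda>x. c' (f x)) ` Z \<subseteq> c' ` Z'" using assms(2) by blast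
 ultimately show ?thesis unfolding bij_betw_def by blast
qed

lemma qis_iff_bij:
 assumes X: "dgm X" and Y: "dgm Y" and f: "f \<in> Cyc X Y 0"
 shows "qis X Y f \<longleftrightarrow> (\<forall>i. bij_betw (cohomology_map Y f i) (cohomology X i) (cohomology Y i))"
proof -
 note fH = CycH[OF f]
 have "bij_betw (cohomology_map Y f i) (cohomology X i) (cohomology Y i) \<longleftrightarrow>
   (\<forall>x\<in>cocycles X i. f i x \<in> coboundaries Y i --> x \<in> coboundaries X i) &
   (\<forall>y\<in>cocycles Y i. \<exists>x\<in>cocycles X i. y \<oplus>[Y,i] \<ominus>[Y,i] f i x \<in> coboundaries Y i)" for i
 proof -
  have fz: "f i x \<in> cocycles Y i" if "x \<in> cocycles X i" for x using Cyc_cocycle[OF assms that, of i] by simp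
  have sub: "f i (x \<oplus>[X,i] \<ominus>[X,i] y) = f i x \<oplus>[Y,i] \<ominus>[Y,i] f i y"
   if "x \<in> car X i" "y \<in> car X i" for x y
   using that X Y Hom_add[OF fH, of x i] Hom_neg[OF fH X Y, of y i] by (simp add: ag_simps)
  have z: "\<zero>[X,i] \<in> cocycles X i" "f i \<zero>[X,i] = \<zero>[Y,i]"
   using cocycles_subgroup(3)[OF X] Hom_zero[OF fH X Y, of i] by auto
  have "(\<forall>x\<in>cocycles X i. \<forall>y\<in>cocycles X i. f i x \<oplus>[Y,i] \<ominus>[Y,i] f i y \<in> coboundaries Y i -->
    x \<oplus>[X,i] \<ominus>[X,i] y \<in> coboundaries X i) \<longleftrightarrow>
   (\<forall>x\<in>cocycles X i. f i x \<in> coboundaries Y i --> x \<in> coboundaries X i)" (is "?A \<longleftrightarrow> ?B")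
  proof
   assume A: ?A
   show ?B
   proof (intro ballI impI)
    fix x assume x: "x \<in> cocycles X i" "f i x \<in> coboundaries Y i"
    then have "x \<in> car X i" "f i x \<in> car Y i" using fz[THEN cocyclesD(1)] cocyclesD(1) by auto
    then show "x \<in> coboundaries X i" using A[rule_format, OF x(1) z(1)] x z X Y by (simp add: ag_simps)
   qed
  next
   assume B: ?B
   show ?A
   proof (intro ballI impI)
    fix x y assume xy: "x \<in> cocycles X i" "y \<in> cocycles X i" "f i x \<oplus>[Y,i] \<ominus>[Y,i] f i y \<in> coboundaries Y i"
    show "x \<oplus>[X,i] \<ominus>[X,i] y \<in> coboundaries X i"
     using xy by (intro B[rule_format] cocycles_subgroup[OF X]) (simp_all add: sub cocyclesD)
   qed
  qed
  moreover have "bij_betw (cohomology_map Y f i) (cohomology X i) (cohomology Y i) \<longleftrightarrow>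
    (\<forall>x\<in>cocycles X i. \<forall>y\<in>cocycles X i. f i x \<oplus>[Y,i] \<ominus>[Y,i] f i y \<in> coboundaries Y i -->
     x \<oplus>[X,i] \<ominus>[X,i] y \<in> coboundaries X i) &
    (\<forall>y\<in>cocycles Y i. \<exists>x\<in>cocycles X i. y \<oplus>[Y,i] \<ominus>[Y,i] f i x \<in> coboundaries Y i)"
   unfolding cohomology_def
   by (subst bij_betw_cosets[where f = "f i"])
     (simp_all add: cohomology_map_coset[OF assms] fz coset_eq_iff[OF X] coset_eq_iff[OF Y] cocyclesD cong: ball_cong bex_cong)
  ultimately show ?thesis by simp
 qed
 then show ?thesis unfolding qis_def by blast
qed

lemma htp_cocycle:
 assumes X: "dgm X" and Y: "dgm Y" and h: "htp X Y 0 f g" and x: "x \<in> cocycles X i"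
 shows "\<exists>b\<in>coboundaries Y i. g i x = f i x \<oplus>[Y,i] b"
proof -
 obtain h where h: "h \<in> Hom X Y (-1)" "g = f \<oplus>[HM X Y 0] D X Y (-1) h" using h by (auto simp: htp_def)
 have "h i x \<in> car Y (i - 1)" using h(1) cocyclesD[OF x] by (simp add: Hom_closed)
 moreover have "g i x = f i x \<oplus>[Y,i] mdiff Y (i - 1) (h i x)"
  using h cocyclesD[OF x] X Y Hom_zero[OF h(1) X Y, of "i + 1"] calculation
  by (simp add: hom_diff_apply ag_simps diff_closed)
 ultimately show ?thesis by (intro bexI[of _ "mdiff Y (i - 1) (h i x)"] coboundariesI[of "h i x" Y "i - 1"]) auto
qed

text \<open>Homotopic maps differ by a coboundary on every cocycle.\<close>

lemma qis_htp1:
 assumes X: "dgm X" and Y: "dgm Y" and h: "htp X Y 0 f g" and q: "qis X Y f"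
 shows "qis X Y g"
 unfolding qis_def
proof (intro conjI allI ballI impI)
 note B = coboundaries_subgroup[OF Y]
 have fz: "f i x \<in> car Y i" if "x \<in> cocycles X i" for x i
  using Hom_closed[OF CycH[OF htpD(1)[OF h X Y]] cocyclesD(1)[OF that], of i] by simp
 fix i x
 { assume x: "x \<in> cocycles X i" and g: "g i x \<in> coboundaries Y i"
  obtain b where b: "b \<in> coboundaries Y i" "g i x = f i x \<oplus>[Y,i] b" using htp_cocycle[OF X Y h x] by blast
  have "f i x = g i x \<oplus>[Y,i] \<ominus>[Y,i] b"
   unfolding b(2) using b(1) fz[OF x] coboundaries_closed[OF Y b(1)] Y by (simp add: ag_assoc ag_simps)
  then have "f i x \<in> coboundaries Y i" using B(1)[OF g B(2)[OF b(1)]] by simp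
  then show "x \<in> coboundaries X i" using q x by (auto simp: qis_def) }
 fix y assume y: "y \<in> cocycles Y i"
 then obtain x where x: "x \<in> cocycles X i" "y \<oplus>[Y,i] \<ominus>[Y,i] f i x \<in> coboundaries Y i"
  using q unfolding qis_def by blast
 obtain b where b: "b \<in> coboundaries Y i" "g i x = f i x \<oplus>[Y,i] b" using htp_cocycle[OF X Y h x(1)] by blast
 have "y \<oplus>[Y,i] \<ominus>[Y,i] g i x = y \<oplus>[Y,i] \<ominus>[Y,i] f i x \<oplus>[Y,i] \<ominus>[Y,i] b"
  unfolding b(2) using cocyclesD[OF y] fz[OF x(1)] coboundaries_closed[OF Y b(1)] Y by (simp add: ag_assoc ag_simps)
 then show "\<exists>x\<in>cocycles X i. y \<oplus>[Y,i] \<ominus>[Y,i] g i x \<in> coboundaries Y i"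
  using B(1)[OF x(2) B(2)[OF b(1)]] x(1) by (intro bexI[of _ x]) simp_all
qed

lemma qis_htp: "[|dgm X; dgm Y; htp X Y 0 f g|] ==> qis X Y f \<longleftrightarrow> qis X Y g"
 using qis_htp1 htp_sym by metis

lemma quasi_isos_hclass:
 assumes X: "dgm X" and Y: "dgm Y" and f: "f \<in> Cyc X Y 0"
 shows "hclass K A X Y f \<in> quasi_isos K A X Y \<longleftrightarrow> qis X Y f"
proof -
 have "hclass K A X Y f \<in> hmors K A X Y" using f by (simp only: hmors_Cyc[OF X Y]) blast
 moreover have "(\<forall>i. bij_betw (cohomology_map Y g i) (cohomology X i) (cohomology Y i)) \<longleftrightarrow> qis X Y f" if "htp X Y 0 f g" for g
  using qis_iff_bij[OF X Y] htpD(2)[OF that X Y] qis_htp[OF X Y that] by blast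
 ultimately show ?thesis
  unfolding quasi_isos_def hclass_htp[OF X Y f] using htp_refl[OF X Y f] by blast
qed

lemma qis_comp:
 assumes X: "dgm X" and Y: "dgm Y" and Z: "dgm Z" and f: "f \<in> Cyc X Y 0" "qis X Y f" and g: "g \<in> Cyc Y Z 0" "qis Y Z g"
 shows "qis X Z (gcomp X 0 g f)"
 unfolding qis_def
proof (intro conjI allI ballI impI)
 have fz: "f i x \<in> cocycles Y i" if "x \<in> cocycles X i" for x i using Cyc_cocycle[OF X Y f(1) that, of i] by simp
 fix i x
 { assume "x \<in> cocycles X i" "gcomp X 0 g f i x \<in> coboundaries Z i"
  then show "x \<in> coboundaries X i" using f(2) g(2) fz by (auto simp: qis_def cocyclesD) }
 fix z assume z: "z \<in> cocycles Z i"
 obtain y where y: "y \<in> cocycles Y i" "z \<oplus>[Z,i] \<ominus>[Z,i] g i y \<in> coboundaries Z i"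
  using g(2) z unfolding qis_def by blast
 obtain x where x: "x \<in> cocycles X i" "y \<oplus>[Y,i] \<ominus>[Y,i] f i x \<in> coboundaries Y i"
  using f(2) y unfolding qis_def by blast
 note gH = CycH[OF g(1)]
 have car: "z \<in> car Z i" "y \<in> car Y i" "f i x \<in> car Y i" using cocyclesD(1)[OF z] cocyclesD(1)[OF y(1)] cocyclesD(1)[OF fz[OF x(1)]] by auto
 have "g i (y \<oplus>[Y,i] \<ominus>[Y,i] f i x) = g i y \<oplus>[Z,i] \<ominus>[Z,i] g i (f i x)"
  using Hom_add[OF gH, of y i] Hom_neg[OF gH Y Z, of "f i x" i] car Y by (simp add: ag_simps)
 then have "(z \<oplus>[Z,i] \<ominus>[Z,i] g i y) \<oplus>[Z,i] (g i y \<oplus>[Z,i] \<ominus>[Z,i] g i (f i x)) \<in> coboundaries Z i"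
  using Cyc_coboundary[OF Y Z g(1) x(2), of i] y(2) coboundaries_subgroup(1)[OF Z] by simp
 then have "z \<oplus>[Z,i] \<ominus>[Z,i] gcomp X 0 g f i x \<in> coboundaries Z i"
  using car Z Hom_closed[OF gH] cocyclesD[OF x(1)] by (simp add: ag_assoc ag_simps)
 then show "\<exists>x\<in>cocycles X i. z \<oplus>[Z,i] \<ominus>[Z,i] gcomp X 0 g f i x \<in> coboundaries Z i" using x by blast
qed

text \<open>The long exact sequence of a cone, read off from its cocycles: \<open>(y, x)\<close> is closed iff \<open>x\<close> is closed
 and \<open>f x\<close> is bounded by \<open>- y\<close>.  This turns statements about quasi-isomorphisms into statements about
 acyclic modules.\<close>

lemma qis_cone:
 assumes X: "dgm X" and Y: "dgm Y" and f: "f \<in> Cyc X Y 0"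
 shows "qis X Y f \<longleftrightarrow> acyclic (dg_cone X Y f)"
proof
 note fH = CycH[OF f]
 note fd = Cyc_diff[OF X Y f, simplified]
 note cl = Hom_closed[OF fH, simplified]
 assume q: "qis X Y f"
 show "acyclic (dg_cone X Y f)"
  unfolding acyclic_def
 proof (intro allI subsetI)
  fix i u assume "u \<in> cocycles (dg_cone X Y f) i"
  then obtain y x where u: "u = (y, x)" and y: "y \<in> car Y i" and x: "x \<in> car X (i + 1)"
   and dy: "mdiff Y i y \<oplus>[Y,i + 1] f (i + 1) x = \<zero>[Y,i + 1]"
   and dx: "\<ominus>[X,i + 1 + 1] mdiff X (i + 1) x = \<zero>[X,i + 1 + 1]"
   by (auto simp: cocycles_def)
  have "mdiff X (i + 1) x = \<zero>[X,i + 1 + 1]"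
   using dx X x by (metis ag_neg_neg ag_neg_zero dgm_ag diff_closed)
  then have xz: "x \<in> cocycles X (i + 1)" using x by (simp add: cocycles_def)
  have fx: "f (i + 1) x = \<ominus>[Y,i + 1] mdiff Y i y"
   using dy ag_neg_unique[of "mcomp Y (i + 1)" "mdiff Y i y" "f (i + 1) x"] Y y x by (simp add: diff_closed cl)
  then have "f (i + 1) x \<in> coboundaries Y (i + 1)"
   using diff_neg[OF Y y] Y y by (intro coboundariesI[of "\<ominus>[Y,i] y" Y i]) (auto simp: ag_simps)
  then have "x \<in> coboundaries X (i + 1)" using q xz by (auto simp: qis_def)
  then obtain x0 where x0: "x0 \<in> car X i" "x = mdiff X i x0" by (auto elim: coboundariesE)
  have "y \<oplus>[Y,i] f i x0 \<in> cocycles Y i"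
   using Y y x0 dy fd[OF x0(1)] by (intro cocyclesI) (auto simp: ag_simps cl diff_add)
  then obtain x1 where x1: "x1 \<in> cocycles X i" "y \<oplus>[Y,i] f i x0 \<oplus>[Y,i] \<ominus>[Y,i] f i x1 \<in> coboundaries Y i"
   using q unfolding qis_def by blast
  obtain w where w: "w \<in> car Y (i - 1)" "y \<oplus>[Y,i] f i x0 \<oplus>[Y,i] \<ominus>[Y,i] f i x1 = mdiff Y (i - 1) w"
   using x1(2) by (rule coboundariesE)
  note x1c = cocyclesD[OF x1(1)]
  have "mdiff Y (i - 1) w \<oplus>[Y,i] f i (x1 \<oplus>[X,i] \<ominus>[X,i] x0) = y"
   using Hom_add[OF fH x1c(1), of "\<ominus>[X,i] x0"] Hom_neg[OF fH X Y x0(1)] X Y y x0 x1c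
   by (simp add: w(2)[symmetric] ag_simps cl ag_ac ag_cancel)
  moreover have "\<ominus>[X,i + 1] mdiff X i (x1 \<oplus>[X,i] \<ominus>[X,i] x0) = x"
   using X x0 x1c x by (simp add: diff_add diff_neg ag_simps)
  ultimately show "u \<in> coboundaries (dg_cone X Y f) i"
   using w(1) x0 x1c X u
   by (intro coboundariesI[of "(w, x1 \<oplus>[X,i] \<ominus>[X,i] x0)" _ "i - 1"]) (auto simp: ag_simps)
 qed
next
 note fH = CycH[OF f]
 note cl = Hom_closed[OF fH, simplified]
 assume a: "acyclic (dg_cone X Y f)"
 show "qis X Y f"
  unfolding qis_def
 proof (intro conjI allI ballI impI)
  fix i x
  assume x: "x \<in> cocycles X i" and fx: "f i x \<in> coboundaries Y i"
  obtain w where w: "w \<in> car Y (i - 1)" "f i x = mdiff Y (i - 1) w" using fx by (rule coboundariesE)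
  have "(\<ominus>[Y,i - 1] w, x) \<in> cocycles (dg_cone X Y f) (i - 1)"
   using w X Y cocyclesD[OF x] diff_neg[OF Y w(1)] diff_closed[OF Y w(1), of i]
   by (intro cocyclesI) (auto simp: ag_simps)
  then have "(\<ominus>[Y,i - 1] w, x) \<in> coboundaries (dg_cone X Y f) (i - 1)" using a by (auto simp: acyclic_def)
  then obtain v where v: "v \<in> car X (i - 1)" "x = \<ominus>[X,i] mdiff X (i - 1) v"
   by (auto elim!: coboundariesE)
  then show "x \<in> coboundaries X i"
   using diff_neg[OF X v(1)] X by (intro coboundariesI[of "\<ominus>[X,i - 1] v" X "i - 1"]) (auto simp: ag_simps)
 next
  fix i y
  assume y: "y \<in> cocycles Y i"
  have "(y, \<zero>[X,i + 1]) \<in> cocycles (dg_cone X Y f) i"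
   using X Y cocyclesD[OF y] diff_zero[OF X] Hom_zero[OF fH X Y] by (intro cocyclesI) (auto simp: ag_simps)
  then have "(y, \<zero>[X,i + 1]) \<in> coboundaries (dg_cone X Y f) i" using a by (auto simp: acyclic_def)
  then obtain w v where v: "w \<in> car Y (i - 1)" "v \<in> car X i" "y = mdiff Y (i - 1) w \<oplus>[Y,i] f i v"
   "\<zero>[X,i + 1] = \<ominus>[X,i + 1] mdiff X i v"
   by (auto elim!: coboundariesE)
  have "mdiff X i v = \<zero>[X,i + 1]"
   using v X by (metis ag_neg_neg ag_neg_zero dgm_ag diff_closed)
  then have "v \<in> cocycles X i" using v by (intro cocyclesI)
  moreover have "y \<oplus>[Y,i] \<ominus>[Y,i] f i v = mdiff Y (i - 1) w"
   using v Y diff_closed[OF Y v(1), of i] by (simp add: ag_assoc ag_simps cl)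
  then have "y \<oplus>[Y,i] \<ominus>[Y,i] f i v \<in> coboundaries Y i"
   using v by (intro coboundariesI[of w Y "i - 1"]) auto
  ultimately show "\<exists>x\<in>cocycles X i. y \<oplus>[Y,i] \<ominus>[Y,i] f i x \<in> coboundaries Y i" by blast
 qed
qed

end

section \<open>Localizations by zigzags\<close>

inductive_simps zigzag_Nil [simp]: "zigzag C W X Y []"
inductive_simps zigzag_Fwd [simp]: "zigzag C W X Z (Fwd U Y f # p)"
inductive_simps zigzag_Bwd [simp]: "zigzag C W X Z (Bwd U Y s # p)"

lemmas [trans] = zigzag_eq.trans

lemma zigzag_objs: "zigzag C W X Y p ==> X \<in> objs C & Y \<in> objs C"
 by (induction rule: zigzag.induct) auto

lemma zigzag_append: "[|zigzag C W X Y p; zigzag C W Y Z q|] ==> zigzag C W X Z (p @ q)"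
 by (induction rule: zigzag.induct) auto

text \<open>The effect of a functor on one arrow of a zigzag.\<close>

definition zstep :: "('o => 'p) => ('o => 'o => 'f => 'g) => ('o, 'f) step => ('p, 'g) step" where
 "zstep F \<Phi> t = (case t of Fwd U V f => Fwd (F U) (F V) (\<Phi> U V f) | Bwd U V s => Bwd (F U) (F V) (\<Phi> U V s))"

lemma zstep_simps [simp]:
 "zstep F \<Phi> (Fwd U V f) = Fwd (F U) (F V) (\<Phi> U V f)" "zstep F \<Phi> (Bwd U V f) = Bwd (F U) (F V) (\<Phi> U V f)"
 by (simp_all add: zstep_def)

abbreviation zmap where "zmap F \<Phi> \<equiv> map (zstep F \<Phi>)"

definition zfun where "zfun C' W' F \<Phi> X Y P = (\<Union>p\<in>P. zclass C' W' (F X) (F Y) (zmap F \<Phi> p))"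

text \<open>Zigzags are composed by concatenation, so closure of the arrows under composition is all that their calculus
 requires.\<close>

locale loc =
 fixes C :: "('o, 'f) tri_cat" and W :: "'o => 'o => 'f set"
 assumes ids_mor: "X \<in> objs C ==> ids C X \<in> mors C X X"
  and cmps_mor: "[|X \<in> objs C; Y \<in> objs C; Z \<in> objs C; f \<in> mors C X Y; g \<in> mors C Y Z|] ==> cmps C X Y Z g f \<in> mors C X Z"
  and W_mor: "[|X \<in> objs C; Y \<in> objs C; s \<in> W X Y|] ==> s \<in> mors C X Y"
begin

abbreviation zz where "zz \<equiv> zigzag C W"
abbreviation ze where "ze \<equiv> zigzag_eq C W"
abbreviation L where "L \<equiv> loc_base C W"
abbreviation cl where "cl \<equiv> zclass C W"

lemma ze_zz: "ze X Y p q ==> zz X Y p & zz X Y q"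
 by (induction rule: zigzag_eq.induct) (auto simp: ids_mor cmps_mor W_mor intro: zigzag_append)

lemma ze_ctx: "[|ze Y Z p q; zz X Y a; zz Z V b; l = a @ p @ b; r = a @ q @ b|] ==> ze X V l r"
 by (auto intro!: zigzag_eq.append zigzag_eq.refl)

lemma cl_eq_iff: "zz X Y p ==> cl X Y p = cl X Y q \<longleftrightarrow> ze X Y p q"
 unfolding zclass_def set_eq_iff mem_Collect_eq
 by (meson zigzag_eq.refl zigzag_eq.sym zigzag_eq.trans ze_zz)

lemma cl_eqI: "ze X Y p q ==> cl X Y p = cl X Y q"
 using cl_eq_iff ze_zz by blast

lemma mem_cl: "q \<in> cl X Y p \<longleftrightarrow> ze X Y p q"
 by (simp add: zclass_def)

lemma UN_cl: assumes "zz X Y p" "\<And>q. ze X Y p q ==> F q = F p" shows "(\<Union>q\<in>cl X Y p. F q) = F p"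
proof (rule UN_const)
 show "p \<in> cl X Y p" using zigzag_eq.refl[OF assms(1)] by (simp add: mem_cl)
 show "F q = F p" if "q \<in> cl X Y p" for q by (rule assms(2)) (use that in \<open>simp only: mem_cl\<close>)
qed

lemma cmps_cl:
 assumes "zz X Y p" "zz Y Z q"
 shows "cmps L X Y Z (cl Y Z q) (cl X Y p) = cl X Z (p @ q)"
proof -
 have "(\<Union>p'\<in>cl X Y p. \<Union>q'\<in>cl Y Z q. cl X Z (p' @ q')) = cl X Z (p @ q)"
 proof (rule UN2_const)
  show "p \<in> cl X Y p" "q \<in> cl Y Z q" using assms by (auto simp: mem_cl intro: zigzag_eq.refl)
  fix p' q' assume "p' \<in> cl X Y p" "q' \<in> cl Y Z q"
  then show "cl X Z (p' @ q') = cl X Z (p @ q)"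
   unfolding mem_cl using zigzag_eq.append zigzag_eq.sym cl_eqI by metis
 qed
 then show ?thesis by (simp add: loc_base_def)
qed

lemma ze_cancel_left:
 assumes "U \<in> objs C" "X \<in> objs C" "s \<in> W U X" "ze U Y (Fwd U X s # p) (Fwd U X s # q)" shows "ze X Y p q"
proof -
 have z: "zz X Y p" "zz X Y q" using ze_zz[OF assms(4)] by auto
 have e: "ze X Y (Bwd U X s # Fwd U X s # r) r" if "zz X Y r" for r
  by (rule ze_ctx[OF zigzag_eq.inv_left[of U C X s W], where a = "[]" and b = r]) (use assms that in auto)
 have "ze X Y (Bwd U X s # Fwd U X s # p) (Bwd U X s # Fwd U X s # q)"
  by (rule ze_ctx[OF assms(4), where a = "[Bwd U X s]" and b = "[]"]) (use assms z zigzag_objs[OF z(1)] in auto)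
 then show ?thesis using e[OF z(1)] e[OF z(2)] by (meson zigzag_eq.trans zigzag_eq.sym)
qed

lemma ze_cancel_right:
 assumes "X \<in> objs C" "Y \<in> objs C" "s \<in> W X Y" "zz U X p" "zz U X q" "ze U Y (p @ [Fwd X Y s]) (q @ [Fwd X Y s])" shows "ze U X p q"
proof -
 have e: "ze U X (r @ [Fwd X Y s, Bwd X Y s]) r" if "zz U X r" for r
  by (rule ze_ctx[OF zigzag_eq.inv_right[of X C Y s W], where a = r and b = "[]"]) (use assms that in auto)
 have "ze U X (p @ [Fwd X Y s, Bwd X Y s]) (q @ [Fwd X Y s, Bwd X Y s])"
  by (rule ze_ctx[OF assms(6), where a = "[]" and b = "[Bwd X Y s]"]) (use assms zigzag_objs[OF assms(4)] in auto)
 then show ?thesis using e[OF assms(4)] e[OF assms(5)] by (meson zigzag_eq.trans zigzag_eq.sym)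
qed

lemma loc_simps:
 "objs L = objs C" "mors L X Y = {cl X Y p | p. zz X Y p}" "ids L X = cl X X []" "shobj L = shobj C"
 "shmor L X Y P = zfun C W (shobj C) (shmor C) X Y P"
 by (simp_all add: loc_base_def zfun_def zstep_def[abs_def])

lemma cat_iso_cl:
 assumes "zz X Y p" "zz Y X q" "ze X X (p @ q) []" "ze Y Y (q @ p) []"
 shows "cat_iso L X Y (cl X Y p)"
 unfolding cat_iso_def loc_simps
 using assms by (auto simp: cmps_cl cl_eqI intro!: bexI[of _ "cl Y X q"])

lemma cat_isoE:
 assumes "cat_iso L X Y f"
 obtains p q where "f = cl X Y p" "zz X Y p" "zz Y X q" "ze X X (p @ q) []" "ze Y Y (q @ p) []"
proof -
 obtain p q where pq: "f = cl X Y p" "zz X Y p" "zz Y X q" "cmps L X Y X (cl Y X q) f = cl X X []" "cmps L Y X Y f (cl Y X q) = cl Y Y []"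
  using assms unfolding cat_iso_def loc_simps by auto
 then have "ze X X (p @ q) []" "ze Y Y (q @ p) []"
  using cl_eq_iff[of X X "p @ q" "[]"] cl_eq_iff[of Y Y "q @ p" "[]"] by (auto simp: cmps_cl zigzag_append)
 then show ?thesis using that pq by blast
qed

lemma W_iso: "[|X \<in> objs C; Y \<in> objs C; s \<in> W X Y|] ==> cat_iso L X Y (cl X Y [Fwd X Y s])"
 by (rule cat_iso_cl[of _ _ _ "[Bwd X Y s]"]) (auto simp: W_mor zigzag_eq.intros)

lemma C_iso: assumes "X \<in> objs C" "Y \<in> objs C" "cat_iso C X Y f" shows "cat_iso L X Y (cl X Y [Fwd X Y f])"
proof -
 obtain g where g: "f \<in> mors C X Y" "g \<in> mors C Y X" "cmps C X Y X g f = ids C X" "cmps C Y X Y f g = ids C Y"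
  using assms(3) by (auto simp: cat_iso_def)
 have "ze X X [Fwd X Y f, Fwd Y X g] []" "ze Y Y [Fwd Y X g, Fwd X Y f] []"
  using zigzag_eq.comp[of X C Y X f g W] zigzag_eq.comp[of Y C X Y g f W] zigzag_eq.ident[of X C W] zigzag_eq.ident[of Y C W] g assms
  by (auto intro: zigzag_eq.trans)
 then show ?thesis using assms g by (intro cat_iso_cl[of _ _ _ "[Fwd Y X g]"]) auto
qed

end

locale loc_functor = S: loc C W + T: loc C' W'
 for C :: "('o, 'f) tri_cat" and W and C' :: "('p, 'g) tri_cat" and W' +
 fixes F :: "'o => 'p" and \<Phi> :: "'o => 'o => 'f => 'g"
 assumes func: "is_functor C C' F \<Phi>"
  and W_pres: "[|X \<in> objs C; Y \<in> objs C; s \<in> W X Y|] ==> \<Phi> X Y s \<in> W' (F X) (F Y)"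
begin

lemma F_simps:
 "X \<in> objs C ==> F X \<in> objs C'" "X \<in> objs C ==> \<Phi> X X (ids C X) = ids C' (F X)"
 "[|X \<in> objs C; Y \<in> objs C; f \<in> mors C X Y|] ==> \<Phi> X Y f \<in> mors C' (F X) (F Y)"
 "[|X \<in> objs C; Y \<in> objs C; Z \<in> objs C; f \<in> mors C X Y; g \<in> mors C Y Z|] ==>
   \<Phi> X Z (cmps C X Y Z g f) = cmps C' (F X) (F Y) (F Z) (\<Phi> Y Z g) (\<Phi> X Y f)"
 using func by (auto simp: is_functor_def)

lemma zmap_zz: "S.zz X Y p ==> T.zz (F X) (F Y) (zmap F \<Phi> p)"
 by (induction rule: zigzag.induct) (auto simp: F_simps W_pres dest: zigzag_objs)

lemma zmap_ze: "S.ze X Y p q ==> T.ze (F X) (F Y) (zmap F \<Phi> p) (zmap F \<Phi> q)"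
proof (induction rule: zigzag_eq.induct)
 case (refl X Y p) then show ?case by (intro zigzag_eq.refl zmap_zz)
next
 case (sym X Y p q) from sym.IH show ?case by (rule zigzag_eq.sym)
next
 case (trans X Y p q r) then show ?case by (blast intro: zigzag_eq.trans)
next
 case (append X Y p p' Z q q') then show ?case by (auto intro: zigzag_eq.append)
next
 case (ident X) then show ?case using zigzag_eq.ident[of "F X" C' W'] by (simp add: F_simps)
next
 case (comp X Y Z f g) then show ?case
  using zigzag_eq.comp[of "F X" C' "F Y" "F Z" "\<Phi> X Y f" "\<Phi> Y Z g" W'] by (simp add: F_simps)
next
 case (inv_right X Y s) then show ?case by (auto simp: F_simps W_pres intro: zigzag_eq.inv_right)
next
 case (inv_left X Y s) then show ?case by (auto simp: F_simps W_pres intro: zigzag_eq.inv_left)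
qed

lemma zfun_cl: "S.zz X Y p ==> zfun C' W' F \<Phi> X Y (S.cl X Y p) = T.cl (F X) (F Y) (zmap F \<Phi> p)"
 unfolding zfun_def by (rule S.UN_cl) (auto dest!: zmap_ze T.cl_eqI)

lemma zfun_functor: "is_functor S.L T.L F (zfun C' W' F \<Phi>)"
 unfolding is_functor_def
proof (intro conjI ballI funcsetI)
 fix X assume "X \<in> objs S.L"
 then have X: "X \<in> objs C" by (simp add: S.loc_simps)
 then show "F X \<in> objs T.L" by (simp add: T.loc_simps F_simps)
 show "zfun C' W' F \<Phi> X X (ids S.L X) = ids T.L (F X)"
  using X zfun_cl[of X X "[]"] by (simp add: T.loc_simps S.loc_simps)
next
 fix X Y f assume "f \<in> mors S.L X Y"
 then show "zfun C' W' F \<Phi> X Y f \<in> mors T.L (F X) (F Y)"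
  using zmap_zz by (auto simp: S.loc_simps T.loc_simps zfun_cl)
next
 fix X Y Z f g assume "f \<in> mors S.L X Y" "g \<in> mors S.L Y Z"
 then obtain p q where "f = S.cl X Y p" "S.zz X Y p" "g = S.cl Y Z q" "S.zz Y Z q" by (auto simp: S.loc_simps)
 then show "zfun C' W' F \<Phi> X Z (cmps S.L X Y Z g f) = cmps T.L (F X) (F Y) (F Z) (zfun C' W' F \<Phi> Y Z g) (zfun C' W' F \<Phi> X Y f)"
  by (simp add: S.cmps_cl T.cmps_cl zfun_cl zigzag_append zmap_zz)
qed

lemma zfun_iso: assumes "cat_iso S.L X Y f" shows "cat_iso T.L (F X) (F Y) (zfun C' W' F \<Phi> X Y f)"
 using assms
proof (rule S.cat_isoE)
 fix p q assume *: "f = S.cl X Y p" "S.zz X Y p" "S.zz Y X q" "S.ze X X (p @ q) []" "S.ze Y Y (q @ p) []"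
 show ?thesis
  using zmap_ze[OF *(4)] zmap_ze[OF *(5)] * by (simp add: zfun_cl) (rule T.cat_iso_cl, auto simp: zmap_zz)
qed

end

text \<open>Naturality extends from arrows to zigzags by induction.  At a backward arrow \<open>s\<close> the naturality
 square of \<open>s\<close> is used after inserting \<open>s\<close> followed by its inverse.\<close>

lemma zmap_natural:
 assumes "loc_functor C W C' W' F1 \<Phi>1" "loc_functor C W C' W' F2 \<Phi>2"
  and t: "\<And>X. X \<in> objs C ==> t X \<in> mors C' (F1 X) (F2 X)"
  and nat: "\<And>X Y f. [|X \<in> objs C; Y \<in> objs C; f \<in> mors C X Y|] ==>
   cmps C' (F1 X) (F1 Y) (F2 Y) (t Y) (\<Phi>1 X Y f) = cmps C' (F1 X) (F2 X) (F2 Y) (\<Phi>2 X Y f) (t X)"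
  and p: "zigzag C W X Y p"
 shows "zigzag_eq C' W' (F1 X) (F2 Y) (zmap F1 \<Phi>1 p @ [Fwd (F1 Y) (F2 Y) (t Y)]) (Fwd (F1 X) (F2 X) (t X) # zmap F2 \<Phi>2 p)"
proof -
 interpret F1: loc_functor C W C' W' F1 \<Phi>1 by fact
 interpret F2: loc_functor C W C' W' F2 \<Phi>2 by fact
 define \<theta> where "\<theta> X = [Fwd (F1 X) (F2 X) (t X)]" for X
 have \<theta>: "F1.T.zz (F1 X) (F2 X) (\<theta> X)" if "X \<in> objs C" for X using that t by (simp add: \<theta>_def F1.F_simps F2.F_simps)
 have nat: "F1.T.ze (F1 X) (F2 Y) (Fwd (F1 X) (F1 Y) (\<Phi>1 X Y f) # \<theta> Y) (\<theta> X @ [Fwd (F2 X) (F2 Y) (\<Phi>2 X Y f)])"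
  if "X \<in> objs C" "Y \<in> objs C" "f \<in> mors C X Y" for X Y f
 proof -
  note m = that t F1.F_simps(1,3) F2.F_simps(1,3)
  have "F1.T.ze (F1 X) (F2 Y) (Fwd (F1 X) (F1 Y) (\<Phi>1 X Y f) # \<theta> Y) [Fwd (F1 X) (F2 Y) (cmps C' (F1 X) (F2 X) (F2 Y) (\<Phi>2 X Y f) (t X))]"
   unfolding nat[OF that, symmetric] \<theta>_def by (rule zigzag_eq.comp) (simp_all add: m)
  moreover have "F1.T.ze (F1 X) (F2 Y) (\<theta> X @ [Fwd (F2 X) (F2 Y) (\<Phi>2 X Y f)]) [Fwd (F1 X) (F2 Y) (cmps C' (F1 X) (F2 X) (F2 Y) (\<Phi>2 X Y f) (t X))]"
   unfolding \<theta>_def append_Cons append_Nil by (rule zigzag_eq.comp) (simp_all add: m)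
  ultimately show ?thesis by (meson zigzag_eq.sym zigzag_eq.trans)
 qed
 have "F1.T.ze (F1 X) (F2 Y) (zmap F1 \<Phi>1 p @ \<theta> Y) (\<theta> X @ zmap F2 \<Phi>2 p)" using p
 proof (induction rule: zigzag.induct)
  case (nil X) then show ?case by (simp add: \<theta> zigzag_eq.refl)
 next
  case (fwd X f Y Z p)
  have o: "X \<in> objs C" "Y \<in> objs C" "Z \<in> objs C" using fwd zigzag_objs[of C W Y Z p] by auto
  have z: "F1.T.zz (F2 Y) (F2 Z) (zmap F2 \<Phi>2 p)" by (rule F2.zmap_zz) fact
  have "F1.T.ze (F1 X) (F2 Z) (Fwd (F1 X) (F1 Y) (\<Phi>1 X Y f) # zmap F1 \<Phi>1 p @ \<theta> Z)
    (Fwd (F1 X) (F1 Y) (\<Phi>1 X Y f) # \<theta> Y @ zmap F2 \<Phi>2 p)"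
   by (rule F1.T.ze_ctx[OF fwd.IH, where a = "[Fwd (F1 X) (F1 Y) (\<Phi>1 X Y f)]" and b = "[]"])
     (use o fwd in \<open>auto simp: F1.F_simps F2.F_simps\<close>)
  also have "F1.T.ze (F1 X) (F2 Z) \<dots> (\<theta> X @ Fwd (F2 X) (F2 Y) (\<Phi>2 X Y f) # zmap F2 \<Phi>2 p)"
   by (rule F1.T.ze_ctx[OF nat[OF o(1,2) fwd(2)], where a = "[]" and b = "zmap F2 \<Phi>2 p"])
     (use o z in \<open>auto simp: F1.F_simps\<close>)
  finally show ?case by simp
 next
  case (bwd Y s X Z p)
  have o: "X \<in> objs C" "Y \<in> objs C" "Z \<in> objs C" using bwd zigzag_objs[of C W X Z p] by auto
  have s: "s \<in> mors C X Y" using bwd(2) o F1.S.W_mor by blast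
  have z: "F1.T.zz (F2 X) (F2 Z) (zmap F2 \<Phi>2 p)" by (rule F2.zmap_zz) fact
  note zs = o s z \<theta> F1.F_simps F2.F_simps F1.W_pres[OF o(1,2) bwd(2)] F2.W_pres[OF o(1,2) bwd(2)]
  let ?f1 = "Fwd (F1 X) (F1 Y) (\<Phi>1 X Y s)" and ?f2 = "Fwd (F2 X) (F2 Y) (\<Phi>2 X Y s)"
   and ?b1 = "Bwd (F1 X) (F1 Y) (\<Phi>1 X Y s)" and ?b2 = "Bwd (F2 X) (F2 Y) (\<Phi>2 X Y s)"
  have "F1.T.ze (F1 Y) (F2 Z) (?b1 # zmap F1 \<Phi>1 p @ \<theta> Z) (?b1 # \<theta> X @ zmap F2 \<Phi>2 p)"
   by (rule F1.T.ze_ctx[OF bwd.IH, where a = "[?b1]" and b = "[]"]) (auto simp: zs intro!: zigzag_append[OF \<theta>])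
  also have "F1.T.ze (F1 Y) (F2 Z) \<dots> (?b1 # \<theta> X @ ?f2 # ?b2 # zmap F2 \<Phi>2 p)"
   by (rule F1.T.ze_ctx[OF zigzag_eq.sym[OF zigzag_eq.inv_right[of "F2 X" C' "F2 Y" "\<Phi>2 X Y s" W']],
      where a = "?b1 # \<theta> X" and b = "zmap F2 \<Phi>2 p"]) (auto simp: zs intro!: zigzag_append[OF \<theta>])
  also have "F1.T.ze (F1 Y) (F2 Z) \<dots> (?b1 # ?f1 # \<theta> Y @ ?b2 # zmap F2 \<Phi>2 p)"
   by (rule F1.T.ze_ctx[OF zigzag_eq.sym[OF nat[OF o(1,2) s]], where a = "[?b1]" and b = "?b2 # zmap F2 \<Phi>2 p"]) (auto simp: zs intro!: zigzag_append[OF \<theta>])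
  also have "F1.T.ze (F1 Y) (F2 Z) \<dots> (\<theta> Y @ ?b2 # zmap F2 \<Phi>2 p)"
   by (rule F1.T.ze_ctx[OF zigzag_eq.inv_left[of "F1 X" C' "F1 Y" "\<Phi>1 X Y s" W'],
      where a = "[]" and b = "\<theta> Y @ ?b2 # zmap F2 \<Phi>2 p"]) (auto simp: zs intro!: zigzag_append[OF \<theta>])
  finally show ?case by simp
 qed
 then show ?thesis by (simp add: \<theta>_def)
qed

lemma loc_functor_comp:
 assumes "loc_functor C W C' W' F1 \<Phi>1" "loc_functor C' W' C'' W'' F2 \<Phi>2"
 shows "loc_functor C W C'' W'' (F2 \<circ> F1) (\<lambda>X Y f. \<Phi>2 (F1 X) (F1 Y) (\<Phi>1 X Y f))"
proof -
 interpret F1: loc_functor C W C' W' F1 \<Phi>1 by fact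
 interpret F2: loc_functor C' W' C'' W'' F2 \<Phi>2 by fact
 show ?thesis
  by unfold_locales (auto simp: is_functor_def F1.F_simps F2.F_simps F1.W_pres F2.W_pres)
qed

lemma zmap_comp: "zmap (F2 \<circ> F1) (\<lambda>X Y f. \<Phi>2 (F1 X) (F1 Y) (\<Phi>1 X Y f)) p = zmap F2 \<Phi>2 (zmap F1 \<Phi>1 p)"
 by (induction p) (auto simp: zstep_def split: step.splits)

lemma loc_functor_id: assumes "loc C W" shows "loc_functor C W C W id (\<lambda>X Y f. f)"
proof -
 interpret loc C W by fact
 show ?thesis by unfold_locales (auto simp: is_functor_def)
qed

lemma zmap_id: "zmap id (\<lambda>X Y f. f) p = p"
proof -
 have "zstep id (\<lambda>X Y f. f) t = t" for t :: "('a, 'b) step" by (cases t) auto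
 then show ?thesis by (simp add: map_idI)
qed

text \<open>One half of an equivalence: a natural transformation \<open>G F \<rightarrow> id\<close> through inverted arrows.\<close>

locale loc_counit = F: loc_functor C W C' W' F \<Phi> + G: loc_functor C' W' C W G \<Psi>
 for C :: "('o, 'f) tri_cat" and W and C' :: "('p, 'g) tri_cat" and W' and F \<Phi> G \<Psi> +
 fixes \<epsilon> :: "'o => 'f"
 assumes \<epsilon>: "X \<in> objs C ==> \<epsilon> X \<in> W (G (F X)) X"
  and \<epsilon>_nat: "[|X \<in> objs C; Y \<in> objs C; f \<in> mors C X Y|] ==>
   cmps C (G (F X)) (G (F Y)) Y (\<epsilon> Y) (\<Psi> (F X) (F Y) (\<Phi> X Y f)) = cmps C (G (F X)) X Y f (\<epsilon> X)"
begin

lemma \<epsilon>_mor: "X \<in> objs C ==> \<epsilon> X \<in> mors C (G (F X)) X"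
 using F.S.W_mor[OF _ _ \<epsilon>] by (simp add: F.F_simps(1) G.F_simps(1))

lemma counit_natural:
 assumes "F.S.zz X Y p"
 shows "F.S.ze (G (F X)) Y (zmap G \<Psi> (zmap F \<Phi> p) @ [Fwd (G (F Y)) Y (\<epsilon> Y)]) (Fwd (G (F X)) X (\<epsilon> X) # p)"
 using zmap_natural[OF loc_functor_comp[OF F.loc_functor_axioms G.loc_functor_axioms] loc_functor_id[OF F.S.loc_axioms] _ _ assms, of \<epsilon>]
 by (simp add: zmap_comp zmap_id \<epsilon>_mor \<epsilon>_nat)

text \<open>By naturality \<open>p\<close> equals the conjugate of \<open>G F p\<close> by the invertible counits.\<close>

lemma faithful:
 assumes "F.S.zz X Y p" "F.S.zz X Y q" "F.T.ze (F X) (F Y) (zmap F \<Phi> p) (zmap F \<Phi> q)"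
 shows "F.S.ze X Y p q"
proof -
 have o: "X \<in> objs C" "Y \<in> objs C" using assms(1) by (auto dest: zigzag_objs)
 have z: "F.S.zz (G (F Y)) Y [Fwd (G (F Y)) Y (\<epsilon> Y)]" using o \<epsilon>_mor by (auto simp: F.F_simps(1) G.F_simps(1))
 have "F.S.ze (G (F X)) Y (zmap G \<Psi> (zmap F \<Phi> p) @ [Fwd (G (F Y)) Y (\<epsilon> Y)]) (zmap G \<Psi> (zmap F \<Phi> q) @ [Fwd (G (F Y)) Y (\<epsilon> Y)])"
  by (rule zigzag_eq.append[OF G.zmap_ze[OF assms(3)] zigzag_eq.refl[OF z]])
 then have "F.S.ze (G (F X)) Y (Fwd (G (F X)) X (\<epsilon> X) # p) (Fwd (G (F X)) X (\<epsilon> X) # q)"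
  using counit_natural[OF assms(1)] counit_natural[OF assms(2)] by (meson zigzag_eq.sym zigzag_eq.trans)
 then show ?thesis using o \<epsilon>[OF o(1)] F.S.ze_cancel_left F.F_simps(1) G.F_simps(1) by metis
qed

end

text \<open>Both functors are faithful.  For fullness of \<open>F\<close> conjugate \<open>G q\<close> with the counits to obtain \<open>p\<close>; then
 \<open>G F p = G q\<close>, and \<open>F p = q\<close> because \<open>G\<close> is faithful.  The second counit shows that \<open>F\<close> is essentially
 surjective.\<close>

lemma loc_equivalence:
 assumes "loc_counit C W C' W' F \<Phi> G \<Psi> \<epsilon>" "loc_counit C' W' C W G \<Psi> F \<Phi> \<delta>"
 shows "is_equivalence (loc_base C W) (loc_base C' W') F (zfun C' W' F \<Phi>)"
proof -
 interpret loc_counit C W C' W' F \<Phi> G \<Psi> \<epsilon> by fact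
 interpret H: loc_counit C' W' C W G \<Psi> F \<Phi> \<delta> by fact
 note ob = F.F_simps(1) G.F_simps(1) and \<delta> = H.\<epsilon>
 have full: "\<exists>p. F.S.zz X Y p & F.T.ze (F X) (F Y) (zmap F \<Phi> p) r" if o: "X \<in> objs C" "Y \<in> objs C" and r: "F.T.zz (F X) (F Y) r" for X Y r
 proof -
  let ?e = "\<lambda>X. Fwd (G (F X)) X (\<epsilon> X)"
  let ?p = "Bwd (G (F X)) X (\<epsilon> X) # zmap G \<Psi> r @ [?e Y]"
  have z: "F.S.zz (G (F X)) Y (zmap G \<Psi> r @ [?e Y])"
   using o ob \<epsilon>[OF o(2)] F.S.W_mor G.zmap_zz[OF r] by (intro zigzag_append) auto
  then have p: "F.S.zz X Y ?p" using o ob \<epsilon>[OF o(1)] by auto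
  have "F.S.ze (G (F X)) Y (?e X # ?p) (zmap G \<Psi> r @ [?e Y])"
   by (rule F.S.ze_ctx[OF zigzag_eq.inv_right[of "G (F X)" C X "\<epsilon> X" W], where a = "[]" and b = "zmap G \<Psi> r @ [?e Y]"])
     (use o ob \<epsilon> z in auto)
  then have "F.S.ze (G (F X)) Y (zmap G \<Psi> (zmap F \<Phi> ?p) @ [?e Y]) (zmap G \<Psi> r @ [?e Y])"
   using counit_natural[OF p] by (blast intro: zigzag_eq.trans)
  then have "F.S.ze (G (F X)) (G (F Y)) (zmap G \<Psi> (zmap F \<Phi> ?p)) (zmap G \<Psi> r)"
   using o ob \<epsilon>[OF o(2)] F.S.ze_cancel_right F.zmap_zz[OF p] G.zmap_zz r by metis
  then have "F.T.ze (F X) (F Y) (zmap F \<Phi> ?p) r" using H.faithful F.zmap_zz[OF p] r by blast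
  then show ?thesis using p by blast
 qed
 show ?thesis
  unfolding is_equivalence_def
 proof (intro conjI ballI)
  show "is_functor F.S.L F.T.L F (zfun C' W' F \<Phi>)" by (rule F.zfun_functor)
 next
  fix X Y assume "X \<in> objs F.S.L" "Y \<in> objs F.S.L"
  then have o: "X \<in> objs C" "Y \<in> objs C" by (simp_all add: F.S.loc_simps)
  show "bij_betw (zfun C' W' F \<Phi> X Y) (mors F.S.L X Y) (mors F.T.L (F X) (F Y))"
  proof (rule bij_betwI')
   fix f g assume "f \<in> mors F.S.L X Y" "g \<in> mors F.S.L X Y"
   then obtain p q where "f = F.S.cl X Y p" "F.S.zz X Y p" "g = F.S.cl X Y q" "F.S.zz X Y q" by (auto simp: F.S.loc_simps)
   then show "zfun C' W' F \<Phi> X Y f = zfun C' W' F \<Phi> X Y g \<longleftrightarrow> f = g"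
    using faithful[of X Y p q] F.zmap_ze[of X Y p q] by (simp add: F.zfun_cl F.S.cl_eq_iff F.T.cl_eq_iff F.zmap_zz) blast
  next
   fix f assume "f \<in> mors F.S.L X Y"
   then show "zfun C' W' F \<Phi> X Y f \<in> mors F.T.L (F X) (F Y)"
    using F.zmap_zz by (auto simp: F.S.loc_simps F.T.loc_simps F.zfun_cl)
  next
   fix g assume "g \<in> mors F.T.L (F X) (F Y)"
   then obtain r where r: "g = F.T.cl (F X) (F Y) r" "F.T.zz (F X) (F Y) r" by (auto simp: F.T.loc_simps)
   obtain p where p: "F.S.zz X Y p" "F.T.ze (F X) (F Y) (zmap F \<Phi> p) r" using full[OF o r(2)] by blast
   then show "\<exists>f\<in>mors F.S.L X Y. g = zfun C' W' F \<Phi> X Y f"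
    using r p(1) F.T.cl_eqI[OF p(2)]
    by (intro bexI[of _ "F.S.cl X Y p"]) (simp add: F.zfun_cl, auto simp: F.S.loc_simps)
  qed
 next
  fix Z assume "Z \<in> objs F.T.L"
  then have Z: "Z \<in> objs C'" by (simp add: F.T.loc_simps)
  then show "\<exists>X\<in>objs F.S.L. \<exists>f. cat_iso F.T.L (F X) Z f"
   using F.T.W_iso[of "F (G Z)" Z "\<delta> Z"] \<delta>[OF Z] ob by (auto simp: F.S.loc_simps intro!: bexI[of _ "G Z"])
 qed
qed

subsection \<open>The sum of morphisms\<close>

text \<open>The last condition provides, without speaking of biproducts, what the addition of morphisms requires:
 \<open>R = X \<oplus> -\<close> and \<open>S = - \<oplus> Y\<close> with \<open>R Y = S X\<close>, the diagonal \<open>\<Delta>\<close> of \<open>X\<close>, the codiagonal \<open>\<mu>\<close> of \<open>Y\<close>, and the arrows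
 \<open>u = (s, 1)\<close> and \<open>v = (1, b)\<close>.\<close>

locale loc_add = loc +
 assumes ids_W: "X \<in> objs C ==> ids C X \<in> W X X"
  and cmps_W: "[|X \<in> objs C; Y \<in> objs C; Z \<in> objs C; s \<in> W X Y; t \<in> W Y Z|] ==> cmps C X Y Z t s \<in> W X Z"
  and adds_mor: "[|X \<in> objs C; Y \<in> objs C; f \<in> mors C X Y; g \<in> mors C X Y|] ==> adds C X Y f g \<in> mors C X Y"
  and Ore: "[|X \<in> objs C; V \<in> objs C; Z \<in> objs C; f \<in> mors C V X; s \<in> W Z X|] ==>
   \<exists>U\<in>objs C. \<exists>s'\<in>W U V. \<exists>f'\<in>mors C U Z. cmps C U Z X s f' = cmps C U V X f s'"
  and sums: "[|X \<in> objs C; Y \<in> objs C|] ==> \<exists>R \<rho> S \<sigma>. loc_functor C W C W R \<rho> & loc_functor C W C W S \<sigma> & R Y = S X &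
   (\<exists>\<Delta>\<in>mors C X (R X). \<exists>\<mu>\<in>mors C (S Y) Y. \<forall>Z\<in>objs C. \<forall>s\<in>W Z X. \<forall>a\<in>mors C Z Y. \<forall>b\<in>mors C Z Y.
    \<exists>u\<in>mors C Z (R Z). \<exists>v\<in>mors C Z (S Z).
     cmps C Z (R Z) (R X) (\<rho> Z X s) u = cmps C Z X (R X) \<Delta> s &
     cmps C Z (R Z) (R Y) (\<rho> Z Y b) u = cmps C Z (S Z) (S X) (\<sigma> Z X s) v &
     cmps C Z (S Y) Y \<mu> (cmps C Z (S Z) (S Y) (\<sigma> Z Y a) v) = adds C Z Y a b)"
begin

lemma ze_comp: "[|X \<in> objs C; Y \<in> objs C; Z \<in> objs C; f \<in> mors C X Y; g \<in> mors C Y Z; h = cmps C X Y Z g f|] ==>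
  ze X Z [Fwd X Y f, Fwd Y Z g] [Fwd X Z h]"
 using zigzag_eq.comp by metis

lemma roof_expand:
 assumes "X \<in> objs C" "Y \<in> objs C" "Z \<in> objs C" "U \<in> objs C" "s \<in> W Z X" "a \<in> mors C Z Y" "f \<in> mors C U Z"
  and r: "r \<in> W U X" "cmps C U Z X s f = r"
 shows "ze X Y [Bwd Z X s, Fwd Z Y a] [Bwd U X r, Fwd U Y (cmps C U Z Y a f)]"
proof -
 note m = assms W_mor cmps_mor
 have "ze X Y [Bwd Z X s, Fwd Z Y a] [Bwd U X r, Fwd U X r, Bwd Z X s, Fwd Z Y a]"
  by (rule ze_ctx[OF zigzag_eq.sym[OF zigzag_eq.inv_left[of U C X r W]], where a = "[]" and b = "[Bwd Z X s, Fwd Z Y a]"]) (use m in auto)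
 also have "ze X Y \<dots> [Bwd U X r, Fwd U Z f, Fwd Z X s, Bwd Z X s, Fwd Z Y a]"
  by (rule ze_ctx[OF zigzag_eq.sym[OF ze_comp[of U Z X f s r]], where a = "[Bwd U X r]" and b = "[Bwd Z X s, Fwd Z Y a]"]) (use m in auto)
 also have "ze X Y \<dots> [Bwd U X r, Fwd U Z f, Fwd Z Y a]"
  by (rule ze_ctx[OF zigzag_eq.inv_right[of Z C X s W], where a = "[Bwd U X r, Fwd U Z f]" and b = "[Fwd Z Y a]"]) (use m in auto)
 also have "ze X Y \<dots> [Bwd U X r, Fwd U Y (cmps C U Z Y a f)]"
  by (rule ze_ctx[OF ze_comp[of U Z Y f a], where a = "[Bwd U X r]" and b = "[]"]) (use m in auto)
 finally show ?thesis .
qed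

text \<open>A leading backward arrow is composed with the denominator; a leading forward arrow is moved past it
 by the Ore condition.\<close>

lemma zigzag_roof: "zz X Y p ==> \<exists>Z s a. Z \<in> objs C & s \<in> W Z X & a \<in> mors C Z Y & ze X Y p [Bwd Z X s, Fwd Z Y a]"
proof (induction rule: zigzag.induct)
 case (nil X)
 then show ?case using zigzag_eq.inv_left[of X C X "ids C X" W] ids_W ids_mor zigzag_eq.sym by metis
next
 case (fwd X f V Y p)
 then obtain Z s a where Z: "Z \<in> objs C" "s \<in> W Z V" "a \<in> mors C Z Y" "ze V Y p [Bwd Z V s, Fwd Z Y a]" by blast
 have o: "V \<in> objs C" "Y \<in> objs C" using fwd by (auto dest: zigzag_objs)
 obtain U s' f' where U: "U \<in> objs C" "s' \<in> W U X" "f' \<in> mors C U Z" "cmps C U Z V s f' = cmps C U X V f s'"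
  using Ore[OF o(1) fwd(1) Z(1) fwd(2) Z(2)] by blast
 note m = o fwd(1,2) Z(1-3) U(1-3) W_mor cmps_mor
 have "ze X Y (Fwd X V f # p) [Fwd X V f, Bwd Z V s, Fwd Z Y a]"
  by (rule ze_ctx[OF Z(4), where a = "[Fwd X V f]" and b = "[]"]) (use m in auto)
 also have "ze X Y \<dots> [Bwd U X s', Fwd U X s', Fwd X V f, Bwd Z V s, Fwd Z Y a]"
  by (rule ze_ctx[OF zigzag_eq.sym[OF zigzag_eq.inv_left[of U C X s' W]], where a = "[]" and b = "[Fwd X V f, Bwd Z V s, Fwd Z Y a]"]) (use m in auto)
 also have "ze X Y \<dots> [Bwd U X s', Fwd U V (cmps C U X V f s'), Bwd Z V s, Fwd Z Y a]"
  by (rule ze_ctx[OF ze_comp[of U X V s' f], where a = "[Bwd U X s']" and b = "[Bwd Z V s, Fwd Z Y a]"]) (use m in auto)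
 also have "ze X Y \<dots> [Bwd U X s', Fwd U Z f', Fwd Z V s, Bwd Z V s, Fwd Z Y a]"
  by (rule ze_ctx[OF zigzag_eq.sym[OF ze_comp[of U Z V f' s]], where a = "[Bwd U X s']" and b = "[Bwd Z V s, Fwd Z Y a]"]) (use m U(4) in auto)
 also have "ze X Y \<dots> [Bwd U X s', Fwd U Z f', Fwd Z Y a]"
  by (rule ze_ctx[OF zigzag_eq.inv_right[of Z C V s W], where a = "[Bwd U X s', Fwd U Z f']" and b = "[Fwd Z Y a]"]) (use m in auto)
 also have "ze X Y \<dots> [Bwd U X s', Fwd U Y (cmps C U Z Y a f')]"
  by (rule ze_ctx[OF ze_comp[of U Z Y f' a], where a = "[Bwd U X s']" and b = "[]"]) (use m in auto)
 finally show ?case using m by blast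
next
 case (bwd X t V Y p)
 then obtain Z s a where Z: "Z \<in> objs C" "s \<in> W Z V" "a \<in> mors C Z Y" "ze V Y p [Bwd Z V s, Fwd Z Y a]" by blast
 have o: "V \<in> objs C" "Y \<in> objs C" using bwd by (auto dest: zigzag_objs)
 let ?r = "cmps C Z V X t s"
 have r: "?r \<in> W Z X" using cmps_W o bwd Z by blast
 note m = o bwd(1,2) Z(1-3) r W_mor cmps_mor
 have "ze X Y (Bwd V X t # p) [Bwd V X t, Bwd Z V s, Fwd Z Y a]"
  by (rule ze_ctx[OF Z(4), where a = "[Bwd V X t]" and b = "[]"]) (use m in auto)
 also have "ze X Y \<dots> [Bwd Z X ?r, Fwd Z X ?r, Bwd V X t, Bwd Z V s, Fwd Z Y a]"
  by (rule ze_ctx[OF zigzag_eq.sym[OF zigzag_eq.inv_left[of Z C X ?r W]], where a = "[]" and b = "[Bwd V X t, Bwd Z V s, Fwd Z Y a]"]) (use m in auto)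
 also have "ze X Y \<dots> [Bwd Z X ?r, Fwd Z V s, Fwd V X t, Bwd V X t, Bwd Z V s, Fwd Z Y a]"
  by (rule ze_ctx[OF zigzag_eq.sym[OF ze_comp[of Z V X s t]], where a = "[Bwd Z X ?r]" and b = "[Bwd V X t, Bwd Z V s, Fwd Z Y a]"]) (use m in auto)
 also have "ze X Y \<dots> [Bwd Z X ?r, Fwd Z V s, Bwd Z V s, Fwd Z Y a]"
  by (rule ze_ctx[OF zigzag_eq.inv_right[of V C X t W], where a = "[Bwd Z X ?r, Fwd Z V s]" and b = "[Bwd Z V s, Fwd Z Y a]"]) (use m in auto)
 also have "ze X Y \<dots> [Bwd Z X ?r, Fwd Z Y a]"
  by (rule ze_ctx[OF zigzag_eq.inv_right[of Z C V s W], where a = "[Bwd Z X ?r]" and b = "[Fwd Z Y a]"]) (use m in auto)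
 finally show ?case using m by blast
qed

text \<open>The Ore condition for the two denominators gives a common refinement.\<close>

lemma common_roof:
 assumes "zz X Y p" "zz X Y q"
 shows "\<exists>Z s a b. Z \<in> objs C & s \<in> W Z X & a \<in> mors C Z Y & b \<in> mors C Z Y &
  ze X Y p [Bwd Z X s, Fwd Z Y a] & ze X Y q [Bwd Z X s, Fwd Z Y b]"
proof -
 have o: "X \<in> objs C" "Y \<in> objs C" using assms by (auto dest: zigzag_objs)
 obtain Z s a where Z: "Z \<in> objs C" "s \<in> W Z X" "a \<in> mors C Z Y" "ze X Y p [Bwd Z X s, Fwd Z Y a]" using zigzag_roof[OF assms(1)] by blast
 obtain V t b where V: "V \<in> objs C" "t \<in> W V X" "b \<in> mors C V Y" "ze X Y q [Bwd V X t, Fwd V Y b]" using zigzag_roof[OF assms(2)] by blast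
 obtain U t' f' where U: "U \<in> objs C" "t' \<in> W U V" "f' \<in> mors C U Z" "cmps C U Z X s f' = cmps C U V X t t'"
  using Ore[OF o(1) V(1) Z(1) W_mor[OF V(1) o(1) V(2)] Z(2)] by blast
 let ?r = "cmps C U V X t t'"
 have r: "?r \<in> W U X" using cmps_W U V o by blast
 have t': "t' \<in> mors C U V" using W_mor U V by blast
 show ?thesis
  using roof_expand[OF o Z(1) U(1) Z(2,3) U(3) r U(4)] roof_expand[OF o V(1) U(1) V(2,3) t' r HOL.refl] Z(4) V(4)
   U r cmps_mor[OF U(1) Z(1) o(2) U(3) Z(3)] cmps_mor[OF U(1) V(1) o(2) t' V(3)] zigzag_eq.trans[of C W X Y] by meson
qed

text \<open>In the localization the sum of two morphisms is defined through all common denominators, so it has to be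
 shown that the result does not depend on the choice.  For zigzags \<open>p\<close>, \<open>q\<close> the zigzag
 \<open>A p q\<close>, which is \<open>\<Delta>\<close> followed by \<open>1 \<oplus> q\<close>, \<open>p \<oplus> 1\<close> and the codiagonal, depends only on the classes of \<open>p\<close> and
 \<open>q\<close>, because functors respect equality of zigzags; and on two roofs with a common denominator it
 yields the sum of the numerators.\<close>

lemma adds_roof:
 assumes o: "X \<in> objs C" "Y \<in> objs C" "Z \<in> objs C" and s: "s \<in> W Z X" and ab: "a \<in> mors C Z Y" "b \<in> mors C Z Y"
 shows "adds L X Y (cl X Y [Bwd Z X s, Fwd Z Y a]) (cl X Y [Bwd Z X s, Fwd Z Y b]) = cl X Y [Bwd Z X s, Fwd Z Y (adds C Z Y a b)]"
proof -
 obtain R \<rho> S \<sigma> \<Delta> \<mu> where R: "loc_functor C W C W R \<rho>" and S: "loc_functor C W C W S \<sigma>" and RS: "R Y = S X"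
  and D: "\<Delta> \<in> mors C X (R X)" and N: "\<mu> \<in> mors C (S Y) Y" and uv: "\<And>Z s a b. [|Z \<in> objs C; s \<in> W Z X; a \<in> mors C Z Y; b \<in> mors C Z Y|] ==>
    \<exists>u\<in>mors C Z (R Z). \<exists>v\<in>mors C Z (S Z).
     cmps C Z (R Z) (R X) (\<rho> Z X s) u = cmps C Z X (R X) \<Delta> s &
     cmps C Z (R Z) (R Y) (\<rho> Z Y b) u = cmps C Z (S Z) (S X) (\<sigma> Z X s) v &
     cmps C Z (S Y) Y \<mu> (cmps C Z (S Z) (S Y) (\<sigma> Z Y a) v) = adds C Z Y a b"
  using sums[OF o(1,2)] by metis
 interpret R: loc_functor C W C W R \<rho> by fact
 interpret S: loc_functor C W C W S \<sigma> by fact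
 (* the zigzag of (p + q) in terms of diagonal, codiagonal and the two functors *)
 define A where "A p q = Fwd X (R X) \<Delta> # zmap R \<rho> q @ zmap S \<sigma> p @ [Fwd (S Y) Y \<mu>]" for p q
 have A_cong: "ze X Y (A p q) (A p' q')" if "ze X Y p p'" "ze X Y q q'" for p q p' q'
 proof -
  have "ze (R X) (S Y) (zmap R \<rho> q @ zmap S \<sigma> p) (zmap R \<rho> q' @ zmap S \<sigma> p')"
   by (rule zigzag_eq.append[OF R.zmap_ze[OF that(2)] S.zmap_ze[OF that(1), folded RS]])
  then show ?thesis unfolding A_def
   by (rule ze_ctx[where a = "[Fwd X (R X) \<Delta>]" and b = "[Fwd (S Y) Y \<mu>]"])
     (simp_all add: o D N R.F_simps(1) S.F_simps(1))
 qed
 have A: "ze X Y (A [Bwd Z X s, Fwd Z Y a] [Bwd Z X s, Fwd Z Y b]) [Bwd Z X s, Fwd Z Y (adds C Z Y a b)]"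
  if Z: "Z \<in> objs C" and s: "s \<in> W Z X" and a: "a \<in> mors C Z Y" and b: "b \<in> mors C Z Y" for Z s a b
 proof -
  obtain u v where u: "u \<in> mors C Z (R Z)" and v: "v \<in> mors C Z (S Z)"
   and e: "cmps C Z (R Z) (R X) (\<rho> Z X s) u = cmps C Z X (R X) \<Delta> s"
    "cmps C Z (R Z) (R Y) (\<rho> Z Y b) u = cmps C Z (S Z) (S X) (\<sigma> Z X s) v"
    "cmps C Z (S Y) Y \<mu> (cmps C Z (S Z) (S Y) (\<sigma> Z Y a) v) = adds C Z Y a b"
   using uv[OF Z s a b] by blast
  note m = o Z s a b u v D N W_mor cmps_mor adds_mor R.F_simps(1,3) S.F_simps(1,3) R.W_pres[OF Z o(1) s] S.W_pres[OF Z o(1) s] RS[symmetric]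
  let ?f = "Fwd Z (R Z) u" and ?n = "Fwd (S Y) Y \<mu>"
  let ?l = "[Bwd (S Z) (S X) (\<sigma> Z X s), Fwd (S Z) (S Y) (\<sigma> Z Y a), ?n]"
  let ?k = "Bwd (R Z) (R X) (\<rho> Z X s) # Fwd (R Z) (R Y) (\<rho> Z Y b) # ?l"
  have "ze X Y (Fwd X (R X) \<Delta> # ?k) (Bwd Z X s # Fwd Z X s # Fwd X (R X) \<Delta> # ?k)"
   by (rule ze_ctx[OF zigzag_eq.sym[OF zigzag_eq.inv_left[of Z C X s W]], where a = "[]" and b = "Fwd X (R X) \<Delta> # ?k"]) (use m in auto)
  also have "ze X Y \<dots> (Bwd Z X s # Fwd Z (R X) (cmps C Z X (R X) \<Delta> s) # ?k)"
   by (rule ze_ctx[OF ze_comp[of Z X "R X" s \<Delta>], where a = "[Bwd Z X s]" and b = ?k]) (use m in auto)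
  also have "ze X Y \<dots> (Bwd Z X s # ?f # Fwd (R Z) (R X) (\<rho> Z X s) # ?k)"
   by (rule ze_ctx[OF zigzag_eq.sym[OF ze_comp[of Z "R Z" "R X" u "\<rho> Z X s"]], where a = "[Bwd Z X s]" and b = ?k]) (use m e in auto)
  also have "ze X Y \<dots> (Bwd Z X s # ?f # Fwd (R Z) (R Y) (\<rho> Z Y b) # ?l)"
   by (rule ze_ctx[OF zigzag_eq.inv_right[of "R Z" C "R X" "\<rho> Z X s" W], where a = "[Bwd Z X s, ?f]" and b = "Fwd (R Z) (R Y) (\<rho> Z Y b) # ?l"]) (use m in auto)
  also have "ze X Y \<dots> (Bwd Z X s # Fwd Z (R Y) (cmps C Z (R Z) (R Y) (\<rho> Z Y b) u) # ?l)"
   by (rule ze_ctx[OF ze_comp[of Z "R Z" "R Y" u "\<rho> Z Y b"], where a = "[Bwd Z X s]" and b = ?l]) (use m in auto)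
  also have "ze X Y \<dots> (Bwd Z X s # Fwd Z (S Z) v # Fwd (S Z) (S X) (\<sigma> Z X s) # ?l)"
   by (rule ze_ctx[OF zigzag_eq.sym[OF ze_comp[of Z "S Z" "S X" v "\<sigma> Z X s"]], where a = "[Bwd Z X s]" and b = ?l]) (use m e(2) in auto)
  also have "ze X Y \<dots> [Bwd Z X s, Fwd Z (S Z) v, Fwd (S Z) (S Y) (\<sigma> Z Y a), ?n]"
   by (rule ze_ctx[OF zigzag_eq.inv_right[of "S Z" C "S X" "\<sigma> Z X s" W], where a = "[Bwd Z X s, Fwd Z (S Z) v]" and b = "[Fwd (S Z) (S Y) (\<sigma> Z Y a), ?n]"]) (use m in auto)
  also have "ze X Y \<dots> [Bwd Z X s, Fwd Z (S Y) (cmps C Z (S Z) (S Y) (\<sigma> Z Y a) v), ?n]"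
   by (rule ze_ctx[OF ze_comp[of Z "S Z" "S Y" v "\<sigma> Z Y a"], where a = "[Bwd Z X s]" and b = "[?n]"]) (use m in auto)
  also have "ze X Y \<dots> [Bwd Z X s, Fwd Z Y (adds C Z Y a b)]"
   by (rule ze_ctx[OF ze_comp[of Z "S Y" Y _ \<mu>], where a = "[Bwd Z X s]" and b = "[]"]) (use m e(3) in auto)
  finally show ?thesis by (simp add: A_def RS)
 qed
 have z: "zz X Y [Bwd Z X s, Fwd Z Y a]" if "Z \<in> objs C" "s \<in> W Z X" "a \<in> mors C Z Y" for Z s a
  using that o by auto
 let ?S = "{cl X Y [Bwd Z' X s', Fwd Z' Y (adds C Z' Y a' b')] | Z' s' a' b'. Z' \<in> objs C & s' \<in> W Z' X & a' \<in> mors C Z' Y & b' \<in> mors C Z' Y &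
   cl X Y [Bwd Z X s, Fwd Z Y a] = cl X Y [Bwd Z' X s', Fwd Z' Y a'] & cl X Y [Bwd Z X s, Fwd Z Y b] = cl X Y [Bwd Z' X s', Fwd Z' Y b']}"
 have "?S = {cl X Y [Bwd Z X s, Fwd Z Y (adds C Z Y a b)]}"
 proof (intro equalityI subsetI)
  fix c assume "c \<in> ?S"
  then obtain Z' s' a' b' where c: "c = cl X Y [Bwd Z' X s', Fwd Z' Y (adds C Z' Y a' b')]" and m': "Z' \<in> objs C" "s' \<in> W Z' X" "a' \<in> mors C Z' Y" "b' \<in> mors C Z' Y"
   and e: "cl X Y [Bwd Z X s, Fwd Z Y a] = cl X Y [Bwd Z' X s', Fwd Z' Y a']" "cl X Y [Bwd Z X s, Fwd Z Y b] = cl X Y [Bwd Z' X s', Fwd Z' Y b']" by blast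
  have "ze X Y (A [Bwd Z X s, Fwd Z Y a] [Bwd Z X s, Fwd Z Y b]) (A [Bwd Z' X s', Fwd Z' Y a'] [Bwd Z' X s', Fwd Z' Y b'])"
   using e cl_eq_iff[OF z[OF o(3) s ab(1)]] cl_eq_iff[OF z[OF o(3) s ab(2)]] by (intro A_cong) auto
  then have "ze X Y [Bwd Z' X s', Fwd Z' Y (adds C Z' Y a' b')] [Bwd Z X s, Fwd Z Y (adds C Z Y a b)]"
   using A[OF o(3) s ab] A[OF m'] by (meson zigzag_eq.trans zigzag_eq.sym)
  then show "c \<in> {cl X Y [Bwd Z X s, Fwd Z Y (adds C Z Y a b)]}" using c cl_eqI by blast
 next
  fix c assume "c \<in> {cl X Y [Bwd Z X s, Fwd Z Y (adds C Z Y a b)]}"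
  then show "c \<in> ?S" using o s ab by blast
 qed
 then show ?thesis unfolding loc_base_def by simp
qed

end

subsection \<open>Triangle functors\<close>

lemma localization_sel:
 "objs (localization C W) = objs (loc_base C W)" "mors (localization C W) = mors (loc_base C W)"
 "ids (localization C W) = ids (loc_base C W)" "cmps (localization C W) = cmps (loc_base C W)"
 "adds (localization C W) = adds (loc_base C W)" "shobj (localization C W) = shobj (loc_base C W)"
 "shmor (localization C W) = shmor (loc_base C W)"
 by (simp_all add: localization_def Let_def)

lemma localization_cat_iso: "cat_iso (localization C W) = cat_iso (loc_base C W)"
 by (intro ext) (simp add: cat_iso_def localization_sel)

lemma localization_functor: "is_functor (localization C W) (localization C' W') = is_functor (loc_base C W) (loc_base C' W')"
 by (intro ext) (simp add: is_functor_def localization_sel)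

lemma localization_equivalence:
 "is_equivalence (localization C W) (localization C' W') = is_equivalence (loc_base C W) (loc_base C' W')"
 by (intro ext) (simp add: is_equivalence_def localization_functor localization_cat_iso localization_sel)

text \<open>A triangle of the localization is one isomorphic to the image of a triangle; the description by zigzag
 classes is what the next result transports.\<close>

lemma (in loc) localization_triangle_iff:
 "(X, Y, Z, f, g, h) \<in> triangles (localization C W) \<longleftrightarrow>
   X \<in> objs C & Y \<in> objs C & Z \<in> objs C & f \<in> mors L X Y & g \<in> mors L Y Z & h \<in> mors L Z (shobj C X) &
   (\<exists>X' Y' Z' f' g' h' \<alpha> \<beta> \<gamma>. (X', Y', Z', f', g', h') \<in> triangles C &
    cat_iso L X X' \<alpha> & cat_iso L Y Y' \<beta> & cat_iso L Z Z' \<gamma> &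
    cmps L X Y Y' \<beta> f = cmps L X X' Y' (cl X' Y' [Fwd X' Y' f']) \<alpha> &
    cmps L Y Z Z' \<gamma> g = cmps L Y Y' Z' (cl Y' Z' [Fwd Y' Z' g']) \<beta> &
    cmps L Z (shobj C X) (shobj C X') (shmor L X X' \<alpha>) h =
     cmps L Z Z' (shobj C X') (cl Z' (shobj C X') [Fwd Z' (shobj C X') h']) \<gamma>)"
 unfolding localization_def Let_def by (simp add: loc_simps)

text \<open>Isomorphisms of triangles are transported by functoriality; naturality of the shift comparison
 holds for arrows and so for zigzags; additivity holds because any two zigzags have a common
 denominator, where \<open>adds_roof\<close> reduces it to additivity before localization.\<close>

lemma loc_triangle_functor:
 assumes F: "loc_functor C W C' W' F \<Phi>" and A: "loc_add C W" and A': "loc_add C' W'"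
  and sh: "loc_functor C W C W (shobj C) (shmor C)" and sh': "loc_functor C' W' C' W' (shobj C') (shmor C')"
  and T: "is_triangle_functor C C' F \<Phi> \<eta>"
  and tri: "\<And>X Y Z f g h. (X, Y, Z, f, g, h) \<in> triangles C ==>
   X \<in> objs C & Y \<in> objs C & Z \<in> objs C & f \<in> mors C X Y & g \<in> mors C Y Z & h \<in> mors C Z (shobj C X)"
 shows "is_triangle_functor (localization C W) (localization C' W') F (zfun C' W' F \<Phi>)
  (\<lambda>X. zclass C' W' (F (shobj C X)) (shobj C' (F X)) [Fwd (F (shobj C X)) (shobj C' (F X)) (\<eta> X)])"
proof -
 interpret A: loc_add C W by fact
 interpret A': loc_add C' W' by fact
 interpret F: loc_functor C W C' W' F \<Phi> by fact
 interpret sh: loc_functor C W C W "shobj C" "shmor C" by fact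
 interpret sh': loc_functor C' W' C' W' "shobj C'" "shmor C'" by fact
 let ?\<eta> = "\<lambda>X. Fwd (F (shobj C X)) (shobj C' (F X)) (\<eta> X)"
 note ob = F.F_simps(1) sh.F_simps(1) sh'.F_simps(1)
 have \<eta>: "\<eta> X \<in> mors C' (F (shobj C X)) (shobj C' (F X))" "cat_iso C' (F (shobj C X)) (shobj C' (F X)) (\<eta> X)" if "X \<in> objs C" for X
  using T that by (auto simp: is_triangle_functor_def cat_iso_def)
 have \<eta>z: "A'.zz (F (shobj C X)) (shobj C' (F X)) [?\<eta> X]" if "X \<in> objs C" for X
  using \<eta>[OF that] that by (simp add: ob)
 have nat: "A'.ze (F (shobj C X)) (shobj C' (F Y)) (zmap F \<Phi> (zmap (shobj C) (shmor C) p) @ [?\<eta> Y])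
   ([?\<eta> X] @ zmap (shobj C') (shmor C') (zmap F \<Phi> p))" if p: "A.zz X Y p" for X Y p
 proof -
  show ?thesis
   using zmap_natural[OF loc_functor_comp[OF sh F] loc_functor_comp[OF F sh'] _ _ p, of \<eta>] \<eta>(1) T
   by (simp add: zmap_comp is_triangle_functor_def)
 qed
 have adds: "zfun C' W' F \<Phi> X Y (adds A.L X Y f g) = adds A'.L (F X) (F Y) (zfun C' W' F \<Phi> X Y f) (zfun C' W' F \<Phi> X Y g)"
  if o: "X \<in> objs C" "Y \<in> objs C" and fg: "f \<in> mors A.L X Y" "g \<in> mors A.L X Y" for X Y f g
 proof -
  obtain p q where pq: "f = A.cl X Y p" "A.zz X Y p" "g = A.cl X Y q" "A.zz X Y q" using fg by (auto simp: A.loc_simps)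
  obtain Z s a b where Z: "Z \<in> objs C" "s \<in> W Z X" "a \<in> mors C Z Y" "b \<in> mors C Z Y"
   "A.ze X Y p [Bwd Z X s, Fwd Z Y a]" "A.ze X Y q [Bwd Z X s, Fwd Z Y b]" using A.common_roof[OF pq(2,4)] by blast
  have e: "f = A.cl X Y [Bwd Z X s, Fwd Z Y a]" "g = A.cl X Y [Bwd Z X s, Fwd Z Y b]" using A.cl_eqI[OF Z(5)] A.cl_eqI[OF Z(6)] pq by auto
  have \<Phi>add: "\<Phi> Z Y (adds C Z Y a b) = adds C' (F Z) (F Y) (\<Phi> Z Y a) (\<Phi> Z Y b)"
   using T Z o by (simp add: is_triangle_functor_def)
  have z: "A.zz X Y [Bwd Z X s, Fwd Z Y c]" if "c \<in> mors C Z Y" for c using that Z o by simp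
  show ?thesis unfolding e
   using A.adds_roof[OF o Z(1-4)] A'.adds_roof[of "F X" "F Y" "F Z" "\<Phi> Z X s" "\<Phi> Z Y a" "\<Phi> Z Y b"] Z o
   by (simp add: F.zfun_cl[OF z] A.adds_mor \<Phi>add F.F_simps F.W_pres)
 qed
 have tria: "(F X, F Y, F Z, zfun C' W' F \<Phi> X Y f, zfun C' W' F \<Phi> Y Z g,
     cmps A'.L (F Z) (F (shobj C X)) (shobj C' (F X)) (A'.cl (F (shobj C X)) (shobj C' (F X)) [?\<eta> X]) (zfun C' W' F \<Phi> Z (shobj C X) h))
    \<in> triangles (localization C' W')" if tr: "(X, Y, Z, f, g, h) \<in> triangles (localization C W)" for X Y Z f g h
 proof -
  obtain X' Y' Z' f' g' h' \<alpha> \<beta> \<gamma> where o: "X \<in> objs C" "Y \<in> objs C" "Z \<in> objs C"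
   and m: "f \<in> mors A.L X Y" "g \<in> mors A.L Y Z" "h \<in> mors A.L Z (shobj C X)"
   and t: "(X', Y', Z', f', g', h') \<in> triangles C"
   and iso: "cat_iso A.L X X' \<alpha>" "cat_iso A.L Y Y' \<beta>" "cat_iso A.L Z Z' \<gamma>"
   and sq: "cmps A.L X Y Y' \<beta> f = cmps A.L X X' Y' (A.cl X' Y' [Fwd X' Y' f']) \<alpha>"
    "cmps A.L Y Z Z' \<gamma> g = cmps A.L Y Y' Z' (A.cl Y' Z' [Fwd Y' Z' g']) \<beta>"
    "cmps A.L Z (shobj C X) (shobj C X') (shmor A.L X X' \<alpha>) h =
     cmps A.L Z Z' (shobj C X') (A.cl Z' (shobj C X') [Fwd Z' (shobj C X') h']) \<gamma>"
   using tr unfolding A.localization_triangle_iff by blast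
  obtain a where a: "\<alpha> = A.cl X X' a" "A.zz X X' a" using iso(1) by (rule A.cat_isoE)
  obtain b where b: "\<beta> = A.cl Y Y' b" "A.zz Y Y' b" using iso(2) by (rule A.cat_isoE)
  obtain c where c: "\<gamma> = A.cl Z Z' c" "A.zz Z Z' c" using iso(3) by (rule A.cat_isoE)
  obtain p where p: "f = A.cl X Y p" "A.zz X Y p" using m by (auto simp: A.loc_simps)
  obtain q where q: "g = A.cl Y Z q" "A.zz Y Z q" using m by (auto simp: A.loc_simps)
  obtain r where r: "h = A.cl Z (shobj C X) r" "A.zz Z (shobj C X) r" using m by (auto simp: A.loc_simps)
  have o': "X' \<in> objs C" "Y' \<in> objs C" "Z' \<in> objs C" and m': "f' \<in> mors C X' Y'" "g' \<in> mors C Y' Z'" "h' \<in> mors C Z' (shobj C X')"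
   using tri[OF t] by auto
  let ?sh = "zmap (shobj C) (shmor C)" and ?sh' = "zmap (shobj C') (shmor C')" and ?F = "zmap F \<Phi>"
  let ?h = "cmps C' (F Z') (F (shobj C X')) (shobj C' (F X')) (\<eta> X') (\<Phi> Z' (shobj C X') h')"
  have t': "(F X', F Y', F Z', \<Phi> X' Y' f', \<Phi> Y' Z' g', ?h) \<in> triangles C'"
   using T t by (auto simp: is_triangle_functor_def)
  note z = p(2) q(2) r(2) a(2) b(2) c(2)
  note zm = sh.zmap_zz[OF a(2)]
  have e: "A.ze X Y' (p @ b) (a @ [Fwd X' Y' f'])" "A.ze Y Z' (q @ c) (b @ [Fwd Y' Z' g'])"
    "A.ze Z (shobj C X') (r @ ?sh a) (c @ [Fwd Z' (shobj C X') h'])"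
   using sq z o o' m' unfolding p(1) q(1) r(1) a(1) b(1) c(1)
   by (simp_all add: A.cmps_cl A.loc_simps sh.zfun_cl zm ob A.cl_eq_iff zigzag_append)
  have h'': "?h \<in> mors C' (F Z') (shobj C' (F X'))" using m' o' \<eta> by (simp add: A'.cmps_mor ob F.F_simps(3))
  have e3: "A'.ze (F Z) (shobj C' (F X')) (?F r @ [?\<eta> X] @ ?sh' (?F a)) (?F c @ [Fwd (F Z') (shobj C' (F X')) ?h])"
  proof -
   have "A'.ze (F Z) (shobj C' (F X')) (?F r @ [?\<eta> X] @ ?sh' (?F a)) (?F r @ ?F (?sh a) @ [?\<eta> X'])"
    by (rule A'.ze_ctx[OF zigzag_eq.sym[OF nat[OF a(2)]], where a = "?F r" and b = "[]"]) (use F.zmap_zz[OF r(2)] o' in \<open>auto simp: ob\<close>)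
   also have "A'.ze (F Z) (shobj C' (F X')) \<dots> (?F c @ [Fwd (F Z') (F (shobj C X')) (\<Phi> Z' (shobj C X') h'), ?\<eta> X'])"
    by (rule A'.ze_ctx[OF F.zmap_ze[OF e(3)], where a = "[]" and b = "[?\<eta> X']"]) (use o o' in \<open>auto simp: ob \<eta>\<close>)
   also have "A'.ze (F Z) (shobj C' (F X')) \<dots> (?F c @ [Fwd (F Z') (shobj C' (F X')) ?h])"
    by (rule A'.ze_ctx[OF A'.ze_comp[of "F Z'" "F (shobj C X')" "shobj C' (F X')"], where a = "?F c" and b = "[]"])
      (use F.zmap_zz[OF c(2)] o o' m' in \<open>auto simp: ob \<eta> F.F_simps(3)\<close>)
   finally show ?thesis .
  qed
  note zF = z[THEN F.zmap_zz] \<eta>z[OF o(1)]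
  note zsh = sh'.zmap_zz[OF F.zmap_zz[OF a(2)]]
  have hz: "cmps A'.L (F Z) (F (shobj C X)) (shobj C' (F X)) (A'.cl (F (shobj C X)) (shobj C' (F X)) [?\<eta> X]) (zfun C' W' F \<Phi> Z (shobj C X) h)
    = A'.cl (F Z) (shobj C' (F X)) (?F r @ [?\<eta> X])"
   unfolding r(1) using A'.cmps_cl[OF zF(3) zF(7)] by (simp add: F.zfun_cl[OF r(2)])
  show ?thesis unfolding A'.localization_triangle_iff hz
  proof (intro conjI exI)
   show "F X \<in> objs C'" "F Y \<in> objs C'" "F Z \<in> objs C'" using o ob by auto
   show "zfun C' W' F \<Phi> X Y f \<in> mors A'.L (F X) (F Y)" "zfun C' W' F \<Phi> Y Z g \<in> mors A'.L (F Y) (F Z)"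
    using zF unfolding p(1) q(1) F.zfun_cl[OF p(2)] F.zfun_cl[OF q(2)] A'.loc_simps by blast+
   show "A'.cl (F Z) (shobj C' (F X)) (?F r @ [?\<eta> X]) \<in> mors A'.L (F Z) (shobj C' (F X))"
    unfolding A'.loc_simps using zigzag_append[OF zF(3) zF(7)] by blast
    show "(F X', F Y', F Z', \<Phi> X' Y' f', \<Phi> Y' Z' g', ?h) \<in> triangles C'" by (rule t')
    show "cat_iso A'.L (F X) (F X') (zfun C' W' F \<Phi> X X' \<alpha>)" "cat_iso A'.L (F Y) (F Y') (zfun C' W' F \<Phi> Y Y' \<beta>)"
     "cat_iso A'.L (F Z) (F Z') (zfun C' W' F \<Phi> Z Z' \<gamma>)" by (rule F.zfun_iso, rule iso)+
    have zf: "A'.zz (F X') (F Y') [Fwd (F X') (F Y') (\<Phi> X' Y' f')]" "A'.zz (F Y') (F Z') [Fwd (F Y') (F Z') (\<Phi> Y' Z' g')]"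
     "A'.zz (F Z') (shobj C' (F X')) [Fwd (F Z') (shobj C' (F X')) ?h]"
     using o' m' h'' ob F.F_simps(3) by auto
    show "cmps A'.L (F X) (F Y) (F Y') (zfun C' W' F \<Phi> Y Y' \<beta>) (zfun C' W' F \<Phi> X Y f) =
      cmps A'.L (F X) (F X') (F Y') (A'.cl (F X') (F Y') [Fwd (F X') (F Y') (\<Phi> X' Y' f')]) (zfun C' W' F \<Phi> X X' \<alpha>)"
     unfolding p(1) a(1) b(1) using F.zmap_ze[OF e(1)]
     by (simp only: F.zfun_cl z A'.cmps_cl zF zf) (intro A'.cl_eqI, simp)
    show "cmps A'.L (F Y) (F Z) (F Z') (zfun C' W' F \<Phi> Z Z' \<gamma>) (zfun C' W' F \<Phi> Y Z g) =
      cmps A'.L (F Y) (F Y') (F Z') (A'.cl (F Y') (F Z') [Fwd (F Y') (F Z') (\<Phi> Y' Z' g')]) (zfun C' W' F \<Phi> Y Y' \<beta>)"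
     unfolding q(1) b(1) c(1) using F.zmap_ze[OF e(2)]
     by (simp only: F.zfun_cl z A'.cmps_cl zF zf) (intro A'.cl_eqI, simp)
    show "cmps A'.L (F Z) (shobj C' (F X)) (shobj C' (F X')) (shmor A'.L (F X) (F X') (zfun C' W' F \<Phi> X X' \<alpha>)) (A'.cl (F Z) (shobj C' (F X)) (?F r @ [?\<eta> X])) =
      cmps A'.L (F Z) (F Z') (shobj C' (F X')) (A'.cl (F Z') (shobj C' (F X')) [Fwd (F Z') (shobj C' (F X')) ?h]) (zfun C' W' F \<Phi> Z Z' \<gamma>)"
     unfolding a(1) c(1) A'.loc_simps
     by (simp only: F.zfun_cl sh'.zfun_cl z A'.cmps_cl zF zf zsh zigzag_append[OF zF(3) zF(7)]) (intro A'.cl_eqI, use e3 in simp)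
  qed
 qed
 have nat': "cmps A'.L (F (shobj C X)) (F (shobj C Y)) (shobj C' (F Y)) (A'.cl (F (shobj C Y)) (shobj C' (F Y)) [?\<eta> Y])
    (zfun C' W' F \<Phi> (shobj C X) (shobj C Y) (shmor A.L X Y f)) =
   cmps A'.L (F (shobj C X)) (shobj C' (F X)) (shobj C' (F Y)) (shmor A'.L (F X) (F Y) (zfun C' W' F \<Phi> X Y f)) (A'.cl (F (shobj C X)) (shobj C' (F X)) [?\<eta> X])"
  if o: "X \<in> objs C" "Y \<in> objs C" and f: "f \<in> mors A.L X Y" for X Y f
 proof -
  obtain p where p: "f = A.cl X Y p" "A.zz X Y p" using f by (auto simp: A.loc_simps)
  show ?thesis unfolding p(1) A.loc_simps A'.loc_simps
   by (simp only: F.zfun_cl sh.zfun_cl sh'.zfun_cl A'.cmps_cl p(2) sh.zmap_zz F.zmap_zz sh'.zmap_zz \<eta>z[OF o(1)] \<eta>z[OF o(2)])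
     (rule A'.cl_eqI[OF nat[OF p(2)]])
 qed
 show ?thesis
  unfolding is_triangle_functor_def localization_functor localization_cat_iso localization_sel
 proof (intro conjI ballI)
  show "is_functor A.L A'.L F (zfun C' W' F \<Phi>)" by (rule F.zfun_functor)
 next
  fix X Y f g assume "X \<in> objs A.L" "Y \<in> objs A.L" "f \<in> mors A.L X Y" "g \<in> mors A.L X Y"
  then show "zfun C' W' F \<Phi> X Y (adds A.L X Y f g) = adds A'.L (F X) (F Y) (zfun C' W' F \<Phi> X Y f) (zfun C' W' F \<Phi> X Y g)"
   by (intro adds) (simp_all add: A.loc_simps)
 next
  fix X assume "X \<in> objs A.L"
  then have X: "X \<in> objs C" by (simp add: A.loc_simps)
  show "cat_iso A'.L (F (shobj A.L X)) (shobj A'.L (F X)) (A'.cl (F (shobj C X)) (shobj C' (F X)) [?\<eta> X])"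
   unfolding A.loc_simps A'.loc_simps by (rule A'.C_iso) (simp_all add: X ob \<eta>)
 next
  fix X Y f assume "X \<in> objs A.L" "Y \<in> objs A.L" "f \<in> mors A.L X Y"
  then show "cmps A'.L (F (shobj A.L X)) (F (shobj A.L Y)) (shobj A'.L (F Y)) (A'.cl (F (shobj C Y)) (shobj C' (F Y)) [?\<eta> Y])
    (zfun C' W' F \<Phi> (shobj A.L X) (shobj A.L Y) (shmor A.L X Y f)) =
   cmps A'.L (F (shobj A.L X)) (shobj A'.L (F X)) (shobj A'.L (F Y)) (shmor A'.L (F X) (F Y) (zfun C' W' F \<Phi> X Y f)) (A'.cl (F (shobj C X)) (shobj C' (F X)) [?\<eta> X])"
   using nat'[of X Y f] by (simp only: A.loc_simps(1,4) A'.loc_simps(4))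
 next
  fix t assume "t \<in> triangles (localization C W)"
  then show "case t of (X, Y, Z, f, g, h) =>
    (F X, F Y, F Z, zfun C' W' F \<Phi> X Y f, zfun C' W' F \<Phi> Y Z g,
     cmps A'.L (F Z) (F (shobj A.L X)) (shobj A'.L (F X)) (A'.cl (F (shobj C X)) (shobj C' (F X)) [?\<eta> X]) (zfun C' W' F \<Phi> Z (shobj A.L X) h))
    \<in> triangles (localization C' W')"
   by (cases t) (simp add: A.loc_simps(4) A'.loc_simps(4) tria)
 qed
qed

section \<open>The homotopy category as a category with quasi-isomorphisms\<close>

subsection \<open>Renaming the elements of a dg module\<close>

definition module_image :: "('m => 'n) => ('k, 'm) module => ('k, 'n) module" where
 "module_image c V = \<lparr>carrier = c ` carrier V, mult = undefined, one = undefined, zero = c \<zero>[V],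
   add = (\<lambda>x y. c (inv_into UNIV c x \<oplus>[V] inv_into UNIV c y)), smult = (\<lambda>a x. c (a \<odot>[V] inv_into UNIV c x))\<rparr>"

text \<open>The elements of a direct sum are pairs.  Renaming them along an injection brings the sum back to modules over
 the original type, so that \<open>X \<oplus> -\<close> becomes an endofunctor.\<close>

definition dg_code :: "('m => 'n) => ('k, 'a, 'm) dg_mod => ('k, 'a, 'n) dg_mod" where
 "dg_code c M = \<lparr>mcomp = (\<lambda>i. module_image c (mcomp M i)),
   mact = (\<lambda>i j x a. c (mact M i j (inv_into UNIV c x) a)), mdiff = (\<lambda>i x. c (mdiff M i (inv_into UNIV c x)))\<rparr>"

definition code_to where "code_to c M = (\<lambda>i. \<lambda>x\<in>car M i. c x)"
definition code_from where "code_from c M = (\<lambda>i. \<lambda>x\<in>c ` car M i. inv_into UNIV c x)"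

lemma module_image_simps [simp]:
 "carrier (module_image c V) = c ` carrier V" "\<zero>[module_image c V] = c \<zero>[V]"
 "x \<oplus>[module_image c V] y = c (inv_into UNIV c x \<oplus>[V] inv_into UNIV c y)" "a \<odot>[module_image c V] x = c (a \<odot>[V] inv_into UNIV c x)"
 by (simp_all add: module_image_def)

lemma dg_code_simps [simp]:
 "mcomp (dg_code c M) i = module_image c (mcomp M i)" "mact (dg_code c M) i j x a = c (mact M i j (inv_into UNIV c x) a)"
 "mdiff (dg_code c M) i x = c (mdiff M i (inv_into UNIV c x))"
 by (simp_all add: dg_code_def)

lemma module_image_ag: assumes c: "inj c" and V: "abelian_group V" shows "abelian_group (module_image c V)"
proof (rule abelian_groupI)
 fix x assume "x \<in> carrier (module_image c V)"
 then obtain v where v: "v \<in> carrier V" "x = c v" by auto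
 show "\<exists>y\<in>carrier (module_image c V). y \<oplus>[module_image c V] x = \<zero>[module_image c V]"
  using v c V by (intro bexI[of _ "c (\<ominus>[V] v)"]) (auto simp: ag_simps)
qed (use c V in \<open>auto simp: ag_simps ag_ac\<close>)

lemma module_image_neg: "[|inj c; abelian_group V; v \<in> carrier V|] ==> \<ominus>[module_image c V] (c v) = c (\<ominus>[V] v)"
 by (rule ag_neg_unique[OF module_image_ag]) (auto simp: ag_simps)

lemma module_image_ksign: "[|inj c; abelian_group V; v \<in> carrier V|] ==> ksign (module_image c V) p (c v) = c (ksign V p v)"
 by (simp add: ksign_def module_image_neg)

lemma module_image_module: assumes c: "inj c" and V: "module K V" shows "module K (module_image c V)"
proof -
 note rules = module.smult_closed[OF V] module.smult_l_distr[OF V] module.smult_r_distr[OF V]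
  module.smult_assoc1[OF V] module.smult_one[OF V]
 show ?thesis
  by (rule moduleI') (auto simp: c rules module_image_ag module_ag[OF V] module.axioms(1)[OF V])
qed

context dg_algebra begin

lemma dgm_code: assumes c: "inj c" and M: "dgm M" shows "dgm (dg_code c M)"
proof -
 note s = c M module_image_module dgm_module dgm_closed
 show ?thesis
  apply (rule dgmI; (elim imageE)?; simp)
  subgoal by (simp add: s)
  subgoal by (auto simp: s)
  subgoal by (auto simp: s act_add_left)
  subgoal by (auto simp: s act_smult_left)
  subgoal by (auto simp: s act_add_right)
  subgoal by (auto simp: s act_smult_right)
  subgoal by (auto simp: s act_assoc)
  subgoal by (auto simp: s act_one)
  subgoal by (auto simp: s)
  subgoal by (auto simp: s diff_add)
  subgoal by (auto simp: s diff_smult)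
  subgoal by (auto simp: s diff_diff)
  subgoal for n q x a
   using adiff_closed[of a q "q + 1"] by (auto simp: s diff_act module_image_ksign ac_simps)
  done
qed

lemma code_Cyc:
 assumes c: "inj c" and M: "dgm M"
 shows "code_to c M \<in> Cyc M (dg_code c M) 0" "code_from c M \<in> Cyc (dg_code c M) M 0"
proof -
 note s = c M dgm_closed
 show "code_to c M \<in> Cyc M (dg_code c M) 0"
  by (intro CycI_pointwise Hom_I dgm_code s) (auto simp: code_to_def s)
 show "code_from c M \<in> Cyc (dg_code c M) M 0"
  by (intro CycI_pointwise Hom_I dgm_code s) (auto simp: code_from_def s)
qed

lemma code_inverse:
 assumes "inj c"
 shows "gcomp M 0 (code_from c M) (code_to c M) = gid M"
  "gcomp (dg_code c M) 0 (code_to c M) (code_from c M) = gid (dg_code c M)"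
 using assms by (auto simp: gcomp_def gid_def code_to_def code_from_def fun_eq_iff)

lemma qis_bij:
 assumes X: "dgm X" and Y: "dgm Y" and f: "f \<in> Cyc X Y 0" and g: "g \<in> Cyc Y X 0"
  and gf: "\<And>i x. x \<in> cocycles X i ==> g i (f i x) = x" and fg: "\<And>i y. y \<in> cocycles Y i ==> f i (g i y) = y"
 shows "qis X Y f"
 unfolding qis_def
proof (intro conjI allI ballI impI)
 fix i x assume "x \<in> cocycles X i" "f i x \<in> coboundaries Y i"
 then show "x \<in> coboundaries X i" using Cyc_coboundary[OF Y X g, of "f i x" i i] gf by simp
next
 fix i y assume y: "y \<in> cocycles Y i"
 then have "y \<oplus>[Y,i] \<ominus>[Y,i] f i (g i y) \<in> coboundaries Y i"
  using fg[OF y] cocyclesD(1)[OF y] coboundaries_subgroup(3)[OF Y, of i] Y by (simp add: ag_simps)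
 then show "\<exists>x\<in>cocycles X i. y \<oplus>[Y,i] \<ominus>[Y,i] f i x \<in> coboundaries Y i"
  using Cyc_cocycle[OF Y X g y, of i] by (intro bexI[of _ "g i y"]) simp_all
qed

lemma qis_inverse:
 assumes X: "dgm X" and Y: "dgm Y" and f: "f \<in> Cyc X Y 0" and g: "g \<in> Cyc Y X 0"
  and gf: "gcomp X 0 g f = gid X" "gcomp Y 0 f g = gid Y"
 shows "qis X Y f"
proof (rule qis_bij[OF X Y f g])
 show "g i (f i x) = x" if "x \<in> cocycles X i" for i x
  using fun_cong[OF fun_cong[OF gf(1)], of i x] cocyclesD(1)[OF that] by simp
 show "f i (g i y) = y" if "y \<in> cocycles Y i" for i y
  using fun_cong[OF fun_cong[OF gf(2)], of i y] cocyclesD(1)[OF that] by simp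
qed

subsection \<open>The homotopy category and its shift\<close>

abbreviation HC :: "(('k, 'a, 'v) dg_mod, (int => 'v => 'v) set) tri_cat" where "HC \<equiv> homotopy_cat K A"
abbreviation hc where "hc \<equiv> hclass K A"

lemma HC_simps:
 "X \<in> objs HC \<longleftrightarrow> dgm X" "ids HC X = hc X X (gid X)" "cmps HC X Y Z = hcomp K A X Z" "adds HC = hadd K A"
 "shobj HC = dg_shift 1" "shmor HC X Y = hshift 1"
 "[|dgm X; dgm Y|] ==> mors HC X Y = hc X Y ` Cyc X Y 0"
 "(X, Y, Z, f, g, h) \<in> triangles HC \<longleftrightarrow> htriangle K A X Y Z f g h"
 unfolding homotopy_cat_def by (simp_all add: hid_def hmors_Cyc)

lemma HC_morE:
 assumes "dgm X" "dgm Y" "F \<in> mors HC X Y"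
 obtains f where "f \<in> Cyc X Y 0" "F = hc X Y f"
 using assms by (auto simp: HC_simps)

lemma HC_mem: "[|dgm X; dgm Y; f \<in> Cyc X Y 0|] ==> hc X Y f \<in> mors HC X Y"
 by (simp add: HC_simps)

lemma quasi_isoE:
 assumes "dgm X" "dgm Y" "F \<in> quasi_isos K A X Y"
 obtains f where "f \<in> Cyc X Y 0" "F = hc X Y f" "qis X Y f"
proof -
 have "F \<in> hc X Y ` Cyc X Y 0" using assms(3) hmors_Cyc[OF assms(1,2)] by (auto simp: quasi_isos_def)
 then show ?thesis using that assms quasi_isos_hclass[OF assms(1,2)] by auto
qed

lemma HC_loc: "loc HC (quasi_isos K A)"
proof
 fix X :: "('k, 'a, 'v) dg_mod" assume "X \<in> objs HC"
 then show "ids HC X \<in> mors HC X X" by (simp add: HC_simps Cyc_gid)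
next
 fix X Y Z :: "('k, 'a, 'v) dg_mod" and f g
 assume "X \<in> objs HC" "Y \<in> objs HC" "Z \<in> objs HC" and fg: "f \<in> mors HC X Y" "g \<in> mors HC Y Z"
 then have o: "dgm X" "dgm Y" "dgm Z" by (simp_all add: HC_simps)
 obtain f0 where f: "f0 \<in> Cyc X Y 0" "f = hc X Y f0" using HC_morE[OF o(1,2) fg(1)] .
 obtain g0 where g: "g0 \<in> Cyc Y Z 0" "g = hc Y Z g0" using HC_morE[OF o(2,3) fg(2)] .
 show "cmps HC X Y Z g f \<in> mors HC X Z"
  using HC_mem[OF o(1,3) Cyc_gcomp[OF o f(1) g(1)]] by (simp add: HC_simps(3) f g hcomp_hclass o)
next
 fix X Y :: "('k, 'a, 'v) dg_mod" and s assume "X \<in> objs HC" "Y \<in> objs HC" and s: "s \<in> quasi_isos K A X Y"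
 then have o: "dgm X" "dgm Y" by (simp_all add: HC_simps)
 show "s \<in> mors HC X Y" using quasi_isoE[OF o s] HC_mem[OF o] by metis
qed

lemma conj_shift_Cyc: "[|dgm X; dgm Y; f \<in> Cyc X Y 0|] ==> conj_shift s X Y f \<in> Cyc (dg_shift s X) (dg_shift s Y) 0"
 by (rule htpD(1)[OF conj_shift_htp[OF _ _ htp_refl]]) simp_all

lemma shift_cocycles: "dgm X ==> cocycles (dg_shift s X) i = cocycles X (i + s)"
 unfolding cocycles_def using diff_closed[of X _ "i + s" "i + s + 1"]
 by (auto simp: ksign_def ag_simps ac_simps) (metis ag_neg_neg ag_neg_zero dgm_ag)

lemma shift_coboundaries: assumes X: "dgm X" shows "coboundaries (dg_shift s X) i = coboundaries X (i + s)"
proof (intro equalityI subsetI)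
 fix x assume "x \<in> coboundaries (dg_shift s X) i"
 then obtain w where w: "w \<in> car X (i - 1 + s)" "x = ksign (mcomp X (i + s)) s (mdiff X (i - 1 + s) w)"
  by (auto elim!: coboundariesE simp: algebra_simps)
 have "mdiff X (i - 1 + s) w \<in> coboundaries X (i + s)" by (rule coboundariesI[OF w(1)]) auto
 then show "x \<in> coboundaries X (i + s)" unfolding w(2) by (rule coboundaries_subgroup[OF X])
next
 fix x assume x: "x \<in> coboundaries X (i + s)"
 then have "ksign (mcomp X (i + s)) s x \<in> coboundaries X (i + s)" by (rule coboundaries_subgroup[OF X])
 then obtain w where w: "w \<in> car X (i + s - 1)" "ksign (mcomp X (i + s)) s x = mdiff X (i + s - 1) w"
  by (rule coboundariesE)
 have "x = ksign (mcomp X (i + s)) s (mdiff X (i + s - 1) w)"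
  unfolding w(2)[symmetric] using X coboundaries_closed[OF X x] by (simp add: ksign_ksign) (simp add: ksign_def)
 then show "x \<in> coboundaries (dg_shift s X) i"
  using w(1) by (intro coboundariesI[of w _ "i - 1"]) (auto simp: algebra_simps)
qed

lemma shift_qis:
 assumes X: "dgm X" and Y: "dgm Y" and f: "f \<in> Cyc X Y 0" and q: "qis X Y f"
 shows "qis (dg_shift s X) (dg_shift s Y) (conj_shift s X Y f)"
 using q unfolding qis_def conj_shift_eq[OF CycH[OF f]] shift_cocycles[OF X] shift_cocycles[OF Y]
  shift_coboundaries[OF X] shift_coboundaries[OF Y] by simp

text \<open>The shift preserves homotopies and quasi-isomorphisms, hence acts on the localization.\<close>

lemma HC_shift: "loc_functor HC (quasi_isos K A) HC (quasi_isos K A) (shobj HC) (shmor HC)"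
proof -
 interpret loc HC "quasi_isos K A" by (rule HC_loc)
 show ?thesis
 proof
  have comp: "conj_shift 1 X Z (gcomp X 0 g f) = gcomp (dg_shift 1 X) 0 (conj_shift 1 Y Z g) (conj_shift 1 X Y f)"
   if "dgm X" "dgm Y" "dgm Z" "f \<in> Cyc X Y 0" "g \<in> Cyc Y Z 0" for X Y Z :: "('k, 'a, 'v) dg_mod" and f g
   unfolding conj_shift_eq[OF CycH[OF Cyc_gcomp[OF that, of 0, simplified]]] conj_shift_eq[OF CycH[OF that(4)]] conj_shift_eq[OF CycH[OF that(5)]]
   by (simp add: gcomp_def)
  have id: "conj_shift 1 X X (gid X) = gid (dg_shift 1 X)" if "dgm X" for X :: "('k, 'a, 'v) dg_mod"
   using conj_shift_eq[OF gid_closed[OF that]] by (simp add: gid_def)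
  show "is_functor HC HC (shobj HC) (shmor HC)"
   unfolding is_functor_def
  proof (intro conjI ballI funcsetI)
   fix X :: "('k, 'a, 'v) dg_mod" assume "X \<in> objs HC"
   then have X: "dgm X" by (simp add: HC_simps)
   then show "shobj HC X \<in> objs HC" by (simp add: HC_simps)
   show "shmor HC X X (ids HC X) = ids HC (shobj HC X)"
    using X by (simp add: HC_simps hshift_hclass Cyc_gid id)
  next
   fix X Y :: "('k, 'a, 'v) dg_mod" and f assume "X \<in> objs HC" "Y \<in> objs HC" and f: "f \<in> mors HC X Y"
   then have o: "dgm X" "dgm Y" by (simp_all add: HC_simps)
   obtain f0 where f: "f0 \<in> Cyc X Y 0" "f = hc X Y f0" using HC_morE[OF o f] .
   show "shmor HC X Y f \<in> mors HC (shobj HC X) (shobj HC Y)"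
    using HC_mem[OF _ _ conj_shift_Cyc[OF o f(1), of 1]] o f by (simp add: HC_simps(5,6) hshift_hclass)
  next
   fix X Y Z :: "('k, 'a, 'v) dg_mod" and f g
   assume "X \<in> objs HC" "Y \<in> objs HC" "Z \<in> objs HC" and fg: "f \<in> mors HC X Y" "g \<in> mors HC Y Z"
   then have o: "dgm X" "dgm Y" "dgm Z" by (simp_all add: HC_simps)
   obtain f0 where f: "f0 \<in> Cyc X Y 0" "f = hc X Y f0" using HC_morE[OF o(1,2) fg(1)] .
   obtain g0 where g: "g0 \<in> Cyc Y Z 0" "g = hc Y Z g0" using HC_morE[OF o(2,3) fg(2)] .
   show "shmor HC X Z (cmps HC X Y Z g f) = cmps HC (shobj HC X) (shobj HC Y) (shobj HC Z) (shmor HC Y Z g) (shmor HC X Y f)"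
    using comp[OF o f(1) g(1)] Cyc_gcomp[OF o f(1) g(1), of 0]
    by (simp add: HC_simps(3,5,6) f g o hshift_hclass hcomp_hclass conj_shift_Cyc)
  qed
  fix X Y :: "('k, 'a, 'v) dg_mod" and s assume "X \<in> objs HC" "Y \<in> objs HC" and s: "s \<in> quasi_isos K A X Y"
  then have o: "dgm X" "dgm Y" by (simp_all add: HC_simps)
  obtain f where f: "f \<in> Cyc X Y 0" "s = hc X Y f" "qis X Y f" using quasi_isoE[OF o s] .
  show "shmor HC X Y s \<in> quasi_isos K A (shobj HC X) (shobj HC Y)"
   using o f by (simp add: HC_simps(5,6) hshift_hclass quasi_isos_hclass conj_shift_Cyc shift_qis)
 qed
qed

end

subsection \<open>Functors given on chain maps\<close>

text \<open>What a functor must satisfy on chain maps in order to descend to homotopy categories.  It covers the dg functors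
 as well as the functors \<open>X \<oplus> -\<close>.\<close>

locale chain_functor = B: dg_algebra K B + C: dg_algebra K C
 for K :: "'k ring" and B :: "('k, 'b) dg_alg" and C :: "('k, 'c) dg_alg" +
 fixes F :: "('k, 'b, 'v) dg_mod => ('k, 'c, 'w) dg_mod"
  and \<Psi> :: "('k, 'b, 'v) dg_mod => ('k, 'b, 'v) dg_mod => (int => 'v => 'v) => (int => 'w => 'w)"
 assumes F_dgm: "B.dgm X ==> C.dgm (F X)"
  and \<Psi>_htp: "[|B.dgm X; B.dgm Y; B.htp X Y 0 f g|] ==> C.htp (F X) (F Y) 0 (\<Psi> X Y f) (\<Psi> X Y g)"
  and \<Psi>_gid: "B.dgm X ==> \<Psi> X X (gid X) = gid (F X)"
  and \<Psi>_gcomp: "[|B.dgm X; B.dgm Y; B.dgm Z; f \<in> B.Cyc X Y 0; g \<in> B.Cyc Y Z 0|] ==>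
   \<Psi> X Z (gcomp X 0 g f) = gcomp (F X) 0 (\<Psi> Y Z g) (\<Psi> X Y f)"
begin

definition \<Psi>K where "\<Psi>K X Y P = (\<Union>f\<in>P. hclass K C (F X) (F Y) (\<Psi> X Y f))"

lemma \<Psi>_Cyc: "[|B.dgm X; B.dgm Y; f \<in> B.Cyc X Y 0|] ==> \<Psi> X Y f \<in> C.Cyc (F X) (F Y) 0"
 by (rule C.htpD(1)[OF \<Psi>_htp[OF _ _ B.htp_refl]]) (simp_all add: F_dgm)

lemma \<Psi>K_hclass:
 assumes X: "B.dgm X" and Y: "B.dgm Y" and f: "f \<in> B.Cyc X Y 0"
 shows "\<Psi>K X Y (hclass K B X Y f) = hclass K C (F X) (F Y) (\<Psi> X Y f)"
 unfolding \<Psi>K_def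
proof (rule UN_const)
 show "f \<in> hclass K B X Y f" by (rule B.hclass_self[OF assms])
 fix g assume "g \<in> hclass K B X Y f"
 then have g: "B.htp X Y 0 f g" by (simp add: B.hclass_htp[OF assms])
 show "hclass K C (F X) (F Y) (\<Psi> X Y g) = hclass K C (F X) (F Y) (\<Psi> X Y f)"
  using C.hclass_eq_iff[OF F_dgm[OF X] F_dgm[OF Y] \<Psi>_Cyc[OF X Y f] \<Psi>_Cyc[OF X Y B.htpD(2)[OF g X Y]]] \<Psi>_htp[OF X Y g] by simp
qed

lemma \<Psi>K_functor: "is_functor B.HC C.HC F \<Psi>K"
 unfolding is_functor_def
proof (intro conjI ballI funcsetI)
 fix X :: "('k, 'b, 'v) dg_mod" assume "X \<in> objs B.HC"
 then have X: "B.dgm X" by (simp add: B.HC_simps)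
 then show "F X \<in> objs C.HC" by (simp add: C.HC_simps F_dgm)
 show "\<Psi>K X X (ids B.HC X) = ids C.HC (F X)"
  using X by (simp add: B.HC_simps(2) C.HC_simps(2) \<Psi>K_hclass B.Cyc_gid \<Psi>_gid)
next
 fix X Y :: "('k, 'b, 'v) dg_mod" and f assume "X \<in> objs B.HC" "Y \<in> objs B.HC" and f: "f \<in> mors B.HC X Y"
 then have o: "B.dgm X" "B.dgm Y" by (simp_all add: B.HC_simps)
 obtain f0 where f: "f0 \<in> B.Cyc X Y 0" "f = hclass K B X Y f0" using B.HC_morE[OF o f] .
 show "\<Psi>K X Y f \<in> mors C.HC (F X) (F Y)"
  using C.HC_mem[OF _ _ \<Psi>_Cyc[OF o f(1)]] o f by (simp add: \<Psi>K_hclass F_dgm)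
next
 fix X Y Z :: "('k, 'b, 'v) dg_mod" and f g assume "X \<in> objs B.HC" "Y \<in> objs B.HC" "Z \<in> objs B.HC" and fg: "f \<in> mors B.HC X Y" "g \<in> mors B.HC Y Z"
 then have o: "B.dgm X" "B.dgm Y" "B.dgm Z" by (simp_all add: B.HC_simps)
 obtain f0 where f: "f0 \<in> B.Cyc X Y 0" "f = hclass K B X Y f0" using B.HC_morE[OF o(1,2) fg(1)] .
 obtain g0 where g: "g0 \<in> B.Cyc Y Z 0" "g = hclass K B Y Z g0" using B.HC_morE[OF o(2,3) fg(2)] .
 show "\<Psi>K X Z (cmps B.HC X Y Z g f) = cmps C.HC (F X) (F Y) (F Z) (\<Psi>K Y Z g) (\<Psi>K X Y f)"
  using B.Cyc_gcomp[OF o f(1) g(1), of 0] \<Psi>_gcomp[OF o f(1) g(1)] o f g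
  by (simp add: B.HC_simps(3) C.HC_simps(3) \<Psi>K_hclass F_dgm B.hcomp_hclass C.hcomp_hclass \<Psi>_Cyc)
qed

lemma \<Psi>K_loc_functor:
 assumes q: "\<And>X Y f. [|B.dgm X; B.dgm Y; f \<in> B.Cyc X Y 0; B.qis X Y f|] ==> C.qis (F X) (F Y) (\<Psi> X Y f)"
 shows "loc_functor B.HC (quasi_isos K B) C.HC (quasi_isos K C) F \<Psi>K"
proof (intro loc_functor.intro loc_functor_axioms.intro B.HC_loc C.HC_loc \<Psi>K_functor)
 fix X Y :: "('k, 'b, 'v) dg_mod" and s assume "X \<in> objs B.HC" "Y \<in> objs B.HC" and s: "s \<in> quasi_isos K B X Y"
 then have o: "B.dgm X" "B.dgm Y" by (simp_all add: B.HC_simps)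
 obtain f where f: "f \<in> B.Cyc X Y 0" "s = hclass K B X Y f" "B.qis X Y f" using B.quasi_isoE[OF o s] .
 show "\<Psi>K X Y s \<in> quasi_isos K C (F X) (F Y)"
  using o f q[OF o f(1,3)] by (simp add: \<Psi>K_hclass C.quasi_isos_hclass F_dgm \<Psi>_Cyc)
qed

end

subsection \<open>Sums and the Ore condition\<close>

definition dsum where "dsum X Y a b = (\<lambda>i. \<lambda>u\<in>car X i \<times> car Y i. (a i (fst u), b i (snd u)))"
definition dpair where "dpair Z a b = (\<lambda>i. \<lambda>z\<in>car Z i. (a i z, b i z))"
definition dfold where "dfold Y = (\<lambda>i. \<lambda>u\<in>car Y i \<times> car Y i. fst u \<oplus>[Y,i] snd u)"
definition conj_code where "conj_code c M N f = (\<lambda>i. \<lambda>x\<in>c ` car M i. c (f i (inv_into UNIV c x)))"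

context dg_algebra begin

lemma dsum_Hom: "[|dgm X; dgm Y; a \<in> Hom X X' n; b \<in> Hom Y Y' n|] ==> dsum X Y a b \<in> Hom (dg_sum X Y) (dg_sum X' Y') n"
 by (intro Hom_I) (auto simp: dsum_def dgm_closed Hom_closed Hom_add Hom_smult Hom_act)

lemma dsum_Cyc: assumes "dgm X" "dgm Y" "dgm X'" "dgm Y'" "a \<in> Cyc X X' n" "b \<in> Cyc Y Y' n"
 shows "dsum X Y a b \<in> Cyc (dg_sum X Y) (dg_sum X' Y') n"
proof -
 note h = CycH[OF assms(5)] CycH[OF assms(6)]
 show ?thesis
  using assms h Cyc_diff[OF assms(1,3,5) _ HOL.refl] Cyc_diff[OF assms(2,4,6) _ HOL.refl]
  by (intro CycI_pointwise dsum_Hom) (auto simp: dsum_def dgm_closed Hom_closed[OF h(1)] Hom_closed[OF h(2)] module_sum_ksign ac_simps)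
qed

lemma D_dsum: assumes "dgm X" "dgm Y" "dgm X'" "dgm Y'" "a \<in> Hom X X' n" "b \<in> Hom Y Y' n"
 shows "D (dg_sum X Y) (dg_sum X' Y') n (dsum X Y a b) = dsum X Y (D X X' n a) (D Y Y' n b)"
 using assms
 by (intro Hom_eqI[of _ "dg_sum X Y" "dg_sum X' Y'" "n + 1"] D_closed dsum_Hom)
   (auto simp: hom_diff_apply, auto simp: dsum_def hom_diff_apply dgm_closed Hom_closed module_sum_ksign ac_simps)

lemma dsum_htp:
 assumes o: "dgm X" "dgm Y" "dgm X'" "dgm Y'" and h: "htp X X' n a a'" "htp Y Y' n b b'"
 shows "htp (dg_sum X Y) (dg_sum X' Y') n (dsum X Y a b) (dsum X Y a' b')"
proof -
 obtain h where a: "a \<in> Cyc X X' n" and h: "h \<in> Hom X X' (n - 1)" "a' = a \<oplus>[HM X X' n] D X X' (n - 1) h"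
  using h htp_def by blast
 obtain k where b: "b \<in> Cyc Y Y' n" and k: "k \<in> Hom Y Y' (n - 1)" "b' = b \<oplus>[HM Y Y' n] D Y Y' (n - 1) k"
  using \<open>htp Y Y' n b b'\<close> htp_def by blast
 have H: "D X X' (n - 1) h \<in> Hom X X' n" "D Y Y' (n - 1) k \<in> Hom Y Y' n" using o h k by (auto intro!: D_closed)
 have "dsum X Y a' b' = dsum X Y a b \<oplus>[HM (dg_sum X Y) (dg_sum X' Y') n] D (dg_sum X Y) (dg_sum X' Y') (n - 1) (dsum X Y h k)"
  unfolding h(2) k(2) D_dsum[OF o h(1) k(1)] using o H CycH[OF a] CycH[OF b]
  by (intro Hom_eqI[of _ "dg_sum X Y" "dg_sum X' Y'" n] HM_add_closed dsum_Hom) (auto simp: dsum_def)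
 then show ?thesis unfolding htp_def using o a b h k by (auto intro!: dsum_Cyc dsum_Hom)
qed

lemma dsum_qis:
 assumes o: "dgm X" "dgm Y" "dgm X'" "dgm Y'" and a: "a \<in> Cyc X X' 0" "qis X X' a" and b: "b \<in> Cyc Y Y' 0" "qis Y Y' b"
 shows "qis (dg_sum X Y) (dg_sum X' Y') (dsum X Y a b)"
proof -
 have cz: "cocycles (dg_sum M N) i = cocycles M i \<times> cocycles N i" for M :: "('k, 'a, 'x) dg_mod" and N :: "('k, 'a, 'y) dg_mod" and i
  by (auto simp: cocycles_def)
 have cb: "coboundaries (dg_sum M N) i = coboundaries M i \<times> coboundaries N i" for M :: "('k, 'a, 'x) dg_mod" and N :: "('k, 'a, 'y) dg_mod" and i
  by (force simp: coboundaries_def)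
 note fz = Cyc_cocycle[OF o(1,3) a(1) _ HOL.refl, simplified] Cyc_cocycle[OF o(2,4) b(1) _ HOL.refl, simplified]
 note cl = cocyclesD(1) cocyclesD(1)[OF fz(1)] cocyclesD(1)[OF fz(2)]
 show ?thesis
  unfolding qis_def
 proof (intro conjI allI ballI impI)
  fix i x assume x: "x \<in> cocycles (dg_sum X Y) i" and "dsum X Y a b i x \<in> coboundaries (dg_sum X' Y') i"
  then have "a i (fst x) \<in> coboundaries X' i" "b i (snd x) \<in> coboundaries Y' i" by (auto simp: cz cb dsum_def cl)
  then show "x \<in> coboundaries (dg_sum X Y) i" using x a(2) b(2) by (auto simp: cz cb qis_def)
 next
  fix i y assume y: "y \<in> cocycles (dg_sum X' Y') i"
  then have y': "fst y \<in> cocycles X' i" "snd y \<in> cocycles Y' i" by (auto simp only: cz mem_Times_iff)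
  obtain u where u: "u \<in> cocycles X i" "fst y \<oplus>[X',i] \<ominus>[X',i] a i u \<in> coboundaries X' i"
   using a(2) y'(1) unfolding qis_def by blast
  obtain v where v: "v \<in> cocycles Y i" "snd y \<oplus>[Y',i] \<ominus>[Y',i] b i v \<in> coboundaries Y' i"
   using b(2) y'(2) unfolding qis_def by blast
  note uv = u v
  show "\<exists>x\<in>cocycles (dg_sum X Y) i. y \<oplus>[dg_sum X' Y',i] \<ominus>[dg_sum X' Y',i] dsum X Y a b i x \<in> coboundaries (dg_sum X' Y') i"
   using uv o cl(2)[OF uv(1)] cl(3)[OF uv(3)] by (intro bexI[of _ "(u, v)"]) (simp_all add: cz cb dsum_def cl module_sum_neg)
 qed
qed

lemma dpair_Cyc: assumes "dgm X" "dgm Y" "dgm Z" "a \<in> Cyc Z X n" "b \<in> Cyc Z Y n" shows "dpair Z a b \<in> Cyc Z (dg_sum X Y) n"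
proof -
 note h = CycH[OF assms(4)] CycH[OF assms(5)]
 show ?thesis
  using assms h Cyc_diff[OF assms(3,1,4) _ HOL.refl] Cyc_diff[OF assms(3,2,5) _ HOL.refl]
  by (intro CycI_pointwise Hom_I) (auto simp: dpair_def dgm_closed Hom_closed[OF h(1)] Hom_closed[OF h(2)] Hom_add Hom_smult Hom_act module_sum_ksign ac_simps)
qed

lemma dfold_Cyc: assumes "dgm Y" shows "dfold Y \<in> Cyc (dg_sum Y Y) Y 0"
 using assms by (intro CycI_pointwise Hom_I)
  (auto simp: dfold_def dgm_closed ag_simps ag_ac diff_add act_add_left module.smult_r_distr[OF dgm_module])

lemma conj_code_Hom: "[|inj c; dgm M; dgm N; f \<in> Hom M N n|] ==> conj_code c M N f \<in> Hom (dg_code c M) (dg_code c N) n"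
 unfolding conj_code_def by (intro Hom_I) (auto simp: dgm_closed Hom_closed Hom_add Hom_smult Hom_act)

lemma conj_code_apply: "[|inj c; f \<in> Hom M N n; x \<in> car M i|] ==> conj_code c M N f i (c x) = c (f i x)"
 by (simp add: conj_code_def)

lemma D_conj_code:
 assumes c: "inj c" and o: "dgm M" "dgm N" and f: "f \<in> Hom M N n"
 shows "D (dg_code c M) (dg_code c N) n (conj_code c M N f) = conj_code c M N (D M N n f)"
 using conj_code_Hom[OF c o f] conj_code_Hom[OF c o D_closed[OF o f HOL.refl]] o f c
 by (intro Hom_eqI[of _ "dg_code c M" "dg_code c N" "n + 1"] D_closed dgm_code)
   (auto simp: hom_diff_apply conj_code_apply dgm_closed Hom_closed module_image_ksign ac_simps,
   auto simp: conj_code_def hom_diff_apply dgm_closed Hom_closed module_image_ksign ac_simps)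

lemma conj_code_htp:
 assumes c: "inj c" and o: "dgm M" "dgm N" and h: "htp M N n f g"
 shows "htp (dg_code c M) (dg_code c N) n (conj_code c M N f) (conj_code c M N g)"
proof -
 obtain h where f: "f \<in> Cyc M N n" and h: "h \<in> Hom M N (n - 1)" "g = f \<oplus>[HM M N n] D M N (n - 1) h"
  using h htp_def by blast
 have H: "f \<in> Hom M N n" "D M N (n - 1) h \<in> Hom M N n" using o h CycH[OF f] by (auto intro!: D_closed)
 have z: "conj_code c M N \<zero>[HM M N (n + 1)] = \<zero>[HM (dg_code c M) (dg_code c N) (n + 1)]"
  using c by (auto simp: conj_code_def hom_module_def fun_eq_iff)
 have "conj_code c M N f \<in> Cyc (dg_code c M) (dg_code c N) n"
  using D_conj_code[OF c o H(1)] CycD(2)[OF f] conj_code_Hom[OF c o H(1)] z by (simp add: Cyc_def)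
 moreover have "conj_code c M N g = conj_code c M N f \<oplus>[HM (dg_code c M) (dg_code c N) n] D (dg_code c M) (dg_code c N) (n - 1) (conj_code c M N h)"
  unfolding h(2) D_conj_code[OF c o h(1)] using c o H
  by (intro Hom_eqI[of _ "dg_code c M" "dg_code c N" n] HM_add_closed conj_code_Hom dgm_code) (auto simp: conj_code_apply[of c _ M N n] HM_add_closed)
 ultimately show ?thesis unfolding htp_def using conj_code_Hom[OF c o h(1)] by blast
qed

lemma conj_code_gcomp:
 "[|inj c; f \<in> Hom M N 0|] ==> conj_code c M P (gcomp M 0 g f) = gcomp (dg_code c M) 0 (conj_code c N P g) (conj_code c M N f)"
 by (auto simp: conj_code_def gcomp_def fun_eq_iff Hom_closed)

lemma conj_code_qis:
 assumes c: "inj c" and o: "dgm M" "dgm N" and f: "f \<in> Cyc M N 0" and q: "qis M N f"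
 shows "qis (dg_code c M) (dg_code c N) (conj_code c M N f)"
proof -
 note cc = dgm_code[OF c o(1)] dgm_code[OF c o(2)]
 have e: "conj_code c M N f = gcomp (dg_code c M) 0 (gcomp M 0 (code_to c N) f) (code_from c M)"
  using c Hom_closed[OF CycH[OF f]] by (auto simp: conj_code_def gcomp_def code_from_def code_to_def fun_eq_iff)
 show ?thesis unfolding e
  by (rule qis_comp[OF cc(1) o(1) cc(2) code_Cyc(2)[OF c o(1)] _ Cyc_gcomp[OF o cc(2) f code_Cyc(1)[OF c o(2)], of 0]]; (simp; fail)?)
    (rule qis_inverse[OF cc(1) o(1) code_Cyc(2)[OF c o(1)] code_Cyc(1)[OF c o(1)] code_inverse(2,1)[OF c]]
     qis_comp[OF o cc(2) f q code_Cyc(1)[OF c o(2)] qis_inverse[OF o(2) cc(2) code_Cyc(1,2)[OF c o(2)] code_inverse(1,2)[OF c]]])+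
qed

abbreviation csum where "csum p X Y \<equiv> dg_code p (dg_sum X Y)"
abbreviation cmap where "cmap p X Y X' Y' a b \<equiv> conj_code p (dg_sum X Y) (dg_sum X' Y') (dsum X Y a b)"

lemma dsum_gid: "dsum X Y (gid X) (gid Y) = gid (dg_sum X Y)"
 by (auto simp: dsum_def gid_def fun_eq_iff)

lemma conj_code_gid: "inj c ==> conj_code c M M (gid M) = gid (dg_code c M)"
 by (auto simp: conj_code_def gid_def fun_eq_iff)

lemma dsum_gcomp: "[|a \<in> Hom X X' 0; b \<in> Hom Y Y' 0|] ==>
  dsum X Y (gcomp X 0 a' a) (gcomp Y 0 b' b) = gcomp (dg_sum X Y) 0 (dsum X' Y' a' b') (dsum X Y a b)"
 by (auto simp: dsum_def gcomp_def fun_eq_iff Hom_closed)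

lemma gcomp_gid_gid: "gcomp X 0 (gid X) (gid X) = gid X"
 by (auto simp: gcomp_def gid_def fun_eq_iff)

lemma csum_right_functor:
 fixes p :: "'v \<times> 'v => 'v" and P :: "('k, 'a, 'v) dg_mod"
 assumes p: "inj p" and P: "dgm P"
 shows "chain_functor K A A (\<lambda>Y. csum p P Y) (\<lambda>Y Y' b. cmap p P Y P Y' (gid P) b)"
proof (intro chain_functor.intro chain_functor_axioms.intro dg_algebra_axioms)
 fix X Y :: "('k, 'a, 'v) dg_mod" and f g assume "dgm X" "dgm Y" "htp X Y 0 f g"
 then show "htp (csum p P X) (csum p P Y) 0 (cmap p P X P Y (gid P) f) (cmap p P X P Y (gid P) g)"
  using P by (intro conj_code_htp p dsum_htp htp_refl Cyc_gid) auto
next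
 fix X Y Z :: "('k, 'a, 'v) dg_mod" and f g assume o: "dgm X" "dgm Y" "dgm Z" and f: "f \<in> Cyc X Y 0" "g \<in> Cyc Y Z 0"
 show "cmap p P X P Z (gid P) (gcomp X 0 g f) = gcomp (csum p P X) 0 (cmap p P Y P Z (gid P) g) (cmap p P X P Y (gid P) f)"
  using dsum_gcomp[OF gid_closed[OF P] CycH[OF f(1)], of "gid P" g] conj_code_gcomp[OF p dsum_Hom[OF P o(1) gid_closed[OF P] CycH[OF f(1)]]]
  by (simp add: gcomp_gid_gid)
qed (simp_all add: p P dgm_code dsum_gid conj_code_gid)

lemma csum_left_functor:
 fixes p :: "'v \<times> 'v => 'v" and P :: "('k, 'a, 'v) dg_mod"
 assumes p: "inj p" and P: "dgm P"
 shows "chain_functor K A A (\<lambda>Y. csum p Y P) (\<lambda>Y Y' b. cmap p Y P Y' P b (gid P))"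
proof (intro chain_functor.intro chain_functor_axioms.intro dg_algebra_axioms)
 fix X Y :: "('k, 'a, 'v) dg_mod" and f g assume "dgm X" "dgm Y" "htp X Y 0 f g"
 then show "htp (csum p X P) (csum p Y P) 0 (cmap p X P Y P f (gid P)) (cmap p X P Y P g (gid P))"
  using P by (intro conj_code_htp p dsum_htp htp_refl Cyc_gid) auto
next
 fix X Y Z :: "('k, 'a, 'v) dg_mod" and f g assume o: "dgm X" "dgm Y" "dgm Z" and f: "f \<in> Cyc X Y 0" "g \<in> Cyc Y Z 0"
 show "cmap p X P Z P (gcomp X 0 g f) (gid P) = gcomp (csum p X P) 0 (cmap p Y P Z P g (gid P)) (cmap p X P Y P f (gid P))"
  using dsum_gcomp[OF CycH[OF f(1)] gid_closed[OF P], of g "gid P"] conj_code_gcomp[OF p dsum_Hom[OF o(1) P CycH[OF f(1)] gid_closed[OF P]]]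
  by (simp add: gcomp_gid_gid)
qed (simp_all add: p P dgm_code dsum_gid conj_code_gid)

lemma qis_gid: "dgm X ==> qis X X (gid X)"
 by (rule qis_inverse[of _ _ _ "gid X"]) (simp_all add: Cyc_gid gcomp_gid_gid)

text \<open>The equations are those of matrices: \<open>(1 \<oplus> s)(s, 1) = (s, s)\<close>, \<open>(1 \<oplus> b)(s, 1) = (s, b) = (s \<oplus> 1)(1, b)\<close>, and the
 codiagonal of \<open>Y\<close> sends \<open>(a \<oplus> 1)(1, b) = (a, b)\<close> to \<open>a + b\<close>.\<close>

lemma HC_sums:
 fixes p :: "'v \<times> 'v => 'v" and X Y :: "('k, 'a, 'v) dg_mod"
 assumes p: "inj p" and X: "dgm X" and Y: "dgm Y"
 shows "\<exists>R \<rho> S \<sigma>. loc_functor HC (quasi_isos K A) HC (quasi_isos K A) R \<rho> & loc_functor HC (quasi_isos K A) HC (quasi_isos K A) S \<sigma> & R Y = S X &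
   (\<exists>\<Delta>\<in>mors HC X (R X). \<exists>\<mu>\<in>mors HC (S Y) Y. \<forall>Z\<in>objs HC. \<forall>s\<in>quasi_isos K A Z X. \<forall>a\<in>mors HC Z Y. \<forall>b\<in>mors HC Z Y.
    \<exists>u\<in>mors HC Z (R Z). \<exists>v\<in>mors HC Z (S Z).
     cmps HC Z (R Z) (R X) (\<rho> Z X s) u = cmps HC Z X (R X) \<Delta> s &
     cmps HC Z (R Z) (R Y) (\<rho> Z Y b) u = cmps HC Z (S Z) (S X) (\<sigma> Z X s) v &
     cmps HC Z (S Y) Y \<mu> (cmps HC Z (S Z) (S Y) (\<sigma> Z Y a) v) = adds HC Z Y a b)"
proof -
 interpret R: chain_functor K A A "\<lambda>Z. csum p X Z" "\<lambda>Z Z' b. cmap p X Z X Z' (gid X) b" by (rule csum_right_functor[OF p X])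
 interpret S: chain_functor K A A "\<lambda>Z. csum p Z Y" "\<lambda>Z Z' b. cmap p Z Y Z' Y b (gid Y)" by (rule csum_left_functor[OF p Y])
 let ?to = "\<lambda>Z P Q a b. gcomp Z 0 (code_to p (dg_sum P Q)) (dpair Z a b)"
 have to: "?to Z P Q a b \<in> Cyc Z (csum p P Q) 0" if "dgm Z" "dgm P" "dgm Q" "a \<in> Cyc Z P 0" "b \<in> Cyc Z Q 0"
  for Z P Q :: "('k, 'a, 'v) dg_mod" and a b
  using that p by (intro Cyc_gcomp[of _ "dg_sum P Q" _ _ 0 _ 0] dpair_Cyc code_Cyc) (auto simp: dgm_code)
 let ?mu = "gcomp (csum p Y Y) 0 (dfold Y) (code_from p (dg_sum Y Y))"
 have mu: "?mu \<in> Cyc (csum p Y Y) Y 0"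
  using Y p by (intro Cyc_gcomp[of _ "dg_sum Y Y" _ _ 0 _ 0] dfold_Cyc code_Cyc) (auto simp: dgm_code)
 note dc = dgm_code[OF p dgm_sum]
 have cm: "gcomp Z 0 (cmap p P Q P' Q' f g) (?to Z P Q a b) = ?to Z P' Q' (gcomp Z 0 f a) (gcomp Z 0 g b)"
  if "a \<in> Cyc Z P 0" "b \<in> Cyc Z Q 0" "f \<in> Cyc P P' 0" "g \<in> Cyc Q Q' 0" for Z P Q P' Q' :: "('k, 'a, 'v) dg_mod" and f g a b
  using that[THEN CycH, THEN Hom_closed] p
  by (auto simp: gcomp_def conj_code_def code_to_def dsum_def dpair_def fun_eq_iff)
 have tc: "gcomp Z 0 (?to V P Q f g) a = ?to Z P Q (gcomp Z 0 f a) (gcomp Z 0 g a)"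
  if "a \<in> Cyc Z V 0" "f \<in> Cyc V P 0" "g \<in> Cyc V Q 0" for Z V P Q :: "('k, 'a, 'v) dg_mod" and f g a
  using that[THEN CycH, THEN Hom_closed] by (auto simp: gcomp_def code_to_def dpair_def fun_eq_iff)
 have fold: "gcomp Z 0 ?mu (?to Z Y Y a b) = a \<oplus>[HM Z Y 0] b" if "a \<in> Cyc Z Y 0" "b \<in> Cyc Z Y 0" for Z :: "('k, 'a, 'v) dg_mod" and a b
  using that[THEN CycH, THEN Hom_closed] p
  by (auto simp: gcomp_def code_to_def code_from_def dpair_def dfold_def hom_module_def fun_eq_iff)
 let ?R = "\<lambda>Z. csum p X Z" and ?S = "\<lambda>Z. csum p Z Y"
 have q: "qis (csum p X Z) (csum p X Z') (cmap p X Z X Z' (gid X) b)" "qis (csum p Z Y) (csum p Z' Y) (cmap p Z Y Z' Y b (gid Y))"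
  if "dgm Z" "dgm Z'" "b \<in> Cyc Z Z' 0" "qis Z Z' b" for Z Z' :: "('k, 'a, 'v) dg_mod" and b
  using that X Y by (auto intro!: conj_code_qis p dsum_qis dsum_Cyc qis_gid Cyc_gid)
 have main: "\<exists>u\<in>mors HC Z (?R Z). \<exists>v\<in>mors HC Z (?S Z).
     cmps HC Z (?R Z) (?R X) (R.\<Psi>K Z X s) u = cmps HC Z X (?R X) (hc X (?R X) (?to X X X (gid X) (gid X))) s &
     cmps HC Z (?R Z) (?R Y) (R.\<Psi>K Z Y b) u = cmps HC Z (?S Z) (?S X) (S.\<Psi>K Z X s) v &
     cmps HC Z (?S Y) Y (hc (?S Y) Y ?mu) (cmps HC Z (?S Z) (?S Y) (S.\<Psi>K Z Y a) v) = adds HC Z Y a b"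
  if o: "Z \<in> objs HC" and s: "s \<in> quasi_isos K A Z X" and a: "a \<in> mors HC Z Y" and b: "b \<in> mors HC Z Y" for Z :: "('k, 'a, 'v) dg_mod" and s a b
 proof -
  have Z: "dgm Z" using o by (simp add: HC_simps)
  obtain s0 where s0: "s0 \<in> Cyc Z X 0" "s = hc Z X s0" using quasi_isoE[OF Z X s] .
  obtain a0 where a0: "a0 \<in> Cyc Z Y 0" "a = hc Z Y a0" using HC_morE[OF Z Y a] .
  obtain b0 where b0: "b0 \<in> Cyc Z Y 0" "b = hc Z Y b0" using HC_morE[OF Z Y b] .
  have 1: "Cyc Z X 0 \<subseteq> Hom Z X 0" "Cyc Z Y 0 \<subseteq> Hom Z Y 0" by (auto dest: CycD)
  note g = gcomp_gid_left[OF Z X, of _ 0] gcomp_gid_left[OF Z Y, of _ 0] gcomp_gid_right[OF Z, of _ _ 0]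
  note H = s0(1)[THEN CycH] a0(1)[THEN CycH] b0(1)[THEN CycH]
  note c = s0(1) a0(1) b0(1) X[THEN Cyc_gid] Y[THEN Cyc_gid] Z[THEN Cyc_gid]
  note g = g H[THEN gcomp_gid_right[OF Z]]
  let ?u = "?to Z X Z s0 (gid Z)" and ?v = "?to Z Z Y (gid Z) b0"
  have u: "?u \<in> Cyc Z (?R Z) 0" and v: "?v \<in> Cyc Z (?S Z) 0" and w: "?to Z Y Y a0 b0 \<in> Cyc Z (?S Y) 0" and D0: "?to X X X (gid X) (gid X) \<in> Cyc X (?R X) 0"
   using X Y Z c by (auto intro!: to)
  have m1: "hc Z (?R Z) ?u \<in> mors HC Z (?R Z)" by (rule HC_mem[OF Z dc[OF X Z] u])
  have m2: "hc Z (?S Z) ?v \<in> mors HC Z (?S Z)" by (rule HC_mem[OF Z dc[OF Z Y] v])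
  note hh = hcomp_hclass[OF Z dc[OF X Z] dc[OF X X] u R.\<Psi>_Cyc[OF Z X s0(1)]] hcomp_hclass[OF Z X dc[OF X X] s0(1) D0]
   hcomp_hclass[OF Z dc[OF X Z] dc[OF X Y] u R.\<Psi>_Cyc[OF Z Y b0(1)]] hcomp_hclass[OF Z dc[OF Z Y] dc[OF X Y] v S.\<Psi>_Cyc[OF Z X s0(1)]]
   hcomp_hclass[OF Z dc[OF Z Y] dc[OF Y Y] v S.\<Psi>_Cyc[OF Z Y a0(1)]] hcomp_hclass[OF Z dc[OF Y Y] Y w mu] hadd_hclass[OF Z Y a0(1) b0(1)]
  have e1: "cmps HC Z (?R Z) (?R X) (R.\<Psi>K Z X s) (hc Z (?R Z) ?u) = cmps HC Z X (?R X) (hc X (?R X) (?to X X X (gid X) (gid X))) s"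
   unfolding HC_simps s0(2) R.\<Psi>K_hclass[OF Z X s0(1)] hh
   by (simp only: cm[OF c(1,6) c(4,1)] tc[OF c(1,4,4)] g H)
  have e2: "cmps HC Z (?R Z) (?R Y) (R.\<Psi>K Z Y b) (hc Z (?R Z) ?u) = cmps HC Z (?S Z) (?S X) (S.\<Psi>K Z X s) (hc Z (?S Z) ?v)"
   unfolding HC_simps s0(2) b0(2) R.\<Psi>K_hclass[OF Z Y b0(1)] S.\<Psi>K_hclass[OF Z X s0(1)] hh
   by (simp only: cm[OF c(1,6) c(4,3)] cm[OF c(6,3) c(1,5)] g H)
  have e3: "cmps HC Z (?S Y) Y (hc (?S Y) Y ?mu) (cmps HC Z (?S Z) (?S Y) (S.\<Psi>K Z Y a) (hc Z (?S Z) ?v)) = adds HC Z Y a b"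
   unfolding HC_simps a0(2) b0(2) S.\<Psi>K_hclass[OF Z Y a0(1)] hh cm[OF c(6,3) c(2,5)]
   by (simp only: g H hh fold[OF c(2,3)])
  show ?thesis using m1 m2 e1 e2 e3 by blast
 qed
 have DM: "hc X (?R X) (?to X X X (gid X) (gid X)) \<in> mors HC X (?R X)" "hc (?S Y) Y ?mu \<in> mors HC (?S Y) Y"
  using X Y by (auto intro!: HC_mem dc to mu Cyc_gid)
 show ?thesis
  by (rule exI[of _ ?R], rule exI[of _ R.\<Psi>K], rule exI[of _ ?S], rule exI[of _ S.\<Psi>K], intro conjI)
    (rule R.\<Psi>K_loc_functor S.\<Psi>K_loc_functor HOL.refl q bexI[OF _ DM(1)] bexI[OF _ DM(2)] ballI main | assumption)+
qed

text \<open>The kernel of the projection from the fibre of \<open>h\<close> to \<open>V\<close> is the acyclic module \<open>C\<close> up to a shift.\<close>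

lemma fibre_qis:
 assumes V: "dgm V" and C: "dgm C" and h: "h \<in> Cyc V C 0" and ac: "acyclic C"
 shows "qis (dg_shift (-1) (dg_cone V C h)) V (\<lambda>i. \<lambda>u\<in>car C (i - 1) \<times> car V i. snd u)" (is "qis ?Q V ?q")
proof -
 have K: "dgm (dg_cone V C h)" using V C h by simp
 note hH = CycH[OF h]
 have n: "\<ominus>[V,i + 1] mdiff V i v = \<zero>[V,i + 1] \<longleftrightarrow> mdiff V i v = \<zero>[V,i + 1]" if "v \<in> car V i" for v i
  using that diff_closed[OF V that HOL.refl] V by (metis ag_neg_neg ag_neg_zero dgm_ag)
 have z: "(c, v) \<in> cocycles ?Q i \<longleftrightarrow> c \<in> car C (i - 1) & v \<in> cocycles V i & mdiff C (i - 1) c \<oplus>[C,i] h i v = \<zero>[C,i]" for c v i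
  unfolding shift_cocycles[OF K] using n[of v i] by (auto simp: cocycles_def ksign_def)
 show ?thesis unfolding qis_def
 proof (intro conjI allI ballI impI)
  fix i u assume u: "u \<in> cocycles ?Q i" and q: "?q i u \<in> coboundaries V i"
  obtain c v where uv: "u = (c, v)" by (cases u)
  have c: "c \<in> car C (i - 1)" and v: "v \<in> cocycles V i" and e: "mdiff C (i - 1) c \<oplus>[C,i] h i v = \<zero>[C,i]"
   using u z uv by auto
  obtain w where w: "w \<in> car V (i - 1)" "v = mdiff V (i - 1) w" using q c cocyclesD(1)[OF v] uv by (auto elim: coboundariesE)
  have hw: "h (i - 1) w \<in> car C (i - 1)" "mdiff C (i - 1) (h (i - 1) w) = h i v"
   using Hom_closed[OF hH w(1)] Cyc_diff[OF V C h w(1), of "i - 1"] w(2) by simp_all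
  have "c \<oplus>[C,i - 1] h (i - 1) w \<in> cocycles C (i - 1)"
   using diff_add[OF C c hw(1)] hw e c C by (intro cocyclesI) (simp_all add: ag_add_closed)
  then have "c \<oplus>[C,i - 1] h (i - 1) w \<in> coboundaries C (i - 1)" using ac by (auto simp: acyclic_def)
  then obtain t where t: "t \<in> car C (i - 1 - 1)" "c \<oplus>[C,i - 1] h (i - 1) w = mdiff C (i - 1 - 1) t" by (rule coboundariesE)
  have "mdiff C (i - 1 - 1) t \<oplus>[C,i - 1] h (i - 1) (\<ominus>[V,i - 1] w) = c"
   unfolding t(2)[symmetric] using Hom_neg[OF hH V C w(1)] c hw(1) C by (simp add: ag_assoc ag_simps)
  then have "u = mdiff (dg_cone V C h) (i - 1 - 1) (t, \<ominus>[V,i - 1] w)"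
   using diff_neg[OF V w(1)] w uv cocyclesD(1)[OF v] V by (simp add: ksign_def ag_simps)
  then show "u \<in> coboundaries ?Q i"
   unfolding shift_coboundaries[OF K] using t(1) w(1) V by (intro coboundariesI[of "(t, \<ominus>[V,i - 1] w)" _ "i - 1 - 1"]) (auto simp: ag_simps)
 next
  fix i v assume v: "v \<in> cocycles V i"
  have "h i v \<in> cocycles C i" using Cyc_cocycle[OF V C h v, of i] by simp
  then have hv: "h i v \<in> coboundaries C i" "h i v \<in> car C i" using ac by (auto simp: acyclic_def cocyclesD)
  obtain c where c: "c \<in> car C (i - 1)" "h i v = mdiff C (i - 1) c" using hv(1) by (rule coboundariesE)
  have "(\<ominus>[C,i - 1] c, v) \<in> cocycles ?Q i" unfolding z using diff_neg[OF C c(1)] c v hv C by (simp add: ag_simps)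
  moreover have "v \<oplus>[V,i] \<ominus>[V,i] ?q i (\<ominus>[C,i - 1] c, v) \<in> coboundaries V i"
   using cocyclesD(1)[OF v] coboundaries_subgroup(3)[OF V] c V C by (simp add: ag_simps)
  ultimately show "\<exists>u\<in>cocycles ?Q i. v \<oplus>[V,i] \<ominus>[V,i] ?q i u \<in> coboundaries V i" by blast
 qed
qed

text \<open>Take for \<open>U\<close> the homotopy pullback of \<open>f\<close> and \<open>s\<close>: the fibre of \<open>V \<rightarrow> X \<rightarrow> cone s\<close>.  Its projection to \<open>V\<close> is a
 quasi-isomorphism because the cone of \<open>s\<close> is acyclic, the component in \<open>Z\<close> gives \<open>f'\<close>, and the component
 in \<open>X\<close> is the homotopy.  Its elements are nested triples, which are recoded at the end.\<close>

lemma Ore_chain: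
 fixes p :: "'v \<times> 'v => 'v" and V X Z :: "('k, 'a, 'v) dg_mod"
 assumes p: "inj p" and V: "dgm V" and X: "dgm X" and Z: "dgm Z" and f: "f \<in> Cyc V X 0" and s: "s \<in> Cyc Z X 0" "qis Z X s"
 shows "\<exists>(U :: ('k, 'a, 'v) dg_mod) s' f'. dgm U & s' \<in> Cyc U V 0 & qis U V s' & f' \<in> Cyc U Z 0 &
  htp U X 0 (gcomp U 0 f s') (gcomp U 0 s f')"
proof -
 let ?C = "dg_cone Z X s"
 define h where "h = gcomp V 0 (cone_in Z X) f"
 let ?Q = "dg_shift (-1) (dg_cone V ?C h)"
 have C: "dgm ?C" using X Z s by simp
 have h: "h \<in> Cyc V ?C 0" unfolding h_def using Cyc_gcomp[OF V X C f] is_cone_cone[OF Z X s(1)] by (simp add: is_cone_def)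
 have Q: "dgm ?Q" using V C h by simp
 have ac: "acyclic ?C" using qis_cone[OF Z X s(1)] s(2) by simp
 note fH = CycH[OF f] and sH = CycH[OF s(1)]
 note cl = Hom_closed[OF fH _ HOL.refl, simplified] Hom_closed[OF sH _ HOL.refl, simplified]
 have ha: "h i v = (f i v, \<zero>[Z,i + 1])" if "v \<in> car V i" for i v using that cl(1) by (simp add: h_def cone_in_def)
 have cQ: "u \<in> car ?Q i \<longleftrightarrow> (\<exists>x z v. u = ((x, z), v) & x \<in> car X (i - 1) & z \<in> car Z i & v \<in> car V i)" for u i by auto
 have dQ: "mdiff ?Q i ((x, z), v) = ((\<ominus>[X,i] (mdiff X (i - 1) x \<oplus>[X,i] s i z \<oplus>[X,i] f i v), mdiff Z i z), mdiff V i v)"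
  if m: "x \<in> car X (i - 1)" "z \<in> car Z i" "v \<in> car V i" for i x z v
  using m cl diff_closed[OF X m(1), of i] diff_closed[OF Z m(2) HOL.refl] diff_closed[OF V m(3) HOL.refl] V X Z
  by (simp add: ksign_def ha module_sum_neg ag_simps)
 let ?q = "\<lambda>i. \<lambda>u\<in>car ?C (i - 1) \<times> car V i. snd u"
 (* the sign makes ?r a homotopy from f q to s g; without it the square would anticommute *)
 let ?g = "\<lambda>i. \<lambda>u\<in>car ?Q i. \<ominus>[Z,i] snd (fst u)"
 let ?r = "\<lambda>i. \<lambda>u\<in>car ?Q i. fst (fst u)"
 have dqg: "?q (i + 1) (mdiff ?Q i u) = mdiff V i (?q i u)" "?g (i + 1) (mdiff ?Q i u) = mdiff Z i (?g i u)" if u: "u \<in> car ?Q i" for i u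
 proof -
  obtain x z v where m: "u = ((x, z), v)" "x \<in> car X (i - 1)" "z \<in> car Z i" "v \<in> car V i" using u cQ by blast
  show "?q (i + 1) (mdiff ?Q i u) = mdiff V i (?q i u)" "?g (i + 1) (mdiff ?Q i u) = mdiff Z i (?g i u)"
   unfolding m(1) dQ[OF m(2-4)] using m cl diff_closed[OF X m(2), of i] diff_closed[OF Z m(3) HOL.refl] diff_closed[OF V m(4) HOL.refl] X Z
   by (simp_all add: ag_simps diff_neg)
 qed
 have q: "?q \<in> Cyc ?Q V 0" and g: "?g \<in> Cyc ?Q Z 0"
 proof -
  have qH: "?q \<in> Hom ?Q V 0" and gH: "?g \<in> Hom ?Q Z 0"
   using V X Z by (auto intro!: Hom_I simp: ag_simps act_closed act_neg_left module.smult_r_minus[OF dgm_module])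
  show "?q \<in> Cyc ?Q V 0" by (rule CycI_pointwise[OF Q V qH]) (simp only: dqg ksign_0 add_0_right)
  show "?g \<in> Cyc ?Q Z 0" by (rule CycI_pointwise[OF Q Z gH]) (simp only: dqg ksign_0 add_0_right)
 qed
 have r: "?r \<in> Hom ?Q X (-1)" using V X Z by (intro Hom_I) (auto simp: ag_simps act_closed)
 have fq: "gcomp ?Q 0 f ?q \<in> Cyc ?Q X 0" and sg: "gcomp ?Q 0 s ?g \<in> Cyc ?Q X 0" using Cyc_gcomp[OF Q V X q f] Cyc_gcomp[OF Q Z X g s(1)] by auto
 have "gcomp ?Q 0 s ?g = gcomp ?Q 0 f ?q \<oplus>[HM ?Q X 0] D ?Q X (-1) ?r"
 proof (rule Hom_eqI[OF CycH[OF sg] HM_add_closed[OF Q X CycH[OF fq] D_closed[OF Q X r]]])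
  fix i u assume u: "u \<in> car ?Q i"
  obtain x z v where m: "u = ((x, z), v)" "x \<in> car X (i - 1)" "z \<in> car Z i" "v \<in> car V i" using u cQ by blast
  have "s i (\<ominus>[Z,i] z) = f i v \<oplus>[X,i] (mdiff X (i - 1) x \<oplus>[X,i] \<ominus>[X,i] (mdiff X (i - 1) x \<oplus>[X,i] s i z \<oplus>[X,i] f i v))"
   using Hom_neg[OF sH Z X m(3)] cl(1)[OF m(4)] cl(2)[OF m(3)] diff_closed[OF X m(2), of i] X by (simp add: ag_simps ag_ac ag_cancel)
  moreover have "?r (i + 1) (mdiff ?Q i u) = \<ominus>[X,i] (mdiff X (i - 1) x \<oplus>[X,i] s i z \<oplus>[X,i] f i v)"
   unfolding m(1) dQ[OF m(2-4)] using m cl diff_closed[OF X m(2), of i] diff_closed[OF Z m(3) HOL.refl] diff_closed[OF V m(4) HOL.refl] X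
   by (simp add: ag_simps)
  moreover have "?g i u = \<ominus>[Z,i] z" "?q i u = v" "?r i u = x" using m by simp_all
  ultimately show "gcomp ?Q 0 s ?g i u = (gcomp ?Q 0 f ?q \<oplus>[HM ?Q X 0] D ?Q X (-1) ?r) i u"
   unfolding HM_add_apply[OF u] hom_diff_apply[OF u] gcomp_apply[OF u] by simp
 qed simp
 then have htp: "htp ?Q X 0 (gcomp ?Q 0 f ?q) (gcomp ?Q 0 s ?g)" using htp_D[OF Q X fq r] by simp
 let ?c = "\<lambda>((x, z), v). p (x, p (z, v))"
 have c: "inj ?c" by (rule injI) (auto simp: inj_eq[OF p])
 let ?U = "dg_code ?c ?Q" and ?E = "code_from ?c ?Q"
 have U: "dgm ?U" using c Q by (rule dgm_code)
 note E = code_Cyc[OF c Q]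
 have qE: "qis ?U ?Q ?E" by (rule qis_inverse[OF U Q E(2,1) code_inverse(2,1)[OF c]])
 have "gcomp ?U 0 ?q ?E \<in> Cyc ?U V 0" "gcomp ?U 0 ?g ?E \<in> Cyc ?U Z 0"
  using Cyc_gcomp[OF U Q V E(2) q] Cyc_gcomp[OF U Q Z E(2) g] by auto
 moreover have "qis ?U V (gcomp ?U 0 ?q ?E)" by (rule qis_comp[OF U Q V E(2) qE q fibre_qis[OF V C h ac]])
 moreover have "htp ?U X 0 (gcomp ?U 0 f (gcomp ?U 0 ?q ?E)) (gcomp ?U 0 s (gcomp ?U 0 ?g ?E))"
  using htp_comp_right[OF U Q X htp E(2), of 0]
  by (simp only: gcomp_assoc[OF CycH[OF E(2)], where p = 0 and h = f and g = ?q]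
   gcomp_assoc[OF CycH[OF E(2)], where p = 0 and h = s and g = ?g] add_0_left)
 ultimately show ?thesis using U by blast
qed

lemma HC_loc_add:
 assumes p: "inj (p :: 'v \<times> 'v => 'v)"
 shows "loc_add (HC :: (('k, 'a, 'v) dg_mod, (int => 'v => 'v) set) tri_cat) (quasi_isos K A)"
proof (intro loc_add.intro loc_add_axioms.intro HC_loc)
 fix X :: "('k, 'a, 'v) dg_mod" assume "X \<in> objs HC"
 then show "ids HC X \<in> quasi_isos K A X X" by (simp add: HC_simps quasi_isos_hclass Cyc_gid qis_gid)
next
 fix X Y Z :: "('k, 'a, 'v) dg_mod" and s t
 assume "X \<in> objs HC" "Y \<in> objs HC" "Z \<in> objs HC" and st: "s \<in> quasi_isos K A X Y" "t \<in> quasi_isos K A Y Z"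
 then have o: "dgm X" "dgm Y" "dgm Z" by (simp_all add: HC_simps)
 obtain f where f: "f \<in> Cyc X Y 0" "s = hc X Y f" "qis X Y f" using quasi_isoE[OF o(1,2) st(1)] .
 obtain g where g: "g \<in> Cyc Y Z 0" "t = hc Y Z g" "qis Y Z g" using quasi_isoE[OF o(2,3) st(2)] .
 show "cmps HC X Y Z t s \<in> quasi_isos K A X Z"
  using Cyc_gcomp[OF o f(1) g(1), of 0] qis_comp[OF o f(1,3) g(1,3)] by (simp add: HC_simps(3) f g o hcomp_hclass quasi_isos_hclass)
next
 fix X Y :: "('k, 'a, 'v) dg_mod" and F G
 assume "X \<in> objs HC" "Y \<in> objs HC" and FG: "F \<in> mors HC X Y" "G \<in> mors HC X Y"
 then have o: "dgm X" "dgm Y" by (simp_all add: HC_simps)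
 obtain f where f: "f \<in> Cyc X Y 0" "F = hc X Y f" using HC_morE[OF o FG(1)] .
 obtain g where g: "g \<in> Cyc X Y 0" "G = hc X Y g" using HC_morE[OF o FG(2)] .
 show "adds HC X Y F G \<in> mors HC X Y"
  using HC_mem[OF o Cyc_add[OF o f(1) g(1)]] by (simp add: HC_simps(4) f g o hadd_hclass)
next
 fix X V Z :: "('k, 'a, 'v) dg_mod" and F s
 assume "X \<in> objs HC" "V \<in> objs HC" "Z \<in> objs HC" and F: "F \<in> mors HC V X" and s: "s \<in> quasi_isos K A Z X"
 then have o: "dgm X" "dgm V" "dgm Z" by (simp_all add: HC_simps)
 obtain f where f: "f \<in> Cyc V X 0" "F = hc V X f" using HC_morE[OF o(2,1) F] .
 obtain g where g: "g \<in> Cyc Z X 0" "s = hc Z X g" "qis Z X g" using quasi_isoE[OF o(3,1) s] .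
 obtain U :: "('k, 'a, 'v) dg_mod" and s' f' where U: "dgm U" "s' \<in> Cyc U V 0" "qis U V s'" "f' \<in> Cyc U Z 0"
  "htp U X 0 (gcomp U 0 f s') (gcomp U 0 g f')" using Ore_chain[OF p o(2,1,3) f(1) g(1,3)] by metis
 have "cmps HC U Z X s (hc U Z f') = cmps HC U V X F (hc U V s')"
  using hclass_eq_iff[OF U(1) o(1) htpD(1)[OF U(5) U(1) o(1)] htpD(2)[OF U(5) U(1) o(1)]] U(5)
  by (simp add: HC_simps(3) f g U o hcomp_hclass)
 then show "\<exists>U\<in>objs HC. \<exists>s'\<in>quasi_isos K A U V. \<exists>f'\<in>mors HC U Z. cmps HC U Z X s f' = cmps HC U V X F s'"
  using U o HC_mem[OF U(1) o(3) U(4)] quasi_isos_hclass[OF U(1) o(2) U(2)]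
  by (intro bexI[of _ U] bexI[of _ "hc U V s'"] bexI[of _ "hc U Z f'"]) (simp_all add: HC_simps(1))
next
 fix X Y :: "('k, 'a, 'v) dg_mod" assume "X \<in> objs HC" "Y \<in> objs HC"
 then have o: "dgm X" "dgm Y" by (simp_all add: HC_simps)
 show "\<exists>R \<rho> S \<sigma>. loc_functor HC (quasi_isos K A) HC (quasi_isos K A) R \<rho> & loc_functor HC (quasi_isos K A) HC (quasi_isos K A) S \<sigma> & R Y = S X &
   (\<exists>\<Delta>\<in>mors HC X (R X). \<exists>\<mu>\<in>mors HC (S Y) Y. \<forall>Z\<in>objs HC. \<forall>s\<in>quasi_isos K A Z X. \<forall>a\<in>mors HC Z Y. \<forall>b\<in>mors HC Z Y.
    \<exists>u\<in>mors HC Z (R Z). \<exists>v\<in>mors HC Z (S Z).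
     cmps HC Z (R Z) (R X) (\<rho> Z X s) u = cmps HC Z X (R X) \<Delta> s &
     cmps HC Z (R Z) (R Y) (\<rho> Z Y b) u = cmps HC Z (S Z) (S X) (\<sigma> Z X s) v &
     cmps HC Z (S Y) Y \<mu> (cmps HC Z (S Z) (S Y) (\<sigma> Z Y a) v) = adds HC Z Y a b)"
  by (rule HC_sums[OF p o])
qed

end

section \<open>Dg functors are triangle functors\<close>

context dg_algebra begin

definition heqv :: "('k, 'a, 'm) dg_mod => ('k, 'a, 'n) dg_mod => (int => 'm => 'n) => bool" where
 "heqv X Y f \<longleftrightarrow> f \<in> Cyc X Y 0 & (\<exists>g\<in>Cyc Y X 0. htp X X 0 (gcomp X 0 g f) (gid X) & htp Y Y 0 (gcomp Y 0 f g) (gid Y))"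

lemma hiso_heqv: "[|dgm X; dgm Y|] ==> hiso K A X Y F \<longleftrightarrow> (\<exists>f. heqv X Y f & F = hc X Y f)"
 by (auto simp: hiso_iff heqv_def)

lemma heqv_inverse:
 "[|dgm X; dgm Y; f \<in> Cyc X Y 0; g \<in> Cyc Y X 0; gcomp X 0 g f = gid X; gcomp Y 0 f g = gid Y|] ==> heqv X Y f"
 unfolding heqv_def by (auto intro!: bexI[of _ g] htp_refl Cyc_gid)

lemma heqv_comp:
 assumes o: "dgm X" "dgm Y" "dgm Z" and f: "heqv X Y f" and g: "heqv Y Z g"
 shows "heqv X Z (gcomp X 0 g f)"
proof -
 obtain f' where f: "f \<in> Cyc X Y 0" "f' \<in> Cyc Y X 0" "htp X X 0 (gcomp X 0 f' f) (gid X)" "htp Y Y 0 (gcomp Y 0 f f') (gid Y)"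
  using f by (auto simp: heqv_def)
 obtain g' where g: "g \<in> Cyc Y Z 0" "g' \<in> Cyc Z Y 0" "htp Y Y 0 (gcomp Y 0 g' g) (gid Y)" "htp Z Z 0 (gcomp Z 0 g g') (gid Z)"
  using g by (auto simp: heqv_def)
 have gf: "gcomp X 0 g f \<in> Cyc X Z 0" "gcomp Z 0 f' g' \<in> Cyc Z X 0"
  using Cyc_gcomp[OF o f(1) g(1)] Cyc_gcomp[OF o(3,2,1) g(2) f(2)] by auto
 have "htp X X 0 (gcomp X 0 (gcomp Z 0 f' g') (gcomp X 0 g f)) (gid X)"
 proof -
  have "gcomp X 0 (gcomp Z 0 f' g') (gcomp X 0 g f) = gcomp X 0 f' (gcomp X 0 (gcomp Y 0 g' g) f)"
   using gcomp_assoc[OF CycH[OF gf(1)], of 0 f' g'] gcomp_assoc[OF CycH[OF f(1)], of 0 g' g] by simp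
  moreover have "htp X X 0 (gcomp X 0 f' (gcomp X 0 (gcomp Y 0 g' g) f)) (gcomp X 0 f' (gcomp X 0 (gid Y) f))"
   by (intro htp_comp_left[of _ Y _ 0 _ _ _ 0] htp_comp_right[of _ Y _ 0 _ _ _ 0] o f g) simp_all
  ultimately show ?thesis using htp_trans[OF o(1,1) _ f(3)] gcomp_gid_left[OF o(1,2) CycH[OF f(1)]] by simp
 qed
 moreover have "htp Z Z 0 (gcomp Z 0 (gcomp X 0 g f) (gcomp Z 0 f' g')) (gid Z)"
 proof -
  have "gcomp Z 0 (gcomp X 0 g f) (gcomp Z 0 f' g') = gcomp Z 0 g (gcomp Z 0 (gcomp Y 0 f f') g')"
   using gcomp_assoc[OF CycH[OF gf(2)], of 0 g f] gcomp_assoc[OF CycH[OF g(2)], of 0 f f'] by simp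
  moreover have "htp Z Z 0 (gcomp Z 0 g (gcomp Z 0 (gcomp Y 0 f f') g')) (gcomp Z 0 g (gcomp Z 0 (gid Y) g'))"
   by (intro htp_comp_left[of _ Y _ 0 _ _ _ 0] htp_comp_right[of _ Y _ 0 _ _ _ 0] o f g) simp_all
  ultimately show ?thesis using htp_trans[OF o(3,3) _ g(4)] gcomp_gid_left[OF o(3,2) CycH[OF g(2)]] by simp
 qed
 ultimately show ?thesis using gf unfolding heqv_def by blast
qed

lemma cone_out_shift:
 assumes "dgm X" "dgm Y"
 shows "gcomp (dg_cone X Y f) 1 (to_shift 1 X) (cone_out X Y) = cone_out X Y"
 by (auto simp: gcomp_def to_shift_def cone_out_def fun_eq_iff)

lemma cone_out_from_shift:
 assumes "dgm X" "dgm Y"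
 shows "gcomp (dg_cone X Y f) 0 (from_shift 1 X) (cone_out X Y) = cone_out X Y"
 by (auto simp: gcomp_def from_shift_def cone_out_def fun_eq_iff)

lemma cone_out_Cyc: assumes "dgm X" "dgm Y" "f \<in> Cyc X Y 0" shows "cone_out X Y \<in> Cyc (dg_cone X Y f) (dg_shift 1 X) 0"
proof -
 have "cone_out X Y \<in> Cyc (dg_cone X Y f) X 1" using is_cone_cone[OF assms] by (simp add: is_cone_def)
 then show ?thesis using Cyc_gcomp[OF _ assms(1) _ _ shift_Cyc(1)[OF assms(1), of 1], of "dg_cone X Y f" "cone_out X Y" 1 0]
  assms by (simp add: cone_out_shift)
qed

text \<open>A triangle in terms of chain maps: equivalent, through homotopy equivalences, to a standard one.\<close>

definition triangle_maps where
 "triangle_maps X Y Z f g h \<longleftrightarrow> f \<in> Cyc X Y 0 & g \<in> Cyc Y Z 0 & h \<in> Cyc Z (dg_shift 1 X) 0 &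
   (\<exists>(X' :: ('k, 'a, 'u) dg_mod) (Y' :: ('k, 'a, 'u) dg_mod) \<phi> \<alpha> \<beta> \<gamma>.
    dgm X' & dgm Y' & \<phi> \<in> Cyc X' Y' 0 & heqv X X' \<alpha> & heqv Y Y' \<beta> & heqv Z (dg_cone X' Y' \<phi>) \<gamma> &
    htp X Y' 0 (gcomp X 0 \<beta> f) (gcomp X 0 \<phi> \<alpha>) &
    htp Y (dg_cone X' Y' \<phi>) 0 (gcomp Y 0 \<gamma> g) (gcomp Y 0 (cone_in X' Y') \<beta>) &
    htp Z (dg_shift 1 X') 0 (gcomp Z 0 (conj_shift 1 X X' \<alpha>) h) (gcomp Z 0 (cone_out X' Y') \<gamma>))"
 for X Y Z :: "('k, 'a, 'u) dg_mod"

lemma htriangle_iff: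
 fixes X Y Z :: "('k, 'a, 'u) dg_mod"
 shows "htriangle K A X Y Z F G H \<longleftrightarrow> dgm X & dgm Y & dgm Z &
  (\<exists>f g h. triangle_maps X Y Z f g h & F = hc X Y f & G = hc Y Z g & H = hc Z (dg_shift 1 X) h)" (is "?L \<longleftrightarrow> ?R")
proof (cases "dgm X & dgm Y & dgm Z")
 case False then show ?thesis by (auto simp: htriangle_def)
next
 case True
 then have o: "dgm X" "dgm Y" "dgm Z" and o1: "dgm (dg_shift 1 X)" by simp_all
 have key: "(hcomp K A X Y' (hc Y Y' \<beta>) (hc X Y f) = hcomp K A X Y' (hc X' Y' \<phi>) (hc X X' \<alpha>) &
    hcomp K A Y (dg_cone X' Y' \<phi>) (hc Z (dg_cone X' Y' \<phi>) \<gamma>) (hc Y Z g) =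
     hcomp K A Y (dg_cone X' Y' \<phi>) (hc Y' (dg_cone X' Y' \<phi>) (cone_in X' Y')) (hc Y Y' \<beta>) &
    hcomp K A Z (dg_shift 1 X') (hshift 1 (hc X X' \<alpha>)) (hc Z (dg_shift 1 X) h) =
     hcomp K A Z (dg_shift 1 X') (hc (dg_cone X' Y' \<phi>) (dg_shift 1 X') (cone_out X' Y')) (hc Z (dg_cone X' Y' \<phi>) \<gamma>)) \<longleftrightarrow>
   htp X Y' 0 (gcomp X 0 \<beta> f) (gcomp X 0 \<phi> \<alpha>) &
    htp Y (dg_cone X' Y' \<phi>) 0 (gcomp Y 0 \<gamma> g) (gcomp Y 0 (cone_in X' Y') \<beta>) &
    htp Z (dg_shift 1 X') 0 (gcomp Z 0 (conj_shift 1 X X' \<alpha>) h) (gcomp Z 0 (cone_out X' Y') \<gamma>)"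
  if o': "dgm X'" "dgm Y'" and \<phi>: "\<phi> \<in> Cyc X' Y' 0" and m: "f \<in> Cyc X Y 0" "g \<in> Cyc Y Z 0" "h \<in> Cyc Z (dg_shift 1 X) 0"
   "\<alpha> \<in> Cyc X X' 0" "\<beta> \<in> Cyc Y Y' 0" "\<gamma> \<in> Cyc Z (dg_cone X' Y' \<phi>) 0"
  for X' Y' :: "('k, 'a, 'u) dg_mod" and \<phi> \<alpha> \<beta> \<gamma> f g h
 proof -
  have C: "dgm (dg_cone X' Y' \<phi>)" and X1: "dgm (dg_shift 1 X')" using o' \<phi> by simp_all
  have ci: "cone_in X' Y' \<in> Cyc Y' (dg_cone X' Y' \<phi>) 0" using is_cone_cone[OF o' \<phi>] by (simp add: is_cone_def)
  note co = cone_out_Cyc[OF o' \<phi>] and ca = conj_shift_Cyc[OF o(1) o'(1) m(4), of 1]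
  note r = hcomp_hclass[OF o(1,2) o'(2) m(1,5)] hcomp_hclass[OF o(1) o' m(4) \<phi>]
   hcomp_hclass[OF o(2,3) C m(2,6)] hcomp_hclass[OF o(2) o'(2) C m(5) ci]
   hshift_hclass[OF o(1) o'(1) m(4)] hcomp_hclass[OF o(3) o1 X1 m(3) ca] hcomp_hclass[OF o(3) C X1 m(6) co]
  note c = Cyc_gcomp[OF o(1,2) o'(2) m(1,5), of 0] Cyc_gcomp[OF o(1) o' m(4) \<phi>, of 0]
   Cyc_gcomp[OF o(2,3) C m(2,6), of 0] Cyc_gcomp[OF o(2) o'(2) C m(5) ci, of 0]
   Cyc_gcomp[OF o(3) o1 X1 m(3) ca, of 0] Cyc_gcomp[OF o(3) C X1 m(6) co, of 0]
  show ?thesis unfolding r using c o o' C X1 by (simp add: hclass_eq_iff)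
 qed
 show ?thesis
 proof
  assume ?L
  then obtain X' Y' :: "('k, 'a, 'u) dg_mod" and \<phi> \<alpha> \<beta> \<gamma> where F: "F \<in> hmors K A X Y" "G \<in> hmors K A Y Z" "H \<in> hmors K A Z (dg_shift 1 X)"
   and o': "dgm X'" "dgm Y'" and \<phi>: "\<phi> \<in> chain_maps K A X' Y'" and i: "hiso K A X X' \<alpha>" "hiso K A Y Y' \<beta>" "hiso K A Z (dg_cone X' Y' \<phi>) \<gamma>"
   and s: "hcomp K A X Y' \<beta> F = hcomp K A X Y' (hc X' Y' \<phi>) \<alpha>"
    "hcomp K A Y (dg_cone X' Y' \<phi>) \<gamma> G = hcomp K A Y (dg_cone X' Y' \<phi>) (hc Y' (dg_cone X' Y' \<phi>) (cone_in X' Y')) \<beta>"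
    "hcomp K A Z (dg_shift 1 X') (hshift 1 \<alpha>) H = hcomp K A Z (dg_shift 1 X') (hc (dg_cone X' Y' \<phi>) (dg_shift 1 X') (cone_out X' Y')) \<gamma>"
   unfolding htriangle_def by blast
  have \<phi>: "\<phi> \<in> Cyc X' Y' 0" using \<phi> chain_maps_Cyc[OF o'] by simp
  then have C: "dgm (dg_cone X' Y' \<phi>)" using o' by simp
  obtain f where f: "f \<in> Cyc X Y 0" "F = hc X Y f" using F(1) hmors_Cyc[OF o(1,2)] by auto
  obtain g where g: "g \<in> Cyc Y Z 0" "G = hc Y Z g" using F(2) hmors_Cyc[OF o(2,3)] by auto
  obtain h where h: "h \<in> Cyc Z (dg_shift 1 X) 0" "H = hc Z (dg_shift 1 X) h" using F(3) hmors_Cyc[OF o(3) o1] by auto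
  obtain a where a: "heqv X X' a" "\<alpha> = hc X X' a" using i(1) hiso_heqv[OF o(1) o'(1)] by auto
  obtain b where b: "heqv Y Y' b" "\<beta> = hc Y Y' b" using i(2) hiso_heqv[OF o(2) o'(2)] by auto
  obtain c where c: "heqv Z (dg_cone X' Y' \<phi>) c" "\<gamma> = hc Z (dg_cone X' Y' \<phi>) c" using i(3) hiso_heqv[OF o(3) C] by auto
  have m: "a \<in> Cyc X X' 0" "b \<in> Cyc Y Y' 0" "c \<in> Cyc Z (dg_cone X' Y' \<phi>) 0" using a b c by (auto simp: heqv_def)
  have "triangle_maps X Y Z f g h"
   unfolding triangle_maps_def using f(1) g(1) h(1) o' \<phi> a(1) b(1) c(1) key[OF o' \<phi> f(1) g(1) h(1) m] s[unfolded f(2) g(2) h(2) a(2) b(2) c(2)] by blast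
  then show ?R using o f g h by blast
 next
  assume ?R
  then obtain f g h where t: "triangle_maps X Y Z f g h" and e: "F = hc X Y f" "G = hc Y Z g" "H = hc Z (dg_shift 1 X) h" by blast
  obtain X' Y' :: "('k, 'a, 'u) dg_mod" and \<phi> a b c where m: "f \<in> Cyc X Y 0" "g \<in> Cyc Y Z 0" "h \<in> Cyc Z (dg_shift 1 X) 0"
   and o': "dgm X'" "dgm Y'" and \<phi>: "\<phi> \<in> Cyc X' Y' 0" and i: "heqv X X' a" "heqv Y Y' b" "heqv Z (dg_cone X' Y' \<phi>) c"
   and s: "htp X Y' 0 (gcomp X 0 b f) (gcomp X 0 \<phi> a) &
    htp Y (dg_cone X' Y' \<phi>) 0 (gcomp Y 0 c g) (gcomp Y 0 (cone_in X' Y') b) &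
    htp Z (dg_shift 1 X') 0 (gcomp Z 0 (conj_shift 1 X X' a) h) (gcomp Z 0 (cone_out X' Y') c)"
   using t unfolding triangle_maps_def by blast
  have C: "dgm (dg_cone X' Y' \<phi>)" using o' \<phi> by simp
  have m': "a \<in> Cyc X X' 0" "b \<in> Cyc Y Y' 0" "c \<in> Cyc Z (dg_cone X' Y' \<phi>) 0" using i by (auto simp: heqv_def)
  have h: "hiso K A X X' (hc X X' a)" "hiso K A Y Y' (hc Y Y' b)" "hiso K A Z (dg_cone X' Y' \<phi>) (hc Z (dg_cone X' Y' \<phi>) c)"
   using i o o' C by (auto simp: hiso_heqv)
  have "F \<in> hmors K A X Y" "G \<in> hmors K A Y Z" "H \<in> hmors K A Z (dg_shift 1 X)"
   using m unfolding e hmors_Cyc[OF o(1,2)] hmors_Cyc[OF o(2,3)] hmors_Cyc[OF o(3) o1] by blast+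
  then show ?L unfolding htriangle_def e
   using o o' \<phi>[folded chain_maps_Cyc[OF o']] h key[OF o' \<phi> m m'] s by blast
 qed
qed

lemma is_cone_pointwise:
 assumes o: "dgm X" "dgm Y" "dgm C" and c: "is_cone X Y C f g h \<sigma> \<rho>"
 shows "c \<in> car C i ==> g i (\<rho> i c) \<oplus>[C,i] \<sigma> (i + 1) (h i c) = c"
  and "y \<in> car Y i ==> \<rho> i (g i y) = y" and "x \<in> car X i ==> h (i - 1) (\<sigma> i x) = x"
  and "y \<in> car Y i ==> h i (g i y) = \<zero>[X,i + 1]" and "x \<in> car X i ==> \<rho> (i - 1) (\<sigma> i x) = \<zero>[Y,i - 1]"
  and "c \<in> car C i ==> mdiff Y i (\<rho> i c) = \<rho> (i + 1) (mdiff C i c) \<oplus>[Y,i + 1] \<ominus>[Y,i + 1] f (i + 1) (h i c)"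
  and "x \<in> car X i ==> mdiff C (i - 1) (\<sigma> i x) = g i (f i x) \<oplus>[C,i] \<ominus>[C,i] \<sigma> (i + 1) (mdiff X i x)"
  and "c \<in> car C i ==> h (i + 1) (mdiff C i c) = \<ominus>[X,i + 1 + 1] mdiff X (i + 1) (h i c)"
proof -
 note c' = c[unfolded is_cone_def]
 have H: "f \<in> Hom X Y 0" "g \<in> Hom Y C 0" "h \<in> Hom C X 1" "\<sigma> \<in> Hom X C (-1)" "\<rho> \<in> Hom C Y 0" using c' by (auto dest: CycD)
 note cl = Hom_closed[OF H(1) _ HOL.refl] Hom_closed[OF H(2) _ HOL.refl] Hom_closed[OF H(3) _ HOL.refl] Hom_closed[OF H(4) _ HOL.refl] Hom_closed[OF H(5) _ HOL.refl]
 have e: "gcomp C 0 g \<rho> \<oplus>[HM C C 0] gcomp C 1 \<sigma> h = gid C" "gcomp Y 0 \<rho> g = gid Y" "gcomp X (-1) h \<sigma> = gid X"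
   "gcomp Y 0 h g = \<zero>[HM Y X 1]" "gcomp X (-1) \<rho> \<sigma> = \<zero>[HM X Y (-1)]"
   "D C Y 0 \<rho> = \<ominus>[HM C Y 1] gcomp C 1 f h" "D X C (-1) \<sigma> = gcomp X 0 g f" using c' by auto
 note e = e[THEN fun_cong, THEN fun_cong]
 show "c \<in> car C i ==> g i (\<rho> i c) \<oplus>[C,i] \<sigma> (i + 1) (h i c) = c" using e(1)[of i c] by simp
 show "y \<in> car Y i ==> \<rho> i (g i y) = y" using e(2)[of i y] by simp
 show "x \<in> car X i ==> h (i - 1) (\<sigma> i x) = x" using e(3)[of i x] by simp
 show "y \<in> car Y i ==> h i (g i y) = \<zero>[X,i + 1]" using e(4)[of i y] by simp
 show "x \<in> car X i ==> \<rho> (i - 1) (\<sigma> i x) = \<zero>[Y,i - 1]" using e(5)[of i x] by simp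
 { assume x: "c \<in> car C i"
  have c1: "mdiff Y i (\<rho> i c) \<in> car Y (i + 1)" "\<rho> (i + 1) (mdiff C i c) \<in> car Y (i + 1)" "f (i + 1) (h i c) \<in> car Y (i + 1)"
   using x o cl(5)[OF x] cl(5)[OF diff_closed[OF o(3) x HOL.refl]] cl(1)[OF cl(3)[OF x]] by (simp_all add: diff_closed)
  have "mdiff Y i (\<rho> i c) \<oplus>[Y,i + 1] \<ominus>[Y,i + 1] \<rho> (i + 1) (mdiff C i c) = \<ominus>[Y,i + 1] f (i + 1) (h i c)"
   using e(6)[of i c] x HM_neg_apply[OF o(3,2) gcomp_closed[OF o(3) H(3,1), of 1] x] by (simp add: hom_diff_apply ksign_def)
  then have "\<rho> (i + 1) (mdiff C i c) \<oplus>[Y,i + 1] (mdiff Y i (\<rho> i c) \<oplus>[Y,i + 1] \<ominus>[Y,i + 1] \<rho> (i + 1) (mdiff C i c))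
    = \<rho> (i + 1) (mdiff C i c) \<oplus>[Y,i + 1] \<ominus>[Y,i + 1] f (i + 1) (h i c)" by simp
  then show "mdiff Y i (\<rho> i c) = \<rho> (i + 1) (mdiff C i c) \<oplus>[Y,i + 1] \<ominus>[Y,i + 1] f (i + 1) (h i c)"
   using c1 o by (simp add: ag_cancel) }
 { assume x: "x \<in> car X i"
  have c1: "mdiff C (i - 1) (\<sigma> i x) \<in> car C i" "\<sigma> (i + 1) (mdiff X i x) \<in> car C i" "g i (f i x) \<in> car C i"
   using x o cl(4)[OF x] cl(4)[OF diff_closed[OF o(1) x HOL.refl]] cl(2)[OF cl(1)[OF x]] by (simp_all add: diff_closed)
  have "g i (f i x) = mdiff C (i - 1) (\<sigma> i x) \<oplus>[C,i] \<sigma> (i + 1) (mdiff X i x)"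
   using e(7)[of i x] x by (simp add: hom_diff_apply ksign_def)
  then show "mdiff C (i - 1) (\<sigma> i x) = g i (f i x) \<oplus>[C,i] \<ominus>[C,i] \<sigma> (i + 1) (mdiff X i x)"
   using c1 o by (simp add: ag_assoc ag_simps) }
 assume x: "c \<in> car C i"
 have "mdiff X (i + 1) (h i c) = \<ominus>[X,i + 1 + 1] h (i + 1) (mdiff C i c)"
  using Cyc_diff[OF o(3,1) _ x HOL.refl, of h 1] c' by (simp add: ksign_def)
 then show "h (i + 1) (mdiff C i c) = \<ominus>[X,i + 1 + 1] mdiff X (i + 1) (h i c)"
  using x o cl(3)[OF diff_closed[OF o(3) x HOL.refl]] by (simp add: ag_simps)
qed

lemma Cyc_inverse:
 assumes X: "dgm X" and Y: "dgm Y" and f: "f \<in> Cyc X Y 0"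
  and g: "\<And>i. g i \<in> extensional (car Y i)" "\<And>i y. y \<in> car Y i ==> g i y \<in> car X i"
  and gf: "\<And>i x. x \<in> car X i ==> g i (f i x) = x" and fg: "\<And>i y. y \<in> car Y i ==> f i (g i y) = y"
 shows "g \<in> Cyc Y X 0"
proof -
 note fH = CycH[OF f]
 have "g \<in> Hom Y X 0"
 proof (rule Hom_I)
  fix i y assume y: "y \<in> car Y i"
  note gy = g(2)[OF y]
  show "g i (y \<oplus>[Y,i] z) = g i y \<oplus>[X,i + 0] g i z" if z: "z \<in> car Y i" for z
   using gf[OF ag_add_closed[OF dgm_ag[OF X] gy g(2)[OF z]]] Hom_add[OF fH gy g(2)[OF z]] fg[OF y] fg[OF z] by simp
  show "g i (c \<odot>[Y,i] y) = c \<odot>[X,i + 0] g i y" if c: "c \<in> carrier K" for c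
   using gf[OF smult_closed[OF X c gy]] Hom_smult[OF fH c gy] fg[OF y] by simp
  show "g (i + k) (mact Y i k y a) = mact X (i + 0) k (g i y) a" if a: "a \<in> acar k" for k a
   using gf[OF act_closed[OF X gy a HOL.refl]] Hom_act[OF fH gy a HOL.refl] fg[OF y] by simp
 qed (use g in simp_all)
 then show ?thesis
 proof (rule CycI_pointwise[OF Y X])
  fix i y assume y: "y \<in> car Y i"
  show "mdiff X (i + 0) (g i y) = ksign (mcomp X (i + 0 + 1)) 0 (g (i + 1) (mdiff Y i y))"
   using gf[OF diff_closed[OF X g(2)[OF y] HOL.refl]] Cyc_diff[OF X Y f g(2)[OF y], of i] fg[OF y] by simp
 qed
qed

text \<open>The two projections \<open>\<rho>\<close> and \<open>h\<close> of an abstract cone identify it with the standard one.\<close>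

lemma is_cone_standard:
 assumes o: "dgm X" "dgm Y" "dgm C" and c: "is_cone X Y C f g h \<sigma> \<rho>"
 defines "\<theta> \<equiv> dpair C \<rho> h"
 shows "heqv C (dg_cone X Y f) \<theta>" "gcomp Y 0 \<theta> g = cone_in X Y" "gcomp C 0 (cone_out X Y) \<theta> = h"
proof -
 note pw = is_cone_pointwise[OF o c]
 have H: "f \<in> Cyc X Y 0" "g \<in> Cyc Y C 0" "h \<in> Cyc C X 1" "\<sigma> \<in> Hom X C (-1)" "\<rho> \<in> Hom C Y 0" using c by (auto simp: is_cone_def)
 note HH = H(1-3)[THEN CycH]
 have K: "dgm (dg_cone X Y f)" using o H(1) by simp
 note cl = Hom_closed[OF HH(1) _ HOL.refl, simplified] Hom_closed[OF HH(2) _ HOL.refl, simplified] Hom_closed[OF HH(3) _ HOL.refl]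
  Hom_closed[OF H(4), of _ "i + 1" i for i, simplified] Hom_closed[OF H(5) _ HOL.refl, simplified]
 have a: "\<theta> i u = (\<rho> i u, h i u)" if "u \<in> car C i" for i u using that by (simp add: \<theta>_def dpair_def)
 have t: "\<theta> \<in> Cyc C (dg_cone X Y f) 0"
 proof (rule CycI_pointwise[OF o(3) K])
  show "\<theta> \<in> Hom C (dg_cone X Y f) 0"
   by (rule Hom_I) (use o in \<open>simp_all add: \<theta>_def dpair_def cl ag_add_closed act_closed Hom_add[OF HH(3)] Hom_add[OF H(5)]
    Hom_smult[OF HH(3)] Hom_smult[OF H(5)] Hom_act[OF HH(3)] Hom_act[OF H(5)] ac_simps\<close>)
  fix i u assume u: "u \<in> car C i"
  note du = diff_closed[OF o(3) u HOL.refl]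
  show "mdiff (dg_cone X Y f) (i + 0) (\<theta> i u) = ksign (mcomp (dg_cone X Y f) (i + 0 + 1)) 0 (\<theta> (i + 1) (mdiff C i u))"
   using pw(6)[OF u] pw(8)[OF u] a[OF u] a[OF du] cl(5)[OF du] cl(1)[OF cl(3)[OF u]] o by (simp add: ag_assoc ag_simps)
 qed
 let ?s = "\<lambda>i. \<lambda>u\<in>car (dg_cone X Y f) i. g i (fst u) \<oplus>[C,i] \<sigma> (i + 1) (snd u)"
 have s: "?s i u \<in> car C i" "\<theta> i (?s i u) = u" if u: "u \<in> car (dg_cone X Y f) i" for i u
 proof -
  obtain y x where m: "u = (y, x)" "y \<in> car Y i" "x \<in> car X (i + 1)" using u by auto
  note gs = cl(2)[OF m(2)] cl(4)[OF m(3)]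
  show c: "?s i u \<in> car C i" using gs m o by (simp add: ag_add_closed)
  show "\<theta> i (?s i u) = u"
   using a[OF c] Hom_add[OF H(5) gs] Hom_add[OF HH(3) gs] pw(2,4)[OF m(2)] pw(3,5)[OF m(3)] m o by (simp add: ag_simps)
 qed
 have st: "?s i (\<theta> i u) = u" if "u \<in> car C i" for i u using Hom_closed[OF CycH[OF t] that HOL.refl] pw(1)[OF that] a[OF that] by simp
 define s' where "s' = ?s"
 have sC: "s' \<in> Cyc (dg_cone X Y f) C 0" unfolding s'_def by (rule Cyc_inverse[OF o(3) K t]) (simp_all only: s st restrict_extensional)
 have st': "s' i (\<theta> i u) = u" if "u \<in> car C i" for i u unfolding s'_def by (rule st[OF that])
 have ts: "\<theta> i (s' i u) = u" if "u \<in> car (dg_cone X Y f) i" for i u unfolding s'_def by (rule s(2)[OF that])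
 note H' = CycH[OF sC] CycH[OF t]
 have "gcomp C 0 s' \<theta> = gid C"
  by (rule Hom_eqI[OF gcomp_closed[OF o(3) H'(2,1)] gid_closed[OF o(3)]]) (simp_all only: gcomp_def gid_def restrict_apply if_True add_0_right st')
 moreover have "gcomp (dg_cone X Y f) 0 \<theta> s' = gid (dg_cone X Y f)"
  by (rule Hom_eqI[OF gcomp_closed[OF K H'(1,2)] gid_closed[OF K]]) (simp_all only: gcomp_def gid_def restrict_apply if_True add_0_right ts)
 ultimately show "heqv C (dg_cone X Y f) \<theta>" by (rule heqv_inverse[OF o(3) K t sC])
 show "gcomp Y 0 \<theta> g = cone_in X Y" using cl(2) a pw(2,4) by (auto simp: gcomp_def cone_in_def fun_eq_iff)
 show "gcomp C 0 (cone_out X Y) \<theta> = h"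
  by (rule ext) (rule extensionalityI[of _ "car C _"], use a cl(3,5) HH(3) in \<open>auto simp: gcomp_def cone_out_def hom_set_def\<close>)
qed

text \<open>The equations of a cone are invariant under isomorphism of the cone object.\<close>

lemma is_cone_transport:
 assumes o: "dgm X" "dgm Y" "dgm C" "dgm C'" and c: "is_cone X Y C f g h \<sigma> \<rho>"
  and E: "e \<in> Cyc C C' 0" "e' \<in> Cyc C' C 0" "gcomp C 0 e' e = gid C" "gcomp C' 0 e e' = gid C'"
 shows "is_cone X Y C' f (gcomp Y 0 e g) (gcomp C' 0 h e') (gcomp X (-1) e \<sigma>) (gcomp C' 0 \<rho> e')"
proof -
 have H: "f \<in> Cyc X Y 0" "g \<in> Cyc Y C 0" "h \<in> Cyc C X 1" "\<sigma> \<in> Hom X C (-1)" "\<rho> \<in> Hom C Y 0"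
   "D X C (-1) \<sigma> = gcomp X 0 g f" "D C Y 0 \<rho> = \<ominus>[HM C Y 1] gcomp C 1 f h"
   "gcomp C 0 g \<rho> \<oplus>[HM C C 0] gcomp C 1 \<sigma> h = gid C" "gcomp Y 0 \<rho> g = gid Y" "gcomp X (-1) h \<sigma> = gid X"
   "gcomp Y 0 h g = \<zero>[HM Y X 1]" "gcomp X (-1) \<rho> \<sigma> = \<zero>[HM X Y (-1)]" using c by (auto simp: is_cone_def)
 note HH = H(1-3)[THEN CycH] and EH = E(1,2)[THEN CycH]
 have g': "gcomp Y 0 e g \<in> Cyc Y C' 0" and h': "gcomp C' 0 h e' \<in> Cyc C' X 1"
  using Cyc_gcomp[OF o(2,3,4) H(2) E(1)] Cyc_gcomp[OF o(4,3,1) E(2) H(3)] by auto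
 have s': "gcomp X (-1) e \<sigma> \<in> Hom X C' (-1)" and r': "gcomp C' 0 \<rho> e' \<in> Hom C' Y 0"
  using gcomp_closed[OF o(1) H(4) EH(1)] gcomp_closed[OF o(4) EH(2) H(5)] by auto
 have cl: "gcomp X 0 e (gcomp X 0 g f) \<in> Hom X C' 0" "gcomp C 1 f h \<in> Hom C Y 1" "gcomp C' 0 (gcomp C 1 f h) e' \<in> Hom C' Y 1"
  "gcomp C 0 g \<rho> \<in> Hom C C 0" "gcomp C 1 \<sigma> h \<in> Hom C C 0"
  using gcomp_closed[OF o(1) gcomp_closed[OF o(1) HH(1,2) HOL.refl] EH(1)] gcomp_closed[OF o(3) HH(3,1)]
   gcomp_closed[OF o(4) EH(2) gcomp_closed[OF o(3) HH(3,1) HOL.refl]] gcomp_closed[OF o(3) H(5) HH(2)] gcomp_closed[OF o(3) HH(3) H(4)] by auto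
 have Ds: "D X C' (-1) (gcomp X (-1) e \<sigma>) = gcomp X 0 (gcomp Y 0 e g) f"
  using D_gcomp[OF o(1,3,4) H(4) EH(1), of "-1"] CycD(2)[OF E(1)] gcomp_zero_left[OF o(1,3,4) H(4), of 0 1] H(6) cl(1) o
   gcomp_assoc[OF HH(1), of 0 e g] by (simp add: ag_l_zero)
 have Dr: "D C' Y 0 (gcomp C' 0 \<rho> e') = \<ominus>[HM C' Y 1] gcomp C' 1 f (gcomp C' 0 h e')"
  using D_gcomp[OF o(4,3,2) EH(2) H(5), of 0] CycD(2)[OF E(2)] gcomp_zero_right[OF o(4,3,2) H(5), of 1 1] H(7) cl(3) o
   gcomp_neg_left[OF o(4,3,2) EH(2) cl(2), of 1] gcomp_assoc[OF EH(2), of 1 f h] by (simp add: ag_r_zero HM_neg_closed)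
 have pe: "e' i (e i x) = x" if "x \<in> car C i" for i x using fun_cong[OF fun_cong[OF E(3)], of i x] that by simp
 have pe': "e i (e' i x) = x" if "x \<in> car C' i" for i x using fun_cong[OF fun_cong[OF E(4)], of i x] that by simp
 note pw = is_cone_pointwise[OF o(1-3) c]
 note k = Hom_closed[OF HH(1)] Hom_closed[OF HH(2)] Hom_closed[OF HH(3)] Hom_closed[OF H(4)] Hom_closed[OF H(5)] Hom_closed[OF EH(1)] Hom_closed[OF EH(2)]
 have 1: "gcomp C' 0 (gcomp Y 0 e g) (gcomp C' 0 \<rho> e') \<oplus>[HM C' C' 0] gcomp C' 1 (gcomp X (-1) e \<sigma>) (gcomp C' 0 h e') = gid C'"
 proof (rule Hom_eqI[OF HM_add_closed[OF o(4,4)] gid_closed[OF o(4)]])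
  show "gcomp C' 0 (gcomp Y 0 e g) (gcomp C' 0 \<rho> e') \<in> Hom C' C' 0" "gcomp C' 1 (gcomp X (-1) e \<sigma>) (gcomp C' 0 h e') \<in> Hom C' C' 0"
   using gcomp_closed[OF o(4) r' CycH[OF g']] gcomp_closed[OF o(4) CycH[OF h'] s'] by auto
  fix i x assume x: "x \<in> car C' i"
  have m: "e' i x \<in> car C i" "\<rho> i (e' i x) \<in> car Y i" "h i (e' i x) \<in> car X (i + 1)" "g i (\<rho> i (e' i x)) \<in> car C i"
   using x k by simp_all
  note m = m k(4)[OF m(3), of i, simplified]
  show "(gcomp C' 0 (gcomp Y 0 e g) (gcomp C' 0 \<rho> e') \<oplus>[HM C' C' 0] gcomp C' 1 (gcomp X (-1) e \<sigma>) (gcomp C' 0 h e')) i x = gid C' i x"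
   using x m Hom_add[OF EH(1) m(4,5)] pw(1)[OF m(1)] pe'[OF x] by simp
 qed
 have 2: "gcomp Y 0 (gcomp C' 0 \<rho> e') (gcomp Y 0 e g) = gid Y" "gcomp X (-1) (gcomp C' 0 h e') (gcomp X (-1) e \<sigma>) = gid X"
   "gcomp Y 0 (gcomp C' 0 h e') (gcomp Y 0 e g) = \<zero>[HM Y X 1]" "gcomp X (-1) (gcomp C' 0 \<rho> e') (gcomp X (-1) e \<sigma>) = \<zero>[HM X Y (-1)]"
  using k pe pw(2-5) by (simp_all add: gcomp_def gid_def hom_module_def fun_eq_iff restrict_def)
 show ?thesis unfolding is_cone_def using H(1) g' h' s' r' Ds Dr 1 2 by simp
qed

lemma shift_conj:
 assumes "f \<in> Hom X Y 0"
 shows "gcomp (dg_shift s X) 0 (from_shift s Y) (conj_shift s X Y f) = gcomp (dg_shift s X) s f (from_shift s X)"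
  and "gcomp X (- s) (conj_shift s X Y f) (to_shift s X) = gcomp X 0 (to_shift s Y) f"
 unfolding conj_shift_eq[OF assms] using Hom_closed[OF assms]
 by (auto simp: gcomp_def from_shift_def to_shift_def fun_eq_iff)

end

text \<open>The maps \<open>\<Phi>\<close> are defined on homogeneous elements of every degree, because cones and homotopies involve elements
 of degree \<open>-1\<close>, \<open>0\<close> and \<open>1\<close>.\<close>

locale dg_functor = B: dg_algebra K B + C: dg_algebra K C
 for K :: "'k ring" and B :: "('k, 'b) dg_alg" and C :: "('k, 'c) dg_alg" +
 fixes F :: "('k, 'b, 'v) dg_mod => ('k, 'c, 'w) dg_mod"
  and \<Phi> :: "('k, 'b, 'v) dg_mod => ('k, 'b, 'v) dg_mod => int => (int => 'v => 'v) => (int => 'w => 'w)"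
 assumes F_dgm: "B.dgm X ==> C.dgm (F X)"
  and \<Phi>_Hom: "[|B.dgm X; B.dgm Y; f \<in> B.Hom X Y n|] ==> \<Phi> X Y n f \<in> C.Hom (F X) (F Y) n"
  and \<Phi>_add: "[|B.dgm X; B.dgm Y; f \<in> B.Hom X Y n; g \<in> B.Hom X Y n|] ==>
   \<Phi> X Y n (f \<oplus>[B.HM X Y n] g) = \<Phi> X Y n f \<oplus>[C.HM (F X) (F Y) n] \<Phi> X Y n g"
  and \<Phi>_gid: "B.dgm X ==> \<Phi> X X 0 (gid X) = gid (F X)"
  and \<Phi>_gcomp: "[|B.dgm X; B.dgm Y; B.dgm Z; f \<in> B.Hom X Y q; g \<in> B.Hom Y Z p; r = q + p|] ==>
   \<Phi> X Z r (gcomp X q g f) = gcomp (F X) q (\<Phi> Y Z p g) (\<Phi> X Y q f)"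
  and \<Phi>_D: "[|B.dgm X; B.dgm Y; f \<in> B.Hom X Y n; m = n + 1|] ==>
   \<Phi> X Y m (hom_diff X Y n f) = hom_diff (F X) (F Y) n (\<Phi> X Y n f)"
begin

lemma \<Phi>_zero: "[|B.dgm X; B.dgm Y|] ==> \<Phi> X Y n \<zero>[B.HM X Y n] = \<zero>[C.HM (F X) (F Y) n]"
 by (rule additive_zero[of "B.HM X Y n" "C.HM (F X) (F Y) n"]) (auto simp: F_dgm \<Phi>_Hom \<Phi>_add)

lemma \<Phi>_neg: "[|B.dgm X; B.dgm Y; f \<in> B.Hom X Y n|] ==> \<Phi> X Y n (\<ominus>[B.HM X Y n] f) = \<ominus>[C.HM (F X) (F Y) n] \<Phi> X Y n f"
 by (rule additive_neg[of "B.HM X Y n" "C.HM (F X) (F Y) n"]) (auto simp: F_dgm \<Phi>_Hom \<Phi>_add)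

lemma \<Phi>_CycN: "[|B.dgm X; B.dgm Y; f \<in> B.Cyc X Y n|] ==> \<Phi> X Y n f \<in> C.Cyc (F X) (F Y) n"
 using \<Phi>_D[of X Y f n "n + 1"] by (auto simp: B.Cyc_def C.Cyc_def \<Phi>_Hom \<Phi>_zero)

lemma \<Phi>_htpN: assumes o: "B.dgm X" "B.dgm Y" and h: "B.htp X Y n f g" shows "C.htp (F X) (F Y) n (\<Phi> X Y n f) (\<Phi> X Y n g)"
proof -
 obtain h where f: "f \<in> B.Cyc X Y n" and h: "h \<in> B.Hom X Y (n - 1)" "g = f \<oplus>[B.HM X Y n] hom_diff X Y (n - 1) h"
  using h B.htp_def by blast
 have "\<Phi> X Y n g = \<Phi> X Y n f \<oplus>[C.HM (F X) (F Y) n] hom_diff (F X) (F Y) (n - 1) (\<Phi> X Y (n - 1) h)"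
  unfolding h(2) using \<Phi>_add[OF o B.CycH[OF f] B.D_closed[OF o h(1)]] \<Phi>_D[OF o h(1), of n] by simp
 then show ?thesis unfolding C.htp_def using \<Phi>_CycN[OF o f] \<Phi>_Hom[OF o h(1)] by blast
qed

sublocale chain_functor K B C F "\<lambda>X Y. \<Phi> X Y 0"
 by (intro chain_functor.intro chain_functor_axioms.intro B.dg_algebra_axioms C.dg_algebra_axioms F_dgm \<Phi>_htpN \<Phi>_gid)
   (auto intro!: \<Phi>_gcomp B.CycD)

lemma \<Phi>_heqv: assumes o: "B.dgm X" "B.dgm Y" and f: "B.heqv X Y f" shows "C.heqv (F X) (F Y) (\<Phi> X Y 0 f)"
proof -
 obtain g where f: "f \<in> B.Cyc X Y 0" "g \<in> B.Cyc Y X 0" "B.htp X X 0 (gcomp X 0 g f) (gid X)" "B.htp Y Y 0 (gcomp Y 0 f g) (gid Y)"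
  using f by (auto simp: B.heqv_def)
 show ?thesis unfolding C.heqv_def
  using \<Psi>_Cyc[OF o f(1)] \<Psi>_Cyc[OF o(2,1) f(2)] \<Phi>_htpN[OF o(1,1) f(3)] \<Phi>_htpN[OF o(2,2) f(4)]
   \<Psi>_gcomp[OF o(1,2,1) f(1,2)] \<Psi>_gcomp[OF o(2,1,2) f(2,1)] o by (auto simp: \<Phi>_gid)
qed

text \<open>The data of a cone are equations between compositions and differentials, so they are preserved.\<close>

lemma \<Phi>_is_cone:
 assumes o: "B.dgm X" "B.dgm Y" "B.dgm Z" and c: "B.is_cone X Y Z f g h \<sigma> \<rho>"
 shows "C.is_cone (F X) (F Y) (F Z) (\<Phi> X Y 0 f) (\<Phi> Y Z 0 g) (\<Phi> Z X 1 h) (\<Phi> X Z (-1) \<sigma>) (\<Phi> Z Y 0 \<rho>)"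
proof -
 have H: "f \<in> B.Cyc X Y 0" "g \<in> B.Cyc Y Z 0" "h \<in> B.Cyc Z X 1" "\<sigma> \<in> B.Hom X Z (-1)" "\<rho> \<in> B.Hom Z Y 0"
   "hom_diff X Z (-1) \<sigma> = gcomp X 0 g f" "hom_diff Z Y 0 \<rho> = \<ominus>[B.HM Z Y 1] gcomp Z 1 f h"
   "gcomp Z 0 g \<rho> \<oplus>[B.HM Z Z 0] gcomp Z 1 \<sigma> h = gid Z" "gcomp Y 0 \<rho> g = gid Y" "gcomp X (-1) h \<sigma> = gid X"
   "gcomp Y 0 h g = \<zero>[B.HM Y X 1]" "gcomp X (-1) \<rho> \<sigma> = \<zero>[B.HM X Y (-1)]" using c by (auto simp: B.is_cone_def)
 note HH = H(1-3)[THEN B.CycH]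
 have cl: "gcomp Z 1 f h \<in> B.Hom Z Y 1" "gcomp Z 0 g \<rho> \<in> B.Hom Z Z 0" "gcomp Z 1 \<sigma> h \<in> B.Hom Z Z 0"
  using B.gcomp_closed[OF o(3) HH(3,1)] B.gcomp_closed[OF o(3) H(5) HH(2)] B.gcomp_closed[OF o(3) HH(3) H(4)] by auto
 note co = \<Phi>_gcomp[OF o(1,2,3) HH(1,2), of 0] \<Phi>_gcomp[OF o(3,1,2) HH(3,1), of 1] \<Phi>_gcomp[OF o(3,2,3) H(5) HH(2), of 0]
  \<Phi>_gcomp[OF o(3,1,3) HH(3) H(4), of 0] \<Phi>_gcomp[OF o(2,3,2) HH(2) H(5), of 0] \<Phi>_gcomp[OF o(1,3,1) H(4) HH(3), of 0]
  \<Phi>_gcomp[OF o(2,3,1) HH(2,3), of 1] \<Phi>_gcomp[OF o(1,3,2) H(4,5), of "-1"]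
 show ?thesis unfolding C.is_cone_def
  using \<Phi>_CycN[OF o(1,2) H(1)] \<Phi>_CycN[OF o(2,3) H(2)] \<Phi>_CycN[OF o(3,1) H(3)] \<Phi>_Hom[OF o(1,3) H(4)] \<Phi>_Hom[OF o(3,2) H(5)]
   co \<Phi>_D[OF o(1,3) H(4), of 0] \<Phi>_D[OF o(3,2) H(5), of 1] \<Phi>_neg[OF o(3,2) cl(1)] \<Phi>_add[OF o(3,3) cl(2,3)] H(6-12) o
  by (simp add: \<Phi>_gid \<Phi>_zero)
qed

definition \<eta>0 where "\<eta>0 X = gcomp (F (dg_shift 1 X)) 1 (to_shift 1 (F X)) (\<Phi> (dg_shift 1 X) X 1 (from_shift 1 X))"
definition \<eta> where "\<eta> X = hclass K C (F (dg_shift 1 X)) (dg_shift 1 (F X)) (\<eta>0 X)"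

lemma \<eta>0_Cyc: assumes X: "B.dgm X" shows "\<eta>0 X \<in> C.Cyc (F (dg_shift 1 X)) (dg_shift 1 (F X)) 0"
 unfolding \<eta>0_def using X B.dgm_shift[OF X] \<Phi>_CycN[OF B.dgm_shift[OF X] X B.shift_Cyc(2)[OF X]]
 by (intro C.Cyc_gcomp[of _ "F X" _ _ 1 _ "-1"] C.shift_Cyc) (auto simp: F_dgm)

text \<open>\<open>\<eta>0\<close> is the image of the closed isomorphism \<open>X[1] \<rightarrow> X\<close> of degree one followed by \<open>F X \<rightarrow> (F X)[1]\<close>, so its inverse is
 obtained in the same way.\<close>

lemma \<eta>0_heqv: assumes X: "B.dgm X" shows "C.heqv (F (dg_shift 1 X)) (dg_shift 1 (F X)) (\<eta>0 X)"
proof -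
 let ?X = "dg_shift 1 X" and ?FX = "dg_shift 1 (F X)"
 have o: "B.dgm ?X" "C.dgm (F ?X)" "C.dgm (F X)" "C.dgm ?FX" using X by (simp_all add: F_dgm)
 let ?s = "\<Phi> X ?X (-1) (to_shift 1 X)" and ?t = "\<Phi> ?X X 1 (from_shift 1 X)"
 note st = B.shift_Cyc[OF X, of 1] and st' = C.shift_Cyc[OF o(3), of 1]
 have s: "?s \<in> C.Cyc (F X) (F ?X) (-1)" and t: "?t \<in> C.Cyc (F ?X) (F X) 1"
  by (rule \<Phi>_CycN[OF X o(1) st(1)], rule \<Phi>_CycN[OF o(1) X st(2)])
 have st_id: "gcomp (F X) (-1) ?t ?s = gid (F X)" "gcomp (F ?X) 1 ?s ?t = gid (F ?X)"
  using \<Phi>_gcomp[OF X o(1) X st[THEN B.CycH], of 0] \<Phi>_gcomp[OF o(1) X o(1) st(2,1)[THEN B.CycH], of 0]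
   B.shift_inverse[OF X, of 1] X o by (auto simp: \<Phi>_gid)
 let ?i = "gcomp ?FX 1 ?s (from_shift 1 (F X))"
 have i: "?i \<in> C.Cyc ?FX (F ?X) 0" using C.Cyc_gcomp[OF o(4,3,2) st'(2) s] by simp
 note H = s[THEN C.CycH] t[THEN C.CycH] st'[THEN C.CycH] \<eta>0_Cyc[OF X, THEN C.CycH] i[THEN C.CycH]
 have "gcomp (F ?X) 0 ?i (\<eta>0 X) = gid (F ?X)"
  using C.gcomp_assoc[OF H(5), of 1 ?s "from_shift 1 (F X)"] C.gcomp_assoc[OF H(2), of "-1" "from_shift 1 (F X)" "to_shift 1 (F X)"]
   C.shift_inverse(1)[OF o(3), of 1] C.gcomp_gid_left[OF o(2,3) H(2)] st_id by (simp add: \<eta>0_def)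
 moreover have "gcomp ?FX 0 (\<eta>0 X) ?i = gid ?FX"
  using C.gcomp_assoc[OF H(6), of 1 "to_shift 1 (F X)" ?t] C.gcomp_assoc[OF H(4), of "-1" ?t ?s]
   C.shift_inverse(2)[OF o(3), of 1] C.gcomp_gid_left[OF o(4,3) H(4)] st_id by (simp add: \<eta>0_def)
 ultimately show ?thesis by (rule C.heqv_inverse[OF o(2,4) \<eta>0_Cyc[OF X] i])
qed

lemma \<Phi>_from_shift:
 assumes o: "B.dgm X" "B.dgm Y" and f: "f \<in> B.Cyc X Y 0"
 shows "gcomp (F (dg_shift 1 X)) 0 (\<Phi> (dg_shift 1 Y) Y 1 (from_shift 1 Y)) (\<Phi> (dg_shift 1 X) (dg_shift 1 Y) 0 (B.conj_shift 1 X Y f)) =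
  gcomp (F (dg_shift 1 X)) 1 (\<Phi> X Y 0 f) (\<Phi> (dg_shift 1 X) X 1 (from_shift 1 X))"
proof -
 note o1 = B.dgm_shift[OF o(1), of 1] B.dgm_shift[OF o(2), of 1]
 note c = B.CycH[OF B.conj_shift_Cyc[OF o f, of 1]] and t = B.shift_Cyc(2)[OF o(1), of 1, THEN B.CycH] B.shift_Cyc(2)[OF o(2), of 1, THEN B.CycH]
 show ?thesis
  using \<Phi>_gcomp[OF o1 o(2) c t(2), of 1] \<Phi>_gcomp[OF o1(1) o t(1) B.CycH[OF f], of 1] B.shift_conj(1)[OF B.CycH[OF f], of 1] by simp
qed

lemma \<eta>0_natural:
 assumes o: "B.dgm X" "B.dgm Y" and f: "f \<in> B.Cyc X Y 0"
 shows "gcomp (F (dg_shift 1 X)) 0 (\<eta>0 Y) (\<Phi> (dg_shift 1 X) (dg_shift 1 Y) 0 (B.conj_shift 1 X Y f)) =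
  gcomp (F (dg_shift 1 X)) 0 (C.conj_shift 1 (F X) (F Y) (\<Phi> X Y 0 f)) (\<eta>0 X)"
proof -
 note o1 = B.dgm_shift[OF o(1), of 1] B.dgm_shift[OF o(2), of 1]
 note c = C.CycH[OF \<Psi>_Cyc[OF o1 B.conj_shift_Cyc[OF o f, of 1]]]
 note t = C.CycH[OF \<Phi>_CycN[OF o1(1) o(1) B.shift_Cyc(2)[OF o(1), of 1]]]
 note fH = C.CycH[OF \<Psi>_Cyc[OF o f]]
 show ?thesis unfolding \<eta>0_def
  using C.gcomp_assoc[OF c, of 1 "to_shift 1 (F Y)" "\<Phi> (dg_shift 1 Y) Y 1 (from_shift 1 Y)"] \<Phi>_from_shift[OF o f]
   C.gcomp_assoc[OF t, of "-1" "C.conj_shift 1 (F X) (F Y) (\<Phi> X Y 0 f)" "to_shift 1 (F X)"]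
   C.gcomp_assoc[OF t, of 0 "to_shift 1 (F Y)" "\<Phi> X Y 0 f"] C.shift_conj(2)[OF fH, of 1] by simp
qed

lemma \<Psi>K_add:
 assumes o: "B.dgm X" "B.dgm Y" and f: "f \<in> hmors K B X Y" and g: "g \<in> hmors K B X Y"
 shows "\<Psi>K X Y (hadd K B X Y f g) = hadd K C (F X) (F Y) (\<Psi>K X Y f) (\<Psi>K X Y g)"
proof -
 obtain a b where a: "a \<in> B.Cyc X Y 0" "f = B.hc X Y a" and b: "b \<in> B.Cyc X Y 0" "g = B.hc X Y b"
  using f g B.hmors_Cyc[OF o] by auto
 note oo = F_dgm[OF o(1)] F_dgm[OF o(2)]
 show ?thesis unfolding a(2) b(2) B.hadd_hclass[OF o a(1) b(1)] \<Psi>K_hclass[OF o B.Cyc_add[OF o a(1) b(1)]]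
   \<Psi>K_hclass[OF o a(1)] \<Psi>K_hclass[OF o b(1)] C.hadd_hclass[OF oo \<Psi>_Cyc[OF o a(1)] \<Psi>_Cyc[OF o b(1)]]
  using \<Phi>_add[OF o B.CycH[OF a(1)] B.CycH[OF b(1)]] by simp
qed

lemma \<eta>_iso: assumes X: "B.dgm X" shows "cat_iso C.HC (F (dg_shift 1 X)) (dg_shift 1 (F X)) (\<eta> X)"
proof -
 have o: "C.dgm (F (dg_shift 1 X))" "C.dgm (dg_shift 1 (F X))" using X by (simp_all add: F_dgm)
 have "hiso K C (F (dg_shift 1 X)) (dg_shift 1 (F X)) (\<eta> X)"
  unfolding C.hiso_heqv[OF o] \<eta>_def using \<eta>0_heqv[OF X] by blast
 then show ?thesis by (auto simp: cat_iso_def hiso_def homotopy_cat_def)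
qed

lemma \<eta>_natural:
 assumes o: "B.dgm X" "B.dgm Y" and f: "f \<in> hmors K B X Y"
 shows "hcomp K C (F (dg_shift 1 X)) (dg_shift 1 (F Y)) (\<eta> Y) (\<Psi>K (dg_shift 1 X) (dg_shift 1 Y) (hshift 1 f)) =
  hcomp K C (F (dg_shift 1 X)) (dg_shift 1 (F Y)) (hshift 1 (\<Psi>K X Y f)) (\<eta> X)"
proof -
 obtain a where a: "a \<in> B.Cyc X Y 0" "f = B.hc X Y a" using f B.hmors_Cyc[OF o] by auto
 note o1 = B.dgm_shift[OF o(1), of 1] B.dgm_shift[OF o(2), of 1]
 note oo = F_dgm[OF o(1)] F_dgm[OF o(2)] and oo1 = F_dgm[OF o1(1)] F_dgm[OF o1(2)]
 note os = C.dgm_shift[OF oo(1), of 1] C.dgm_shift[OF oo(2), of 1]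
 note c = B.conj_shift_Cyc[OF o a(1), of 1]
 show ?thesis unfolding a(2) B.hshift_hclass[OF o a(1)] \<Psi>K_hclass[OF o1 c] \<Psi>K_hclass[OF o a(1)]
   C.hshift_hclass[OF oo \<Psi>_Cyc[OF o a(1)]] \<eta>_def
   C.hcomp_hclass[OF oo1 os(2) \<Psi>_Cyc[OF o1 c] \<eta>0_Cyc[OF o(2)]]
   C.hcomp_hclass[OF oo1(1) os \<eta>0_Cyc[OF o(1)] C.conj_shift_Cyc[OF oo \<Psi>_Cyc[OF o a(1)]]]
  using \<eta>0_natural[OF o a(1)] by simp
qed

text \<open>The image of a standard cone is a cone of the image by \<open>\<Phi>_is_cone\<close>, hence equivalent to the standard one by
 \<open>is_cone_standard\<close>; the comparison \<open>\<eta>0\<close> absorbs the difference between \<open>F(X[1])\<close> and \<open>(F X)[1]\<close>.\<close>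

lemma \<Phi>_triangle:
 fixes p :: "'v \<times> 'v => 'v"
 assumes p: "inj p" and o: "B.dgm X" "B.dgm Y" "B.dgm Z" and t: "B.triangle_maps X Y Z f g h"
 shows "C.triangle_maps (F X) (F Y) (F Z) (\<Phi> X Y 0 f) (\<Phi> Y Z 0 g) (gcomp (F Z) 0 (\<eta>0 X) (\<Phi> Z (dg_shift 1 X) 0 h))"
proof -
 obtain X' Y' :: "('k, 'b, 'v) dg_mod" and \<phi> a b c where m: "f \<in> B.Cyc X Y 0" "g \<in> B.Cyc Y Z 0" "h \<in> B.Cyc Z (dg_shift 1 X) 0"
  and o': "B.dgm X'" "B.dgm Y'" and \<phi>: "\<phi> \<in> B.Cyc X' Y' 0" and i: "B.heqv X X' a" "B.heqv Y Y' b" "B.heqv Z (dg_cone X' Y' \<phi>) c"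
  and s: "B.htp X Y' 0 (gcomp X 0 b f) (gcomp X 0 \<phi> a)"
    "B.htp Y (dg_cone X' Y' \<phi>) 0 (gcomp Y 0 c g) (gcomp Y 0 (cone_in X' Y') b)"
    "B.htp Z (dg_shift 1 X') 0 (gcomp Z 0 (B.conj_shift 1 X X' a) h) (gcomp Z 0 (cone_out X' Y') c)"
  using t unfolding B.triangle_maps_def by blast
 define N where "N = dg_cone X' Y' \<phi>"
 define N' where "N' = dg_code p N"
 define e where "e = code_to p N"
 define e' where "e' = code_from p N"
 have oN: "B.dgm N" "B.dgm N'" using o' \<phi> B.dgm_code[OF p] by (simp_all add: N_def N'_def)
 have e: "e \<in> B.Cyc N N' 0" "e' \<in> B.Cyc N' N 0" "gcomp N 0 e' e = gid N" "gcomp N' 0 e e' = gid N'"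
  unfolding e_def e'_def N'_def using B.code_Cyc[OF p oN(1)] B.code_inverse[OF p] by auto
 have ic: "B.is_cone X' Y' N \<phi> (cone_in X' Y') (cone_out X' Y') (cone_inr X' Y') (cone_prl X' Y')"
  using B.is_cone_cone[OF o' \<phi>] by (simp add: N_def)
 have cc: "cone_in X' Y' \<in> B.Cyc Y' N 0" "cone_out X' Y' \<in> B.Cyc N X' 1" using ic by (auto simp: B.is_cone_def)
 note i = i[folded N_def] and s = s[folded N_def]
 have m': "a \<in> B.Cyc X X' 0" "b \<in> B.Cyc Y Y' 0" "c \<in> B.Cyc Z N 0" using i by (auto simp: B.heqv_def)
 note oF = F_dgm[OF o(1)] F_dgm[OF o(2)] F_dgm[OF o(3)] F_dgm[OF o'(1)] F_dgm[OF o'(2)] F_dgm[OF oN(2)]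
 note \<phi>F = \<Psi>_Cyc[OF o' \<phi>]
 define M where "M = dg_cone (F X') (F Y') (\<Phi> X' Y' 0 \<phi>)"
 have oM: "C.dgm M" using oF(4,5) \<phi>F by (simp add: M_def)
 note icF = \<Phi>_is_cone[OF o' oN(2) B.is_cone_transport[OF o' oN ic e]]
 obtain \<theta> where \<theta>: "C.heqv (F N') M \<theta>" "gcomp (F Y') 0 \<theta> (\<Phi> Y' N' 0 (gcomp Y' 0 e (cone_in X' Y'))) = cone_in (F X') (F Y')"
   "gcomp (F N') 0 (cone_out (F X') (F Y')) \<theta> = \<Phi> N' X' 1 (gcomp N' 0 (cone_out X' Y') e')"
  using C.is_cone_standard[OF oF(4,5,6) icF, folded M_def] by blast
 have \<theta>C: "\<theta> \<in> C.Cyc (F N') M 0" using \<theta>(1) by (auto simp: C.heqv_def)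
 define d where "d = gcomp Z 0 e c"
 have d: "d \<in> B.Cyc Z N' 0" unfolding d_def using B.Cyc_gcomp[OF o(3) oN m'(3) e(1)] by simp
 have dq: "B.heqv Z N' d" unfolding d_def using B.heqv_comp[OF o(3) oN i(3) B.heqv_inverse[OF oN e]] .
 define \<gamma> where "\<gamma> = gcomp (F Z) 0 \<theta> (\<Phi> Z N' 0 d)"
 have \<gamma>: "C.heqv (F Z) M \<gamma>" unfolding \<gamma>_def by (rule C.heqv_comp[OF oF(3,6) oM \<Phi>_heqv[OF o(3) oN(2) dq] \<theta>(1)])
 have 1: "C.htp (F X) (F Y') 0 (gcomp (F X) 0 (\<Phi> Y Y' 0 b) (\<Phi> X Y 0 f)) (gcomp (F X) 0 (\<Phi> X' Y' 0 \<phi>) (\<Phi> X X' 0 a))"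
  using \<Phi>_htpN[OF o(1) o'(2) s(1)] \<Psi>_gcomp[OF o(1,2) o'(2) m(1) m'(2)] \<Psi>_gcomp[OF o(1) o' m'(1) \<phi>] by simp
 have 2: "C.htp (F Y) M 0 (gcomp (F Y) 0 \<gamma> (\<Phi> Y Z 0 g)) (gcomp (F Y) 0 (cone_in (F X') (F Y')) (\<Phi> Y Y' 0 b))"
 proof -
  have cg: "gcomp Y' 0 e (cone_in X' Y') \<in> B.Cyc Y' N' 0" using B.Cyc_gcomp[OF o'(2) oN cc(1) e(1)] by simp
  have "B.htp Y N' 0 (gcomp Y 0 e (gcomp Y 0 c g)) (gcomp Y 0 e (gcomp Y 0 (cone_in X' Y') b))"
   using B.htp_comp_left[OF o(2) oN s(2) e(1), of 0] by simp
  then have "B.htp Y N' 0 (gcomp Y 0 d g) (gcomp Y 0 (gcomp Y' 0 e (cone_in X' Y')) b)"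
   unfolding d_def using B.gcomp_assoc[OF B.CycH[OF m(2)], of 0 e c] B.gcomp_assoc[OF B.CycH[OF m'(2)], of 0 e "cone_in X' Y'"] by simp
  from \<Phi>_htpN[OF o(2) oN(2) this]
  have "C.htp (F Y) (F N') 0 (gcomp (F Y) 0 (\<Phi> Z N' 0 d) (\<Phi> Y Z 0 g)) (gcomp (F Y) 0 (\<Phi> Y' N' 0 (gcomp Y' 0 e (cone_in X' Y'))) (\<Phi> Y Y' 0 b))"
   using \<Psi>_gcomp[OF o(2,3) oN(2) m(2) d] \<Psi>_gcomp[OF o(2) o'(2) oN(2) m'(2) cg] by simp
  from C.htp_comp_left[OF oF(2,6) oM this \<theta>C, of 0] show ?thesis
   unfolding \<gamma>_def using C.gcomp_assoc[OF C.CycH[OF \<Psi>_Cyc[OF o(2,3) m(2)]], of 0 \<theta> "\<Phi> Z N' 0 d"]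
    C.gcomp_assoc[OF C.CycH[OF \<Psi>_Cyc[OF o(2) o'(2) m'(2)]], of 0 \<theta> "\<Phi> Y' N' 0 (gcomp Y' 0 e (cone_in X' Y'))"] \<theta>(2) by simp
 qed
 have 3: "C.htp (F Z) (dg_shift 1 (F X')) 0 (gcomp (F Z) 0 (C.conj_shift 1 (F X) (F X') (\<Phi> X X' 0 a)) (gcomp (F Z) 0 (\<eta>0 X) (\<Phi> Z (dg_shift 1 X) 0 h)))
  (gcomp (F Z) 0 (cone_out (F X') (F Y')) \<gamma>)"
 proof -
  note o1 = B.dgm_shift[OF o(1), of 1] B.dgm_shift[OF o'(1), of 1]
  note tX = B.shift_Cyc(2)[OF o(1), of 1] and tX' = B.shift_Cyc(2)[OF o'(1), of 1] and ca = B.conj_shift_Cyc[OF o(1) o'(1) m'(1), of 1]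
  define th where "th = gcomp Z 0 (from_shift 1 X) h"
  have th: "th \<in> B.Cyc Z X 1" unfolding th_def using B.Cyc_gcomp[OF o(3) o1(1) o(1) m(3) tX] by simp
  have ath: "gcomp Z 1 a th \<in> B.Cyc Z X' 1" using B.Cyc_gcomp[OF o(3) o(1) o'(1) th m'(1)] by simp
  have coe: "gcomp N' 0 (cone_out X' Y') e' \<in> B.Cyc N' X' 1" using B.Cyc_gcomp[OF oN(2,1) o'(1) e(2) cc(2)] by simp
  have "B.htp Z X' 1 (gcomp Z 0 (from_shift 1 X') (gcomp Z 0 (B.conj_shift 1 X X' a) h)) (gcomp Z 0 (from_shift 1 X') (gcomp Z 0 (cone_out X' Y') c))"
   using B.htp_comp_left[OF o(3) o1(2) o'(1) s(3) tX', of 1] by simp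
  moreover have "gcomp Z 0 (from_shift 1 X') (gcomp Z 0 (B.conj_shift 1 X X' a) h) = gcomp Z 1 a th"
   unfolding th_def using B.gcomp_assoc[OF B.CycH[OF m(3)], of 0 "from_shift 1 X'" "B.conj_shift 1 X X' a"]
    B.gcomp_assoc[OF B.CycH[OF m(3)], of 1 a "from_shift 1 X"] B.shift_conj(1)[OF B.CycH[OF m'(1)], of 1] by simp
  moreover have "gcomp Z 0 (from_shift 1 X') (gcomp Z 0 (cone_out X' Y') c) = gcomp Z 0 (gcomp N' 0 (cone_out X' Y') e') d"
   unfolding d_def using B.gcomp_assoc[OF B.CycH[OF d, unfolded d_def], of 0 "cone_out X' Y'" e']
    B.gcomp_assoc[OF B.CycH[OF m'(3)], of 0 e' e] e(3) B.gcomp_gid_left[OF o(3) oN(1) B.CycH[OF m'(3)]]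
    B.gcomp_assoc[OF B.CycH[OF m'(3)], of 0 "from_shift 1 X'" "cone_out X' Y'"] B.cone_out_from_shift[OF o', of \<phi>, folded N_def] by simp
  ultimately have "B.htp Z X' 1 (gcomp Z 1 a th) (gcomp Z 0 (gcomp N' 0 (cone_out X' Y') e') d)" by simp
  from \<Phi>_htpN[OF o(3) o'(1) this]
  have "C.htp (F Z) (F X') 1 (gcomp (F Z) 1 (\<Phi> X X' 0 a) (\<Phi> Z X 1 th)) (gcomp (F Z) 0 (\<Phi> N' X' 1 (gcomp N' 0 (cone_out X' Y') e')) (\<Phi> Z N' 0 d))"
   using \<Phi>_gcomp[OF o(3) o(1) o'(1) B.CycH[OF th] B.CycH[OF m'(1)], of 1]
    \<Phi>_gcomp[OF o(3) oN(2) o'(1) B.CycH[OF d] B.CycH[OF coe], of 1] by simp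
  from C.htp_comp_left[OF oF(3,4) C.dgm_shift[OF oF(4)] this C.shift_Cyc(1)[OF oF(4), of 1], of 0]
  have *: "C.htp (F Z) (dg_shift 1 (F X')) 0 (gcomp (F Z) 1 (to_shift 1 (F X')) (gcomp (F Z) 1 (\<Phi> X X' 0 a) (\<Phi> Z X 1 th)))
   (gcomp (F Z) 1 (to_shift 1 (F X')) (gcomp (F Z) 0 (\<Phi> N' X' 1 (gcomp N' 0 (cone_out X' Y') e')) (\<Phi> Z N' 0 d)))" by simp
  have hF: "\<Phi> Z (dg_shift 1 X) 0 h \<in> C.Hom (F Z) (F (dg_shift 1 X)) 0" "\<Phi> Z N' 0 d \<in> C.Hom (F Z) (F N') 0" "\<Phi> Z X 1 th \<in> C.Hom (F Z) (F X) 1"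
   using \<Phi>_Hom[OF o(3) o1(1) B.CycH[OF m(3)]] \<Phi>_Hom[OF o(3) oN(2) B.CycH[OF d]] \<Phi>_Hom[OF o(3,1) B.CycH[OF th]] by auto
  have l: "gcomp (F Z) 0 (\<eta>0 X) (\<Phi> Z (dg_shift 1 X) 0 h) = gcomp (F Z) 1 (to_shift 1 (F X)) (\<Phi> Z X 1 th)"
   unfolding \<eta>0_def th_def using C.gcomp_assoc[OF hF(1), of 1 "to_shift 1 (F X)" "\<Phi> (dg_shift 1 X) X 1 (from_shift 1 X)"]
    \<Phi>_gcomp[OF o(3) o1(1) o(1) B.CycH[OF m(3)] B.CycH[OF tX], of 1] by simp
  have "gcomp (F Z) 0 (C.conj_shift 1 (F X) (F X') (\<Phi> X X' 0 a)) (gcomp (F Z) 0 (\<eta>0 X) (\<Phi> Z (dg_shift 1 X) 0 h)) =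
    gcomp (F Z) 1 (to_shift 1 (F X')) (gcomp (F Z) 1 (\<Phi> X X' 0 a) (\<Phi> Z X 1 th))"
   unfolding l using C.gcomp_assoc[OF hF(3), of "-1" "C.conj_shift 1 (F X) (F X') (\<Phi> X X' 0 a)" "to_shift 1 (F X)"]
    C.gcomp_assoc[OF hF(3), of 0 "to_shift 1 (F X')" "\<Phi> X X' 0 a"] C.shift_conj(2)[OF C.CycH[OF \<Psi>_Cyc[OF o(1) o'(1) m'(1)]], of 1] by simp
  moreover have "gcomp (F Z) 0 (cone_out (F X') (F Y')) \<gamma> =
    gcomp (F Z) 1 (to_shift 1 (F X')) (gcomp (F Z) 0 (\<Phi> N' X' 1 (gcomp N' 0 (cone_out X' Y') e')) (\<Phi> Z N' 0 d))"
  proof -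
   have \<gamma>H: "\<gamma> \<in> C.Hom (F Z) M 0" using \<gamma> by (auto simp: C.heqv_def dest: C.CycD)
   have "gcomp (F Z) 0 (cone_out (F X') (F Y')) \<gamma> = gcomp (F Z) 0 (gcomp M 1 (to_shift 1 (F X')) (cone_out (F X') (F Y'))) \<gamma>"
    using C.cone_out_shift[OF oF(4,5), of "\<Phi> X' Y' 0 \<phi>"] by (simp add: M_def)
   then have "gcomp (F Z) 0 (cone_out (F X') (F Y')) \<gamma> = gcomp (F Z) 1 (to_shift 1 (F X')) (gcomp (F Z) 0 (cone_out (F X') (F Y')) \<gamma>)"
    using C.gcomp_assoc[OF \<gamma>H, of 1 "to_shift 1 (F X')" "cone_out (F X') (F Y')"] by simp
   moreover have "gcomp (F Z) 0 (cone_out (F X') (F Y')) \<gamma> = gcomp (F Z) 0 (gcomp (F N') 0 (cone_out (F X') (F Y')) \<theta>) (\<Phi> Z N' 0 d)"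
    unfolding \<gamma>_def using C.gcomp_assoc[OF hF(2), of 0 "cone_out (F X') (F Y')" \<theta>] by simp
   ultimately show ?thesis unfolding \<theta>(3) by (rule HOL.trans[OF _ arg_cong[where f = "gcomp (F Z) 1 (to_shift 1 (F X'))"]])
  qed
  ultimately show ?thesis using * by simp
 qed
 have hC: "gcomp (F Z) 0 (\<eta>0 X) (\<Phi> Z (dg_shift 1 X) 0 h) \<in> C.Cyc (F Z) (dg_shift 1 (F X)) 0"
  using C.Cyc_gcomp[OF oF(3) F_dgm[OF B.dgm_shift[OF o(1)]] C.dgm_shift[OF oF(1)] \<Psi>_Cyc[OF o(3) B.dgm_shift[OF o(1)] m(3)] \<eta>0_Cyc[OF o(1)]] by simp
 show ?thesis unfolding C.triangle_maps_def
  using \<Psi>_Cyc[OF o(1,2) m(1)] \<Psi>_Cyc[OF o(2,3) m(2)] hC oF(4,5) \<phi>F \<Phi>_heqv[OF o(1) o'(1) i(1)] \<Phi>_heqv[OF o(2) o'(2) i(2)]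
   \<gamma>[unfolded M_def] 1 2[unfolded M_def] 3 by blast
qed

lemma \<Psi>K_triangle_functor:
 fixes p :: "'v \<times> 'v => 'v"
 assumes p: "inj p"
 shows "is_triangle_functor B.HC C.HC F \<Psi>K \<eta>"
proof -
 have "htriangle K C (F X) (F Y) (F Z) (\<Psi>K X Y f) (\<Psi>K Y Z g) (hcomp K C (F Z) (dg_shift 1 (F X)) (\<eta> X) (\<Psi>K Z (dg_shift 1 X) h))"
  if t: "htriangle K B X Y Z f g h" for X Y Z f g h
 proof -
  obtain a b c where o: "B.dgm X" "B.dgm Y" "B.dgm Z" and t: "B.triangle_maps X Y Z a b c"
   and e: "f = B.hc X Y a" "g = B.hc Y Z b" "h = B.hc Z (dg_shift 1 X) c" using t unfolding B.htriangle_iff by blast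
  have m: "a \<in> B.Cyc X Y 0" "b \<in> B.Cyc Y Z 0" "c \<in> B.Cyc Z (dg_shift 1 X) 0" using t by (auto simp: B.triangle_maps_def)
  note o1 = B.dgm_shift[OF o(1), of 1]
  have r: "\<Psi>K X Y f = C.hc (F X) (F Y) (\<Phi> X Y 0 a)" "\<Psi>K Y Z g = C.hc (F Y) (F Z) (\<Phi> Y Z 0 b)"
   "hcomp K C (F Z) (dg_shift 1 (F X)) (\<eta> X) (\<Psi>K Z (dg_shift 1 X) h) = C.hc (F Z) (dg_shift 1 (F X)) (gcomp (F Z) 0 (\<eta>0 X) (\<Phi> Z (dg_shift 1 X) 0 c))"
   unfolding e \<eta>_def \<Psi>K_hclass[OF o(1,2) m(1)] \<Psi>K_hclass[OF o(2,3) m(2)] \<Psi>K_hclass[OF o(3) o1 m(3)]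
   using C.hcomp_hclass[OF F_dgm[OF o(3)] F_dgm[OF o1] C.dgm_shift[OF F_dgm[OF o(1)]] \<Psi>_Cyc[OF o(3) o1 m(3)] \<eta>0_Cyc[OF o(1)]] by auto
  show ?thesis unfolding C.htriangle_iff r using \<Phi>_triangle[OF p o t] F_dgm[OF o(1)] F_dgm[OF o(2)] F_dgm[OF o(3)] by blast
 qed
 then show ?thesis unfolding is_triangle_functor_def
  using \<Psi>K_functor \<eta>_iso by (auto simp: homotopy_cat_def \<Psi>K_add \<eta>_natural)
qed

end

lemma dg_functor_comp:
 assumes "dg_functor K B C F \<Phi>" "dg_functor K C E G \<Psi>"
 shows "dg_functor K B E (\<lambda>X. G (F X)) (\<lambda>X Y n f. \<Psi> (F X) (F Y) n (\<Phi> X Y n f))"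
proof -
 interpret F: dg_functor K B C F \<Phi> by fact
 interpret G: dg_functor K C E G \<Psi> by fact
 show ?thesis
  by (intro dg_functor.intro dg_functor_axioms.intro F.B.dg_algebra_axioms G.C.dg_algebra_axioms)
    (simp_all add: F.F_dgm G.F_dgm F.\<Phi>_Hom G.\<Phi>_Hom F.\<Phi>_add G.\<Phi>_add F.\<Phi>_gid G.\<Phi>_gid F.\<Phi>_gcomp G.\<Phi>_gcomp F.\<Phi>_D G.\<Phi>_D)
qed

text \<open>Inverse equivalences up to natural quasi-isomorphisms.  Both comparison maps point towards the identity, which
 is the form in which they arise from corners.\<close>

locale dg_equivalence = F: dg_functor K B C F \<Phi> + G: dg_functor K C B G \<Psi>
 for K :: "'k ring" and B :: "('k, 'b) dg_alg" and C :: "('k, 'c) dg_alg"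
  and F :: "('k, 'b, 'v) dg_mod => ('k, 'c, 'v) dg_mod" and \<Phi>
  and G :: "('k, 'c, 'v) dg_mod => ('k, 'b, 'v) dg_mod" and \<Psi> +
 fixes \<epsilon> \<delta> and p :: "'v \<times> 'v => 'v"
 assumes inj_p: "inj p"
  and F_qis: "[|F.B.dgm X; F.B.dgm Y; f \<in> F.B.Cyc X Y 0; F.B.qis X Y f|] ==> F.C.qis (F X) (F Y) (\<Phi> X Y 0 f)"
  and G_qis: "[|F.C.dgm U; F.C.dgm V; g \<in> F.C.Cyc U V 0; F.C.qis U V g|] ==> F.B.qis (G U) (G V) (\<Psi> U V 0 g)"
  and \<epsilon>: "F.B.dgm X ==> \<epsilon> X \<in> F.B.Cyc (G (F X)) X 0" "F.B.dgm X ==> F.B.qis (G (F X)) X (\<epsilon> X)"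
  and \<epsilon>_natural: "[|F.B.dgm X; F.B.dgm Y; f \<in> F.B.Cyc X Y 0|] ==>
   gcomp (G (F X)) 0 (\<epsilon> Y) (\<Psi> (F X) (F Y) 0 (\<Phi> X Y 0 f)) = gcomp (G (F X)) 0 f (\<epsilon> X)"
  and \<delta>: "F.C.dgm U ==> \<delta> U \<in> F.C.Cyc (F (G U)) U 0" "F.C.dgm U ==> F.C.qis (F (G U)) U (\<delta> U)"
  and \<delta>_natural: "[|F.C.dgm U; F.C.dgm V; g \<in> F.C.Cyc U V 0|] ==>
   gcomp (F (G U)) 0 (\<delta> V) (\<Phi> (G U) (G V) 0 (\<Psi> U V 0 g)) = gcomp (F (G U)) 0 g (\<delta> U)"
begin

lemma counit_natural_hclass:
 assumes o: "F.B.dgm X" "F.B.dgm Y" and f: "f \<in> hmors K B X Y"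
 shows "hcomp K B (G (F X)) Y (hclass K B (G (F Y)) Y (\<epsilon> Y)) (G.\<Psi>K (F X) (F Y) (F.\<Psi>K X Y f)) =
  hcomp K B (G (F X)) Y f (hclass K B (G (F X)) X (\<epsilon> X))"
proof -
 obtain a where a: "a \<in> F.B.Cyc X Y 0" "f = hclass K B X Y a" using f F.B.hmors_Cyc[OF o] by auto
 note o1 = F.F_dgm[OF o(1)] F.F_dgm[OF o(2)] and o2 = G.F_dgm[OF F.F_dgm[OF o(1)]] G.F_dgm[OF F.F_dgm[OF o(2)]]
 note c = F.\<Psi>_Cyc[OF o a(1)]
 show ?thesis
  unfolding a(2) F.\<Psi>K_hclass[OF o a(1)] G.\<Psi>K_hclass[OF o1 c] F.B.hcomp_hclass[OF o2 o(2) G.\<Psi>_Cyc[OF o1 c] \<epsilon>(1)[OF o(2)]]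
   F.B.hcomp_hclass[OF o2(1) o \<epsilon>(1)[OF o(1)] a(1)] \<epsilon>_natural[OF o a(1)] ..
qed

lemma counit_quasi_iso: "F.B.dgm X ==> hclass K B (G (F X)) X (\<epsilon> X) \<in> quasi_isos K B (G (F X)) X"
 using F.B.quasi_isos_hclass[OF G.F_dgm[OF F.F_dgm] _ \<epsilon>(1)] \<epsilon>(2) by simp

end

lemma dg_equivalence_sym:
 assumes "dg_equivalence K B C F \<Phi> G \<Psi> \<epsilon> \<delta> p" shows "dg_equivalence K C B G \<Psi> F \<Phi> \<delta> \<epsilon> p"
 using assms unfolding dg_equivalence_def dg_equivalence_axioms_def by blast

lemma (in dg_algebra) HC_triangles: "(X, Y, Z, f, g, h) \<in> triangles HC ==>
  X \<in> objs HC & Y \<in> objs HC & Z \<in> objs HC & f \<in> mors HC X Y & g \<in> mors HC Y Z & h \<in> mors HC Z (shobj HC X)"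
 by (simp add: homotopy_cat_def htriangle_def)

theorem (in dg_equivalence) derived_equivalence: "derived_equivalent TYPE('v) K B C"
proof -
 interpret S: dg_equivalence K C B G \<Psi> F \<Phi> \<delta> \<epsilon> p by (rule dg_equivalence_sym) (rule dg_equivalence_axioms)
 have lF: "loc_functor F.B.HC (quasi_isos K B) F.C.HC (quasi_isos K C) F F.\<Psi>K"
  by (rule F.\<Psi>K_loc_functor) (rule F_qis)
 have lG: "loc_functor F.C.HC (quasi_isos K C) F.B.HC (quasi_isos K B) G G.\<Psi>K"
  by (rule G.\<Psi>K_loc_functor) (rule G_qis)
 have "is_equivalence (loc_base F.B.HC (quasi_isos K B)) (loc_base F.C.HC (quasi_isos K C)) F (zfun F.C.HC (quasi_isos K C) F F.\<Psi>K)"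
  by (rule loc_equivalence[where G = G and \<Psi> = G.\<Psi>K and \<epsilon> = "\<lambda>X. hclass K B (G (F X)) X (\<epsilon> X)" and \<delta> = "\<lambda>X. hclass K C (F (G X)) X (\<delta> X)"];
    intro loc_counit.intro loc_counit_axioms.intro lF lG)
    (simp_all add: homotopy_cat_def counit_quasi_iso counit_natural_hclass S.counit_quasi_iso S.counit_natural_hclass)
 moreover note loc_triangle_functor[OF lF F.B.HC_loc_add[OF inj_p] F.C.HC_loc_add[OF inj_p] F.B.HC_shift F.C.HC_shift F.\<Psi>K_triangle_functor[OF inj_p] F.B.HC_triangles]
 ultimately show ?thesis
  unfolding derived_equivalent_def triangle_equivalent_def derived_cat_def localization_equivalence[symmetric] by blast
qed

section \<open>Corner algebras and restriction of modules\<close>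

definition dg_regular :: "('k, 'a) dg_alg => ('k, 'a, 'a) dg_mod" where
 "dg_regular A = \<lparr>mcomp = acomp A, mact = amult A, mdiff = adiff A\<rparr>"

lemma dg_regular_simps [simp]: "mcomp (dg_regular A) = acomp A" "mact (dg_regular A) = amult A" "mdiff (dg_regular A) = adiff A"
 by (simp_all add: dg_regular_def)

context dg_algebra begin

lemma dgm_regular: "dgm (dg_regular A)"
 by (intro dg_module.intro dg_module_axioms.intro dg_algebra_axioms)
   (simp_all add: acomp_module amult_linear_left amult_linear_right amult_assoc aone_right adiff_linear adiff_square adiff_leibniz)

lemmas amult_rules = act_add_left[OF dgm_regular, simplified] act_smult_left[OF dgm_regular, simplified]
 act_add_right[OF dgm_regular, simplified] act_smult_right[OF dgm_regular, simplified]
 act_zero_left[OF dgm_regular, simplified] act_zero_right[OF dgm_regular, simplified]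
 act_ksign_left[OF dgm_regular, simplified] act_ksign_right[OF dgm_regular, simplified]
 act_neg_left[OF dgm_regular, simplified]
lemmas adiff_rules = diff_add[OF dgm_regular, simplified] diff_smult[OF dgm_regular, simplified] diff_zero[OF dgm_regular, simplified]
 diff_ksign[OF dgm_regular, simplified]
lemmas adiff_adiff = diff_diff[OF dgm_regular, simplified]
lemmas adiff_amult = diff_act[OF dgm_regular, simplified]

end

text \<open>For the elements of a module that are fixed by an idempotent.\<close>

lemma sub_ag:
 assumes V: "abelian_group V" and S: "S \<subseteq> carrier V" "\<zero>[V] \<in> S" "\<And>x y. [|x \<in> S; y \<in> S|] ==> x \<oplus>[V] y \<in> S"
  "\<And>x. x \<in> S ==> \<ominus>[V] x \<in> S"
 shows "abelian_group (V\<lparr>carrier := S\<rparr>)"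
proof (rule abelian_groupI)
 show "\<exists>y\<in>carrier (V\<lparr>carrier := S\<rparr>). y \<oplus>[V\<lparr>carrier := S\<rparr>] x = \<zero>[V\<lparr>carrier := S\<rparr>]" if "x \<in> carrier (V\<lparr>carrier := S\<rparr>)" for x
  using that S(4)[of x] subsetD[OF S(1), of x] V by (intro bexI[of _ "\<ominus>[V] x"]) (simp_all add: ag_simps)
qed (use S(2,3) subsetD[OF S(1)] V in \<open>simp_all add: ag_ac ag_simps\<close>)

lemma sub_neg:
 assumes V: "abelian_group V" and S: "abelian_group (V\<lparr>carrier := S\<rparr>)" "S \<subseteq> carrier V" and x: "x \<in> S" and n: "\<ominus>[V] x \<in> S"
 shows "\<ominus>[V\<lparr>carrier := S\<rparr>] x = \<ominus>[V] x"
 by (rule ag_neg_unique[OF S(1)]) (use assms in \<open>auto simp: ag_simps\<close>)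

text \<open>The map \<open>j\<close> identifies the dg algebra \<open>L\<close> with \<open>e B e\<close> for a closed idempotent \<open>e\<close>.  Working with an embedding and not
 with the subalgebra itself allows \<open>L\<close> to be the dg endomorphism algebra of a summand.\<close>

locale corner = B: dg_algebra K B + L: dg_algebra K L
 for K :: "'k ring" and B :: "('k, 'b) dg_alg" and L :: "('k, 'l) dg_alg" +
 fixes e :: 'b and j :: "int => 'l => 'b"
 assumes e_closed: "e \<in> B.acar 0" and e_e: "amult B 0 0 e e = e" and d_e: "adiff B 0 e = \<zero>[acomp B 1]"
  and j_linear: "linear_map K (acomp L i) (acomp B i) (j i)"
  and j_mult: "[|a \<in> L.acar i; a' \<in> L.acar k; n = i + k|] ==> j n (amult L i k a a') = amult B i k (j i a) (j k a')"
  and j_one: "j 0 (aone L) = e"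
  and j_diff: "[|a \<in> L.acar i; k = i + 1|] ==> j k (adiff L i a) = adiff B i (j i a)"
  and j_inj: "inj_on (j i) (L.acar i)"
  and j_surj: "[|b \<in> B.acar i; amult B 0 i e b = b; amult B i 0 b e = b|] ==> b \<in> j i ` L.acar i"
begin

lemmas j_rules = linear_mapD[OF j_linear]

lemma j_corner: assumes "a \<in> L.acar i" shows "amult B 0 i e (j i a) = j i a" "amult B i 0 (j i a) e = j i a"
 using j_mult[OF L.aone_closed assms] j_mult[OF assms L.aone_closed] assms by (simp_all add: j_one L.aone_left L.aone_right)

text \<open>The module \<open>N e\<close>.\<close>

definition res_set where "res_set N i = {x \<in> car N i. mact N i 0 x e = x}"

definition res :: "('k, 'b, 'm) dg_mod => ('k, 'l, 'm) dg_mod" where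
 "res N = \<lparr>mcomp = (\<lambda>i. (mcomp N i)\<lparr>carrier := res_set N i\<rparr>), mact = (\<lambda>i k x a. mact N i k x (j k a)), mdiff = mdiff N\<rparr>"

lemma res_simps [simp]: "car (res N) i = res_set N i" "x \<oplus>[res N,i] y = x \<oplus>[N,i] y" "\<zero>[res N,i] = \<zero>[N,i]"
  "c \<odot>[res N,i] x = c \<odot>[N,i] x" "mact (res N) i k x a = mact N i k x (j k a)" "mdiff (res N) = mdiff N"
 by (simp_all add: res_def)

lemma res_setD: "x \<in> res_set N i ==> x \<in> car N i" "x \<in> res_set N i ==> mact N i 0 x e = x"
 by (auto simp: res_set_def)

lemma res_setI: "[|B.dgm N; x \<in> car N i; b \<in> B.acar k; amult B k 0 b e = b; n = i + k|] ==> mact N i k x b \<in> res_set N n"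
 by (simp add: res_set_def B.act_closed B.act_assoc e_closed)

lemma res_set_closed:
 assumes N: "B.dgm N"
 shows "\<zero>[N,i] \<in> res_set N i" "[|x \<in> res_set N i; y \<in> res_set N i|] ==> x \<oplus>[N,i] y \<in> res_set N i"
  "x \<in> res_set N i ==> \<ominus>[N,i] x \<in> res_set N i" "[|c \<in> carrier K; x \<in> res_set N i|] ==> c \<odot>[N,i] x \<in> res_set N i"
  "[|x \<in> res_set N i; a \<in> L.acar k; n = i + k|] ==> mact N i k x (j k a) \<in> res_set N n"
  "[|x \<in> res_set N i; n = i + 1|] ==> mdiff N i x \<in> res_set N n"
  "x \<in> car N i ==> mact N i 0 x e \<in> res_set N i"
proof -
 show "\<zero>[N,i] \<in> res_set N i" "[|x \<in> res_set N i; y \<in> res_set N i|] ==> x \<oplus>[N,i] y \<in> res_set N i"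
  "x \<in> res_set N i ==> \<ominus>[N,i] x \<in> res_set N i" "[|c \<in> carrier K; x \<in> res_set N i|] ==> c \<odot>[N,i] x \<in> res_set N i"
  using N by (simp_all add: res_set_def ag_simps B.act_add_left B.act_zero_left B.act_neg_left B.act_smult_left e_closed)
 show "[|x \<in> res_set N i; a \<in> L.acar k; n = i + k|] ==> mact N i k x (j k a) \<in> res_set N n"
  using N by (intro res_setI) (auto simp: res_setD j_rules(1) j_corner)
 show "[|x \<in> res_set N i; n = i + 1|] ==> mdiff N i x \<in> res_set N n"
  using B.diff_act[OF N _ e_closed, of x i i] N
  by (auto simp: res_set_def B.diff_closed d_e B.act_zero_right B.act_closed ag_simps ksign_zero e_closed)
 show "x \<in> car N i ==> mact N i 0 x e \<in> res_set N i" using N by (intro res_setI) (auto simp: e_closed e_e)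
qed

lemma res_ag: assumes N: "B.dgm N" shows "abelian_group (mcomp (res N) i)"
 unfolding res_def dg_mod.simps by (rule sub_ag) (use N in \<open>auto simp: res_set_closed res_setD\<close>)

lemma res_ksign: assumes N: "B.dgm N" and x: "x \<in> res_set N i" shows "ksign (mcomp (res N) i) p x = ksign (mcomp N i) p x"
proof -
 have "\<ominus>[res N,i] x = \<ominus>[N,i] x"
  using sub_neg[of "mcomp N i" "res_set N i" x] res_ag[OF N, of i] N x by (simp add: res_def res_set_closed res_setD subsetI)
 then show ?thesis by (simp add: ksign_def)
qed

lemma res_dgm: assumes N: "B.dgm N" shows "L.dgm (res N)"
proof (rule L.dgmI)
 show "module K (mcomp (res N) i)" for i
  by (rule moduleI') (use N B.is_cring B.module_rules[OF B.dgm_module[OF N, of i]] in \<open>simp_all add: res_ag res_setD(1) res_set_closed\<close>)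
 show "mdiff (res N) (n + q) (mact (res N) n q x a) = mact (res N) (n + 1) q (mdiff (res N) n x) a \<oplus>[res N,n + q + 1]
   ksign (mcomp (res N) (n + q + 1)) n (mact (res N) n (q + 1) x (adiff L q a))"
  if x: "x \<in> car (res N) n" and a: "a \<in> L.acar q" for n q x a
 proof -
  have "mact N n (q + 1) x (j (q + 1) (adiff L q a)) \<in> res_set N (n + q + 1)" using x a by (intro res_set_closed(5) N) (auto simp: L.adiff_closed)
  then show ?thesis using x a N by (simp add: res_setD(1) j_rules(1) B.diff_act j_diff res_ksign)
 qed
qed (use N in \<open>simp_all add: res_setD res_set_closed j_rules B.act_add_left B.act_smult_left B.act_add_right B.act_smult_right B.act_assoc j_mult j_one
 B.diff_add B.diff_smult B.diff_diff\<close>)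

definition res_map :: "('k, 'b, 'm) dg_mod => (int => 'm => 'n) => int => 'm => 'n" where "res_map X f = (\<lambda>i. restrict (f i) (res_set X i))"

lemma res_map_apply [simp]: "x \<in> res_set X i ==> res_map X f i x = f i x"
 by (simp add: res_map_def)

lemma Hom_res_set: "[|f \<in> B.Hom X Y n; x \<in> res_set X i; k = i + n|] ==> f i x \<in> res_set Y k"
 using B.Hom_act[of f X Y n x i e 0 i] by (auto simp: res_set_def e_closed B.Hom_closed)

lemma res_map_Hom: "[|B.dgm X; B.dgm Y; f \<in> B.Hom X Y n|] ==> res_map X f \<in> L.Hom (res X) (res Y) n"
 by (intro L.Hom_I) (auto simp: Hom_res_set res_set_closed B.Hom_add B.Hom_smult B.Hom_act res_setD j_rules res_map_def)

lemma res_map_D: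
 assumes X: "B.dgm X" and Y: "B.dgm Y" and f: "f \<in> B.Hom X Y n"
 shows "res_map X (hom_diff X Y n f) = hom_diff (res X) (res Y) n (res_map X f)"
proof (rule L.Hom_eqI)
 show "res_map X (hom_diff X Y n f) \<in> L.Hom (res X) (res Y) (n + 1)" using X Y f by (intro res_map_Hom) (auto simp: B.D_closed)
 show "hom_diff (res X) (res Y) n (res_map X f) \<in> L.Hom (res X) (res Y) (n + 1)" using X Y f by (intro L.D_closed res_dgm res_map_Hom) auto
 fix i x assume x: "x \<in> car (res X) i"
 have "f (i + 1) (mdiff X i x) \<in> res_set Y (i + n + 1)" using x X by (intro Hom_res_set[OF f]) (auto simp: res_set_closed)
 then show "res_map X (hom_diff X Y n f) i x = hom_diff (res X) (res Y) n (res_map X f) i x"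
  using x X Y by (simp add: B.hom_diff_apply L.hom_diff_apply res_setD res_set_closed res_ksign)
qed

lemma res_map_Cyc: assumes X: "B.dgm X" and Y: "B.dgm Y" and f: "f \<in> B.Cyc X Y n" shows "res_map X f \<in> L.Cyc (res X) (res Y) n"
proof -
 have "res_map X \<zero>[B.HM X Y (n + 1)] = \<zero>[L.HM (res X) (res Y) (n + 1)]"
  by (auto simp: res_map_def fun_eq_iff hom_module_def res_setD)
 then show ?thesis using res_map_D[OF X Y B.CycH[OF f]] res_map_Hom[OF X Y B.CycH[OF f]] B.CycD(2)[OF f] by (simp add: L.Cyc_def)
qed

lemma res_functor: "dg_functor K B L (res :: ('k, 'b, 'v) dg_mod => _) (\<lambda>X Y n. res_map X)"
proof (intro dg_functor.intro dg_functor_axioms.intro B.dg_algebra_axioms L.dg_algebra_axioms res_dgm res_map_Hom)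
 show "res_map X (f \<oplus>[B.HM X Y n] g) = res_map X f \<oplus>[L.HM (res X) (res Y) n] res_map X g" for X Y :: "('k, 'b, 'v) dg_mod" and f g n
  by (auto simp: res_map_def fun_eq_iff hom_module_def res_setD)
 show "res_map X (gid X) = gid (res X)" for X :: "('k, 'b, 'v) dg_mod"
  by (auto simp: res_map_def fun_eq_iff gid_def res_setD)
 show "res_map X (gcomp X q g f) = gcomp (res X) q (res_map Y g) (res_map X f)" if "f \<in> B.Hom X Y q" for X Y :: "('k, 'b, 'v) dg_mod" and f g q
  using Hom_res_set[OF that _ HOL.refl] by (auto simp: res_map_def fun_eq_iff gcomp_def res_setD)
qed (auto simp: res_map_D)

lemma res_cocycles: assumes "B.dgm N" shows "cocycles (res N) i = {x \<in> cocycles N i. mact N i 0 x e = x}"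
 by (auto simp: cocycles_def res_set_def)

lemma res_acyclic: assumes N: "B.dgm N" and a: "B.acyclic N" shows "L.acyclic (res N)"
 unfolding L.acyclic_def
proof (intro allI subsetI)
 fix i x assume x: "x \<in> cocycles (res N) i"
 then have x: "x \<in> coboundaries N i" "mact N i 0 x e = x" using a by (auto simp: res_cocycles[OF N] B.acyclic_def)
 obtain y where y: "y \<in> car N (i - 1)" "x = mdiff N (i - 1) y" using x(1) by (rule B.coboundariesE)
 have "mdiff N (i - 1) (mact N (i - 1) 0 y e) = x"
  using B.diff_act[OF N y(1) e_closed, of "i - 1"] x(2) N y B.diff_closed[OF N y(1), of i] by (simp add: d_e B.act_zero_right ksign_zero B.act_closed e_closed ag_simps)
 then show "x \<in> coboundaries (res N) i" using res_set_closed(7)[OF N y(1)] by (intro L.coboundariesI) auto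
qed

text \<open>The algebra acts componentwise on a cone, so restriction commutes with cones.\<close>

lemma res_cone_acyclic:
 assumes X: "B.dgm X" and Y: "B.dgm Y" and f: "f \<in> B.Cyc X Y 0"
 shows "L.acyclic (res (dg_cone X Y f)) \<longleftrightarrow> L.acyclic (dg_cone (res X) (res Y) (res_map X f))"
proof -
 have s: "res_set (dg_cone X Y f) i = res_set Y i \<times> res_set X (i + 1)" for i by (auto simp: res_set_def)
 have d: "mdiff (res (dg_cone X Y f)) i u = mdiff (dg_cone (res X) (res Y) (res_map X f)) i u" if "u \<in> res_set Y i \<times> res_set X (i + 1)" for i u
  using that X res_set_closed(6)[OF X, of "snd u" "i + 1"] by (auto simp: dg_cone_def dg_sum_def dg_shift_def res_ksign)
 have "cocycles (res (dg_cone X Y f)) i = cocycles (dg_cone (res X) (res Y) (res_map X f)) i" for i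
  unfolding cocycles_def using d s by auto
 moreover have "coboundaries (res (dg_cone X Y f)) i = coboundaries (dg_cone (res X) (res Y) (res_map X f)) i" for i
  unfolding coboundaries_def using d[of _ "i - 1"] s[of "i - 1"] by (intro image_cong) auto
 ultimately show ?thesis by (simp add: L.acyclic_def)
qed

lemma res_qis: assumes X: "B.dgm X" and Y: "B.dgm Y" and f: "f \<in> B.Cyc X Y 0" and q: "B.qis X Y f" shows "L.qis (res X) (res Y) (res_map X f)"
 using q B.qis_cone[OF X Y f] L.qis_cone[OF res_dgm[OF X] res_dgm[OF Y] res_map_Cyc[OF X Y f]]
  res_acyclic[OF B.dgm_cone'[OF X Y f]] res_cone_acyclic[OF X Y f] by simp

end

section \<open>Tensor products\<close>

definition additive where
 "additive V W f \<longleftrightarrow> (\<forall>x\<in>carrier V. f x \<in> carrier W) & (\<forall>x\<in>carrier V. \<forall>y\<in>carrier V. f (x \<oplus>[V] y) = f x \<oplus>[W] f y)"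

lemma additiveD: "[|additive V W f; x \<in> carrier V|] ==> f x \<in> carrier W"
 "[|additive V W f; x \<in> carrier V; y \<in> carrier V|] ==> f (x \<oplus>[V] y) = f x \<oplus>[W] f y"
 by (auto simp: additive_def)

lemma additive_comp: "[|additive V W f; additive W U g|] ==> additive V U (\<lambda>x. g (f x))"
 by (auto simp: additive_def)

lemma additive_plus: "[|abelian_group W; additive V W f; additive V W g|] ==> additive V W (\<lambda>x. f x \<oplus>[W] g x)"
 by (simp add: additive_def ag_add_closed ag_ac)

lemma additive_sign: "[|abelian_group W; additive V W f|] ==> additive V W (\<lambda>x. ksign W p (f x))"
 by (simp add: additive_def ksign_add ksign_closed)

lemma additive_id: "additive V V (\<lambda>x. x)"
 by (simp add: additive_def)

lemma additive_const_zero: "abelian_group W ==> additive V W (\<lambda>x. \<zero>[W])"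
 by (simp add: additive_def ag_simps)

text \<open>An element of \<open>N \<otimes>\<^sub>L e B\<close> is a class of words in elementary tensors; \<open>code\<close> stores a representative in the
 type \<open>'v\<close> of the elements of \<open>N\<close>.\<close>

locale coded_corner = corner K B L e j
 for K :: "'k ring" and B :: "('k, 'b) dg_alg" and L :: "('k, 'l) dg_alg" and e :: 'b and j :: "int => 'l => 'b" +
 fixes code :: "(int \<times> int \<times> 'v \<times> 'b) list => 'v"
 assumes inj_code: "inj code"
begin

text \<open>The right \<open>B\<close>-module \<open>e B\<close>, which is a left \<open>L\<close>-module through \<open>j\<close>.\<close>

definition lset where "lset k = {w \<in> B.acar k. amult B 0 k e w = w}"

lemma lsetD: "w \<in> lset k ==> w \<in> B.acar k" "w \<in> lset k ==> amult B 0 k e w = w"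
 by (auto simp: lset_def)

lemma lset_closed:
 "\<zero>[acomp B k] \<in> lset k" "[|w \<in> lset k; w' \<in> lset k|] ==> w \<oplus>[acomp B k] w' \<in> lset k"
 "[|w \<in> lset k; b \<in> B.acar l; n = k + l|] ==> amult B k l w b \<in> lset n"
 "[|w \<in> lset k; n = k + 1|] ==> adiff B k w \<in> lset n"
 "[|a \<in> L.acar l; w \<in> B.acar k; n = l + k|] ==> amult B l k (j l a) w \<in> lset n"
 "e \<in> lset 0"
proof -
 note r = lset_def e_closed B.amult_rules B.amult_closed e_e j_rules j_corner ag_simps
 show "\<zero>[acomp B k] \<in> lset k" "[|w \<in> lset k; w' \<in> lset k|] ==> w \<oplus>[acomp B k] w' \<in> lset k" "e \<in> lset 0" by (simp_all add: r)
 show "[|w \<in> lset k; b \<in> B.acar l; n = k + l|] ==> amult B k l w b \<in> lset n"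
  using B.amult_assoc[of e 0 w k b l] by (simp add: r)
 show "[|a \<in> L.acar l; w \<in> B.acar k; n = l + k|] ==> amult B l k (j l a) w \<in> lset n"
  using B.amult_assoc[of e 0 "j l a" l w k] by (simp add: r)
 show "adiff B k w \<in> lset n" if w: "w \<in> lset k" and n: "n = k + 1"
 proof -
  have c: "adiff B k w \<in> B.acar (k + 1)" using lsetD(1)[OF w] by (simp add: B.adiff_closed)
  have "adiff B k (amult B 0 k e w) = amult B 0 (k + 1) e (adiff B k w)"
   using B.adiff_amult[OF e_closed lsetD(1)[OF w], of k] B.amult_rules(5)[OF lsetD(1)[OF w], of 1] B.amult_closed[OF e_closed c, of "k + 1"]
   by (simp add: d_e ag_l_zero add.commute)
  then show ?thesis using c n by (simp add: lset_def lsetD(2)[OF w])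
 qed
qed

definition words where "words N n = lists {(i, k, x, w). i + k = n & x \<in> car N i & w \<in> lset k}"

text \<open>The relations of a tensor product over \<open>L\<close>.  Words of elementary tensors stand for their sums; the scalars need no
 separate relation because they act through \<open>L\<close>.\<close>

inductive teq :: "('k, 'l, 'v) dg_mod => int => (int \<times> int \<times> 'v \<times> 'b) list => (int \<times> int \<times> 'v \<times> 'b) list => bool"
 for N :: "('k, 'l, 'v) dg_mod" and n :: int where
 refl: "t \<in> words N n ==> teq N n t t"
| sym: "teq N n s t ==> teq N n t s"
| trans: "[|teq N n s t; teq N n t u|] ==> teq N n s u"
| append: "[|teq N n s s'; teq N n t t'|] ==> teq N n (s @ t) (s' @ t')"
| comm: "[|s \<in> words N n; t \<in> words N n|] ==> teq N n (s @ t) (t @ s)"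
| add_left: "[|i + k = n; x \<in> car N i; y \<in> car N i; w \<in> lset k|] ==>
  teq N n [(i, k, x \<oplus>[N,i] y, w)] [(i, k, x, w), (i, k, y, w)]"
| add_right: "[|i + k = n; x \<in> car N i; w \<in> lset k; z \<in> lset k|] ==>
  teq N n [(i, k, x, w \<oplus>[acomp B k] z)] [(i, k, x, w), (i, k, x, z)]"
| zero: "[|i + k = n; w \<in> lset k|] ==> teq N n [(i, k, \<zero>[N,i], w)] []"
| balance: "[|i + l + k = n; x \<in> car N i; a \<in> L.acar l; w \<in> lset k|] ==>
  teq N n [(i + l, k, mact N i l x a, w)] [(i, l + k, x, amult B l k (j l a) w)]"

definition cls where "cls N n t = code (SOME q. teq N n t q)"
definition dec where "dec = inv_into UNIV code"
definition tens where "tens N n i k x w = cls N n [(i, k, x, w)]"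

definition tmod :: "('k, 'l, 'v) dg_mod => int => ('k, 'v) module" where
 "tmod N n = \<lparr>carrier = cls N n ` words N n, mult = undefined, one = undefined, zero = cls N n [],
   add = (\<lambda>u v. cls N n (dec u @ dec v)),
   smult = (\<lambda>c u. foldr (\<lambda>(i, k, x, w) s. cls N n (dec (tens N n i k (c \<odot>[N,i] x) w) @ dec s)) (dec u) (cls N n []))\<rparr>"

abbreviation tcar where "tcar N n \<equiv> carrier (tmod N n)"

text \<open>The map out of the tensor product induced by \<open>\<beta>\<close>, computed on the coded representative.  It is well defined for
 balanced \<open>\<beta>\<close> only; see \<open>lift_additive\<close>.\<close>

definition lift :: "('q, 'g) module => (int => int => 'v => 'b => 'g) => 'v => 'g" where
 "lift G \<beta> u = foldr (\<lambda>(i, k, x, w) s. \<beta> i k x w \<oplus>[G] s) (dec u) \<zero>[G]"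

definition balanced :: "('k, 'l, 'v) dg_mod => int => ('q, 'g) module => (int => int => 'v => 'b => 'g) => bool" where
 "balanced N n G \<beta> \<longleftrightarrow>
  (\<forall>i k x w. i + k = n --> x \<in> car N i --> w \<in> lset k --> \<beta> i k x w \<in> carrier G) &
  (\<forall>i k x y w. i + k = n --> x \<in> car N i --> y \<in> car N i --> w \<in> lset k -->
   \<beta> i k (x \<oplus>[N,i] y) w = \<beta> i k x w \<oplus>[G] \<beta> i k y w) &
  (\<forall>i k x w z. i + k = n --> x \<in> car N i --> w \<in> lset k --> z \<in> lset k -->
   \<beta> i k x (w \<oplus>[acomp B k] z) = \<beta> i k x w \<oplus>[G] \<beta> i k x z) &
  (\<forall>i l k x a w. i + l + k = n --> x \<in> car N i --> a \<in> L.acar l --> w \<in> lset k -->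
   \<beta> (i + l) k (mact N i l x a) w = \<beta> i (l + k) x (amult B l k (j l a) w))"

lemma balancedI:
 assumes "\<And>i k x w. [|i + k = n; x \<in> car N i; w \<in> lset k|] ==> \<beta> i k x w \<in> carrier G"
  "\<And>i k x y w. [|i + k = n; x \<in> car N i; y \<in> car N i; w \<in> lset k|] ==>
   \<beta> i k (x \<oplus>[N,i] y) w = \<beta> i k x w \<oplus>[G] \<beta> i k y w"
  "\<And>i k x w z. [|i + k = n; x \<in> car N i; w \<in> lset k; z \<in> lset k|] ==>
   \<beta> i k x (w \<oplus>[acomp B k] z) = \<beta> i k x w \<oplus>[G] \<beta> i k x z"
  "\<And>i l k x a w. [|i + l + k = n; x \<in> car N i; a \<in> L.acar l; w \<in> lset k|] ==>
   \<beta> (i + l) k (mact N i l x a) w = \<beta> i (l + k) x (amult B l k (j l a) w)"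
 shows "balanced N n G \<beta>"
 unfolding balanced_def using assms by simp

lemma balancedD:
 assumes "balanced N n G \<beta>"
 shows "[|i + k = n; x \<in> car N i; w \<in> lset k|] ==> \<beta> i k x w \<in> carrier G"
  "[|i + k = n; x \<in> car N i; y \<in> car N i; w \<in> lset k|] ==>
   \<beta> i k (x \<oplus>[N,i] y) w = \<beta> i k x w \<oplus>[G] \<beta> i k y w"
  "[|i + k = n; x \<in> car N i; w \<in> lset k; z \<in> lset k|] ==>
   \<beta> i k x (w \<oplus>[acomp B k] z) = \<beta> i k x w \<oplus>[G] \<beta> i k x z"
  "[|i + l + k = n; x \<in> car N i; a \<in> L.acar l; w \<in> lset k|] ==>
   \<beta> (i + l) k (mact N i l x a) w = \<beta> i (l + k) x (amult B l k (j l a) w)"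
 using assms unfolding balanced_def by simp_all

lemma words_simps: "[] \<in> words N n" "s @ t \<in> words N n \<longleftrightarrow> s \<in> words N n & t \<in> words N n"
 "(i, k, x, w) # t \<in> words N n \<longleftrightarrow> i + k = n & x \<in> car N i & w \<in> lset k & t \<in> words N n"
 by (auto simp: words_def)

lemma teq_words: assumes N: "L.dgm N" and t: "teq N n s t" shows "s \<in> words N n & t \<in> words N n"
 using t
proof induction
 case (add_left i k x y w) then show ?case using N by (simp add: words_simps ag_add_closed)
next
 case (add_right i k x w z) then show ?case by (simp add: words_simps lset_closed(2))
next
 case (zero i k w) then show ?case using N by (simp add: words_simps ag_zero_closed)
next
 case (balance i l k x a w)
 then show ?case using L.act_closed[OF N balance(2,3) HOL.refl] lset_closed(5)[OF balance(3) lsetD(1)[OF balance(4)] HOL.refl]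
  by (simp add: words_simps add.assoc)
qed (simp_all add: words_simps)

lemma cls_eq: assumes "teq N n s t" shows "cls N n s = cls N n t"
proof -
 have "teq N n s = teq N n t" using assms teq.sym teq.trans by (intro ext) blast
 then show ?thesis by (simp add: cls_def)
qed

lemma dec_cls: assumes "t \<in> words N n" shows "teq N n t (dec (cls N n t))"
 unfolding dec_def cls_def inv_f_f[OF inj_code] by (rule someI[of "teq N n t" t]) (rule teq.refl[OF assms])

lemma cls_closed: "t \<in> words N n ==> cls N n t \<in> tcar N n"
 by (simp add: tmod_def)

lemma cls_append: assumes "s \<in> words N n" "t \<in> words N n" shows "cls N n s \<oplus>[tmod N n] cls N n t = cls N n (s @ t)"
proof -
 have "teq N n (s @ t) (dec (cls N n s) @ dec (cls N n t))" by (intro teq.append dec_cls assms)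
 then show ?thesis using cls_eq by (simp add: tmod_def)
qed

lemma tmod_zero: "\<zero>[tmod N n] = cls N n []"
 by (simp add: tmod_def)

text \<open>Negating the left factor of every letter gives the negative, by additivity in that factor.\<close>

lemma tmod_neg:
 assumes N: "L.dgm N" and t: "t \<in> words N n"
 shows "\<exists>s\<in>words N n. teq N n (s @ t) []"
 using t
proof (induction t)
 case Nil then show ?case by (auto intro!: bexI[of _ "[]"] teq.refl simp: words_simps)
next
 case (Cons a t)
 obtain i k x w where a: "a = (i, k, x, w)" by (cases a)
 have m: "i + k = n" "x \<in> car N i" "w \<in> lset k" "t \<in> words N n" using Cons.prems by (simp_all add: a words_simps)
 obtain s where s: "s \<in> words N n" "teq N n (s @ t) []" using Cons.IH m(4) by blast
 let ?b = "(i, k, \<ominus>[N,i] x, w)"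
 have b: "[?b] \<in> words N n" "[a] \<in> words N n" using m N by (simp_all add: a words_simps ag_simps)
 have "teq N n [(i, k, \<ominus>[N,i] x \<oplus>[N,i] x, w)] ([?b] @ [a])"
  unfolding a append_Cons append_Nil by (rule teq.add_left) (use m N in \<open>simp_all add: ag_simps\<close>)
 then have "teq N n ([?b] @ [a]) []" using teq.zero[OF m(1,3), where N = N] m N by (auto simp: ag_simps intro: teq.sym teq.trans)
 then have "teq N n (([?b] @ [a]) @ (s @ t)) ([] @ [])" using s(2) by (rule teq.append)
 moreover have "teq N n (((s @ [?b]) @ [a]) @ t) (([?b] @ ([a] @ s)) @ t)"
  using teq.append[OF teq.comm[OF s(1), of "[?b] @ [a]"] teq.refl[OF m(4)]] b by (simp add: words_simps)
 ultimately have "teq N n ((s @ [?b]) @ (a # t)) []" by (auto intro: teq.trans)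
 then show ?case using s b by (intro bexI[of _ "s @ [?b]"]) (auto simp: words_simps)
qed

lemma tmod_ag: assumes N: "L.dgm N" shows "abelian_group (tmod N n)"
proof (rule abelian_groupI)
 have rep: "\<exists>t\<in>words N n. u = cls N n t" if "u \<in> tcar N n" for u using that by (auto simp: tmod_def)
 fix u assume u: "u \<in> tcar N n"
 obtain r where r: "r \<in> words N n" "u = cls N n r" using rep[OF u] by blast
 show "\<zero>[tmod N n] \<oplus>[tmod N n] u = u" by (simp add: r tmod_zero cls_append words_simps)
 obtain s where s: "s \<in> words N n" "teq N n (s @ r) []" using tmod_neg[OF N r(1)] by blast
 show "\<exists>y\<in>tcar N n. y \<oplus>[tmod N n] u = \<zero>[tmod N n]"
  by (rule bexI[of _ "cls N n s"]) (simp_all add: r s cls_append cls_closed tmod_zero cls_eq[OF s(2)])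
 fix v assume v: "v \<in> tcar N n"
 obtain s where s: "s \<in> words N n" "v = cls N n s" using rep[OF v] by blast
 show "u \<oplus>[tmod N n] v \<in> tcar N n" by (simp add: r s cls_append cls_closed words_simps)
 show "u \<oplus>[tmod N n] v = v \<oplus>[tmod N n] u" by (simp add: r s cls_append cls_eq[OF teq.comm])
 fix w assume w: "w \<in> tcar N n"
 obtain t where t: "t \<in> words N n" "w = cls N n t" using rep[OF w] by blast
 show "u \<oplus>[tmod N n] v \<oplus>[tmod N n] w = u \<oplus>[tmod N n] (v \<oplus>[tmod N n] w)" by (simp add: r s t cls_append words_simps)
qed (simp add: tmod_zero cls_closed words_simps)

lemma tens_closed: "[|i + k = n; x \<in> car N i; w \<in> lset k|] ==> tens N n i k x w \<in> tcar N n"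
 by (simp add: tens_def cls_closed words_simps)

lemma tens_balanced: assumes N: "L.dgm N" shows "balanced N n (tmod N n) (tens N n)"
proof (rule balancedI)
 show "tens N n i k (x \<oplus>[N,i] y) w = tens N n i k x w \<oplus>[tmod N n] tens N n i k y w"
  if m: "i + k = n" "x \<in> car N i" "y \<in> car N i" "w \<in> lset k" for i k x y w
  using cls_eq[OF teq.add_left[OF m]] m by (simp add: tens_def cls_append words_simps)
 show "tens N n i k x (w \<oplus>[acomp B k] z) = tens N n i k x w \<oplus>[tmod N n] tens N n i k x z"
  if m: "i + k = n" "x \<in> car N i" "w \<in> lset k" "z \<in> lset k" for i k x w z
  using cls_eq[OF teq.add_right[OF m]] m by (simp add: tens_def cls_append words_simps)
qed (simp_all add: tens_def cls_closed words_simps cls_eq[OF teq.balance])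

lemmas tens_rules = balancedD(2-4)[OF tens_balanced]

lemma tens_zero: assumes N: "L.dgm N" shows "[|i + k = n; w \<in> lset k|] ==> tens N n i k \<zero>[N,i] w = \<zero>[tmod N n]"
  "[|i + k = n; x \<in> car N i|] ==> tens N n i k x \<zero>[acomp B k] = \<zero>[tmod N n]"
proof -
 show "[|i + k = n; w \<in> lset k|] ==> tens N n i k \<zero>[N,i] w = \<zero>[tmod N n]"
  by (simp add: tens_def tmod_zero cls_eq[OF teq.zero])
 show "[|i + k = n; x \<in> car N i|] ==> tens N n i k x \<zero>[acomp B k] = \<zero>[tmod N n]"
  using tens_rules(2)[OF N, of i k n x "\<zero>[acomp B k]" "\<zero>[acomp B k]"] ag_idem_zero[OF tmod_ag[OF N] tens_closed[of i k n x N "\<zero>[acomp B k]"]]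
  by (simp add: lset_closed(1) ag_simps)
qed

lemma tens_ksign: assumes N: "L.dgm N" and m: "i + k = n" "x \<in> car N i" "w \<in> lset k"
 shows "tens N n i k (ksign (mcomp N i) p x) w = ksign (tmod N n) p (tens N n i k x w)"
 using additive_ksign[of "mcomp N i" "tmod N n" "\<lambda>x. tens N n i k x w"] m N by (simp add: tmod_ag tens_closed tens_rules)

lemma tmod_induct [consumes 2, case_names zero add]:
 assumes N: "L.dgm N" and u: "u \<in> tcar N n" and z: "P \<zero>[tmod N n]"
  and a: "\<And>i k x w v. [|i + k = n; x \<in> car N i; w \<in> lset k; v \<in> tcar N n; P v|] ==> P (tens N n i k x w \<oplus>[tmod N n] v)"
 shows "P u"
proof -
 have "P (cls N n t)" if "t \<in> words N n" for t using that
 proof (induction t)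
  case Nil then show ?case using z by (simp add: tmod_zero)
 next
  case (Cons b t)
  obtain i k x w where b: "b = (i, k, x, w)" by (cases b)
  have m: "i + k = n" "x \<in> car N i" "w \<in> lset k" "t \<in> words N n" using Cons.prems by (simp_all add: b words_simps)
  then have "cls N n (b # t) = tens N n i k x w \<oplus>[tmod N n] cls N n t" by (simp add: tens_def b cls_append words_simps)
  then show ?case using a[OF m(1-3) cls_closed[OF m(4)]] Cons.IH m by simp
 qed
 then show ?thesis using u by (auto simp: tmod_def)
qed

text \<open>Elementary tensors generate.  Together with \<open>lift_additive\<close> this is the universal property, and nothing else
 about words is used afterwards.\<close>

lemma tmod_ext:
 assumes N: "L.dgm N" and G: "abelian_group G" and f: "additive (tmod N n) G f" and g: "additive (tmod N n) G g"
  and fg: "\<And>i k x w. [|i + k = n; x \<in> car N i; w \<in> lset k|] ==> f (tens N n i k x w) = g (tens N n i k x w)"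
  and u: "u \<in> tcar N n"
 shows "f u = g u"
 using N u
proof (induction rule: tmod_induct)
 case zero show ?case using additive_zero[of "tmod N n" G f, OF tmod_ag[OF N] G additiveD[OF f]] additive_zero[of "tmod N n" G g, OF tmod_ag[OF N] G additiveD[OF g]] by simp
next
 case (add i k x w v) then show ?case by (simp add: additiveD(2)[OF f] additiveD(2)[OF g] tens_closed fg)
qed

lemma lift_additive:
 assumes N: "L.dgm N" and G: "abelian_group G" and b: "balanced N n G \<beta>"
 shows "additive (tmod N n) G (lift G \<beta>)" and "[|i + k = n; x \<in> car N i; w \<in> lset k|] ==> lift G \<beta> (tens N n i k x w) = \<beta> i k x w"
proof -
 define ev where "ev t = foldr (\<lambda>(i, k, x, w) s. \<beta> i k x w \<oplus>[G] s) t \<zero>[G]" for t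
 have ev_simps: "ev [] = \<zero>[G]" "ev ((i, k, x, w) # t) = \<beta> i k x w \<oplus>[G] ev t" for i k x w t by (simp_all add: ev_def)
 have ev: "ev t \<in> carrier G" if "t \<in> words N n" for t using that
  by (induction t) (auto simp: ev_simps words_simps ag_simps G balancedD(1)[OF b])
 have ev_append: "ev (s @ t) = ev s \<oplus>[G] ev t" if "s \<in> words N n" "t \<in> words N n" for s t using that(1)
  by (induction s) (auto simp: ev_simps words_simps ag_l_zero ag_assoc G balancedD(1)[OF b] ev that(2))
 have z: "\<beta> i k \<zero>[N,i] w = \<zero>[G]" if "i + k = n" "w \<in> lset k" for i k w
  using additive_zero[of "mcomp N i" G "\<lambda>x. \<beta> i k x w"] that N G balancedD(1,2)[OF b] by simp
 have eq: "ev s = ev t" if "teq N n s t" for s t using that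
 proof (induction rule: teq.induct)
  case (append s s' t t') then show ?case using teq_words[OF N append(1)] teq_words[OF N append(2)] by (simp add: ev_append)
 next
  case (comm s t) then show ?case by (simp add: ev_append ag_comm[OF G] ev)
 next
  case (add_left i k x y w) then show ?case using balancedD(1,2)[OF b] N G by (simp add: ev_simps ag_simps)
 next
  case (add_right i k x w z) then show ?case using balancedD(1,3)[OF b] N G by (simp add: ev_simps ag_simps)
 next
  case (balance i l k x a w) then show ?case using balancedD(4)[OF b] by (simp add: ev_simps)
 qed (simp_all add: ev_simps z ag_simps G)
 have lift: "lift G \<beta> (cls N n t) = ev t" if "t \<in> words N n" for t
  using eq[OF dec_cls[OF that]] by (simp add: lift_def ev_def)
 show "additive (tmod N n) G (lift G \<beta>)" unfolding additive_def
 proof (intro conjI ballI)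
  fix u v assume "u \<in> tcar N n" "v \<in> tcar N n"
  then obtain s t where s: "s \<in> words N n" "u = cls N n s" "t \<in> words N n" "v = cls N n t" by (auto simp: tmod_def)
  then show "lift G \<beta> (u \<oplus>[tmod N n] v) = lift G \<beta> u \<oplus>[G] lift G \<beta> v" by (simp add: cls_append lift words_simps ev_append)
  show "lift G \<beta> u \<in> carrier G" using s by (simp add: lift ev)
 qed
 show "lift G \<beta> (tens N n i k x w) = \<beta> i k x w" if m: "i + k = n" "x \<in> car N i" "w \<in> lset k" for i k x w
  using m G balancedD(1)[OF b m] by (simp add: tens_def lift words_simps ev_simps ag_simps)
qed

lemma tmod_smult: "c \<odot>[tmod N n] u = lift (tmod N n) (\<lambda>i k x w. tens N n i k (c \<odot>[N,i] x) w) u"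
 by (simp add: tmod_def lift_def)

end

lemma (in dg_algebra) additive_neg_amult:
 "[|a \<in> acar i; b \<in> acar k|] ==> amult A i k a (\<ominus>[acomp A k] b) = \<ominus>[acomp A (i + k)] amult A i k a b"
 using amult_rules(8)[of a i b k 1] by (simp add: ksign_def)

context coded_corner begin

lemma tens_ksign_right: assumes N: "L.dgm N" and m: "i + k = n" "x \<in> car N i" "w \<in> lset k"
 shows "tens N n i k x (ksign (acomp B k) p w) = ksign (tmod N n) p (tens N n i k x w)"
proof -
 have "\<ominus>[acomp B k] w \<in> lset k"
  using m(3) B.additive_neg_amult[OF e_closed lsetD(1)[OF m(3)]] by (simp add: lset_def ag_neg_closed)
 then have "\<ominus>[tmod N n] tens N n i k x w = tens N n i k x (\<ominus>[acomp B k] w)"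
  using tens_rules(2)[OF N m(1,2,3), of "\<ominus>[acomp B k] w"] m tens_zero(2)[OF N m(1,2)]
  by (intro ag_neg_unique[OF tmod_ag[OF N]]) (simp_all add: tens_closed ag_r_neg lsetD)
 then show ?thesis by (simp add: ksign_def)
qed

lemma lset_ksign: assumes "w \<in> lset k" shows "ksign (acomp B k) p w \<in> lset k"
 using assms B.additive_neg_amult[OF e_closed lsetD(1)[OF assms]] by (simp add: ksign_def lset_def ag_neg_closed)

lemma smult_balanced: assumes N: "L.dgm N" and c: "c \<in> carrier K"
 shows "balanced N n (tmod N n) (\<lambda>i k x w. tens N n i k (c \<odot>[N,i] x) w)"
proof (rule balancedI)
 show "tens N n (i + l) k (c \<odot>[N,i + l] mact N i l x a) w = tens N n i (l + k) (c \<odot>[N,i] x) (amult B l k (j l a) w)"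
  if "i + l + k = n" "x \<in> car N i" "a \<in> L.acar l" "w \<in> lset k" for i l k x a w
  using that tens_rules(3)[OF N, of i l k n "c \<odot>[N,i] x" a w] N c by (simp add: L.act_smult_left)
qed (use N c in \<open>simp_all add: tens_closed tens_rules module.smult_r_distr[OF L.dgm_module]\<close>)

lemma smult_additive: "[|L.dgm N; c \<in> carrier K|] ==> additive (tmod N n) (tmod N n) (\<lambda>u. c \<odot>[tmod N n] u)"
 unfolding tmod_smult by (rule lift_additive(1)[OF _ tmod_ag smult_balanced])

lemma smult_tens: "[|L.dgm N; c \<in> carrier K; i + k = n; x \<in> car N i; w \<in> lset k|] ==>
  c \<odot>[tmod N n] tens N n i k x w = tens N n i k (c \<odot>[N,i] x) w"
 unfolding tmod_smult by (rule lift_additive(2)[OF _ tmod_ag smult_balanced])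

text \<open>The scalar \<open>c\<close> acts through the element \<open>c 1\<close> of \<open>L\<close>, which may be moved across the tensor sign.\<close>

lemma smult_tens_right:
 assumes N: "L.dgm N" and c: "c \<in> carrier K" and m: "i + k = n" "x \<in> car N i" "w \<in> lset k"
 shows "tens N n i k x (c \<odot>[acomp B k] w) = c \<odot>[tmod N n] tens N n i k x w"
proof -
 let ?c = "c \<odot>[acomp L 0] aone L"
 have c1: "?c \<in> L.acar 0" using module.smult_closed[OF L.acomp_module c L.aone_closed] .
 have "mact N i 0 x ?c = c \<odot>[N,i] x" using L.act_smult_right[OF N c m(2) L.aone_closed] m N by (simp add: L.act_one)
 moreover have "amult B 0 k (j 0 ?c) w = c \<odot>[acomp B k] w"
  using j_rules(3)[OF c L.aone_closed] B.amult_rules(2)[OF c e_closed lsetD(1)[OF m(3)]] m by (simp add: j_one lsetD)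
 ultimately show ?thesis using tens_rules(3)[OF N _ m(2) c1 m(3), of n] m N c by (simp add: smult_tens)
qed

lemma tmod_module: assumes N: "L.dgm N" shows "module K (tmod N n)"
proof (rule moduleI'[OF B.is_cring tmod_ag[OF N]])
 note G = tmod_ag[OF N, of n] and A = smult_additive[OF N]
 note t = smult_tens[OF N] and M = L.module_rules[OF L.dgm_module[OF N]]
 fix c x assume c: "c \<in> carrier K" and x: "x \<in> tcar N n"
 show "c \<odot>[tmod N n] x \<in> tcar N n" by (rule additiveD(1)[OF A[OF c] x])
 show "c \<odot>[tmod N n] (x \<oplus>[tmod N n] y) = c \<odot>[tmod N n] x \<oplus>[tmod N n] c \<odot>[tmod N n] y" if "y \<in> tcar N n" for y
  by (rule additiveD(2)[OF A[OF c] x that])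
 fix d assume d: "d \<in> carrier K"
 show "(c \<oplus>[K] d) \<odot>[tmod N n] x = c \<odot>[tmod N n] x \<oplus>[tmod N n] d \<odot>[tmod N n] x"
  by (rule tmod_ext[OF N G A additive_plus[OF G A[OF c] A[OF d]] _ x]) (use c d N in \<open>simp_all add: t M tens_rules\<close>)
 show "c \<otimes>\<^bsub>K\<^esub> d \<odot>[tmod N n] x = c \<odot>[tmod N n] (d \<odot>[tmod N n] x)"
  by (rule tmod_ext[OF N G A additive_comp[OF A[OF d] A[OF c]] _ x]) (use c d N in \<open>simp_all add: t M\<close>)
next
 fix x assume x: "x \<in> tcar N n"
 show "\<one>\<^bsub>K\<^esub> \<odot>[tmod N n] x = x"
  by (rule tmod_ext[OF N tmod_ag[OF N] smult_additive[OF N] additive_id _ x])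
    (use N in \<open>simp_all add: smult_tens L.module_rules[OF L.dgm_module[OF N]]\<close>)
qed

text \<open>The \<open>B\<close>-module \<open>N \<otimes>\<^sub>L e B\<close> with differential \<open>d(x \<otimes> w) = d x \<otimes> w + (-1)\<^sup>i x \<otimes> d w\<close> for \<open>x\<close> of degree \<open>i\<close>.\<close>

definition tp :: "('k, 'l, 'v) dg_mod => ('k, 'b, 'v) dg_mod" where
 "tp N = \<lparr>mcomp = tmod N,
   mact = (\<lambda>n l u b. lift (tmod N (n + l)) (\<lambda>i k x w. tens N (n + l) i (k + l) x (amult B k l w b)) u),
   mdiff = (\<lambda>n u. lift (tmod N (n + 1)) (\<lambda>i k x w. tens N (n + 1) (i + 1) k (mdiff N i x) w \<oplus>[tmod N (n + 1)]
    tens N (n + 1) i (k + 1) (ksign (mcomp N i) i x) (adiff B k w)) u)\<rparr>"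

lemma tp_mcomp [simp]: "mcomp (tp N) = tmod N" by (simp add: tp_def)

lemma act_balanced: assumes N: "L.dgm N" and b: "b \<in> B.acar l"
 shows "balanced N n (tmod N (n + l)) (\<lambda>i k x w. tens N (n + l) i (k + l) x (amult B k l w b))"
proof (rule balancedI)
 note cl = lset_closed(3)[OF _ b HOL.refl]
 fix i k assume ik: "i + k = n"
 then have ik': "i + (k + l) = n + l" by simp
 fix x w assume m: "x \<in> car N i" "w \<in> lset k"
 show "tens N (n + l) i (k + l) x (amult B k l w b) \<in> tcar N (n + l)" by (rule tens_closed[OF ik' m(1) cl[OF m(2)]])
 show "tens N (n + l) i (k + l) (x \<oplus>[N,i] y) (amult B k l w b) =
   tens N (n + l) i (k + l) x (amult B k l w b) \<oplus>[tmod N (n + l)] tens N (n + l) i (k + l) y (amult B k l w b)"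
  if "y \<in> car N i" for y by (rule tens_rules(1)[OF N ik' m(1) that cl[OF m(2)]])
 show "tens N (n + l) i (k + l) x (amult B k l (w \<oplus>[acomp B k] z) b) =
   tens N (n + l) i (k + l) x (amult B k l w b) \<oplus>[tmod N (n + l)] tens N (n + l) i (k + l) x (amult B k l z b)"
  if z: "z \<in> lset k" for z
  using tens_rules(2)[OF N ik' m(1) cl[OF m(2)] cl[OF z]] B.amult_rules(1)[OF lsetD(1)[OF m(2)] lsetD(1)[OF z] b] by simp
next
 fix i l' k x a w assume ik: "i + l' + k = n" and m: "x \<in> car N i" "a \<in> carrier (acomp L l')" "w \<in> lset k"
 have "tens N (n + l) (i + l') (k + l) (mact N i l' x a) (amult B k l w b) = tens N (n + l) i (l' + (k + l)) x (amult B l' (k + l) (j l' a) (amult B k l w b))"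
  by (rule tens_rules(3)[OF N _ m(1,2) lset_closed(3)[OF m(3) b HOL.refl]]) (use ik in simp)
 also have "amult B l' (k + l) (j l' a) (amult B k l w b) = amult B (l' + k) l (amult B l' k (j l' a) w) b"
  using B.amult_assoc[OF j_rules(1)[OF m(2)] lsetD(1)[OF m(3)] b] by simp
 finally show "tens N (n + l) (i + l') (k + l) (mact N i l' x a) (amult B k l w b) =
   tens N (n + l) i (l' + k + l) x (amult B (l' + k) l (amult B l' k (j l' a) w) b)" by (simp add: add.assoc)
qed

lemma tp_act_additive: "[|L.dgm N; b \<in> B.acar l|] ==> additive (tmod N n) (tmod N (n + l)) (\<lambda>u. mact (tp N) n l u b)"
 unfolding tp_def dg_mod.simps by (rule lift_additive(1)[OF _ tmod_ag act_balanced])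

lemma tp_act_tens: "[|L.dgm N; b \<in> B.acar l; i + k = n; x \<in> car N i; w \<in> lset k|] ==>
  mact (tp N) n l (tens N n i k x w) b = tens N (n + l) i (k + l) x (amult B k l w b)"
 unfolding tp_def dg_mod.simps by (rule lift_additive(2)[OF _ tmod_ag act_balanced])

text \<open>For \<open>a\<close> of degree \<open>l\<close> both sides of the balancing relation \<open>x a \<otimes> w = x \<otimes> a w\<close> acquire the three terms
 \<open>d x \<otimes> a w\<close>, \<open>(-1)\<^sup>i x \<otimes> (d a) w\<close> and \<open>(-1)\<^sup>i\<^sup>+\<^sup>l x \<otimes> a d w\<close>.\<close>

lemma diff_balanced: assumes N: "L.dgm N"
 shows "balanced N n (tmod N (n + 1)) (\<lambda>i k x w. tens N (n + 1) (i + 1) k (mdiff N i x) w \<oplus>[tmod N (n + 1)]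
    tens N (n + 1) i (k + 1) (ksign (mcomp N i) i x) (adiff B k w))"
proof (rule balancedI)
 note G = tmod_ag[OF N, of "n + 1"] and A = L.dgm_ag[OF N]
 fix i k assume ik: "i + k = n"
 then have ik': "(i + 1) + k = n + 1" "i + (k + 1) = n + 1" by simp_all
 fix x w assume m: "x \<in> car N i" "w \<in> lset k"
 have c: "mdiff N i x \<in> car N (i + 1)" "ksign (mcomp N i) i x \<in> car N i" if "x \<in> car N i" for x
  using that N by (simp_all add: L.diff_closed ksign_closed)
 note w = lset_closed(4)[OF _ HOL.refl]
 note tc = tens_closed[OF ik'(1) c(1)] tens_closed[OF ik'(2) c(2) w]
 show "tens N (n + 1) (i + 1) k (mdiff N i x) w \<oplus>[tmod N (n + 1)] tens N (n + 1) i (k + 1) (ksign (mcomp N i) i x) (adiff B k w) \<in> tcar N (n + 1)"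
  using m tc G by (simp add: ag_add_closed)
 show "tens N (n + 1) (i + 1) k (mdiff N i (x \<oplus>[N,i] y)) w \<oplus>[tmod N (n + 1)] tens N (n + 1) i (k + 1) (ksign (mcomp N i) i (x \<oplus>[N,i] y)) (adiff B k w) =
  (tens N (n + 1) (i + 1) k (mdiff N i x) w \<oplus>[tmod N (n + 1)] tens N (n + 1) i (k + 1) (ksign (mcomp N i) i x) (adiff B k w)) \<oplus>[tmod N (n + 1)]
  (tens N (n + 1) (i + 1) k (mdiff N i y) w \<oplus>[tmod N (n + 1)] tens N (n + 1) i (k + 1) (ksign (mcomp N i) i y) (adiff B k w))"
  if y: "y \<in> car N i" for y
  using m y tc[OF m] tc[OF y m(2)] tens_rules(1)[OF N ik'(1) c(1)[OF m(1)] c(1)[OF y] m(2)] tens_rules(1)[OF N ik'(2) c(2)[OF m(1)] c(2)[OF y] w[OF m(2)]]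
  by (simp add: L.diff_add[OF N] ksign_add[OF A] ag_add_closed[OF G] ag_ac[OF G])
 show "tens N (n + 1) (i + 1) k (mdiff N i x) (w \<oplus>[acomp B k] z) \<oplus>[tmod N (n + 1)] tens N (n + 1) i (k + 1) (ksign (mcomp N i) i x) (adiff B k (w \<oplus>[acomp B k] z)) =
  (tens N (n + 1) (i + 1) k (mdiff N i x) w \<oplus>[tmod N (n + 1)] tens N (n + 1) i (k + 1) (ksign (mcomp N i) i x) (adiff B k w)) \<oplus>[tmod N (n + 1)]
  (tens N (n + 1) (i + 1) k (mdiff N i x) z \<oplus>[tmod N (n + 1)] tens N (n + 1) i (k + 1) (ksign (mcomp N i) i x) (adiff B k z))"
  if z: "z \<in> lset k" for z
  using m z tc[OF m] tc[OF m(1) z] tens_rules(2)[OF N ik'(1) c(1)[OF m(1)] m(2) z] tens_rules(2)[OF N ik'(2) c(2)[OF m(1)] w[OF m(2)] w[OF z]]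
  by (simp add: B.adiff_rules(1)[OF lsetD(1) lsetD(1)] ag_add_closed[OF G] ag_ac[OF G])
next
 note G = tmod_ag[OF N, of "n + 1"] and A = L.dgm_ag[OF N]
 fix i l k x a w assume ik: "i + l + k = n" and m: "x \<in> car N i" "a \<in> L.acar l" "w \<in> lset k"
 let ?t = "tens N (n + 1)" and ?G = "tmod N (n + 1)"
 have dx: "mdiff N i x \<in> car N (i + 1)" and da: "adiff L l a \<in> L.acar (l + 1)" and dw: "adiff B k w \<in> lset (k + 1)"
  using m N by (simp_all add: L.diff_closed L.adiff_closed lset_closed)
 have ex: "ksign (mcomp N i) p x \<in> car N i" for p using m A by (simp add: ksign_closed)
 have jw: "amult B l k (j l a) w \<in> lset (l + k)" and jdw: "amult B l (k + 1) (j l a) (adiff B k w) \<in> lset (l + (k + 1))"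
  and djw: "amult B (l + 1) k (adiff B l (j l a)) w \<in> lset (l + 1 + k)"
  using lset_closed(5)[OF m(2) lsetD(1)[OF m(3)] HOL.refl] lset_closed(5)[OF m(2) lsetD(1)[OF dw] HOL.refl] lset_closed(5)[OF da lsetD(1)[OF m(3)] HOL.refl]
  by (simp_all add: j_diff[OF m(2)])
 have t1: "?t (i + l + 1) k (mdiff N (i + l) (mact N i l x a)) w =
   ?t (i + 1) (l + k) (mdiff N i x) (amult B l k (j l a) w) \<oplus>[?G] ksign ?G i (?t i (l + 1 + k) x (amult B (l + 1) k (adiff B l (j l a)) w))"
 proof -
  have c: "mact N (i + 1) l (mdiff N i x) a \<in> car N (i + l + 1)" "mact N i (l + 1) x (adiff L l a) \<in> car N (i + l + 1)"
   using L.act_closed[OF N dx m(2)] L.act_closed[OF N m(1) da] by (simp_all add: ac_simps)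
  have ik2: "i + l + 1 + k = n + 1" using ik by simp
  have "?t (i + l + 1) k (mdiff N (i + l) (mact N i l x a)) w =
    ?t (i + l + 1) k (mact N (i + 1) l (mdiff N i x) a) w \<oplus>[?G] ksign ?G i (?t (i + l + 1) k (mact N i (l + 1) x (adiff L l a)) w)"
   using L.diff_act[OF N m(1,2), of "i + l"] tens_rules(1)[OF N ik2 c(1) ksign_closed[OF A c(2)] m(3)] tens_ksign[OF N ik2 c(2) m(3), of i] by simp
  moreover have "?t (i + l + 1) k (mact N (i + 1) l (mdiff N i x) a) w = ?t (i + 1) (l + k) (mdiff N i x) (amult B l k (j l a) w)"
   using tens_rules(3)[OF N _ dx m(2,3), of "n + 1"] ik by (simp add: ac_simps)
  moreover have "?t (i + l + 1) k (mact N i (l + 1) x (adiff L l a)) w = ?t i (l + 1 + k) x (amult B (l + 1) k (adiff B l (j l a)) w)"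
   using tens_rules(3)[OF N _ m(1) da m(3), of "n + 1"] ik j_diff[OF m(2) HOL.refl] by (simp add: ac_simps)
  ultimately show ?thesis by simp
 qed
 have t2: "?t (i + l) (k + 1) (ksign (mcomp N (i + l)) (i + l) (mact N i l x a)) (adiff B k w) =
   ksign ?G (i + l) (?t i (l + (k + 1)) x (amult B l (k + 1) (j l a) (adiff B k w)))"
  using tens_ksign[OF N, of "i + l" "k + 1" "n + 1" "mact N i l x a" "adiff B k w" "i + l"] tens_rules(3)[OF N _ m(1,2) dw, of "n + 1"] ik dw m N
  by (simp add: L.act_closed)
 have t3: "?t i (l + k + 1) (ksign (mcomp N i) i x) (adiff B (l + k) (amult B l k (j l a) w)) =
   ksign ?G i (?t i (l + 1 + k) x (amult B (l + 1) k (adiff B l (j l a)) w)) \<oplus>[?G] ksign ?G (i + l) (?t i (l + (k + 1)) x (amult B l (k + 1) (j l a) (adiff B k w)))"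
 proof -
  have ik2: "i + (l + k + 1) = n + 1" using ik by simp
  have c: "amult B (l + 1) k (adiff B l (j l a)) w \<in> lset (l + k + 1)" "amult B l (k + 1) (j l a) (adiff B k w) \<in> lset (l + k + 1)"
   using djw jdw by (simp_all add: ac_simps)
  have "adiff B (l + k) (amult B l k (j l a) w) = amult B (l + 1) k (adiff B l (j l a)) w \<oplus>[acomp B (l + k + 1)] ksign (acomp B (l + k + 1)) l (amult B l (k + 1) (j l a) (adiff B k w))"
   using B.adiff_amult[OF j_rules(1)[OF m(2)] lsetD(1)[OF m(3)] HOL.refl] .
  then have "?t i (l + k + 1) (ksign (mcomp N i) i x) (adiff B (l + k) (amult B l k (j l a) w)) =
    ksign ?G i (?t i (l + k + 1) x (amult B (l + 1) k (adiff B l (j l a)) w)) \<oplus>[?G] ksign ?G (i + l) (?t i (l + k + 1) x (amult B l (k + 1) (j l a) (adiff B k w)))"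
   using tens_rules(2)[OF N ik2 ex c(1) lset_ksign[OF c(2)]] tens_ksign[OF N ik2 m(1) c(1), of i] tens_ksign[OF N ik2 m(1) lset_ksign[OF c(2)], of i]
     tens_ksign_right[OF N ik2 m(1) c(2), of l] ksign_ksign[OF G tens_closed[OF ik2 m(1) c(2)]] by simp
  then show ?thesis by (simp add: ac_simps)
 qed
 have cl: "?t (i + 1) (l + k) (mdiff N i x) (amult B l k (j l a) w) \<in> carrier ?G" "?t i (l + 1 + k) x (amult B (l + 1) k (adiff B l (j l a)) w) \<in> carrier ?G"
  "?t i (l + (k + 1)) x (amult B l (k + 1) (j l a) (adiff B k w)) \<in> carrier ?G"
  using ik by (auto intro!: tens_closed dx m jw djw jdw)
 show "?t (i + l + 1) k (mdiff N (i + l) (mact N i l x a)) w \<oplus>[?G] ?t (i + l) (k + 1) (ksign (mcomp N (i + l)) (i + l) (mact N i l x a)) (adiff B k w) =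
  ?t (i + 1) (l + k) (mdiff N i x) (amult B l k (j l a) w) \<oplus>[?G] ?t i (l + k + 1) (ksign (mcomp N i) i x) (adiff B (l + k) (amult B l k (j l a) w))"
  unfolding t1 t2 t3 using cl by (simp add: ag_assoc[OF G] ksign_closed[OF G])
qed

lemma tp_diff_additive: "L.dgm N ==> additive (tmod N n) (tmod N (n + 1)) (mdiff (tp N) n)"
 unfolding tp_def dg_mod.simps by (rule lift_additive(1)[OF _ tmod_ag diff_balanced])

lemma tp_diff_tens: "[|L.dgm N; i + k = n; x \<in> car N i; w \<in> lset k|] ==>
  mdiff (tp N) n (tens N n i k x w) = tens N (n + 1) (i + 1) k (mdiff N i x) w \<oplus>[tmod N (n + 1)]
   ksign (tmod N (n + 1)) i (tens N (n + 1) i (k + 1) x (adiff B k w))"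
 unfolding tp_def dg_mod.simps
 using lift_additive(2)[OF _ tmod_ag diff_balanced, of N i k n x w] tens_ksign[of N i "k + 1" "n + 1" x "adiff B k w" i] by (simp add: lset_closed(4))

text \<open>Every axiom is an equality of additive maps and is checked on elementary tensors.\<close>

lemma tp_dgm: assumes N: "L.dgm N" shows "B.dgm (tp N)"
proof (rule B.dgmI, unfold tp_mcomp)
 show "module K (tmod N i)" for i by (rule tmod_module[OF N])
 note G = tmod_ag[OF N] and A = tp_act_additive[OF N] and S = smult_additive[OF N] and Dd = tp_diff_additive[OF N]
 note t = tp_act_tens[OF N] smult_tens[OF N] smult_tens_right[OF N] tp_diff_tens[OF N]
 note comp = additive_comp and plus = additive_plus
 { fix i k u a assume u: "u \<in> tcar N i" and a: "a \<in> B.acar k"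
  show "mact (tp N) i k u a \<in> tcar N (i + k)" by (rule additiveD(1)[OF A[OF a] u])
  show "mact (tp N) i k (u \<oplus>[tmod N i] v) a = mact (tp N) i k u a \<oplus>[tmod N (i + k)] mact (tp N) i k v a" if "v \<in> tcar N i" for v
   by (rule additiveD(2)[OF A[OF a] u that])
  show "mact (tp N) i k u (a \<oplus>[acomp B k] b) = mact (tp N) i k u a \<oplus>[tmod N (i + k)] mact (tp N) i k u b" if b: "b \<in> B.acar k" for b
   by (rule tmod_ext[OF N G A plus[OF G A[OF a] A[OF b]] _ u]) (use a b N lset_closed(3) in \<open>simp_all add: t lsetD B.amult_rules ag_simps tens_rules\<close>)
  show "mact (tp N) (i + k) l (mact (tp N) i k u a) b = mact (tp N) i (k + l) u (amult B k l a b)" if b: "b \<in> B.acar l" for b l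
  proof (rule tmod_ext[OF N _ _ _ _ u, where G = "tmod N (i + k + l)"])
   show "additive (tmod N i) (tmod N (i + k + l)) (\<lambda>u. mact (tp N) (i + k) l (mact (tp N) i k u a) b)" by (rule comp[OF A[OF a] A[OF b]])
   show "additive (tmod N i) (tmod N (i + k + l)) (\<lambda>u. mact (tp N) i (k + l) u (amult B k l a b))"
    using A[OF B.amult_closed[OF a b HOL.refl], of i] by (simp add: add.assoc)
  qed (use a b in \<open>simp_all add: G t lset_closed(3) B.amult_closed lsetD B.amult_assoc add.assoc\<close>)
  show "mact (tp N) i k (c \<odot>[tmod N i] u) a = c \<odot>[tmod N (i + k)] mact (tp N) i k u a"
   "mact (tp N) i k u (c \<odot>[acomp B k] a) = c \<odot>[tmod N (i + k)] mact (tp N) i k u a" if c: "c \<in> carrier K" for c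
  proof -
   have ca: "c \<odot>[acomp B k] a \<in> B.acar k" using module.smult_closed[OF B.acomp_module c a] .
   show "mact (tp N) i k (c \<odot>[tmod N i] u) a = c \<odot>[tmod N (i + k)] mact (tp N) i k u a"
    by (rule tmod_ext[OF N G comp[OF S[OF c] A[OF a]] comp[OF A[OF a] S[OF c]] _ u]) (use a c N in \<open>simp_all add: t lset_closed(3)\<close>)
   show "mact (tp N) i k u (c \<odot>[acomp B k] a) = c \<odot>[tmod N (i + k)] mact (tp N) i k u a"
    by (rule tmod_ext[OF N G A[OF ca] comp[OF A[OF a] S[OF c]] _ u]) (use a c ca N in \<open>simp_all add: t lset_closed(3) lsetD B.amult_rules\<close>)
  qed }
 { fix i u assume u: "u \<in> tcar N i"
  show "mact (tp N) i 0 u (aone B) = u"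
   using tmod_ext[OF N G, of i i "\<lambda>u. mact (tp N) i 0 u (aone B)" "\<lambda>u. u"] A[OF B.aone_closed, of i] u
   by (simp add: additive_id t B.aone_closed B.aone_right lsetD)
  show "mdiff (tp N) i u \<in> tcar N (i + 1)" by (rule additiveD(1)[OF Dd u])
  show "mdiff (tp N) i (u \<oplus>[tmod N i] v) = mdiff (tp N) i u \<oplus>[tmod N (i + 1)] mdiff (tp N) i v" if "v \<in> tcar N i" for v
   by (rule additiveD(2)[OF Dd u that])
  show "mdiff (tp N) i (c \<odot>[tmod N i] u) = c \<odot>[tmod N (i + 1)] mdiff (tp N) i u" if c: "c \<in> carrier K" for c
  proof (rule tmod_ext[OF N G comp[OF S[OF c] Dd] comp[OF Dd S[OF c]] _ u])
   fix p q x w assume m: "p + q = i" "x \<in> car N p" "w \<in> lset q"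
   have m': "p + 1 + q = i + 1" "p + (q + 1) = i + 1" using m by auto
   have "tens N (i + 1) p (q + 1) x (adiff B q w) \<in> tcar N (i + 1)" "tens N (i + 1) (p + 1) q (mdiff N p x) w \<in> tcar N (i + 1)"
    using m m' N by (auto intro!: tens_closed simp: lset_closed(4) L.diff_closed)
   note this ksign_smult[OF tmod_module[OF N] c this(1), of p, symmetric]
   then show "mdiff (tp N) i (c \<odot>[tmod N i] tens N i p q x w) = c \<odot>[tmod N (i + 1)] mdiff (tp N) i (tens N i p q x w)"
    using m m' c N t(2)[OF c m'(1) _ m(3), of "mdiff N p x"] t(2)[OF c m'(2) m(2), of "adiff B q w"]
    by (simp add: t(2)[OF c m] t(4) additiveD(2)[OF S[OF c]] ksign_closed[OF G] L.diff_smult L.diff_closed lset_closed(4))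
  qed
  show "mdiff (tp N) (i + 1) (mdiff (tp N) i u) = \<zero>[tmod N (i + 2)]"
  proof (rule tmod_ext[OF N G _ _ _ u])
   show "additive (tmod N i) (tmod N (i + 2)) (\<lambda>u. mdiff (tp N) (i + 1) (mdiff (tp N) i u))" using comp[OF Dd Dd, of i] by (simp add: add.commute)
   show "additive (tmod N i) (tmod N (i + 2)) (\<lambda>u. \<zero>[tmod N (i + 2)])" by (rule additive_const_zero[OF G])
   fix p q x w assume m: "p + q = i" "x \<in> car N p" "w \<in> lset q"
   have m': "p + 1 + q = i + 1" "p + (q + 1) = i + 1" "p + 1 + (q + 1) = i + 2" "p + 1 + 1 + q = i + 2" "p + (q + 1 + 1) = i + 2" using m by auto
   have dw: "adiff B q w \<in> lset (q + 1)" and dx: "mdiff N p x \<in> car N (p + 1)" using m N by (simp_all add: lset_closed(4) L.diff_closed)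
   have dd: "adiff B (q + 1) (adiff B q w) = \<zero>[acomp B (q + 1 + 1)]" "mdiff N (p + 1) (mdiff N p x) = \<zero>[N,p + 1 + 1]"
    using B.adiff_adiff[OF lsetD(1)[OF m(3)] HOL.refl] L.diff_diff[OF N m(2) HOL.refl] by (simp_all add: add.assoc)
   let ?z = "tens N (i + 2) (p + 1) (q + 1) (mdiff N p x) (adiff B q w)"
   have z: "?z \<in> tcar N (i + 2)" using m' dw dx by (simp add: tens_closed)
   have c: "tens N (i + 1) p (q + 1) x (adiff B q w) \<in> tcar N (i + 1)" "tens N (i + 1) (p + 1) q (mdiff N p x) w \<in> tcar N (i + 1)"
    using m m' dw dx by (auto intro!: tens_closed)
   have i2: "i + 1 + 1 = i + 2" by simp
   have 1: "mdiff (tp N) (i + 1) (tens N (i + 1) (p + 1) q (mdiff N p x) w) = ksign (tmod N (i + 2)) (p + 1) ?z"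
    using t(4)[OF m'(1) dx m(3)] z tens_zero(1)[OF N m'(4) m(3)] unfolding i2 by (simp add: dd ag_l_zero[OF G] ksign_closed[OF G])
   have 2: "mdiff (tp N) (i + 1) (tens N (i + 1) p (q + 1) x (adiff B q w)) = ?z"
    using t(4)[OF m'(2) m(2) dw] z tens_zero(2)[OF N m'(5) m(2)] unfolding i2 by (simp add: dd ag_r_zero[OF G] ksign_zero[OF G])
   have 3: "mdiff (tp N) (i + 1) (ksign (tmod N (i + 1)) p v) = ksign (tmod N (i + 2)) p (mdiff (tp N) (i + 1) v)" if "v \<in> tcar N (i + 1)" for v
    using additive_ksign[of "tmod N (i + 1)" "tmod N (i + 1 + 1)" "mdiff (tp N) (i + 1)", OF G G additiveD[OF Dd] that] unfolding i2 .
   show "mdiff (tp N) (i + 1) (mdiff (tp N) i (tens N i p q x w)) = \<zero>[tmod N (i + 2)]"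
    using additiveD(2)[OF Dd c(2) ksign_closed[OF G c(1)], of p, unfolded i2] z
    by (cases "even p") (simp_all add: t(4)[OF m] 1 2 3[OF c(1)], simp_all add: ksign_def ag_l_neg[OF G] ag_r_neg[OF G])
  qed }
 fix n q u a assume u: "u \<in> tcar N n" and a: "a \<in> B.acar q"
 have da: "adiff B q a \<in> B.acar (q + 1)" using a by (simp add: B.adiff_closed)
 have i: "n + 1 + q = n + q + 1" "n + (q + 1) = n + q + 1" by auto
 show "mdiff (tp N) (n + q) (mact (tp N) n q u a) = mact (tp N) (n + 1) q (mdiff (tp N) n u) a \<oplus>[tmod N (n + q + 1)]
   ksign (tmod N (n + q + 1)) n (mact (tp N) n (q + 1) u (adiff B q a))"
 proof (rule tmod_ext[OF N G comp[OF A[OF a] Dd] plus[OF G _ additive_sign[OF G]] _ u])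
  show 1: "additive (tmod N n) (tmod N (n + q + 1)) (\<lambda>u. mact (tp N) (n + 1) q (mdiff (tp N) n u) a)"
   using comp[OF Dd A[OF a], of n] unfolding i .
  show 2: "additive (tmod N n) (tmod N (n + q + 1)) (\<lambda>u. mact (tp N) n (q + 1) u (adiff B q a))"
   using A[OF da, of n] unfolding i .
  fix p k x w assume m: "p + k = n" "x \<in> car N p" "w \<in> lset k"
  have dw: "adiff B k w \<in> lset (k + 1)" and dx: "mdiff N p x \<in> car N (p + 1)" using m N by (simp_all add: lset_closed(4) L.diff_closed)
  have s: "p + k + 1 = n + 1" "p + 1 + k = n + 1" "p + (k + 1) = n + 1" "p + (k + q) = n + q" "p + 1 + (k + q) = n + q + 1" "p + (k + q + 1) = n + q + 1" using m by auto
  let ?T = "tens N (n + q + 1)" and ?G = "tmod N (n + q + 1)"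
  have wa: "amult B k q w a \<in> lset (k + q)" "amult B (k + 1) q (adiff B k w) a \<in> lset (k + q + 1)" "amult B k (q + 1) w (adiff B q a) \<in> lset (k + q + 1)"
   using lset_closed(3)[OF m(3) a HOL.refl] lset_closed(3)[OF dw a, of "k + q + 1"] lset_closed(3)[OF m(3) da, of "k + q + 1"] by auto
  define t1 where "t1 = ?T (p + 1) (k + q) (mdiff N p x) (amult B k q w a)"
  define t2 where "t2 = ?T p (k + q + 1) x (amult B (k + 1) q (adiff B k w) a)"
  define t3 where "t3 = ?T p (k + q + 1) x (amult B k (q + 1) w (adiff B q a))"
  have tc: "t1 \<in> carrier ?G" "t2 \<in> carrier ?G" "t3 \<in> carrier ?G" unfolding t1_def t2_def t3_def using s m dx wa by (auto intro!: tens_closed)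
  have "mdiff (tp N) (n + q) (mact (tp N) n q (tens N n p k x w) a) = t1 \<oplus>[?G] ksign ?G p (?T p (k + q + 1) x (adiff B (k + q) (amult B k q w a)))"
   unfolding t1_def t(1)[OF a m] t(4)[OF s(4) m(2) wa(1)] ..
  also have "?T p (k + q + 1) x (adiff B (k + q) (amult B k q w a)) = t2 \<oplus>[?G] ksign ?G k t3"
   unfolding t2_def t3_def B.adiff_amult[OF lsetD(1)[OF m(3)] a HOL.refl]
   using tens_rules(2)[OF N s(6) m(2) wa(2) lset_ksign[OF wa(3)]] tens_ksign_right[OF N s(6) m(2) wa(3)] by simp
  also have "ksign ?G p (t2 \<oplus>[?G] ksign ?G k t3) = ksign ?G p t2 \<oplus>[?G] ksign ?G n t3"
   using tc by (simp add: ksign_add[OF G] ksign_closed[OF G] ksign_ksign[OF G] m(1))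
  finally have l: "mdiff (tp N) (n + q) (mact (tp N) n q (tens N n p k x w) a) = t1 \<oplus>[?G] (ksign ?G p t2 \<oplus>[?G] ksign ?G n t3)" .
  have c: "tens N (n + 1) (p + 1) k (mdiff N p x) w \<in> tcar N (n + 1)" "tens N (n + 1) p (k + 1) x (adiff B k w) \<in> tcar N (n + 1)"
   using s m dx dw by (auto intro!: tens_closed)
  have r1: "mact (tp N) (n + 1) q (tens N (n + 1) (p + 1) k (mdiff N p x) w) a = t1"
   using t(1)[OF a s(2) dx m(3)] unfolding i t1_def .
  have "mact (tp N) (n + 1) q (tens N (n + 1) p (k + 1) x (adiff B k w)) a = t2"
   using t(1)[OF a s(3) m(2) dw] unfolding i t2_def by (simp add: ac_simps)
  then have r2: "mact (tp N) (n + 1) q (ksign (tmod N (n + 1)) p (tens N (n + 1) p (k + 1) x (adiff B k w))) a = ksign ?G p t2"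
   using additive_ksign[of "tmod N (n + 1)" "tmod N (n + 1 + q)" "\<lambda>u. mact (tp N) (n + 1) q u a", OF G G additiveD[OF A[OF a]] c(2), of p] unfolding i by simp
  have "mact (tp N) (n + 1) q (mdiff (tp N) n (tens N n p k x w)) a = t1 \<oplus>[?G] ksign ?G p t2"
   using additiveD(2)[OF A[OF a] c(1) ksign_closed[OF G c(2)], of p] unfolding i t(4)[OF m] r1 r2 .
  moreover have "mact (tp N) n (q + 1) (tens N n p k x w) (adiff B q a) = t3"
   using t(1)[OF da m] unfolding t3_def i by (simp add: ac_simps)
  ultimately show "mdiff (tp N) (n + q) (mact (tp N) n q (tens N n p k x w) a) = mact (tp N) (n + 1) q (mdiff (tp N) n (tens N n p k x w)) a \<oplus>[?G]
   ksign ?G n (mact (tp N) n (q + 1) (tens N n p k x w) (adiff B q a))"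
   using l tc by (simp add: ag_assoc[OF G] ksign_closed[OF G])
 qed
qed

end

context coded_corner begin

text \<open>The map \<open>f \<otimes> 1\<close>.  No sign arises, since \<open>f\<close> acts on the left of the right module.\<close>

definition tmap where "tmap N N' m f = (\<lambda>n. restrict (lift (tmod N' (n + m)) (\<lambda>i k x w. tens N' (n + m) (i + m) k (f i x) w)) (tcar N n))"

lemma tmap_balanced:
 assumes N: "L.dgm N" and N': "L.dgm N'" and f: "f \<in> L.Hom N N' m"
 shows "balanced N n (tmod N' (n + m)) (\<lambda>i k x w. tens N' (n + m) (i + m) k (f i x) w)"
proof (rule balancedI)
 fix i k x w assume ik: "i + k = n" and m: "x \<in> car N i" "w \<in> lset k"
 have ik': "i + m + k = n + m" using ik by simp
 note c = L.Hom_closed[OF f _ HOL.refl]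
 show "tens N' (n + m) (i + m) k (f i x) w \<in> tcar N' (n + m)" by (rule tens_closed[OF ik' c[OF m(1)] m(2)])
 show "tens N' (n + m) (i + m) k (f i (x \<oplus>[N,i] y)) w = tens N' (n + m) (i + m) k (f i x) w \<oplus>[tmod N' (n + m)] tens N' (n + m) (i + m) k (f i y) w"
  if y: "y \<in> car N i" for y using tens_rules(1)[OF N' ik' c[OF m(1)] c[OF y] m(2)] L.Hom_add[OF f m(1) y] by simp
 show "tens N' (n + m) (i + m) k (f i x) (w \<oplus>[acomp B k] z) = tens N' (n + m) (i + m) k (f i x) w \<oplus>[tmod N' (n + m)] tens N' (n + m) (i + m) k (f i x) z"
  if z: "z \<in> lset k" for z by (rule tens_rules(2)[OF N' ik' c[OF m(1)] m(2) z])
next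
 fix i l k x a w assume ik: "i + l + k = n" and m: "x \<in> car N i" "a \<in> L.acar l" "w \<in> lset k"
 show "tens N' (n + m) (i + l + m) k (f (i + l) (mact N i l x a)) w = tens N' (n + m) (i + m) (l + k) (f i x) (amult B l k (j l a) w)"
  using tens_rules(3)[OF N' _ L.Hom_closed[OF f m(1) HOL.refl] m(2,3), of "n + m"] ik L.Hom_act[OF f m(1,2) HOL.refl] by (simp add: ac_simps)
qed

lemma tmap_additive:
 assumes N: "L.dgm N" and N': "L.dgm N'" and f: "f \<in> L.Hom N N' m"
 shows "additive (tmod N n) (tmod N' (n + m)) (tmap N N' m f n)"
 using lift_additive(1)[OF N tmod_ag[OF N'] tmap_balanced[OF assms, of n]] ag_add_closed[OF tmod_ag[OF N], of _ n]
 by (simp add: additive_def tmap_def)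

lemma tmap_tens:
 assumes N: "L.dgm N" and N': "L.dgm N'" and f: "f \<in> L.Hom N N' m" and m: "i + k = n" "x \<in> car N i" "w \<in> lset k"
 shows "tmap N N' m f n (tens N n i k x w) = tens N' (n + m) (i + m) k (f i x) w"
 using lift_additive(2)[OF N tmod_ag[OF N'] tmap_balanced[OF assms(1-3), of n] m] tens_closed[OF m] by (simp add: tmap_def)

lemma tmap_Hom:
 assumes N: "L.dgm N" and N': "L.dgm N'" and f: "f \<in> L.Hom N N' m"
 shows "tmap N N' m f \<in> B.Hom (tp N) (tp N') m"
proof (rule B.Hom_I, unfold tp_mcomp)
 note A = tmap_additive[OF assms] and t = tmap_tens[OF assms] and G = tmod_ag[OF N']
 show "tmap N N' m f i \<in> extensional (tcar N i)" for i by (simp add: tmap_def)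
 fix n u assume u: "u \<in> tcar N n"
 show "tmap N N' m f n u \<in> tcar N' (n + m)" by (rule additiveD(1)[OF A u])
 show "tmap N N' m f n (u \<oplus>[tmod N n] v) = tmap N N' m f n u \<oplus>[tmod N' (n + m)] tmap N N' m f n v" if "v \<in> tcar N n" for v
  by (rule additiveD(2)[OF A u that])
 show "tmap N N' m f n (c \<odot>[tmod N n] u) = c \<odot>[tmod N' (n + m)] tmap N N' m f n u" if c: "c \<in> carrier K" for c
 proof (rule tmod_ext[OF N G additive_comp[OF smult_additive[OF N c] A] additive_comp[OF A smult_additive[OF N' c]] _ u])
  fix i k x w assume m: "i + k = n" "x \<in> car N i" "w \<in> lset k"
  have ik': "i + m + k = n + m" using m by simp
  show "tmap N N' m f n (c \<odot>[tmod N n] tens N n i k x w) = c \<odot>[tmod N' (n + m)] tmap N N' m f n (tens N n i k x w)"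
   using m c N smult_tens[OF N' c ik' L.Hom_closed[OF f m(2) HOL.refl] m(3)] L.Hom_smult[OF f c m(2)] by (simp add: smult_tens t)
 qed
 fix q a assume a: "a \<in> B.acar q"
 have i: "n + q + m = n + m + q" by simp
 show "tmap N N' m f (n + q) (mact (tp N) n q u a) = mact (tp N') (n + m) q (tmap N N' m f n u) a"
 proof (rule tmod_ext[OF N G _ additive_comp[OF A tp_act_additive[OF N' a]] _ u])
  show "additive (tmod N n) (tmod N' (n + m + q)) (\<lambda>u. tmap N N' m f (n + q) (mact (tp N) n q u a))"
   using additive_comp[OF tp_act_additive[OF N a] A, of n] unfolding i .
  fix p k x w assume m: "p + k = n" "x \<in> car N p" "w \<in> lset k"
  have s: "p + m + k = n + m" "p + (k + q) = n + q" using m by auto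
  show "tmap N N' m f (n + q) (mact (tp N) n q (tens N n p k x w) a) = mact (tp N') (n + m) q (tmap N N' m f n (tens N n p k x w)) a"
   unfolding t[OF m] tp_act_tens[OF N a m] tp_act_tens[OF N' a s(1) L.Hom_closed[OF f m(2) HOL.refl] m(3)]
    t[OF s(2) m(2) lset_closed(3)[OF m(3) a HOL.refl]] i ..
 qed
qed

lemma tmap_D:
 assumes N: "L.dgm N" and N': "L.dgm N'" and f: "f \<in> L.Hom N N' m"
 shows "tmap N N' (m + 1) (hom_diff N N' m f) = hom_diff (tp N) (tp N') m (tmap N N' m f)"
proof (rule B.Hom_eqI)
 have Df: "hom_diff N N' m f \<in> L.Hom N N' (m + 1)" by (rule L.D_closed[OF assms HOL.refl])
 show "tmap N N' (m + 1) (hom_diff N N' m f) \<in> B.Hom (tp N) (tp N') (m + 1)" by (rule tmap_Hom[OF N N' Df])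
 show "hom_diff (tp N) (tp N') m (tmap N N' m f) \<in> B.Hom (tp N) (tp N') (m + 1)"
  by (rule B.D_closed[OF tp_dgm[OF N] tp_dgm[OF N'] tmap_Hom[OF assms] HOL.refl])
 fix n u assume "u \<in> car (tp N) n"
 then have u: "u \<in> tcar N n" by simp
 note A = tmap_additive[OF assms] and t = tmap_tens[OF assms] and G = tmod_ag[OF N']
 have i: "n + (m + 1) = n + m + 1" "n + 1 + m = n + m + 1" by auto
 have "tmap N N' (m + 1) (hom_diff N N' m f) n u = mdiff (tp N') (n + m) (tmap N N' m f n u) \<oplus>[tmod N' (n + m + 1)]
   ksign (tmod N' (n + m + 1)) (m + 1) (tmap N N' m f (n + 1) (mdiff (tp N) n u))"
 proof (rule tmod_ext[OF N G _ additive_plus[OF G additive_comp[OF A tp_diff_additive[OF N']] additive_sign[OF G]] _ u])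
  show "additive (tmod N n) (tmod N' (n + m + 1)) (tmap N N' (m + 1) (hom_diff N N' m f) n)"
   using tmap_additive[OF N N' Df, of n] unfolding i .
  show "additive (tmod N n) (tmod N' (n + m + 1)) (\<lambda>u. tmap N N' m f (n + 1) (mdiff (tp N) n u))"
   using additive_comp[OF tp_diff_additive[OF N] A, of n] unfolding i .
  fix p k x w assume m: "p + k = n" "x \<in> car N p" "w \<in> lset k"
  let ?T = "tens N' (n + m + 1)" and ?G = "tmod N' (n + m + 1)"
  have s: "p + m + k = n + m" "p + 1 + k = n + 1" "p + (k + 1) = n + 1" "p + m + 1 + k = n + m + 1" "p + m + (k + 1) = n + m + 1" using m by auto
  note fx = L.Hom_closed[OF f m(2) HOL.refl]
  have dw: "adiff B k w \<in> lset (k + 1)" and dx: "mdiff N p x \<in> car N (p + 1)" using m N by (simp_all add: lset_closed(4) L.diff_closed)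
  have dfx: "mdiff N' (p + m) (f p x) \<in> car N' (p + m + 1)" using fx N' by (simp add: L.diff_closed)
  have fdx: "f (p + 1) (mdiff N p x) \<in> car N' (p + m + 1)" using L.Hom_closed[OF f dx, of "p + m + 1"] by simp
  define t1 where "t1 = ?T (p + m + 1) k (mdiff N' (p + m) (f p x)) w"
  define t2 where "t2 = ?T (p + m) (k + 1) (f p x) (adiff B k w)"
  define t3 where "t3 = ?T (p + m + 1) k (f (p + 1) (mdiff N p x)) w"
  have tc: "t1 \<in> carrier ?G" "t2 \<in> carrier ?G" "t3 \<in> carrier ?G"
   unfolding t1_def t2_def t3_def using tens_closed[OF s(4) dfx m(3)] tens_closed[OF s(5) fx dw] tens_closed[OF s(4) fdx m(3)] .
  have "tmap N N' (m + 1) (hom_diff N N' m f) n (tens N n p k x w) = ?T (p + m + 1) k (hom_diff N N' m f p x) w"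
   using tmap_tens[OF N N' Df m] by (simp add: add.assoc)
  also have "\<dots> = t1 \<oplus>[?G] ksign ?G (m + 1) t3"
   unfolding t1_def t3_def L.hom_diff_apply[OF m(2)] tens_rules(1)[OF N' s(4) dfx ksign_closed[OF L.dgm_ag[OF N'] fdx] m(3)] tens_ksign[OF N' s(4) fdx m(3)] ..
  finally have l: "tmap N N' (m + 1) (hom_diff N N' m f) n (tens N n p k x w) = t1 \<oplus>[?G] ksign ?G (m + 1) t3" .
  have r1: "mdiff (tp N') (n + m) (tmap N N' m f n (tens N n p k x w)) = t1 \<oplus>[?G] ksign ?G (p + m) t2"
   unfolding t[OF m] tp_diff_tens[OF N' s(1) fx m(3)] t1_def t2_def ..
  have c: "tens N (n + 1) (p + 1) k (mdiff N p x) w \<in> tcar N (n + 1)" "tens N (n + 1) p (k + 1) x (adiff B k w) \<in> tcar N (n + 1)"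
   using s m dx dw by (auto intro!: tens_closed)
  have "tmap N N' m f (n + 1) (tens N (n + 1) (p + 1) k (mdiff N p x) w) = t3"
   using t[OF s(2) dx m(3)] unfolding t3_def by (simp add: ac_simps)
  moreover have "tmap N N' m f (n + 1) (tens N (n + 1) p (k + 1) x (adiff B k w)) = t2"
   using t[OF s(3) m(2) dw] unfolding t2_def by (simp add: ac_simps)
  ultimately have r2: "tmap N N' m f (n + 1) (mdiff (tp N) n (tens N n p k x w)) = t3 \<oplus>[?G] ksign ?G p t2"
   using additiveD(2)[OF A c(1) ksign_closed[OF tmod_ag[OF N] c(2)], of p]
    additive_ksign[of "tmod N (n + 1)" "tmod N' (n + 1 + m)" "tmap N N' m f (n + 1)", OF tmod_ag[OF N] G additiveD[OF A] c(2), of p]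
   unfolding i tp_diff_tens[OF N m] by simp
  show "tmap N N' (m + 1) (hom_diff N N' m f) n (tens N n p k x w) = mdiff (tp N') (n + m) (tmap N N' m f n (tens N n p k x w)) \<oplus>[?G]
   ksign ?G (m + 1) (tmap N N' m f (n + 1) (mdiff (tp N) n (tens N n p k x w)))"
  proof -
   have "ksign ?G (m + 1) (ksign ?G p t2) = \<ominus>[?G] ksign ?G (p + m) t2" using tc by (auto simp: ksign_def ag_simps[OF G])
   then show ?thesis unfolding l r1 r2 using tc ksign_closed[OF G tc(2)] ksign_closed[OF G tc(3)]
    by (simp add: ksign_add[OF G] ksign_closed[OF G] ag_simps[OF G] ag_ac[OF G])
  qed
 qed
 then show "tmap N N' (m + 1) (hom_diff N N' m f) n u = hom_diff (tp N) (tp N') m (tmap N N' m f) n u"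
  using u by (simp add: B.hom_diff_apply)
qed

lemma tp_functor: "dg_functor K L B tp tmap"
proof (intro dg_functor.intro dg_functor_axioms.intro B.dg_algebra_axioms L.dg_algebra_axioms tp_dgm tmap_Hom)
 fix X Y :: "('k, 'l, 'v) dg_mod" and f g n assume o: "L.dgm X" "L.dgm Y" and f: "f \<in> L.Hom X Y n"
 { assume g: "g \<in> L.Hom X Y n"
  note fg = L.HM_add_closed[OF o f g]
  show "tmap X Y n (f \<oplus>[L.HM X Y n] g) = tmap X Y n f \<oplus>[B.HM (tp X) (tp Y) n] tmap X Y n g"
  proof (rule B.Hom_eqI[OF tmap_Hom[OF o fg] B.HM_add_closed[OF tp_dgm[OF o(1)] tp_dgm[OF o(2)] tmap_Hom[OF o f] tmap_Hom[OF o g]]])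
   fix i u assume u: "u \<in> car (tp X) i"
   note G = tmod_ag[OF o(2)]
   have "tmap X Y n (f \<oplus>[L.HM X Y n] g) i u = tmap X Y n f i u \<oplus>[tmod Y (i + n)] tmap X Y n g i u"
   proof (rule tmod_ext[OF o(1) G tmap_additive[OF o fg] additive_plus[OF G tmap_additive[OF o f] tmap_additive[OF o g]] _ u[unfolded tp_mcomp]])
    fix p k x w assume m: "p + k = i" "x \<in> car X p" "w \<in> lset k"
    have s: "p + n + k = i + n" using m by simp
    show "tmap X Y n (f \<oplus>[L.HM X Y n] g) i (tens X i p k x w) = tmap X Y n f i (tens X i p k x w) \<oplus>[tmod Y (i + n)] tmap X Y n g i (tens X i p k x w)"
     unfolding tmap_tens[OF o fg m] tmap_tens[OF o f m] tmap_tens[OF o g m]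
     using tens_rules(1)[OF o(2) s L.Hom_closed[OF f m(2) HOL.refl] L.Hom_closed[OF g m(2) HOL.refl] m(3)] m by simp
   qed
   then show "tmap X Y n (f \<oplus>[L.HM X Y n] g) i u = (tmap X Y n f \<oplus>[B.HM (tp X) (tp Y) n] tmap X Y n g) i u" using u by simp
  qed }
 show "tmap X Y q (hom_diff X Y n f) = hom_diff (tp X) (tp Y) n (tmap X Y n f)" if "q = n + 1" for q
  unfolding that by (rule tmap_D[OF o f])
 fix Z :: "('k, 'l, 'v) dg_mod" and g p r assume Z: "L.dgm Z" and g: "g \<in> L.Hom Y Z p" and r: "r = n + p"
 note gf = L.gcomp_closed[OF o(1) f g r]
 show "tmap X Z r (gcomp X n g f) = gcomp (tp X) n (tmap Y Z p g) (tmap X Y n f)"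
 proof (rule B.Hom_eqI[OF tmap_Hom[OF o(1) Z gf] B.gcomp_closed[OF tp_dgm[OF o(1)] tmap_Hom[OF o f] tmap_Hom[OF o(2) Z g] r]])
  fix i u assume u: "u \<in> car (tp X) i"
  have ir: "i + n + p = i + r" using r by simp
  have "tmap X Z r (gcomp X n g f) i u = tmap Y Z p g (i + n) (tmap X Y n f i u)"
  proof (rule tmod_ext[OF o(1) tmod_ag[OF Z] tmap_additive[OF o(1) Z gf] _ _ u[unfolded tp_mcomp]])
   show "additive (tmod X i) (tmod Z (i + r)) (\<lambda>u. tmap Y Z p g (i + n) (tmap X Y n f i u))"
    using additive_comp[OF tmap_additive[OF o f] tmap_additive[OF o(2) Z g], of i] unfolding ir .
   fix q k x w assume m: "q + k = i" "x \<in> car X q" "w \<in> lset k"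
   have s: "q + n + k = i + n" using m by simp
   show "tmap X Z r (gcomp X n g f) i (tens X i q k x w) = tmap Y Z p g (i + n) (tmap X Y n f i (tens X i q k x w))"
    unfolding tmap_tens[OF o(1) Z gf m] tmap_tens[OF o f m] tmap_tens[OF o(2) Z g s L.Hom_closed[OF f m(2) HOL.refl] m(3)] ir using m r by (simp add: add.assoc)
  qed
  then show "tmap X Z r (gcomp X n g f) i u = gcomp (tp X) n (tmap Y Z p g) (tmap X Y n f) i u" using u by simp
 qed
next
 fix X :: "('k, 'l, 'v) dg_mod" assume X: "L.dgm X"
 show "tmap X X 0 (gid X) = gid (tp X)"
 proof (rule B.Hom_eqI[OF tmap_Hom[OF X X L.gid_closed[OF X]] B.gid_closed[OF tp_dgm[OF X]]])
  fix i u assume u: "u \<in> car (tp X) i"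
  then show "tmap X X 0 (gid X) i u = gid (tp X) i u"
   using tmod_ext[OF X tmod_ag[OF X] tmap_additive[OF X X L.gid_closed[OF X], of i] , of "\<lambda>u. u" u]
   by (simp add: additive_id tmap_tens[OF X X L.gid_closed[OF X]])
 qed
qed

end

context coded_corner begin

text \<open>For \<open>w\<close> in \<open>e B\<close> the product \<open>w e\<close> lies in \<open>e B e\<close>; \<open>jinv w\<close> is the corresponding element of \<open>L\<close>.\<close>

definition jinv where "jinv k w = inv_into (L.acar k) (j k) (amult B k 0 w e)"

lemma jinv_unique: "[|a \<in> L.acar k; j k a = amult B k 0 w e|] ==> jinv k w = a"
 unfolding jinv_def by (metis inv_into_f_f j_inj)

lemma jinv: assumes "w \<in> lset k" shows "jinv k w \<in> L.acar k" "j k (jinv k w) = amult B k 0 w e"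
proof -
 have c: "amult B k 0 w e \<in> B.acar k" using lsetD(1)[OF assms] by (simp add: B.amult_closed e_closed)
 have "amult B 0 k e (amult B k 0 w e) = amult B k 0 w e"
  using B.amult_assoc[OF e_closed lsetD(1)[OF assms] e_closed] lsetD(2)[OF assms] by simp
 moreover have "amult B k 0 (amult B k 0 w e) e = amult B k 0 w e"
  using B.amult_assoc[OF lsetD(1)[OF assms] e_closed e_closed] by (simp add: e_e)
 ultimately have "amult B k 0 w e \<in> j k ` L.acar k" using j_surj c by blast
 then show "jinv k w \<in> L.acar k" "j k (jinv k w) = amult B k 0 w e"
  unfolding jinv_def by (auto intro: inv_into_into f_inv_into_f)
qed

lemma jinv_add: assumes w: "w \<in> lset k" and z: "z \<in> lset k" shows "jinv k (w \<oplus>[acomp B k] z) = jinv k w \<oplus>[acomp L k] jinv k z"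
 using jinv[OF w] jinv[OF z] B.amult_rules(1)[OF lsetD(1)[OF w] lsetD(1)[OF z] e_closed]
 by (intro jinv_unique) (simp_all add: ag_add_closed j_rules)

lemma jinv_mult_left: assumes w: "w \<in> lset k" and a: "a \<in> L.acar l"
 shows "jinv (l + k) (amult B l k (j l a) w) = amult L l k a (jinv k w)"
 using jinv[OF w] B.amult_assoc[OF j_rules(1)[OF a] lsetD(1)[OF w] e_closed] a
 by (intro jinv_unique) (simp_all add: L.amult_closed j_mult)

lemma jinv_e: "jinv 0 e = aone L"
 by (rule jinv_unique) (simp_all add: L.aone_closed j_one e_e)

text \<open>The comparison \<open>(N \<otimes> e B) e \<rightarrow> N\<close>, \<open>x \<otimes> w \<mapsto> x (w e)\<close>, and its inverse \<open>x \<mapsto> x \<otimes> e\<close>.\<close>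

definition mu where "mu N n = restrict (lift (mcomp N n) (\<lambda>i k x w. mact N i k x (jinv k w))) (res_set (tp N) n)"
definition iota where "iota N = (\<lambda>n. \<lambda>x\<in>car N n. tens N n n 0 x e)"

lemma mu_balanced: assumes N: "L.dgm N" shows "balanced N n (mcomp N n) (\<lambda>i k x w. mact N i k x (jinv k w))"
proof (rule balancedI)
 fix i l k x a w assume "i + l + k = n" "x \<in> car N i" "a \<in> L.acar l" "w \<in> lset k"
 then show "mact N (i + l) k (mact N i l x a) (jinv k w) = mact N i (l + k) x (jinv (l + k) (amult B l k (j l a) w))"
  using N by (simp add: jinv_mult_left jinv L.act_assoc)
qed (use N in \<open>auto simp: jinv jinv_add L.act_closed L.act_add_left L.act_add_right\<close>)

lemma res_set_tmod: "u \<in> res_set (tp N) n ==> u \<in> tcar N n"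
 using res_setD(1)[of u "tp N" n] by simp

lemma tens_e: "[|L.dgm N; i + k = n; x \<in> car N i; w \<in> lset k|] ==>
  tens N n n 0 (mact N i k x (jinv k w)) e = tens N n i k x (amult B k 0 w e)"
 using tens_rules(3)[of N i k 0 n x "jinv k w" e] B.amult_assoc[of w k e 0 e 0] by (simp add: jinv lset_closed(6) lsetD e_closed e_e)

lemma mu_additive: "L.dgm N ==> additive (tmod N n) (mcomp N n) (lift (mcomp N n) (\<lambda>i k x w. mact N i k x (jinv k w)))"
 by (rule lift_additive(1)[OF _ L.dgm_ag mu_balanced])

lemma iota_Cyc:
 assumes N: "L.dgm N"
 shows "iota N \<in> L.Cyc N (res (tp N)) 0"
proof -
 note T = tp_dgm[OF N] and R = res_dgm[OF tp_dgm[OF N]] and TG = tmod_ag[OF N] and es = lset_closed(6)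
 have te: "tens N n n 0 x e \<in> tcar N n" if "x \<in> car N n" for n x using that es by (simp add: tens_closed)
 have ac: "mact (tp N) n k (tens N n n 0 x e) b = tens N (n + k) n k x (amult B 0 k e b)" if "x \<in> car N n" "b \<in> B.acar k" for n k x b
  using tp_act_tens[OF N that(2) _ that(1) es, of n] by simp
 have tr: "tens N n n 0 x e \<in> res_set (tp N) n" if "x \<in> car N n" for n x
  using te[OF that] ac[OF that e_closed] by (simp add: res_set_def e_e)
 have iH: "iota N \<in> L.Hom N (res (tp N)) 0"
 proof (rule L.Hom_I)
  fix i k x a assume x: "x \<in> car N i" and a: "a \<in> L.acar k"
  have "tens N (i + k) (i + k) 0 (mact N i k x a) e = tens N (i + k) i k x (j k a)"
   using tens_rules(3)[OF N _ x a es, of "i + k"] j_corner[OF a] by simp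
  then show "iota N (i + k) (mact N i k x a) = mact (res (tp N)) (i + 0) k (iota N i x) a"
   using x a N by (simp add: iota_def L.act_closed ac j_rules j_corner)
 qed (use N in \<open>simp_all add: iota_def tr tens_rules es smult_tens ag_add_closed\<close>)
 show ?thesis
 proof (rule L.CycI_pointwise[OF N R iH])
  fix i x assume x: "x \<in> car N i"
  have dx: "mdiff N i x \<in> car N (i + 1)" using x N by (simp add: L.diff_closed)
  show "mdiff (res (tp N)) (i + 0) (iota N i x) = ksign (mcomp (res (tp N)) (i + 0 + 1)) 0 (iota N (i + 1) (mdiff N i x))"
   using tp_diff_tens[OF N _ x es, of i] x dx te[OF dx] tens_zero(2)[OF N _ x, of 1 "i + 1"] by (simp add: iota_def d_e ksign_zero TG ag_r_zero)
 qed
qed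

text \<open>An element \<open>u\<close> of the tensor product with \<open>u e = u\<close> is a sum of tensors \<open>x \<otimes> w e = x (w e) \<otimes> e\<close>.\<close>

lemma iota_mu:
 assumes N: "L.dgm N"
 shows "x \<in> car N n ==> mu N n (iota N n x) = x"
  and "u \<in> res_set (tp N) n ==> mu N n u \<in> car N n" "u \<in> res_set (tp N) n ==> iota N n (mu N n u) = u"
proof -
 note A = mu_additive[OF N] and es = lset_closed(6)
 show "mu N n (iota N n x) = x" if x: "x \<in> car N n"
  using lift_additive(2)[OF N L.dgm_ag[OF N] mu_balanced[OF N], of n 0 n x e] L.Hom_closed[OF L.CycH[OF iota_Cyc[OF N]] x] x N es
  by (simp add: mu_def iota_def jinv_e L.act_one)
 assume u: "u \<in> res_set (tp N) n"
 note ut = res_set_tmod[OF u]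
 show m: "mu N n u \<in> car N n" using additiveD(1)[OF A ut] u by (simp add: mu_def)
 have "tens N n n 0 (lift (mcomp N n) (\<lambda>i k x w. mact N i k x (jinv k w)) u) e = mact (tp N) n 0 u e"
 proof (rule tmod_ext[OF N tmod_ag[OF N] additive_comp[OF A] _ _ ut])
  show "additive (mcomp N n) (tmod N n) (\<lambda>x. tens N n n 0 x e)" using N es by (simp add: additive_def tens_closed tens_rules)
  show "additive (tmod N n) (tmod N n) (\<lambda>u. mact (tp N) n 0 u e)" using tp_act_additive[OF N e_closed, of n] by simp
 qed (use tp_act_tens[OF N e_closed, of _ _ n] lift_additive(2)[OF N L.dgm_ag[OF N] mu_balanced[OF N]] in \<open>simp add: tens_e[OF N]\<close>)
 then show "iota N n (mu N n u) = u" using m u res_setD(2)[OF u] by (simp add: mu_def iota_def)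
qed

lemma mu_Cyc:
 assumes N: "L.dgm N"
 shows "mu N \<in> L.Cyc (res (tp N)) N 0"
  "gcomp (res (tp N)) 0 (iota N) (mu N) = gid (res (tp N))" "gcomp N 0 (mu N) (iota N) = gid N"
proof -
 note R = res_dgm[OF tp_dgm[OF N]]
 show "mu N \<in> L.Cyc (res (tp N)) N 0"
  by (rule L.Cyc_inverse[OF N R iota_Cyc[OF N]]) (simp_all add: iota_mu[OF N], simp add: mu_def)
 show "gcomp (res (tp N)) 0 (iota N) (mu N) = gid (res (tp N))" "gcomp N 0 (mu N) (iota N) = gid N"
  using iota_mu[OF N] by (auto simp: gcomp_def gid_def fun_eq_iff)
qed

lemma mu_qis: "L.dgm N ==> L.qis (res (tp N)) N (mu N)"
 by (rule L.qis_inverse[OF res_dgm[OF tp_dgm] _ mu_Cyc(1) iota_Cyc mu_Cyc(2,3)])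

lemma mu_natural:
 assumes o: "L.dgm N" "L.dgm N'" and f: "f \<in> L.Cyc N N' 0"
 shows "gcomp (res (tp N)) 0 (mu N') (res_map (tp N) (tmap N N' 0 f)) = gcomp (res (tp N)) 0 f (mu N)"
proof -
 note fH = L.CycH[OF f]
 have "mu N' n (tmap N N' 0 f n u) = f n (mu N n u)" if u: "u \<in> res_set (tp N) n" for n u
 proof -
  note m = iota_mu(2)[OF o(1) u]
  have "tmap N N' 0 f n (iota N n (mu N n u)) = iota N' n (f n (mu N n u))"
   using tmap_tens[OF o fH _ m lset_closed(6), of n] m L.Hom_closed[OF fH m] by (simp add: iota_def)
  then show ?thesis using iota_mu(3)[OF o(1) u] iota_mu(1)[OF o(2) L.Hom_closed[OF fH m]] by simp
 qed
 then show ?thesis by (auto simp: gcomp_def fun_eq_iff)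
qed

text \<open>The comparison \<open>M e \<otimes> e B \<rightarrow> M\<close>, \<open>x \<otimes> w \<mapsto> x w\<close>.\<close>

definition nu where "nu M n = restrict (lift (mcomp M n) (\<lambda>i k x w. mact M i k x w)) (tcar (res M) n)"

lemma nu_balanced: assumes M: "B.dgm M" shows "balanced (res M) n (mcomp M n) (\<lambda>i k x w. mact M i k x w)"
 by (rule balancedI; use M in \<open>simp add: res_setD lsetD B.act_add_left B.act_add_right B.act_assoc j_rules\<close>)
   (auto simp: B.act_closed res_setD lsetD)

lemma nu_tens:
 assumes M: "B.dgm M" and m: "i + k = n" "x \<in> res_set M i" "w \<in> lset k"
 shows "nu M n (tens (res M) n i k x w) = mact M i k x w"
proof -
 have x: "x \<in> car (res M) i" using m by simp
 show ?thesis using lift_additive(2)[OF res_dgm[OF M] B.dgm_ag[OF M] nu_balanced[OF M] m(1) x m(3)] tens_closed[OF m(1) x m(3)] by (simp add: nu_def)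
qed

lemma nu_additive: assumes M: "B.dgm M" shows "additive (tmod (res M) n) (mcomp M n) (nu M n)"
 using lift_additive(1)[OF res_dgm[OF M] B.dgm_ag[OF M] nu_balanced[OF M], of n] ag_add_closed[OF tmod_ag[OF res_dgm[OF M]], of _ n]
 by (simp add: additive_def nu_def)

lemma nu_Cyc: assumes M: "B.dgm M" shows "nu M \<in> B.Cyc (tp (res M)) M 0"
proof -
 note N = res_dgm[OF M] and G = B.dgm_ag[OF M]
 note T = tp_dgm[OF N] and TG = tmod_ag[OF N] and A = nu_additive[OF M] and t = nu_tens[OF M]
 have "nu M \<in> B.Hom (tp (res M)) M 0"
 proof (rule B.Hom_I, unfold tp_mcomp add_0_right)
  show "nu M i \<in> extensional (tcar (res M) i)" for i by (simp add: nu_def)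
  fix n u assume u: "u \<in> tcar (res M) n"
  show "nu M n u \<in> car M n" by (rule additiveD(1)[OF A u])
  show "nu M n (u \<oplus>[tmod (res M) n] v) = nu M n u \<oplus>[M,n] nu M n v" if "v \<in> tcar (res M) n" for v
   by (rule additiveD(2)[OF A u that])
  show "nu M n (c \<odot>[tmod (res M) n] u) = c \<odot>[M,n] nu M n u" if c: "c \<in> carrier K" for c
  proof (rule tmod_ext[OF N G additive_comp[OF smult_additive[OF N c] A] additive_comp[OF A] _ u])
   show "additive (mcomp M n) (mcomp M n) (\<lambda>x. c \<odot>[M,n] x)" using c M by (simp add: additive_def module.smult_r_distr[OF B.dgm_module])
  qed (use M c res_set_closed[OF M] in \<open>auto simp: smult_tens[OF N c] t B.act_smult_left res_setD lsetD\<close>)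
  fix l b assume b: "b \<in> B.acar l"
  show "nu M (n + l) (mact (tp (res M)) n l u b) = mact M n l (nu M n u) b"
  proof (rule tmod_ext[OF N G additive_comp[OF tp_act_additive[OF N b] A] additive_comp[OF A] _ u])
   show "additive (mcomp M n) (mcomp M (n + l)) (\<lambda>x. mact M n l x b)" using b M by (simp add: additive_def B.act_closed B.act_add_left)
   fix i k x w assume m: "i + k = n" "x \<in> car (res M) i" "w \<in> lset k"
   then have x: "x \<in> res_set M i" by simp
   have s: "i + (k + l) = n + l" using m by simp
   show "nu M (n + l) (mact (tp (res M)) n l (tens (res M) n i k x w) b) = mact M n l (nu M n (tens (res M) n i k x w)) b"
    unfolding tp_act_tens[OF N b m] t[OF s x lset_closed(3)[OF m(3) b HOL.refl]] t[OF m(1) x m(3)]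
    using B.act_assoc[OF M res_setD(1)[OF x] lsetD(1)[OF m(3)] b, of n] m by simp
  qed
 qed
 then show ?thesis
 proof (rule B.CycI_pointwise[OF T M], unfold tp_mcomp)
  fix n u assume u: "u \<in> tcar (res M) n"
  have "nu M (n + 1) (mdiff (tp (res M)) n u) = mdiff M n (nu M n u)"
  proof (rule tmod_ext[OF N G additive_comp[OF tp_diff_additive[OF N] A] additive_comp[OF A] _ u])
   show "additive (mcomp M n) (mcomp M (n + 1)) (mdiff M n)" using M by (simp add: additive_def B.diff_closed B.diff_add)
   fix i k x w assume m: "i + k = n" "x \<in> car (res M) i" "w \<in> lset k"
   then have x: "x \<in> res_set M i" by simp
   have s: "i + 1 + k = n + 1" "i + (k + 1) = n + 1" using m by auto
   have dw: "adiff B k w \<in> lset (k + 1)" and dx: "mdiff M i x \<in> res_set M (i + 1)" using m M by (simp_all add: lset_closed(4) res_set_closed)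
   have c: "tens (res M) (n + 1) (i + 1) k (mdiff M i x) w \<in> tcar (res M) (n + 1)" "tens (res M) (n + 1) i (k + 1) x (adiff B k w) \<in> tcar (res M) (n + 1)"
    using s m dx dw by (auto intro!: tens_closed)
   show "nu M (n + 1) (mdiff (tp (res M)) n (tens (res M) n i k x w)) = mdiff M n (nu M n (tens (res M) n i k x w))"
    using additiveD(2)[OF A c(1) ksign_closed[OF TG c(2)]] additive_ksign[of "tmod (res M) (n + 1)" "mcomp M (n + 1)" "nu M (n + 1)", OF TG G additiveD[OF A] c(2)]
     t[OF s(1) dx m(3)] t[OF s(2) x dw] B.diff_act[OF M res_setD(1)[OF x] lsetD(1)[OF m(3)], of n] m
    by (simp add: tp_diff_tens[OF N m] t[OF m(1) x m(3)])
  qed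
  then show "mdiff M (n + 0) (nu M n u) = ksign (mcomp M (n + 0 + 1)) 0 (nu M (n + 1) (mdiff (tp (res M)) n u))" by simp
 qed
qed

lemma nu_natural:
 assumes o: "B.dgm M" "B.dgm M'" and f: "f \<in> B.Cyc M M' 0"
 shows "gcomp (tp (res M)) 0 (nu M') (tmap (res M) (res M') 0 (res_map M f)) = gcomp (tp (res M)) 0 f (nu M)"
proof (rule B.Hom_eqI)
 note N = res_dgm[OF o(1)] res_dgm[OF o(2)] and fH = B.CycH[OF f]
 note T = tp_dgm[OF N(1)] and rf = res_map_Hom[OF o fH]
 note F = tmap_Hom[OF N rf]
 show "gcomp (tp (res M)) 0 (nu M') (tmap (res M) (res M') 0 (res_map M f)) \<in> B.Hom (tp (res M)) M' 0"
  using B.gcomp_closed[OF T F B.CycH[OF nu_Cyc[OF o(2)]]] by simp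
 show "gcomp (tp (res M)) 0 f (nu M) \<in> B.Hom (tp (res M)) M' 0" using B.gcomp_closed[OF T B.CycH[OF nu_Cyc[OF o(1)]] fH] by simp
 fix n u assume "u \<in> car (tp (res M)) n"
 then have u: "u \<in> tcar (res M) n" by simp
 have "nu M' n (tmap (res M) (res M') 0 (res_map M f) n u) = f n (nu M n u)"
 proof (rule tmod_ext[OF N(1) B.dgm_ag[OF o(2)] _ additive_comp[OF nu_additive[OF o(1)]] _ u])
  show "additive (tmod (res M) n) (mcomp M' n) (\<lambda>u. nu M' n (tmap (res M) (res M') 0 (res_map M f) n u))"
   using additive_comp[OF tmap_additive[OF N rf, of n]] nu_additive[OF o(2), of n] by simp
  show "additive (mcomp M n) (mcomp M' n) (f n)" using B.Hom_closed[OF fH] B.Hom_add[OF fH] by (simp add: additive_def)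
  fix i k x w assume h: "i + k = n" "x \<in> car (res M) i" "w \<in> lset k"
  then have x: "x \<in> res_set M i" by simp
  show "nu M' n (tmap (res M) (res M') 0 (res_map M f) n (tens (res M) n i k x w)) = f n (nu M n (tens (res M) n i k x w))"
   using tmap_tens[OF N rf h] nu_tens[OF o(2) h(1) Hom_res_set[OF fH x] h(3)] nu_tens[OF o(1) h(1) x h(3)]
    B.Hom_act[OF fH res_setD(1)[OF x] lsetD(1)[OF h(3)], of n] h x by simp
 qed
 then show "gcomp (tp (res M)) 0 (nu M') (tmap (res M) (res M') 0 (res_map M f)) n u = gcomp (tp (res M)) 0 f (nu M) n u"
  using u by simp
qed

text \<open>Both maps send \<open>x \<otimes> w\<close> to \<open>x w\<close>.  Hence \<open>nu\<close> becomes an isomorphism after restriction.\<close>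

lemma res_nu: assumes M: "B.dgm M" shows "res_map (tp (res M)) (nu M) = mu (res M)"
proof (rule L.Hom_eqI[OF res_map_Hom[OF tp_dgm[OF res_dgm[OF M]] M B.CycH[OF nu_Cyc[OF M]]] L.CycH[OF mu_Cyc(1)[OF res_dgm[OF M]]]])
 fix n u assume "u \<in> car (res (tp (res M))) n"
 then have u: "u \<in> res_set (tp (res M)) n" by simp
 have m: "mu (res M) n u \<in> res_set M n" using iota_mu(2)[OF res_dgm[OF M] u] by simp
 have "nu M n (iota (res M) n (mu (res M) n u)) = mu (res M) n u"
  using nu_tens[OF M _ m lset_closed(6), of n] m res_setD(2)[OF m] by (simp add: iota_def)
 then show "res_map (tp (res M)) (nu M) n u = mu (res M) n u" using u iota_mu(3)[OF res_dgm[OF M] u] by simp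
qed

end

text \<open>Fullness up to acyclic modules.  It is assumed for modules of pairs because it is applied to mapping cones.\<close>

locale full_corner = coded_corner K B L e j code
 for K :: "'k ring" and B :: "('k, 'b) dg_alg" and L :: "('k, 'l) dg_alg" and e :: 'b and j :: "int => 'l => 'b"
  and code :: "(int \<times> int \<times> 'v \<times> 'b) list => 'v" +
 assumes full: "\<And>N :: ('k, 'b, 'v \<times> 'v) dg_mod. [|B.dgm N; L.acyclic (res N)|] ==> B.acyclic N"
begin

text \<open>Restriction commutes with cones, and a map is a quasi-isomorphism iff its cone is acyclic.\<close>

lemma res_reflects_qis:
 fixes X Y :: "('k, 'b, 'v) dg_mod"
 assumes X: "B.dgm X" and Y: "B.dgm Y" and f: "f \<in> B.Cyc X Y 0" and q: "L.qis (res X) (res Y) (res_map X f)"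
 shows "B.qis X Y f"
 using q B.qis_cone[OF X Y f] L.qis_cone[OF res_dgm[OF X] res_dgm[OF Y] res_map_Cyc[OF X Y f]]
  full[OF B.dgm_cone'[OF X Y f]] res_cone_acyclic[OF X Y f] by simp

text \<open>After restriction the map becomes the isomorphism \<open>mu\<close>.\<close>

lemma nu_qis: assumes M: "B.dgm M" shows "B.qis (tp (res M)) M (nu M)"
 using res_reflects_qis[OF tp_dgm[OF res_dgm[OF M]] M nu_Cyc[OF M]] mu_qis[OF res_dgm[OF M]] res_nu[OF M] by simp

text \<open>After restriction \<open>f \<otimes> 1\<close> becomes isomorphic to \<open>f\<close>.\<close>

lemma tp_qis:
 assumes o: "L.dgm N" "L.dgm N'" and f: "f \<in> L.Cyc N N' 0" and q: "L.qis N N' f"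
 shows "B.qis (tp N) (tp N') (tmap N N' 0 f)"
proof -
 interpret T: dg_functor K L B tp tmap by (rule tp_functor)
 note t = tp_dgm[OF o(1)] tp_dgm[OF o(2)] and F = T.\<Psi>_Cyc[OF o f]
 note r = res_dgm[OF t(1)] res_dgm[OF t(2)] and rF = res_map_Cyc[OF t F]
 note m = mu_Cyc[OF o(1)] and m' = mu_Cyc[OF o(2)]
 have "gcomp (res (tp N)) 0 (iota N') (gcomp (res (tp N)) 0 f (mu N)) = res_map (tp N) (tmap N N' 0 f)"
  unfolding mu_natural[OF o f, symmetric]
  using L.gcomp_assoc[OF L.CycH[OF rF], of 0 "iota N'" "mu N'"] m'(2) L.gcomp_gid_left[OF r L.CycH[OF rF]] by simp
 moreover have "L.qis (res (tp N)) (res (tp N')) (gcomp (res (tp N)) 0 (iota N') (gcomp (res (tp N)) 0 f (mu N)))"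
  using L.qis_comp[OF r(1) o(2) r(2) L.Cyc_gcomp[OF r(1) o m(1) f, of 0] L.qis_comp[OF r(1) o m(1) mu_qis[OF o(1)] f q] iota_Cyc[OF o(2)]
   L.qis_inverse[OF o(2) r(2) iota_Cyc[OF o(2)] m'(1,3,2)]] by simp
 ultimately show ?thesis using res_reflects_qis[OF t F] by simp
qed

end

section \<open>Two full corners of a dg algebra are derived equivalent\<close>

locale two_corners = X: full_corner K B L e j code + Y: full_corner K B L' e' j' code'
 for K :: "'k ring" and B :: "('k, 'b) dg_alg" and L :: "('k, 'l) dg_alg" and e :: 'b and j :: "int => 'l => 'b"
  and code :: "(int \<times> int \<times> 'v \<times> 'b) list => 'v"
  and L' :: "('k, 'm) dg_alg" and e' :: 'b and j' :: "int => 'm => 'b"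
  and code' :: "(int \<times> int \<times> 'v \<times> 'b) list => 'v"
begin

text \<open>Tensor up from the first corner, then restrict to the second.\<close>

definition transfer where "transfer N = Y.res (X.tp N)"
definition transfer_map where "transfer_map N N' n f = Y.res_map (X.tp N) (X.tmap N N' n f)"

lemma transfer_functor: "dg_functor K L L' transfer transfer_map"
 using dg_functor_comp[OF X.tp_functor Y.res_functor] unfolding transfer_def[abs_def] transfer_map_def[abs_def] .

lemma transfer_qis:
 assumes o: "X.L.dgm N" "X.L.dgm N'" and f: "f \<in> X.L.Cyc N N' 0" and q: "X.L.qis N N' f"
 shows "Y.L.qis (transfer N) (transfer N') (transfer_map N N' 0 f)"
proof -
 interpret T: dg_functor K L B X.tp X.tmap by (rule X.tp_functor)
 show ?thesis unfolding transfer_def transfer_map_def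
  by (rule Y.res_qis[OF X.tp_dgm[OF o(1)] X.tp_dgm[OF o(2)] T.\<Psi>_Cyc[OF o f] X.tp_qis[OF o f q]])
qed

text \<open>Going to the other corner and back: \<open>nu\<close> of the second corner, restricted to the first, followed by \<open>mu\<close> of the
 first.\<close>

definition counit where
 "counit N = gcomp (X.res (Y.tp (transfer N))) 0 (X.mu N) (X.res_map (Y.tp (transfer N)) (Y.nu (X.tp N)))"

lemma counit_Cyc_qis:
 assumes N: "X.L.dgm N"
 shows "counit N \<in> X.L.Cyc (X.res (Y.tp (transfer N))) N 0" "X.L.qis (X.res (Y.tp (transfer N))) N (counit N)"
proof -
 note T = X.tp_dgm[OF N]
 note S = Y.tp_dgm[OF Y.res_dgm[OF T]]
 note n = Y.nu_Cyc[OF T]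
 note r = X.res_dgm[OF S] X.res_dgm[OF T]
 show "counit N \<in> X.L.Cyc (X.res (Y.tp (transfer N))) N 0"
  unfolding counit_def transfer_def using X.L.Cyc_gcomp[OF r N X.res_map_Cyc[OF S T n] X.mu_Cyc(1)[OF N]] by simp
 show "X.L.qis (X.res (Y.tp (transfer N))) N (counit N)"
  unfolding counit_def transfer_def
  by (rule X.L.qis_comp[OF r N X.res_map_Cyc[OF S T n] X.res_qis[OF S T n Y.nu_qis[OF T]] X.mu_Cyc(1)[OF N] X.mu_qis[OF N]])
qed

lemma counit_natural:
 assumes o: "X.L.dgm N" "X.L.dgm N'" and f: "f \<in> X.L.Cyc N N' 0"
 shows "gcomp (X.res (Y.tp (transfer N))) 0 (counit N') (X.res_map (Y.tp (transfer N)) (Y.tmap (transfer N) (transfer N') 0 (transfer_map N N' 0 f))) =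
  gcomp (X.res (Y.tp (transfer N))) 0 f (counit N)"
proof -
 interpret F: dg_functor K L B X.tp X.tmap by (rule X.tp_functor)
 interpret R: dg_functor K B L "X.res :: ('k, 'b, 'v) dg_mod => _" "\<lambda>X Y n. X.res_map X" by (rule X.res_functor)
 interpret H: dg_functor K L' B Y.tp Y.tmap by (rule Y.tp_functor)
 note T = X.tp_dgm[OF o(1)] X.tp_dgm[OF o(2)]
 note Q = Y.res_dgm[OF T(1)] Y.res_dgm[OF T(2)]
 note S = Y.tp_dgm[OF Q(1)] Y.tp_dgm[OF Q(2)]
 note tf = F.\<Psi>_Cyc[OF o f]
 note stf = H.\<Psi>_Cyc[OF Q Y.res_map_Cyc[OF T tf]]
 note n = Y.nu_Cyc[OF T(1)] Y.nu_Cyc[OF T(2)]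
 let ?S = "X.res (Y.tp (Y.res (X.tp N)))" and ?S' = "X.res (Y.tp (Y.res (X.tp N')))"
 let ?s = "X.res_map (Y.tp (Y.res (X.tp N))) (Y.tmap (Y.res (X.tp N)) (Y.res (X.tp N')) 0 (Y.res_map (X.tp N) (X.tmap N N' 0 f)))"
 let ?n = "X.res_map (Y.tp (Y.res (X.tp N))) (Y.nu (X.tp N))" and ?n' = "X.res_map (Y.tp (Y.res (X.tp N'))) (Y.nu (X.tp N'))"
 have s: "?s \<in> X.L.Hom ?S ?S' 0" using X.L.CycH[OF X.res_map_Cyc[OF S stf]] .
 have nH: "?n \<in> X.L.Hom ?S (X.res (X.tp N)) 0" using X.L.CycH[OF X.res_map_Cyc[OF S(1) T(1) n(1)]] .
 have "gcomp ?S 0 ?n' ?s = gcomp ?S 0 (X.res_map (X.tp N) (X.tmap N N' 0 f)) ?n"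
  using R.\<Psi>_gcomp[OF S T(2) stf n(2)] R.\<Psi>_gcomp[OF S(1) T n(1) tf] Y.nu_natural[OF T tf] by simp
 then show ?thesis unfolding counit_def transfer_def transfer_map_def
  using X.L.gcomp_assoc[OF s, of 0 "X.mu N'" ?n'] X.L.gcomp_assoc[OF nH, of 0 "X.mu N'" "X.res_map (X.tp N) (X.tmap N N' 0 f)"]
   X.mu_natural[OF o f] X.L.gcomp_assoc[OF nH, of 0 f "X.mu N"] by simp
qed

lemma swap: "two_corners K B L' e' j' code' L e j code"
 by (rule two_corners.intro) (rule Y.full_corner_axioms, rule X.full_corner_axioms)

text \<open>The situation is symmetric in the two corners, so the same counit serves in both directions.\<close>

theorem corners_derived_equivalent:
 assumes p: "inj (p :: 'v \<times> 'v => 'v)"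
 shows "derived_equivalent TYPE('v) K L L'"
proof -
 interpret S: two_corners K B L' e' j' code' L e j code by (rule swap)
 note c = counit_Cyc_qis[folded S.transfer_def] counit_natural[folded S.transfer_def S.transfer_map_def]
  S.counit_Cyc_qis[folded transfer_def] S.counit_natural[folded transfer_def transfer_map_def]
 have "dg_equivalence K L L' transfer transfer_map S.transfer S.transfer_map counit S.counit p"
  by (intro dg_equivalence.intro dg_equivalence_axioms.intro transfer_functor S.transfer_functor p; (rule transfer_qis S.transfer_qis c; assumption))
 then show ?thesis by (rule dg_equivalence.derived_equivalence)
qed

end

section \<open>Corners from strict retracts\<close>

lemma dg_End_simps [simp]: "acomp (dg_End K A W) = hom_module K A W W" "amult (dg_End K A W) p q f g = gcomp W q f g"
 "aone (dg_End K A W) = gid W" "adiff (dg_End K A W) = hom_diff W W"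
 by (simp_all add: dg_End_def)

context dg_algebra begin

text \<open>A strict summand: the equation holds on the nose and not only up to homotopy, so that \<open>i r\<close> is an idempotent.\<close>

definition retract :: "('k, 'a, 'm) dg_mod => ('k, 'a, 'n) dg_mod => (int => 'm => 'n) => (int => 'n => 'm) => bool" where
 "retract X W i r \<longleftrightarrow> i \<in> Cyc X W 0 & r \<in> Cyc W X 0 & gcomp X 0 r i = gid X"

lemma retract_gid: "dgm X ==> retract X X (gid X) (gid X)"
 unfolding retract_def using gcomp_gid_left[OF _ _ gid_closed] by (auto intro: Cyc_gid)

lemma retract_trans:
 assumes o: "dgm X" "dgm Y" "dgm Z" and a: "retract X Y i r" and b: "retract Y Z i' r'"
 shows "retract X Z (gcomp X 0 i' i) (gcomp Z 0 r r')"
proof -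
 have m: "i \<in> Cyc X Y 0" "r \<in> Cyc Y X 0" "gcomp X 0 r i = gid X" "i' \<in> Cyc Y Z 0" "r' \<in> Cyc Z Y 0" "gcomp Y 0 r' i' = gid Y"
  using a b by (auto simp: retract_def)
 have ii: "gcomp X 0 i' i \<in> Cyc X Z 0" using Cyc_gcomp[OF o m(1,4)] by simp
 show ?thesis unfolding retract_def
  using ii Cyc_gcomp[OF o(3,2,1) m(5,2), of 0] gcomp_assoc[OF CycH[OF ii], of 0 r r'] gcomp_assoc[OF CycH[OF m(1)], of 0 r' i']
   m(3,6) gcomp_gid_left[OF o(1,2) CycH[OF m(1)]] by simp
qed

lemma retract_sum:
 assumes "dgm X" "dgm Y"
 shows "retract X (dg_sum X Y) (sum_inl X Y) (sum_prl X Y)" "retract Y (dg_sum X Y) (sum_inr X Y) (sum_prr X Y)"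
 unfolding retract_def using sum_in_out_Cyc[OF assms] sum_in_out[OF assms] by auto

text \<open>For summands \<open>P\<close> and \<open>Q\<close> of \<open>W\<close> this embeds the maps \<open>P \<rightarrow> Q\<close> into the endomorphisms of \<open>W\<close>.\<close>

definition conj :: "('k, 'a, 'w) dg_mod => ('k, 'a, 'm) dg_mod => (int => 'n => 'w) => (int => 'w => 'm) => int => (int => 'm => 'n) => int => 'w => 'w" where
 "conj W X i r n u = gcomp W 0 (gcomp X n i u) r"

text \<open>As \<open>i\<close> and \<open>r\<close> are closed of degree \<open>0\<close>, conjugation commutes with every operation of the dg category.\<close>

lemma conj_rules:
 assumes o: "dgm W" "dgm X" "dgm Y" and i: "i \<in> Cyc Y W 0" and r: "r \<in> Cyc W X 0" and u: "u \<in> Hom X Y n"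
 shows "conj W X i r n u \<in> Hom W W n"
  and "v \<in> Hom X Y n ==> conj W X i r n (u \<oplus>[HM X Y n] v) = conj W X i r n u \<oplus>[HM W W n] conj W X i r n v"
  and "c \<in> carrier K ==> conj W X i r n (c \<odot>[HM X Y n] u) = c \<odot>[HM W W n] conj W X i r n u"
  and "k = n + 1 ==> conj W X i r k (D X Y n u) = D W W n (conj W X i r n u)"
  and "[|u' \<in> Hom Y Z m; gcomp Y 0 r' i = gid Y; k = n + m|] ==>
   gcomp W n (conj W Y i' r' m u') (conj W X i r n u) = conj W X i' r k (gcomp X n u' u)"
proof -
 note iH = CycH[OF i] and rH = CycH[OF r]
 have iu: "gcomp X n i v \<in> Hom X W n" if "v \<in> Hom X Y n" for v n using gcomp_closed[OF o(2) that iH] by simp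
 have ur: "gcomp W 0 u r \<in> Hom W Y n" using gcomp_closed[OF o(1) rH u] by simp
 show c: "conj W X i r n u \<in> Hom W W n" using gcomp_closed[OF o(1) rH iu[OF u]] by (simp add: conj_def)
 show "v \<in> Hom X Y n ==> conj W X i r n (u \<oplus>[HM X Y n] v) = conj W X i r n u \<oplus>[HM W W n] conj W X i r n v"
  using gcomp_add_right[OF o(2,3,1) u _ iH] gcomp_add_left[OF o(1,2,1) rH iu[OF u] iu] by (simp add: conj_def)
 show "c \<in> carrier K ==> conj W X i r n (c \<odot>[HM X Y n] u) = c \<odot>[HM W W n] conj W X i r n u"
  using gcomp_smult_right[OF o(2,3,1) u iH] gcomp_smult_left[OF o(1,2,1) rH iu[OF u]] by (simp add: conj_def)
 have Du: "D X Y n u \<in> Hom X Y (n + 1)" using D_closed[OF o(2,3) u] by simp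
 have 1: "D X W n (gcomp X n i u) = gcomp X (n + 1) i (D X Y n u)"
  using D_gcomp[OF o(2,3,1) u iH, of n] CycD(2)[OF i] gcomp_zero_left[OF o(2,3,1) u, of "n + 1" 1] iu[OF Du] o by (simp add: ag_l_zero)
 have "D W W n (gcomp W 0 (gcomp X n i u) r) = gcomp W 0 (D X W n (gcomp X n i u)) r"
  using D_gcomp[OF o(1,2,1) rH iu[OF u], of n] CycD(2)[OF r] gcomp_zero_right[OF o(1,2,1) iu[OF u], of "n + 1" 1] gcomp_closed[OF o(1) rH iu[OF Du], of "n + 1"] o
  by (simp add: 1 ag_r_zero ksign_zero)
 then show "k = n + 1 ==> conj W X i r k (D X Y n u) = D W W n (conj W X i r n u)" by (simp add: conj_def 1)
 show "gcomp W n (conj W Y i' r' m u') (conj W X i r n u) = conj W X i' r k (gcomp X n u' u)"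
  if ri: "gcomp Y 0 r' i = gid Y" and k: "k = n + m"
 proof -
  have "gcomp W n r' (conj W X i r n u) = gcomp W 0 u r"
   using gcomp_assoc[OF rH, of n i u] gcomp_assoc[OF ur, of 0 r' i] gcomp_gid_left[OF o(1,3) ur] ri by (simp add: conj_def)
  then show ?thesis
   using gcomp_assoc[OF c, of 0 "gcomp Y m i' u'" r'] gcomp_assoc[OF rH, of n "gcomp Y m i' u'" u] gcomp_assoc[OF u, of m i' u'] k
   by (simp add: conj_def)
 qed
qed

lemma conj_gid: "i \<in> Hom X W 0 ==> dgm X ==> conj W X i r 0 (gid X) = gcomp W 0 i r"
 by (simp add: conj_def gcomp_gid_right)

text \<open>The idempotent is \<open>i r\<close>, and \<open>u \<mapsto> i u r\<close> identifies the endomorphisms of \<open>x\<close> with the endomorphisms \<open>b\<close> of \<open>W\<close> such that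
 \<open>i r b i r = b\<close>; the inverse is \<open>b \<mapsto> r b i\<close>.\<close>

lemma retract_corner:
 assumes x: "dgm x" and W: "dgm W" and r: "retract x W i r"
 shows "corner K (dg_End K A W) (dg_End K A x) (gcomp W 0 i r) (conj W x i r)"
proof -
 have m: "i \<in> Cyc x W 0" "r \<in> Cyc W x 0" and ri: "gcomp x 0 r i = gid x" using r by (auto simp: retract_def)
 note H = m[THEN CycH]
 have e: "gcomp W 0 i r \<in> Cyc W W 0" using Cyc_gcomp[OF W x W m(2,1)] by simp
 note cr = conj_rules[OF W x x m]
 have ret: "gcomp x 0 (gcomp W n r (conj W x i r n l)) i = l" if l: "l \<in> Hom x x n" for l n
 proof -
  have lr: "gcomp W 0 l r \<in> Hom W x n" using gcomp_closed[OF W H(2) l] by simp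
  have "gcomp W n r (conj W x i r n l) = gcomp W 0 l r"
   using gcomp_assoc[OF H(2), of n i l] gcomp_assoc[OF lr, of 0 r i] gcomp_gid_left[OF W x lr] ri by (simp add: conj_def)
  then show ?thesis using gcomp_assoc[OF H(1), of 0 l r] ri gcomp_gid_right[OF x l] by simp
 qed
 interpret E: dg_algebra K "dg_End K A W" by (rule dg_End_dg_algebra[OF W])
 interpret L: dg_algebra K "dg_End K A x" by (rule dg_End_dg_algebra[OF x])
 show ?thesis
 proof (intro corner.intro corner_axioms.intro E.dg_algebra_axioms L.dg_algebra_axioms)
  show "gcomp W 0 i r \<in> carrier (acomp (dg_End K A W) 0)" using CycH[OF e] by simp
  show "amult (dg_End K A W) 0 0 (gcomp W 0 i r) (gcomp W 0 i r) = gcomp W 0 i r"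
   using gcomp_assoc[OF CycH[OF e], of 0 i r] gcomp_assoc[OF H(2), of 0 r i] ri gcomp_gid_left[OF W x H(2)] by simp
  show "adiff (dg_End K A W) 0 (gcomp W 0 i r) = \<zero>[acomp (dg_End K A W) 1]" using CycD(2)[OF e] by simp
  show "linear_map K (acomp (dg_End K A x) n) (acomp (dg_End K A W) n) (conj W x i r n)" for n
   by (rule linear_mapI) (simp_all add: cr)
  show "conj W x i r n (amult (dg_End K A x) p q a a') = amult (dg_End K A W) p q (conj W x i r p a) (conj W x i r q a')"
   if a: "a \<in> carrier (acomp (dg_End K A x) p)" and a': "a' \<in> carrier (acomp (dg_End K A x) q)" and n: "n = p + q" for a a' p q n
   using cr(5)[of a' q a x p r n i] a a' ri n by simp
  show "conj W x i r 0 (aone (dg_End K A x)) = gcomp W 0 i r" using conj_gid[OF H(1) x] by simp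
  show "conj W x i r k (adiff (dg_End K A x) n a) = adiff (dg_End K A W) n (conj W x i r n a)"
   if "a \<in> carrier (acomp (dg_End K A x) n)" "k = n + 1" for a n k using that by (simp add: cr)
  show "inj_on (conj W x i r n) (carrier (acomp (dg_End K A x) n))" for n
   by (rule inj_on_inverseI[where g = "\<lambda>b. gcomp x 0 (gcomp W n r b) i"]) (simp add: ret)
  show "b \<in> conj W x i r n ` carrier (acomp (dg_End K A x) n)"
   if b: "b \<in> carrier (acomp (dg_End K A W) n)" "amult (dg_End K A W) 0 n (gcomp W 0 i r) b = b" "amult (dg_End K A W) n 0 b (gcomp W 0 i r) = b" for b n
  proof (rule image_eqI)
   have bH: "b \<in> Hom W W n" using b by simp
   have rb: "gcomp W n r b \<in> Hom W x n" using gcomp_closed[OF W bH H(2)] by simp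
   have rbi: "gcomp x 0 (gcomp W n r b) i \<in> Hom x x n" using gcomp_closed[OF x H(1) rb] by simp
   have eb: "gcomp W n i (gcomp W n r b) = b" using b(2) gcomp_assoc[OF bH, of 0 i r] by simp
   have be: "gcomp W 0 b (gcomp W 0 i r) = b" using b(3) by simp
   show "gcomp x 0 (gcomp W n r b) i \<in> carrier (acomp (dg_End K A x) n)" using rbi by simp
   show "b = conj W x i r n (gcomp x 0 (gcomp W n r b) i)"
    unfolding conj_def using gcomp_assoc[OF H(2), of n i "gcomp x 0 (gcomp W n r b) i"] gcomp_assoc[OF H(2), of 0 "gcomp W n r b" i]
     gcomp_assoc[OF CycH[OF e], of n r b] be eb by simp
  qed
 qed
qed

end

section \<open>Objects acting as zero\<close>

locale null_maps = dg_algebra K A for K :: "'k ring" and A :: "('k, 'a) dg_alg" +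
 fixes W :: "('k, 'a, 'w) dg_mod" and N :: "('k, int => 'w => 'w, 'n) dg_mod"
 assumes W: "dg_module K A W" and N: "dg_module K (dg_End K A W) N"
begin

sublocale E: dg_algebra K "dg_End K A W" by (rule dg_End_dg_algebra[OF W])

abbreviation act where "act \<equiv> mact N"

text \<open>Acts as zero on the cohomology of \<open>N\<close>.\<close>

definition null where "null n u \<longleftrightarrow> (\<forall>m. \<forall>z\<in>cocycles N m. act m n z u \<in> coboundaries N (m + n))"

lemma act_assoc': "[|z \<in> car N m; u \<in> Hom W W p; v \<in> Hom W W q; k = m + p; r = q + p|] ==>
  act m r z (gcomp W q u v) = act k q (act m p z u) v"
 using E.act_assoc[OF N, of z m u p v q k] by (simp add: add.commute)

lemma act_c: "[|z \<in> car N m; u \<in> Hom W W p; k = m + p|] ==> act m p z u \<in> car N k"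
 using E.act_closed[OF N, of z m u p k] by simp

lemma act_diff: "[|z \<in> car N m; u \<in> Hom W W p; k = m + p; l = k + 1|] ==>
  mdiff N k (act m p z u) = act (m + 1) p (mdiff N m z) u \<oplus>[N,l] ksign (mcomp N l) m (act m (p + 1) z (hom_diff W W p u))"
 using E.diff_act[OF N, of z m u p k] by simp

lemma act_diff_Cyc: "[|z \<in> car N m; u \<in> Cyc W W p; k = m + p|] ==> mdiff N k (act m p z u) = act (m + 1) p (mdiff N m z) u"
 using act_diff[of z m u p k "k + 1"] E.act_zero_right[OF N, of z m "p + 1"] act_c[of "mdiff N m z" "m + 1" u p "k + 1"]
  E.diff_closed[OF N, of z m "m + 1"] CycD[of u W W p] E.dgm_ag[OF N]
 by (simp add: ksign_zero ag_r_zero ac_simps)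

lemma act_cocycle: "[|z \<in> cocycles N m; u \<in> Cyc W W p; k = m + p|] ==> act m p z u \<in> cocycles N k"
 using act_diff_Cyc[of z m u p k] act_c[of z m u p k] E.act_zero_left[OF N, of u p "m + 1"] CycH[of u W W p]
 by (simp add: cocycles_def ac_simps)

lemma null_left: assumes u: "u \<in> Cyc W W p" "null p u" and v: "v \<in> Cyc W W q" and r: "r = q + p" shows "null r (gcomp W q u v)"
 unfolding null_def
proof (intro allI ballI)
 fix m z assume z: "z \<in> cocycles N m"
 note c = E.cocyclesD(1)[OF z]
 have "act m p z u \<in> coboundaries N (m + p)" using u(2) z by (simp add: null_def)
 then obtain y where y: "y \<in> car N (m + p - 1)" "act m p z u = mdiff N (m + p - 1) y" by (rule E.coboundariesE)
 have "act m r z (gcomp W q u v) = act (m + p) q (mdiff N (m + p - 1) y) v"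
  using act_assoc'[OF c CycH[OF u(1)] CycH[OF v] HOL.refl r] y(2) by simp
 also have "\<dots> = mdiff N (m + p - 1 + q) (act (m + p - 1) q y v)" using act_diff_Cyc[OF y(1) v HOL.refl] by simp
 finally show "act m r z (gcomp W q u v) \<in> coboundaries N (m + r)"
  using act_c[OF y(1) CycH[OF v] HOL.refl] r by (intro E.coboundariesI) auto
qed

lemma null_right: assumes v: "null q v" "v \<in> Cyc W W q" and u: "u \<in> Cyc W W p" and r: "r = q + p" shows "null r (gcomp W q u v)"
 unfolding null_def
proof (intro allI ballI)
 fix m z assume z: "z \<in> cocycles N m"
 have "act (m + p) q (act m p z u) v \<in> coboundaries N (m + p + q)"
  using act_cocycle[OF z u HOL.refl] v(1) unfolding null_def by blast
 moreover have "m + r = m + p + q" using r by simp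
 ultimately show "act m r z (gcomp W q u v) \<in> coboundaries N (m + r)"
  using act_assoc'[OF E.cocyclesD(1)[OF z] CycH[OF u] CycH[OF v(2)] HOL.refl r] by (simp add: add.assoc)
qed

lemma null_add: assumes "u \<in> Hom W W p" "v \<in> Hom W W p" "null p u" "null p v" shows "null p (u \<oplus>[HM W W p] v)"
 using assms E.act_add_right[OF N, of _ _ u p v] E.coboundaries_subgroup(1)[OF N] by (simp add: null_def cocycles_def)

text \<open>By the Leibniz rule a boundary maps each cocycle to a coboundary.\<close>

lemma null_boundary: assumes h: "h \<in> Hom W W q" and p: "p = q + 1" shows "null p (hom_diff W W q h)"
 unfolding null_def
proof (intro allI ballI)
 fix m z assume z: "z \<in> cocycles N m"
 note c = E.cocyclesD[OF z]
 have Dh: "act m p z (hom_diff W W q h) \<in> car N (m + p)" using act_c[OF c(1) D_closed[OF W W h p] HOL.refl] .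
 have "mdiff N (m + q) (act m q z h) = ksign (mcomp N (m + p)) m (act m p z (hom_diff W W q h))"
  using act_diff[OF c(1) h HOL.refl, of "m + p"] c(2) E.act_zero_left[OF N, of h q "m + 1"] h p Dh E.dgm_ag[OF N]
  by (simp add: ag_l_zero ksign_closed ac_simps)
 then have "ksign (mcomp N (m + p)) m (act m p z (hom_diff W W q h)) \<in> coboundaries N (m + p)"
  using act_c[OF c(1) h HOL.refl] p by (intro E.coboundariesI[of "act m q z h" N "m + q"]) auto
 then have "ksign (mcomp N (m + p)) m (ksign (mcomp N (m + p)) m (act m p z (hom_diff W W q h))) \<in> coboundaries N (m + p)"
  by (rule E.coboundaries_subgroup[OF N])
 then show "act m p z (hom_diff W W q h) \<in> coboundaries N (m + p)"
  using Dh E.dgm_ag[OF N] by (simp add: ksign_ksign) (simp add: ksign_def)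
qed

lemma null_htp: assumes h: "htp W W p u v" and u: "null p u" shows "null p v"
proof -
 obtain h where h: "u \<in> Cyc W W p" "h \<in> Hom W W (p - 1)" "v = u \<oplus>[HM W W p] hom_diff W W (p - 1) h" using h unfolding htp_def by blast
 show ?thesis unfolding h(3) using null_add[OF CycH[OF h(1)] D_closed[OF W W h(2)] u null_boundary[OF h(2)]] by simp
qed

text \<open>If \<open>g\<close> and \<open>h\<close> are the structure maps of a cone, then \<open>g r + s h\<close> is its identity.  For a cocycle \<open>z\<close> write
 \<open>z g = d y\<close>.  Then \<open>z s\<close> corrected by \<open>y f\<close> is a cocycle, so its product with \<open>h\<close> bounds; the remaining part
 \<open>(d y) r\<close> of \<open>z (g r + s h)\<close> agrees with \<open>d (y r)\<close> up to the term \<open>y f h\<close>, which cancels.\<close>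

lemma null_cone_object:
 assumes g: "g \<in> Cyc W W 0" "null 0 g" and h: "h \<in> Cyc W W 1" "null 1 h" and f: "f \<in> Cyc W W 0"
  and s: "s \<in> Hom W W (-1)" "hom_diff W W (-1) s = gcomp W 0 g f"
  and r: "r \<in> Hom W W 0" "hom_diff W W 0 r = \<ominus>[HM W W 1] gcomp W 1 f h"
 shows "null 0 (gcomp W 0 g r \<oplus>[HM W W 0] gcomp W 1 s h)"
 unfolding null_def
proof (intro allI ballI)
 fix m z assume z: "z \<in> cocycles N m"
 note c = E.cocyclesD[OF z] and G = E.dgm_ag[OF N]
 note H = CycH[OF g(1)] CycH[OF h(1)] CycH[OF f]
 have "act m 0 z g \<in> coboundaries N m" using g(2) z by (auto simp: null_def)
 then obtain y where y: "y \<in> car N (m - 1)" "act m 0 z g = mdiff N (m - 1) y" by (rule E.coboundariesE)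
 have yf: "act (m - 1) 0 y f \<in> car N (m - 1)" and yr: "act (m - 1) 0 y r \<in> car N (m - 1)"
  and zs: "act m (-1) z s \<in> car N (m - 1)" using act_c[OF y(1) H(3)] act_c[OF y(1) r(1)] act_c[OF c(1) s(1)] by simp_all
 define yfh where "yfh = act (m - 1) 1 (act (m - 1) 0 y f) h"
 define zsh where "zsh = act (m - 1) 1 (act m (-1) z s) h"
 have fh: "gcomp W 1 f h \<in> Hom W W 1" using gcomp_closed[OF W H(2,3)] by simp
 have cl: "yfh \<in> car N m" "zsh \<in> car N m" unfolding yfh_def zsh_def using act_c[OF yf H(2)] act_c[OF zs H(2)] by auto
 have dyr: "act m 0 (mdiff N (m - 1) y) r \<in> car N m" using act_c[OF E.diff_closed[OF N y(1)] r(1), of m m] by simp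
 have 1: "mdiff N (m - 1) (act (m - 1) 0 y r) = act m 0 (mdiff N (m - 1) y) r \<oplus>[N,m] ksign (mcomp N m) m yfh"
 proof -
  have "act (m - 1) 1 y (hom_diff W W 0 r) = \<ominus>[N,m] yfh"
   unfolding r(2) yfh_def using E.act_ksign_right[OF N y(1), of "gcomp W 1 f h" 1 1] fh act_assoc'[OF y(1) H(3,2), of "m - 1" 1] by (simp add: ksign_def)
  then show ?thesis using act_diff[OF y(1) r(1), of "m - 1" m] cl by (auto simp: ksign_def ag_simps[OF G])
 qed
 define w where "w = act m (-1) z s \<oplus>[N,m - 1] ksign (mcomp N (m - 1)) (m + 1) (act (m - 1) 0 y f)"
 have w: "w \<in> cocycles N (m - 1)"
 proof (rule E.cocyclesI)
  show "w \<in> car N (m - 1)" unfolding w_def using zs yf by (simp add: ag_add_closed[OF G] ksign_closed[OF G])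
  have df: "act m 0 (mdiff N (m - 1) y) f \<in> car N m" using act_c[OF E.diff_closed[OF N y(1)] H(3), of m m] by simp
  have "mdiff N (m - 1) (act m (-1) z s) = ksign (mcomp N m) m (act m 0 (mdiff N (m - 1) y) f)"
   using act_diff[OF c(1) s(1), of "m - 1" m] c(2) E.act_zero_left[OF N, of s "-1" "m + 1"] s act_assoc'[OF c(1) H(1,3), of m 0] y(2) df
   by (simp add: ag_l_zero[OF G] ksign_closed[OF G])
  moreover have "mdiff N (m - 1) (ksign (mcomp N (m - 1)) (m + 1) (act (m - 1) 0 y f)) = ksign (mcomp N m) (m + 1) (act m 0 (mdiff N (m - 1) y) f)"
   using E.diff_ksign[OF N yf] act_diff_Cyc[OF y(1) f, of "m - 1"] by simp
  ultimately show "mdiff N (m - 1) w = \<zero>[N,m - 1 + 1]"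
   unfolding w_def using E.diff_add[OF N zs ksign_closed[OF G yf], of "m + 1"] df by (auto simp: ksign_def ag_simps[OF G])
 qed
 have "act (m - 1) 1 w h \<in> coboundaries N (m - 1 + 1)" using h(2) w unfolding null_def by blast
 then have "act (m - 1) 1 w h \<in> coboundaries N m" by simp
 moreover have "act (m - 1) 1 w h = zsh \<oplus>[N,m] ksign (mcomp N m) (m + 1) yfh"
  unfolding w_def zsh_def yfh_def using E.act_add_left[OF N zs ksign_closed[OF G yf], of h 1 "m + 1"] E.act_ksign_left[OF N yf, of h 1 "m + 1"] H(2) by simp
 moreover have "mdiff N (m - 1) (act (m - 1) 0 y r) \<in> coboundaries N m" using yr by (intro E.coboundariesI) auto
 ultimately have "(act m 0 (mdiff N (m - 1) y) r \<oplus>[N,m] ksign (mcomp N m) m yfh) \<oplus>[N,m] (zsh \<oplus>[N,m] ksign (mcomp N m) (m + 1) yfh) \<in> coboundaries N m"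
  unfolding 1 using E.coboundaries_subgroup(1)[OF N, of _ m] by simp
 moreover have "(act m 0 (mdiff N (m - 1) y) r \<oplus>[N,m] ksign (mcomp N m) m yfh) \<oplus>[N,m] (zsh \<oplus>[N,m] ksign (mcomp N m) (m + 1) yfh)
   = act m 0 (mdiff N (m - 1) y) r \<oplus>[N,m] zsh"
  using cl dyr by (auto simp: ksign_def ag_simps[OF G] ag_ac[OF G])
 moreover have "act m 0 z (gcomp W 0 g r \<oplus>[HM W W 0] gcomp W 1 s h) = act m 0 (mdiff N (m - 1) y) r \<oplus>[N,m] zsh"
  unfolding zsh_def using E.act_add_right[OF N c(1), of "gcomp W 0 g r" 0 "gcomp W 1 s h"] gcomp_closed[OF W r(1) H(1), of 0] gcomp_closed[OF W H(2) s(1), of 0]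
   act_assoc'[OF c(1) H(1) r(1), of m 0] act_assoc'[OF c(1) s(1) H(2), of "m - 1" 0] y(2) by simp
 ultimately show "act m 0 z (gcomp W 0 g r \<oplus>[HM W W 0] gcomp W 1 s h) \<in> coboundaries N (m + 0)" by simp
qed

text \<open>Here \<open>h s\<close> is the identity of the first term of a cone triangle.  For a cocycle \<open>z\<close> write \<open>z h = d y\<close>.  Then \<open>y g\<close> is a
 cocycle because \<open>h g = 0\<close>, so \<open>y g f\<close> bounds, and \<open>z h s = (d y) s\<close> is \<open>d (y s)\<close> up to \<open>y g f\<close>.\<close>

lemma null_cone_base:
 assumes g: "g \<in> Cyc W W 0" and h: "h \<in> Cyc W W 1" "null 1 h" and f: "f \<in> Cyc W W 0" "null 0 f"
  and s: "s \<in> Hom W W (-1)" "hom_diff W W (-1) s = gcomp W 0 g f" and hg: "gcomp W 0 h g = \<zero>[HM W W 1]"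
 shows "null 0 (gcomp W (-1) h s)"
 unfolding null_def
proof (intro allI ballI)
 fix m z assume z: "z \<in> cocycles N m"
 note c = E.cocyclesD[OF z] and G = E.dgm_ag[OF N]
 note H = CycH[OF g(1)] CycH[OF h(1)] CycH[OF f(1)]
 have "act m 1 z h \<in> coboundaries N (m + 1)" using h(2) z by (auto simp: null_def)
 then obtain y where y: "y \<in> car N m" "act m 1 z h = mdiff N m y" using E.coboundariesE[of _ N "m + 1"] by auto
 have yg: "act m 0 y g \<in> cocycles N m"
 proof (rule E.cocyclesI)
  show "act m 0 y g \<in> car N m" using act_c[OF y(1) H(1)] by simp
  show "mdiff N m (act m 0 y g) = \<zero>[N,m + 1]"
   using act_diff_Cyc[OF y(1) g, of m] y(2) act_assoc'[OF c(1) H(2,1), of "m + 1" 1] hg E.act_zero_right[OF N c(1), of 1] by simp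
 qed
 define b where "b = act m 0 (act m 0 y g) f"
 have "b \<in> coboundaries N (m + 0)" using f(2) yg unfolding b_def null_def by blast
 then have b: "b \<in> coboundaries N m" by simp
 then have "ksign (mcomp N m) (m + 1) b \<in> coboundaries N m" by (rule E.coboundaries_subgroup[OF N])
 moreover have ys: "act m (-1) y s \<in> car N (m - 1)" using act_c[OF y(1) s(1)] by simp
 then have "mdiff N (m - 1) (act m (-1) y s) \<in> coboundaries N m" by (intro E.coboundariesI) auto
 ultimately have "mdiff N (m - 1) (act m (-1) y s) \<oplus>[N,m] ksign (mcomp N m) (m + 1) b \<in> coboundaries N m"
  by (intro E.coboundaries_subgroup(1)[OF N])
 moreover have "mdiff N (m - 1) (act m (-1) y s) = act (m + 1) (-1) (mdiff N m y) s \<oplus>[N,m] ksign (mcomp N m) m b"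
  unfolding b_def using act_diff[OF y(1) s(1), of "m - 1" m] s(2) act_assoc'[OF y(1) H(1,3), of m 0] by simp
 moreover have "act m 0 z (gcomp W (-1) h s) = act (m + 1) (-1) (mdiff N m y) s" using act_assoc'[OF c(1) H(2) s(1), of "m + 1" 0] y(2) by simp
 moreover have "act (m + 1) (-1) (mdiff N m y) s \<in> car N m" using act_c[OF E.diff_closed[OF N y(1)] s(1), of "m + 1" m] by simp
 moreover have "b \<in> car N m" using E.coboundaries_closed[OF N b] .
 ultimately show "act m 0 z (gcomp W (-1) h s) \<in> coboundaries N (m + 0)"
  by (cases "even m") (auto simp: ksign_def ag_simps[OF G] ag_assoc[OF G])
qed

text \<open>Arbitrary degrees make the notion invariant under shifts.  Factoring through \<open>P\<close> on both sides makes sense for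
 every dg module \<open>P\<close>, also for the middle term of the given triangle, which is only homotopy equivalent
 to a summand of \<open>W\<close>.\<close>

definition null_obj :: "('k, 'a, 'p) dg_mod => bool" where
 "null_obj P \<longleftrightarrow> (\<forall>p q a b. a \<in> Cyc W P p --> b \<in> Cyc P W q --> null (p + q) (gcomp W p b a))"

lemma null_objD: "[|null_obj P; a \<in> Cyc W P p; b \<in> Cyc P W q; r = p + q|] ==> null r (gcomp W p b a)"
 by (simp add: null_obj_def)

text \<open>Insert \<open>r i\<close> into the composite \<open>W \<rightarrow> P \<rightarrow> W\<close>.  The degree \<open>d\<close> covers shifts and homotopy equivalences at once.\<close>

lemma null_obj_retract:
 assumes P: "dgm P" and R: "dgm R" and nR: "null_obj R" and i: "i \<in> Cyc P R d" and r: "r \<in> Cyc R P (-d)" and h: "htp P P 0 (gcomp P d r i) (gid P)"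
 shows "null_obj P"
 unfolding null_obj_def
proof (intro allI impI)
 fix p q a b assume a: "a \<in> Cyc W P p" and b: "b \<in> Cyc P W q"
 have ia: "gcomp W p i a \<in> Cyc W R (p + d)" and br: "gcomp R (-d) b r \<in> Cyc R W (q - d)" using Cyc_gcomp[OF W P R a i] Cyc_gcomp[OF R P W r b] by simp_all
 have n: "null (p + q) (gcomp W (p + d) (gcomp R (-d) b r) (gcomp W p i a))" by (rule null_objD[OF nR ia br]) simp
 have "gcomp W (p + d) (gcomp R (-d) b r) (gcomp W p i a) = gcomp W p b (gcomp W p (gcomp P d r i) a)"
  using gcomp_assoc[OF CycH[OF ia], of "-d" b r] gcomp_assoc[OF CycH[OF a], of d r i] by simp
 moreover have "htp W W (p + q) (gcomp W p b (gcomp W p (gcomp P d r i) a)) (gcomp W p b (gcomp W p (gid P) a))"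
  by (rule htp_comp_left[OF W P W htp_comp_right[OF W P P h a] b]) simp_all
 ultimately show "null (p + q) (gcomp W p b a)" using null_htp n gcomp_gid_left[OF W P CycH[OF a]] by metis
qed

lemma null_obj_strict_retract: "[|dgm P; dgm R; null_obj R; retract P R i r|] ==> null_obj P"
 using null_obj_retract[of P R i 0 r] htp_refl[OF _ _ Cyc_gid, of P] by (simp add: retract_def)

lemma null_obj_heqv: assumes "dgm P" "dgm Q" "heqv P Q f" shows "null_obj P \<longleftrightarrow> null_obj Q"
proof -
 obtain g where "f \<in> Cyc P Q 0" "g \<in> Cyc Q P 0" "htp P P 0 (gcomp P 0 g f) (gid P)" "htp Q Q 0 (gcomp Q 0 f g) (gid Q)"
  using assms(3) by (auto simp: heqv_def)
 then show ?thesis using null_obj_retract[OF assms(1,2), of f 0 g] null_obj_retract[OF assms(2,1), of g 0 f] by auto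
qed

lemma null_obj_sum: assumes o: "dgm P" "dgm Q" and n: "null_obj P" "null_obj Q" shows "null_obj (dg_sum P Q)"
 unfolding null_obj_def
proof (intro allI impI)
 fix p q a b assume a: "a \<in> Cyc W (dg_sum P Q) p" and b: "b \<in> Cyc (dg_sum P Q) W q"
 have S: "dgm (dg_sum P Q)" using o by simp
 note io = sum_in_out_Cyc[OF o]
 have m: "gcomp W p (sum_prl P Q) a \<in> Cyc W P p" "gcomp W p (sum_prr P Q) a \<in> Cyc W Q p" "gcomp P 0 b (sum_inl P Q) \<in> Cyc P W q" "gcomp Q 0 b (sum_inr P Q) \<in> Cyc Q W q"
  using Cyc_gcomp[OF W S o(1) a io(3), of p] Cyc_gcomp[OF W S o(2) a io(4), of p] Cyc_gcomp[OF o(1) S W io(1) b, of q] Cyc_gcomp[OF o(2) S W io(2) b, of q] by auto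
 have c: "gcomp W p (gcomp P 0 b (sum_inl P Q)) (gcomp W p (sum_prl P Q) a) \<in> Hom W W (p + q)"
  "gcomp W p (gcomp Q 0 b (sum_inr P Q)) (gcomp W p (sum_prr P Q) a) \<in> Hom W W (p + q)"
  using gcomp_closed[OF W CycH[OF m(1)] CycH[OF m(3)] HOL.refl] gcomp_closed[OF W CycH[OF m(2)] CycH[OF m(4)] HOL.refl] .
 have "gcomp W p b a = gcomp W p (gcomp P 0 b (sum_inl P Q)) (gcomp W p (sum_prl P Q) a) \<oplus>[HM W W (p + q)]
   gcomp W p (gcomp Q 0 b (sum_inr P Q)) (gcomp W p (sum_prr P Q) a)"
 proof (rule Hom_eqI[OF gcomp_closed[OF W CycH[OF a] CycH[OF b] HOL.refl] HM_add_closed[OF W W c]])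
  fix i w assume w: "w \<in> car W i"
  have aw: "a i w \<in> car (dg_sum P Q) (i + p)" by (rule Hom_closed[OF CycH[OF a] w HOL.refl])
  obtain u v where uv: "a i w = (u, v)" "u \<in> car P (i + p)" "v \<in> car Q (i + p)" using aw by auto
  have "b (i + p) (u, v) = b (i + p) (u, \<zero>[Q,i + p]) \<oplus>[W,i + p + q] b (i + p) (\<zero>[P,i + p], v)"
   using Hom_add[OF CycH[OF b], of "(u, \<zero>[Q,i + p])" "i + p" "(\<zero>[P,i + p], v)"] uv o by (simp add: ag_simps)
  then show "gcomp W p b a i w = (gcomp W p (gcomp P 0 b (sum_inl P Q)) (gcomp W p (sum_prl P Q) a) \<oplus>[HM W W (p + q)]
   gcomp W p (gcomp Q 0 b (sum_inr P Q)) (gcomp W p (sum_prr P Q) a)) i w"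
   using w uv by (simp add: sum_prl_def sum_prr_def sum_inl_def sum_inr_def add.assoc)
 qed
 then show "null (p + q) (gcomp W p b a)" using null_add[OF c null_objD[OF n(1) m(1,3)] null_objD[OF n(2) m(2,4)]] by simp
qed

lemma null_obj_shift: assumes "dgm M" "null_obj M" shows "null_obj (dg_shift s M)"
proof -
 have o: "dgm (dg_shift s M)" using assms by simp
 show ?thesis
  using null_obj_retract[OF o assms shift_Cyc(2)[OF assms(1), of s] shift_Cyc(1)[OF assms(1), of s]] shift_inverse[OF assms(1), of s] htp_refl[OF o o Cyc_gid[OF o]] by simp
qed

text \<open>A power is a module of functions on \<open>{..<r}\<close>, so the composite through it is built up by truncation, one
 coordinate at a time.\<close>

lemma null_obj_power: assumes M: "dgm M" and n: "null_obj M" shows "null_obj (dg_power r M)"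
 unfolding null_obj_def
proof (intro allI impI)
 let ?P = "dg_power r M"
 fix p q a b assume a: "a \<in> Cyc W ?P p" and b: "b \<in> Cyc ?P W q"
 have P: "dgm ?P" using M by simp
 note aH = CycH[OF a] and bH = CycH[OF b]
 define j where "j = (\<lambda>s i. \<lambda>x\<in>car M i. \<lambda>t\<in>{..<r}. if t = s then x else \<zero>[M,i])"
 define e where "e = (\<lambda>s i. \<lambda>u\<in>car ?P i. u s)"
 have j: "j s \<in> Cyc M ?P 0" for s
  by (intro CycI_pointwise[OF M P] Hom_I)
    (use M in \<open>auto simp: j_def ag_simps dgm_closed act_zero_left diff_zero module.smult_r_null[OF dgm_module] module_power_ops
     intro!: restrict_ext module_power_restrict\<close>)
 have e: "e s \<in> Cyc ?P M 0" if s: "s < r" for s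
  by (intro CycI_pointwise[OF P M] Hom_I)
    (use P s in \<open>auto simp: e_def module_power_apply module_power_mem ag_add_closed[OF dgm_ag[OF P], simplified] smult_closed[OF P, simplified]
     act_closed[OF P, simplified] diff_closed[OF P, simplified] simp del: dgm_power\<close>)
 (* the first k coordinates of u, the others replaced by zero *)
 let ?tr = "\<lambda>k i u. \<lambda>t\<in>{..<r}. if t < k then u t else \<zero>[M,i]"
 have "k \<le> r ==> \<exists>g\<in>Hom W W (p + q). null (p + q) g & (\<forall>i. \<forall>w\<in>car W i. g i w = b (i + p) (?tr k (i + p) (a i w)))" for k
 proof (induction k)
  case 0
  have "null (p + q) \<zero>[HM W W (p + q)]"
   unfolding null_def using E.act_zero_right[OF N, of _ _ "p + q"] E.coboundaries_subgroup(3)[OF N] by (simp add: cocycles_def)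
  moreover have "?tr 0 i u = \<zero>[?P,i]" for i u by (auto simp: module_power_ops intro!: restrict_ext)
  then have "\<zero>[HM W W (p + q)] i w = b (i + p) (?tr 0 (i + p) (a i w))" if "w \<in> car W i" for i w
   using Hom_zero[OF bH P W, of "i + p"] that by (simp only: HM_zero_apply add.assoc)
  ultimately show ?case using HM_zero_closed[OF W W, of "p + q"] by blast
 next
  case (Suc k)
  then have k: "k < r" by simp
  obtain g where g: "g \<in> Hom W W (p + q)" "null (p + q) g" "\<And>i w. w \<in> car W i ==> g i w = b (i + p) (?tr k (i + p) (a i w))"
   using Suc.IH[OF less_imp_le[OF k]] by blast
  have ea: "gcomp W p (e k) a \<in> Cyc W M p" and bj: "gcomp M 0 b (j k) \<in> Cyc M W q"
   using Cyc_gcomp[OF W P M a e[OF k]] Cyc_gcomp[OF M P W j b] by simp_all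
  let ?h = "gcomp W p (gcomp M 0 b (j k)) (gcomp W p (e k) a)"
  have h: "?h \<in> Hom W W (p + q)" "null (p + q) ?h"
   using gcomp_closed[OF W CycH[OF ea] CycH[OF bj]] null_objD[OF n ea bj] by simp_all
  have "(g \<oplus>[HM W W (p + q)] ?h) i w = b (i + p) (?tr (Suc k) (i + p) (a i w))" if w: "w \<in> car W i" for i w
  proof -
   have u: "a i w \<in> car ?P (i + p)" by (rule Hom_closed[OF aH w HOL.refl])
   have uk: "a i w k \<in> car M (i + p)" using module_power_mem[of "a i w" r "mcomp M (i + p)" k] u k by simp
   have t: "?tr k (i + p) (a i w) \<in> car ?P (i + p)" "j k (i + p) (a i w k) \<in> car ?P (i + p)"
    using u uk M Hom_closed[OF CycH[OF j] uk, of "i + p" k] module_power_mem[of "a i w" r "mcomp M (i + p)"]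
    by (auto simp: ag_simps intro!: module_power_restrict)
   have "?tr (Suc k) (i + p) (a i w) = ?tr k (i + p) (a i w) \<oplus>[?P,i + p] j k (i + p) (a i w k)"
    using uk u M module_power_mem[of "a i w" r "mcomp M (i + p)"]
    by (auto simp: module_power_ops j_def ag_simps less_Suc_eq intro!: restrict_ext)
   then show ?thesis using Hom_add[OF bH t] w g(3)[OF w] u uk by (simp add: e_def add.assoc)
  qed
  then show ?case using HM_add_closed[OF W W g(1) h(1)] null_add[OF g(1) h(1) g(2) h(2)] by blast
 qed
 from this[OF order_refl] obtain g where g: "g \<in> Hom W W (p + q)" "null (p + q) g"
  "\<And>i w. w \<in> car W i ==> g i w = b (i + p) (?tr r (i + p) (a i w))" by blast
 have "g = gcomp W p b a"
 proof (rule Hom_eqI[OF g(1) gcomp_closed[OF W aH bH HOL.refl]])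
  fix i w assume w: "w \<in> car W i"
  have u: "a i w \<in> carrier (module_power r (mcomp M (i + p)))" using Hom_closed[OF aH w HOL.refl] by simp
  have "?tr r (i + p) (a i w) = a i w"
   by (rule module_power_eqI[OF module_power_restrict u]) (use module_power_mem[OF u] in simp_all)
  then show "g i w = gcomp W p b a i w" using g(3)[OF w] w by simp
 qed
 then show "null (p + q) (gcomp W p b a)" using g(2) by simp
qed

lemma null_obj_hisomorphic: assumes "dgm P" "dgm Q" "hisomorphic K A P Q" shows "null_obj P \<longleftrightarrow> null_obj Q"
proof -
 obtain f where "heqv P Q f" using assms by (auto simp: hisomorphic_def hiso_heqv)
 then show ?thesis by (rule null_obj_heqv[OF assms(1,2)])
qed

lemma null_obj_add_gen:
 fixes M L :: "('k, 'a, 'u) dg_mod"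
 assumes M: "dgm M" and n: "null_obj M" and L: "L \<in> add_gen K A M"
 shows "dgm L & null_obj L"
 using L
proof induction
 case (base L s)
 obtain L' :: "('k, 'a, 'u) dg_mod" and r where L: "dgm L" "dgm L'" "hisomorphic K A (dg_sum L L') (dg_power r (dg_shift s M))"
  using base by (auto simp: add_cat_def)
 have o: "dgm (dg_sum L L')" "dgm (dg_shift s M)" "dgm (dg_power r (dg_shift s M))" using L M by simp_all
 have "null_obj (dg_sum L L')"
  using null_obj_hisomorphic[OF o(1,3) L(3)] null_obj_power[OF o(2) null_obj_shift[OF M n]] by simp
 then show ?case using null_obj_strict_retract[OF L(1) o(1) _ retract_sum(1)[OF L(1,2)]] L by simp
next
 case (sum L1 L2 L)
 have o: "dgm (dg_sum L1 L2)" using sum by simp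
 show ?case using null_obj_hisomorphic[OF sum(3) o sum(4)] null_obj_sum[of L1 L2] sum by simp
qed

text \<open>If \<open>i r\<close> is null then so is \<open>b a = (b r) (i r) (i a)\<close>, because null cocycles form an ideal.\<close>

lemma null_obj_iff:
 assumes P: "dgm P" and r: "retract P W i r"
 shows "null_obj P \<longleftrightarrow> null 0 (gcomp W 0 i r)"
proof
 have m: "i \<in> Cyc P W 0" "r \<in> Cyc W P 0" and ri: "gcomp P 0 r i = gid P" using r by (auto simp: retract_def)
 show "null_obj P ==> null 0 (gcomp W 0 i r)" using null_objD[OF _ m(2,1), of 0] by simp
 assume n: "null 0 (gcomp W 0 i r)"
 have e: "gcomp W 0 i r \<in> Cyc W W 0" using Cyc_gcomp[OF W P W m(2,1)] by simp
 show "null_obj P" unfolding null_obj_def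
 proof (intro allI impI)
  fix p q a b assume a: "a \<in> Cyc W P p" and b: "b \<in> Cyc P W q"
  have ia: "gcomp W p i a \<in> Cyc W W p" and br: "gcomp W 0 b r \<in> Cyc W W q"
   using Cyc_gcomp[OF W P W a m(1)] Cyc_gcomp[OF W P W m(2) b] by simp_all
  have "gcomp W p (gcomp W 0 i r) (gcomp W p i a) = gcomp W p i a"
   using gcomp_assoc[OF CycH[OF ia], of 0 i r] gcomp_assoc[OF CycH[OF a], of 0 r i] gcomp_gid_left[OF W P CycH[OF a]] ri by simp
  then have n': "null p (gcomp W p i a)" using null_left[OF e n ia, of p] by simp
  have "gcomp W p (gcomp W 0 b r) (gcomp W p i a) = gcomp W p b a"
   using gcomp_assoc[OF CycH[OF ia], of 0 b r] gcomp_assoc[OF CycH[OF a], of 0 r i] gcomp_gid_left[OF W P CycH[OF a]] ri by simp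
  then show "null (p + q) (gcomp W p b a)" using null_right[OF n' ia br, of "p + q"] by simp
 qed
qed

text \<open>A morphism into or out of a null object becomes null when embedded into the endomorphisms of \<open>W\<close>.\<close>

lemma null_conj:
 assumes o: "dgm P" "dgm Q" and i: "i \<in> Cyc Q W 0" and r: "r \<in> Cyc W P 0" and u: "u \<in> Cyc P Q n"
 shows "conj W P i r n u \<in> Cyc W W n" and "null_obj P \<or> null_obj Q ==> null n (conj W P i r n u)"
proof -
 have iu: "gcomp P n i u \<in> Cyc P W n" and ur: "gcomp W 0 u r \<in> Cyc W Q n" using Cyc_gcomp[OF o W u i] Cyc_gcomp[OF W o r u] by simp_all
 show "conj W P i r n u \<in> Cyc W W n" unfolding conj_def using Cyc_gcomp[OF W o(1) W r iu] by simp
 have "conj W P i r n u = gcomp W n i (gcomp W 0 u r)" unfolding conj_def using gcomp_assoc[OF CycH[OF r], of n i u] by simp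
 then show "null_obj P \<or> null_obj Q ==> null n (conj W P i r n u)"
  using null_objD[OF _ r iu, of n] null_objD[OF _ ur i, of n] by (auto simp: conj_def)
qed

text \<open>The structure maps of the cone are embedded into the endomorphisms of \<open>W\<close>, which requires all three terms to be
 summands of \<open>W\<close>; then \<open>null_cone_object\<close> and \<open>null_cone_base\<close> apply.\<close>

lemma null_obj_cone:
 assumes o: "dgm X" "dgm Y" "dgm C" and c: "is_cone X Y C f g h \<sigma> \<rho>"
  and r: "retract X W iX rX" "retract Y W iY rY" "retract C W iC rC" and nY: "null_obj Y"
 shows "null_obj X \<longleftrightarrow> null_obj C"
proof
 have H: "f \<in> Cyc X Y 0" "g \<in> Cyc Y C 0" "h \<in> Cyc C X 1" "\<sigma> \<in> Hom X C (-1)" "\<rho> \<in> Hom C Y 0"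
   "D X C (-1) \<sigma> = gcomp X 0 g f" "D C Y 0 \<rho> = \<ominus>[HM C Y 1] gcomp C 1 f h"
   "gcomp C 0 g \<rho> \<oplus>[HM C C 0] gcomp C 1 \<sigma> h = gid C" "gcomp X (-1) h \<sigma> = gid X" "gcomp Y 0 h g = \<zero>[HM Y X 1]"
  using c by (auto simp: is_cone_def)
 note HH = H(1-3)[THEN CycH]
 have m: "iX \<in> Cyc X W 0" "rX \<in> Cyc W X 0" "gcomp X 0 rX iX = gid X" "iY \<in> Cyc Y W 0" "rY \<in> Cyc W Y 0" "gcomp Y 0 rY iY = gid Y"
  "iC \<in> Cyc C W 0" "rC \<in> Cyc W C 0" "gcomp C 0 rC iC = gid C" using r by (auto simp: retract_def)
 define f' where "f' = conj W X iY rX 0 f"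
 define g' where "g' = conj W Y iC rY 0 g"
 define h' where "h' = conj W C iX rC 1 h"
 define s' where "s' = conj W X iC rX (-1) \<sigma>"
 define r' where "r' = conj W C iY rC 0 \<rho>"
 have f': "f' \<in> Cyc W W 0" "null 0 f'" unfolding f'_def using null_conj[OF o(1,2) m(4,2) H(1)] nY by auto
 have g': "g' \<in> Cyc W W 0" "null 0 g'" unfolding g'_def using null_conj[OF o(2,3) m(7,5) H(2)] nY by auto
 have h': "h' \<in> Cyc W W 1" "null_obj X \<or> null_obj C ==> null 1 h'" unfolding h'_def using null_conj[OF o(3,1) m(1,8) H(3)] by auto
 note cX = conj_rules[OF W o(1,3) m(7,2) H(4)] and cC = conj_rules[OF W o(3,2) m(4,8) H(5)]
  and cf = conj_rules(5)[OF W o(1,2) m(4,2) HH(1) _ m(6)] and ch = conj_rules(5)[OF W o(3,1) m(1,8) HH(3) _ m(3)]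
  and cg = conj_rules(5)[OF W o(2,3) m(7,5) HH(2) _ m(9)]
 have s': "s' \<in> Hom W W (-1)" "D W W (-1) s' = gcomp W 0 g' f'"
  unfolding s'_def f'_def g'_def using cX(1) cX(4)[of 0] H(6) cf[OF HH(2), of 0] by simp_all
 have fh: "gcomp C 1 f h \<in> Hom C Y 1" using gcomp_closed[OF o(3) HH(3,1)] by simp
 have "conj W C iY rC 1 (\<ominus>[HM C Y 1] gcomp C 1 f h) = \<ominus>[HM W W 1] conj W C iY rC 1 (gcomp C 1 f h)"
  by (rule additive_neg[of "HM C Y 1"]) (use o W fh conj_rules(1,2)[OF W o(3,2) m(4,8)] in auto)
 then have r': "r' \<in> Hom W W 0" "D W W 0 r' = \<ominus>[HM W W 1] gcomp W 1 f' h'"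
  unfolding r'_def f'_def h'_def using cC(1) cC(4)[of 1] H(7) ch[OF HH(1), of 1] by simp_all
 { assume "null_obj X"
  then have "null 0 (gcomp W 0 g' r' \<oplus>[HM W W 0] gcomp W 1 s' h')" using null_cone_object[OF g' h'(1) h'(2) f'(1) s' r'] by simp
  moreover have "gcomp W 0 g' r' \<oplus>[HM W W 0] gcomp W 1 s' h' = conj W C iC rC 0 (gcomp C 0 g \<rho> \<oplus>[HM C C 0] gcomp C 1 \<sigma> h)"
   unfolding g'_def r'_def s'_def h'_def using cC(5)[OF HH(2) m(6), of 0] ch[OF H(4), of 0]
    conj_rules(2)[OF W o(3,3) m(7,8) gcomp_closed[OF o(3) H(5) HH(2)] gcomp_closed[OF o(3) HH(3) H(4)], of 0] by simp
  ultimately show "null_obj C" using null_obj_iff[OF o(3) r(3)] conj_gid[OF CycH[OF m(7)] o(3)] H(8) by simp }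
 assume n: "null_obj C"
 have "gcomp W 0 h' g' = conj W Y iX rY 1 \<zero>[HM Y X 1]" unfolding h'_def g'_def using cg[OF HH(3), of 1] H(10) by simp
 also have "\<dots> = \<zero>[HM W W 1]" by (rule additive_zero[of "HM Y X 1"]) (use o W conj_rules(1,2)[OF W o(2,1) m(1,5)] in auto)
 finally have hg: "gcomp W 0 h' g' = \<zero>[HM W W 1]" .
 have "null 0 (gcomp W (-1) h' s')" using null_cone_base[OF g'(1) h'(1) h'(2) f' s' hg] n by simp
 moreover have "gcomp W (-1) h' s' = conj W X iX rX 0 (gcomp X (-1) h \<sigma>)" unfolding h'_def s'_def using cX(5)[OF HH(3) m(9), of 0] by simp
 ultimately show "null_obj X" using null_obj_iff[OF o(1) r(1)] conj_gid[OF CycH[OF m(1)] o(1)] H(9) by simp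
qed

lemma null_obj_W_acyclic: assumes "null_obj W" shows "E.acyclic N"
proof -
 have "null 0 (gid W)" using null_obj_iff[OF W retract_gid[OF W]] gcomp_gid_left[OF W W gid_closed[OF W]] assms by simp
 then show ?thesis unfolding null_def E.acyclic_def
  using E.act_one[OF N] by (auto simp: cocycles_def)
qed

end

section \<open>The triangle\<close>

text \<open>The element \<open>z e\<close> is a cocycle of \<open>N e\<close>.\<close>

lemma (in corner) acyclic_res_coboundary:
 assumes N: "B.dgm N" and a: "L.acyclic (res N)" and z: "z \<in> cocycles N m"
 shows "mact N m 0 z e \<in> coboundaries N m"
proof -
 note c = B.cocyclesD[OF z]
 have "mdiff N m (mact N m 0 z e) = \<zero>[N,m + 1]"
  using B.diff_act[OF N c(1) e_closed, of m] c N by (simp add: d_e B.act_zero_left B.act_zero_right e_closed ksign_zero ag_simps)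
 then have "mact N m 0 z e \<in> cocycles (res N) m"
  using res_set_closed(7)[OF N c(1)] by (simp add: res_cocycles[OF N] cocycles_def res_set_def)
 then have "mact N m 0 z e \<in> coboundaries (res N) m" using a by (auto simp: L.acyclic_def)
 then show ?thesis by (auto simp: coboundaries_def res_set_def)
qed

context dg_algebra begin

text \<open>If \<open>X \<oplus> M\<close> is null, so are its summands \<open>X\<close> and \<open>M\<close>, hence the middle term, hence \<open>Y\<close> by the cone, and then
 every summand of \<open>W\<close>; likewise for \<open>Y \<oplus> M\<close>.  The terms \<open>X'\<close>, \<open>Y'\<close> and \<open>C\<close> of the standard triangle are included in \<open>W\<close>
 because \<open>null_obj_cone\<close> speaks of summands of \<open>W\<close>, and \<open>X\<close>, \<open>Y\<close> and the middle term are only homotopy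
 equivalent to them.\<close>

lemma triangle_common_retract:
 fixes X M M1 Y :: "('k, 'a, 'u) dg_mod"
 assumes M: "dgm M" and t: "htriangle K A X M1 Y f g h" and M1: "M1 \<in> add_gen K A M"
 shows "\<exists>(W :: ('k, 'a, (('u \<times> 'u) \<times> ('u \<times> 'u)) \<times> (('u \<times> 'u) \<times> ('u \<times> 'u))) dg_mod) i r i' r'. dgm W &
  retract (dg_sum X M) W i r & retract (dg_sum Y M) W i' r' &
  (\<forall>N :: ('k, _, 'n) dg_mod. null_maps K A W N -->
   (null_maps.null_obj K A W N (dg_sum X M) --> null_maps.null_obj K A W N W) &
   (null_maps.null_obj K A W N (dg_sum Y M) --> null_maps.null_obj K A W N W))"
proof -
 obtain a b c where o: "dgm X" "dgm M1" "dgm Y" and t: "triangle_maps X M1 Y a b c" using t unfolding htriangle_iff by blast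
 obtain X' Y' :: "('k, 'a, 'u) dg_mod" and \<phi> \<alpha> \<beta> \<gamma> where o': "dgm X'" "dgm Y'" and \<phi>: "\<phi> \<in> Cyc X' Y' 0"
  and q: "heqv X X' \<alpha>" "heqv M1 Y' \<beta>" "heqv Y (dg_cone X' Y' \<phi>) \<gamma>"
  using t unfolding triangle_maps_def by blast
 define C where "C = dg_cone X' Y' \<phi>"
 define x where "x = dg_sum X M"
 define y where "y = dg_sum Y M"
 define W where "W = dg_sum (dg_sum x y) (dg_sum C (dg_sum X' Y'))"
 have C: "dgm C" using o' \<phi> by (simp add: C_def)
 note q = q[folded C_def]
 have d: "dgm x" "dgm y" "dgm (dg_sum x y)" "dgm (dg_sum X' Y')" "dgm (dg_sum C (dg_sum X' Y'))" "dgm W"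
  using o o' M C by (simp_all add: x_def y_def W_def)
 note w = retract_sum[OF d(3,5), folded W_def] and xy = retract_sum[OF d(1,2)] and cc = retract_sum[OF C d(4)] and xy' = retract_sum[OF o']
 note rx = retract_trans[OF d(1,3,6) xy(1) w(1)] and ry = retract_trans[OF d(2,3,6) xy(2) w(1)]
  and rC = retract_trans[OF C d(5,6) cc(1) w(2)]
  and rX' = retract_trans[OF o'(1) d(5,6) retract_trans[OF o'(1) d(4,5) xy'(1) cc(2)] w(2)]
  and rY' = retract_trans[OF o'(2) d(5,6) retract_trans[OF o'(2) d(4,5) xy'(2) cc(2)] w(2)]
 have "(null_maps.null_obj K A W N x --> null_maps.null_obj K A W N W) & (null_maps.null_obj K A W N y --> null_maps.null_obj K A W N W)"
  if "null_maps K A W N" for N :: "('k, _, 'n) dg_mod"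
 proof -
  interpret null_maps K A W N by fact
  note cone = null_obj_cone[OF o' C is_cone_cone[OF o' \<phi>, folded C_def] rX' rY' rC]
  have sx: "null_obj X & null_obj M" if "null_obj x"
   using null_obj_strict_retract[OF o(1) d(1) that] null_obj_strict_retract[OF M d(1) that] retract_sum[OF o(1) M] by (auto simp: x_def)
  have sy: "null_obj Y & null_obj M" if "null_obj y"
   using null_obj_strict_retract[OF o(3) d(2) that] null_obj_strict_retract[OF M d(2) that] retract_sum[OF o(3) M] by (auto simp: y_def)
  have Y': "null_obj Y'" if "null_obj M"
   using null_obj_add_gen[OF M that M1] null_obj_heqv[OF o(2) o'(2) q(2)] by blast
  note eX = null_obj_heqv[OF o(1) o'(1) q(1)] and eY = null_obj_heqv[OF o(3) C q(3)]
  have all: "null_obj W" if M0: "null_obj M" and XY: "null_obj X \<or> null_obj Y"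
  proof -
   have 1: "null_obj X" "null_obj Y" "null_obj X'" "null_obj Y'" "null_obj C" using cone[OF Y'[OF M0]] eX eY XY Y'[OF M0] by auto
   have 2: "null_obj x" "null_obj y" unfolding x_def y_def
    by (rule null_obj_sum[OF o(1) M 1(1) M0], rule null_obj_sum[OF o(3) M 1(2) M0])
   show ?thesis
    using null_obj_sum[OF d(3,5) null_obj_sum[OF d(1,2) 2] null_obj_sum[OF C d(4) 1(5) null_obj_sum[OF o' 1(3,4)]]] by (simp only: W_def)
  qed
  show ?thesis using all sx sy by blast
 qed
 then show ?thesis using d(6) rx ry unfolding x_def y_def by blast
qed

text \<open>Acyclicity of \<open>N e\<close> says that \<open>e = i r\<close> is null, that is, \<open>x\<close> is null; acyclicity of \<open>N\<close> follows once \<open>W\<close> is null.\<close>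

lemma retract_full_corner:
 fixes code :: "(int \<times> int \<times> 'v \<times> (int => 'w => 'w)) list => 'v" and W :: "('k, 'a, 'w) dg_mod"
 assumes x: "dgm x" and W: "dgm W" and r: "retract x W i r" and c: "inj code"
  and n: "\<And>N :: ('k, int => 'w => 'w, 'v \<times> 'v) dg_mod. [|null_maps K A W N; null_maps.null_obj K A W N x|] ==> null_maps.null_obj K A W N W"
 shows "full_corner K (dg_End K A W) (dg_End K A x) (gcomp W 0 i r) (conj W x i r) code"
proof -
 interpret c: corner K "dg_End K A W" "dg_End K A x" "gcomp W 0 i r" "conj W x i r" by (rule retract_corner[OF x W r])
 show ?thesis
 proof (intro full_corner.intro coded_corner.intro coded_corner_axioms.intro full_corner_axioms.intro c.corner_axioms c)
  fix N :: "('k, int => 'w => 'w, 'v \<times> 'v) dg_mod" assume N: "c.B.dgm N" and a: "c.L.acyclic (c.res N)"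
  have nm: "null_maps K A W N" by (intro null_maps.intro null_maps_axioms.intro dg_algebra_axioms W N)
  interpret n: null_maps K A W N by (rule nm)
  have "n.null 0 (gcomp W 0 i r)" unfolding n.null_def using c.acyclic_res_coboundary[OF N a] by simp
  then have "n.null_obj W" using n.null_obj_iff[OF x r] n[OF nm] by blast
  then show "c.B.acyclic N" by (rule n.null_obj_W_acyclic)
 qed
qed

end

section \<open>Codings\<close>

lemma infinite_pair_bij: assumes "infinite (UNIV :: 'v set)" shows "\<exists>p :: 'v \<times> 'v => 'v. bij p"
 using card_of_Times_same_infinite[OF assms] card_of_ordIso[of "UNIV :: ('v \<times> 'v) set" "UNIV :: 'v set"] by simp

text \<open>The length is coded separately, so that only lists of equal length have to be distinguished.\<close>

lemma list_code:
 assumes p: "inj (p :: 'v \<times> 'v => 'v)" and n: "inj (n :: int => 'v)" and b: "inj (b :: 'b => 'v)"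
 shows "\<exists>code :: (int \<times> int \<times> 'v \<times> 'b) list => 'v. inj code"
proof -
 define a where "a = (\<lambda>(i, k, x, w). p (n i, p (n k, p (x, b w))))"
 define s where "s = (\<lambda>t. foldr (\<lambda>u v. p (a u, v)) t (n 0))"
 have a: "a u = a v \<longleftrightarrow> u = v" for u v using p n b by (auto simp: a_def inj_eq split: prod.splits)
 have s: "s t = s t' ==> t = t'" if "length t = length t'" for t t' using that
  by (induction t t' rule: list_induct2) (simp_all add: s_def inj_eq[OF p] a)
 have "inj (\<lambda>t. p (n (int (length t)), s t))" by (rule injI) (use s in \<open>auto simp: inj_eq[OF p] inj_eq[OF n]\<close>)
 then show ?thesis by blast
qed

lemma conj_bij_inj:
 assumes k: "bij (k :: 'w => 'z)" shows "inj (\<lambda>(f :: int => 'w => 'w) n. k \<circ> f n \<circ> inv_into UNIV k)"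
proof (rule inj_on_inverseI[where g = "\<lambda>f n. inv_into UNIV k \<circ> f n \<circ> k"])
 show "(\<lambda>n. inv_into UNIV k \<circ> (k \<circ> f n \<circ> inv_into UNIV k) \<circ> k) = f" for f :: "int => 'w => 'w"
  using k by (auto simp: fun_eq_iff bij_is_inj)
qed

lemma bij_map_prod: "[|bij f; bij g|] ==> bij (map_prod f g)"
 by (simp add: bij_def prod.inj_map map_prod_surj)

text \<open>Constant functions embed \<open>'u\<close> into \<open>'v\<close>, so \<open>'v\<close> is infinite and admits pairing.  Since \<open>'u\<close> is in bijection with its
 square, the endomorphisms of the eightfold sum \<open>W\<close> are no more than the functions that are embedded
 into \<open>'v\<close> by assumption.\<close>

lemma codes_exist:
 fixes \<iota> :: "(int => 'u \<times> 'u => 'u \<times> 'u) => 'v"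
 assumes u: "infinite (UNIV :: 'u set)" and \<iota>: "inj \<iota>"
 shows "\<exists>p :: 'v \<times> 'v => 'v. inj p"
  and "\<exists>code :: (int \<times> int \<times> 'v \<times> (int => (('u \<times> 'u) \<times> ('u \<times> 'u)) \<times> (('u \<times> 'u) \<times> ('u \<times> 'u)) =>
   (('u \<times> 'u) \<times> ('u \<times> 'u)) \<times> (('u \<times> 'u) \<times> ('u \<times> 'u)))) list => 'v. inj code"
proof -
 obtain q :: "'u \<times> 'u => 'u" where q: "bij q" using infinite_pair_bij[OF u] by blast
 have "inj (\<lambda>u. \<iota> (\<lambda>_ _. (u, u)))" by (rule injI) (auto dest!: injD[OF \<iota>] simp: fun_eq_iff)
 then have v: "infinite (UNIV :: 'v set)" using u finite_imageD[of "\<lambda>u. \<iota> (\<lambda>_ _. (u, u))" UNIV] rev_finite_subset[of "UNIV :: 'v set"] by blast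
 then obtain p :: "'v \<times> 'v => 'v" where "bij p" using infinite_pair_bij by blast
 then have p: "inj p" by (rule bij_is_inj)
 then show "\<exists>p :: 'v \<times> 'v => 'v. inj p" by blast
 obtain c d :: 'u where cd: "c \<noteq> d" using u by (metis (full_types) UNIV_eq_I finite.emptyI finite_insert insertCI)
 (* integers are coded by the indicator functions of single degrees *)
 define n where "n i = \<iota> (\<lambda>k _. if k = i then (c, c) else (d, d))" for i :: int
 have n: "inj n" by (rule injI) (use cd in \<open>auto dest!: injD[OF \<iota>] simp: n_def fun_eq_iff split: if_splits\<close>)
 define k where "k = map_prod (q \<circ> map_prod q q) (q \<circ> map_prod q q)"
 have k: "bij k" unfolding k_def using q by (intro bij_map_prod bij_comp)
 have "inj (\<lambda>f. \<iota> (\<lambda>n. k \<circ> f n \<circ> inv_into UNIV k))" using inj_compose[OF \<iota> conj_bij_inj[OF k]] by (simp add: comp_def)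
 then show "\<exists>code :: (int \<times> int \<times> 'v \<times> (int => (('u \<times> 'u) \<times> ('u \<times> 'u)) \<times> (('u \<times> 'u) \<times> ('u \<times> 'u)) =>
   (('u \<times> 'u) \<times> ('u \<times> 'u)) \<times> (('u \<times> 'u) \<times> ('u \<times> 'u)))) list => 'v. inj code"
  by (rule list_code[OF p n])
qed

theorem theorem4p7:
  fixes K :: "'k ring" and A :: "('k, 'a) dg_alg"
    and M X M\<^sub>1 Y :: "('k, 'a, 'u) dg_mod"
  assumes "cring K" and "dg_algebra K A"
    and "infinite (UNIV :: 'u set)"
    and "dg_module K A M"
    and "(X, M\<^sub>1, Y, f, g, h) \<in> triangles (homotopy_cat K A)"
    and "M\<^sub>1 \<in> add_gen K A M"
    and "\<exists>\<iota> :: (int \<Rightarrow> 'u \<times> 'u \<Rightarrow> 'u \<times> 'u) \<Rightarrow> 'v. inj \<iota>"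
  shows "derived_equivalent TYPE('v) K
           (dg_End K A (dg_sum X M)) (dg_End K A (dg_sum Y M))"
proof -
  interpret dg_algebra K A by fact
  obtain \<iota> :: "(int \<Rightarrow> 'u \<times> 'u \<Rightarrow> 'u \<times> 'u) \<Rightarrow> 'v" where \<iota>: "inj \<iota>" using assms(7) by blast
  obtain p :: "'v \<times> 'v \<Rightarrow> 'v" where p: "inj p" using codes_exist(1)[OF assms(3) \<iota>] by blast
  obtain code :: "(int \<times> int \<times> 'v \<times> (int \<Rightarrow> (('u \<times> 'u) \<times> ('u \<times> 'u)) \<times> (('u \<times> 'u) \<times> ('u \<times> 'u)) \<Rightarrow>
      (('u \<times> 'u) \<times> ('u \<times> 'u)) \<times> (('u \<times> 'u) \<times> ('u \<times> 'u)))) list \<Rightarrow> 'v" where code: "inj code"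
    using codes_exist(2)[OF assms(3) \<iota>] by blast
  have t: "htriangle K A X M\<^sub>1 Y f g h" using assms(5) by (simp add: homotopy_cat_def)
  then have o: "dgm (dg_sum X M)" "dgm (dg_sum Y M)" using assms(4) by (simp_all add: htriangle_def)
  obtain W :: "('k, 'a, (('u \<times> 'u) \<times> ('u \<times> 'u)) \<times> (('u \<times> 'u) \<times> ('u \<times> 'u))) dg_mod" and i r i' r'
    where W: "dgm W" and r: "retract (dg_sum X M) W i r" "retract (dg_sum Y M) W i' r'"
      and n: "\<And>N :: ('k, _, 'v \<times> 'v) dg_mod. null_maps K A W N \<Longrightarrow>
      (null_maps.null_obj K A W N (dg_sum X M) \<longrightarrow> null_maps.null_obj K A W N W) \<and>
      (null_maps.null_obj K A W N (dg_sum Y M) \<longrightarrow> null_maps.null_obj K A W N W)"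
    using triangle_common_retract[OF assms(4) t assms(6), where ?'n = "'v \<times> 'v"] by blast
  interpret two_corners K "dg_End K A W" "dg_End K A (dg_sum X M)" "gcomp W 0 i r" "conj W (dg_sum X M) i r" code
      "dg_End K A (dg_sum Y M)" "gcomp W 0 i' r'" "conj W (dg_sum Y M) i' r'" code
    by (intro two_corners.intro retract_full_corner o W r code) (use n in blast)+
  show ?thesis by (rule corners_derived_equivalent[OF p])
qed

end
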